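(* Let $K$ be a triangle with diameter $h_K$ and shape-regularity constant $\gamma$, and let $\Pi_K$ be the NTW interpolation operator on $K$. There exists $C$ that depends on $\gamma$ such that for $m=2,3$ and all $v\in H^m(K)$, $$\sum_{j=0}^2h_K^j\|\nabla^j(v-\Pi_K v)\|_{L^2(K)}\le Ch_K^m\|\nabla^mv\|_{L^2(K)},$$ and for all $v\in H^2(K)$, $$\|\nabla(v-\Pi_K v)\|_{L^2(K)}\le Ch_K^{1/2}\|\nabla v\|_{L^2(K)}^{1/2}\|\nabla^2 v\|_{L^2(K)}^{1/2}.$$
   Context: Shape regularity: $h_K/\rho_K\le\gamma$, where $\rho_K$ is the diameter of the largest ball inscribed in $K$. $K$ has vertices $a_1,a_2,a_3$, edges $e_i$ opposite to $a_i$, and edge midpoints $b_i$ of $e_i$; $\lambda_1,\lambda_2,\lambda_3$ are the barycentric coordinates and $b_K=\lambda_1\lambda_2\lambda_3$ is the bubble function. The NTW (Nilssen–Tai–Winther) element has scalar shape function space $P_K=\mathbb{P}_2(K)+b_K\mathbb{P}_1(K)$ (dimension 9), where $\mathbb{P}_k(K)$ denotes polynomials of degree at most $k$, and degrees of freedom $p(a_i)$, $p(b_i)$, $\frac{1}{|e_i|}\int_{e_i}\partial_n p$, $i=1,2,3$, with $n$ the unit normal. The interpolation operator $\Pi_K v\in P_K$ is defined for $i=1,2,3$ by $\Pi_Kv(a_i)=v(a_i)$, $\Pi_Kv(b_i)=v(b_i)$, $\int_{e_i}\partial_n\Pi_K v=\int_{e_i}\partial_n v$. *)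

theory Defs
  imports "HOL-Analysis.Analysis"
begin

section \<open>Smooth functions, weak derivatives and Sobolev spaces\<close>

definition partial_deriv :: "'n \<Rightarrow> (real^'n::finite \<Rightarrow> real) \<Rightarrow> real^'n \<Rightarrow> real" where
  "partial_deriv i f x = frechet_derivative f (at x) (axis i 1)"

text \<open>Iterated partial derivatives are indexed by lists of coordinate directions, so that the
  lists of length \<open>j\<close> index the components of the tensor \<open>\<nabla>\<^sup>j f\<close>.\<close>

definition partial_derivs :: "'n list \<Rightarrow> (real^'n::finite \<Rightarrow> real) \<Rightarrow> real^'n \<Rightarrow> real" where
  "partial_derivs is f = foldr partial_deriv is f"

definition smooth :: "(real^'n::finite \<Rightarrow> real) \<Rightarrow> bool" where
  "smooth f \<longleftrightarrow> (\<forall>is x. partial_derivs is f differentiable (at x))"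

definition test_fun :: "(real^'n::finite) set \<Rightarrow> (real^'n \<Rightarrow> real) \<Rightarrow> bool" where
  "test_fun S \<phi> \<longleftrightarrow> smooth \<phi> \<and> compact (closure {x. \<phi> x \<noteq> 0}) \<and> closure {x. \<phi> x \<noteq> 0} \<subseteq> S"

definition locally_integrable :: "(real^'n::finite) set \<Rightarrow> (real^'n \<Rightarrow> real) \<Rightarrow> bool" where
  "locally_integrable S f \<longleftrightarrow> (\<forall>C. compact C \<and> C \<subseteq> S \<longrightarrow> f absolutely_integrable_on C)"

definition has_weak_deriv ::
    "(real^'n::finite) set \<Rightarrow> 'n list \<Rightarrow> (real^'n \<Rightarrow> real) \<Rightarrow> (real^'n \<Rightarrow> real) \<Rightarrow> bool" where
  "has_weak_deriv S is v g \<longleftrightarrow>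
     locally_integrable S v \<and> locally_integrable S g \<and>
     (\<forall>\<phi>. test_fun S \<phi> \<longrightarrow>
        (LINT x|lebesgue_on S. v x * partial_derivs is \<phi> x)
          = (-1) ^ length is * (LINT x|lebesgue_on S. g x * \<phi> x))"

text \<open>A representative; weak derivatives are determined only almost everywhere.\<close>

definition weak_deriv :: "(real^'n::finite) set \<Rightarrow> 'n list \<Rightarrow> (real^'n \<Rightarrow> real) \<Rightarrow> real^'n \<Rightarrow> real" where
  "weak_deriv S is v = (SOME g. has_weak_deriv S is v g)"

definition L2_space :: "'a::euclidean_space set \<Rightarrow> ('a \<Rightarrow> real) set" where
  "L2_space S = {f \<in> borel_measurable (lebesgue_on S). integrable (lebesgue_on S) (\<lambda>x. (f x)\<^sup>2)}"

definition L2_norm :: "'a::euclidean_space set \<Rightarrow> ('a \<Rightarrow> real) \<Rightarrow> real" where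
  "L2_norm S f = sqrt (LINT x|lebesgue_on S. (f x)\<^sup>2)"

definition sobolev_space :: "nat \<Rightarrow> (real^'n::finite) set \<Rightarrow> (real^'n \<Rightarrow> real) set" where
  "sobolev_space m S =
     {v \<in> L2_space S. \<forall>is. length is \<le> m \<longrightarrow> (\<exists>g \<in> L2_space S. has_weak_deriv S is v g)}"

text \<open>\<open>grad_norm j S v\<close> is the \<open>L\<^sup>2(S)\<close> norm of \<open>\<nabla>\<^sup>j v\<close>, with the Frobenius norm of tensors.\<close>

definition grad_norm :: "nat \<Rightarrow> (real^'n::finite) set \<Rightarrow> (real^'n \<Rightarrow> real) \<Rightarrow> real" where
  "grad_norm j S v = sqrt (\<Sum>is | length is = j. (L2_norm S (weak_deriv S is v))\<^sup>2)"

definition sobolev_norm :: "nat \<Rightarrow> (real^'n::finite) set \<Rightarrow> (real^'n \<Rightarrow> real) \<Rightarrow> real" where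
  "sobolev_norm m S v = sqrt (\<Sum>j\<le>m. (grad_norm j S v)\<^sup>2)"

section \<open>Point values and traces\<close>

text \<open>Functions in \<open>H\<^sup>2\<close> of a triangle have a unique continuous representative on the closed
  triangle, and point values are taken from it.\<close>

definition cont_rep :: "(real^'n::finite) set \<Rightarrow> (real^'n \<Rightarrow> real) \<Rightarrow> real^'n \<Rightarrow> real" where
  "cont_rep K v =
     (SOME g. continuous_on K g \<and> (AE x in lebesgue_on (interior K). g x = v x))"

definition segment_integral :: "'a::euclidean_space \<Rightarrow> 'a \<Rightarrow> ('a \<Rightarrow> real) \<Rightarrow> real" where
  "segment_integral x y f = dist x y * (LINT t|lebesgue_on {0..1}. f (linepath x y t))"

text \<open>\<open>g\<close> is the trace of \<open>w \<in> H\<^sup>1(S)\<close> on the boundary segment from \<open>x\<close> to \<open>y\<close>: the trace operator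
  is the continuous extension to \<open>H\<^sup>1(S)\<close>, with values in \<open>L\<^sup>2\<close> of the segment, of the restriction
  of functions smooth up to the boundary.\<close>

definition has_trace ::
    "(real^'n::finite) set \<Rightarrow> real^'n \<Rightarrow> real^'n \<Rightarrow> (real^'n \<Rightarrow> real) \<Rightarrow> (real^'n \<Rightarrow> real) \<Rightarrow> bool" where
  "has_trace S x y w g \<longleftrightarrow>
     w \<in> sobolev_space 1 S \<and> (\<lambda>t. g (linepath x y t)) \<in> L2_space {0..1} \<and>
     (\<exists>u :: nat \<Rightarrow> real^'n \<Rightarrow> real. (\<forall>k. smooth (u k)) \<and>
        (\<lambda>k. sobolev_norm 1 S (\<lambda>z. u k z - w z)) \<longlonglongrightarrow> 0 \<and>
        (\<lambda>k. segment_integral x y (\<lambda>z. (u k z - g z)\<^sup>2)) \<longlonglongrightarrow> 0)"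

definition segment_trace ::
    "(real^'n::finite) set \<Rightarrow> real^'n \<Rightarrow> real^'n \<Rightarrow> (real^'n \<Rightarrow> real) \<Rightarrow> real^'n \<Rightarrow> real" where
  "segment_trace S x y w = (SOME g. has_trace S x y w g)"

section \<open>Triangles\<close>

text \<open>A triangle is given by its vertices \<open>a i\<close>, \<open>i :: 3\<close>. Index arithmetic is modulo 3, so the
  edge opposite to \<open>a i\<close> joins \<open>a (i + 1)\<close> and \<open>a (i + 2)\<close>.\<close>

type_synonym triangle = "3 \<Rightarrow> real^2"

definition nondegenerate :: "triangle \<Rightarrow> bool" where
  "nondegenerate a \<longleftrightarrow> \<not> collinear (range a)"

definition tri :: "triangle \<Rightarrow> (real^2) set" where
  "tri a = convex hull (range a)"

definition inscribed_diameter :: "(real^2) set \<Rightarrow> real" where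
  "inscribed_diameter K = Sup {diameter (cball x r) | x r. cball x r \<subseteq> K}"

definition edge_midpoint :: "triangle \<Rightarrow> 3 \<Rightarrow> real^2" where
  "edge_midpoint a i = midpoint (a (i + 1)) (a (i + 2))"

definition edge_integral :: "triangle \<Rightarrow> 3 \<Rightarrow> (real^2 \<Rightarrow> real) \<Rightarrow> real" where
  "edge_integral a i f = segment_integral (a (i + 1)) (a (i + 2)) f"

text \<open>The outward unit normal of the edge opposite to \<open>a i\<close>.\<close>

definition edge_normal :: "triangle \<Rightarrow> 3 \<Rightarrow> real^2" where
  "edge_normal a i =
     (THE n. norm n = 1 \<and> n \<bullet> (a (i + 2) - a (i + 1)) = 0 \<and> n \<bullet> (a i - a (i + 1)) < 0)"

definition barycentric :: "triangle \<Rightarrow> real^2 \<Rightarrow> 3 \<Rightarrow> real" where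
  "barycentric a x = (THE l. (\<Sum>i\<in>UNIV. l i) = 1 \<and> (\<Sum>i\<in>UNIV. l i *\<^sub>R a i) = x)"

definition bubble :: "triangle \<Rightarrow> real^2 \<Rightarrow> real" where
  "bubble a x = (\<Prod>i\<in>UNIV. barycentric a x i)"

section \<open>The Nilssen--Tai--Winther element\<close>

text \<open>Polynomials in two variables of total degree at most \<open>k\<close>, as functions on the whole plane.\<close>

definition poly_space :: "nat \<Rightarrow> (real^2 \<Rightarrow> real) set" where
  "poly_space k =
     {p. \<exists>c :: nat \<Rightarrow> nat \<Rightarrow> real. p = (\<lambda>x. \<Sum>i\<le>k. \<Sum>j\<le>k - i. c i j * (x $ 1) ^ i * (x $ 2) ^ j)}"

definition NTW_space :: "triangle \<Rightarrow> (real^2 \<Rightarrow> real) set" where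
  "NTW_space a = {\<lambda>x. q x + bubble a x * r x | q r. q \<in> poly_space 2 \<and> r \<in> poly_space 1}"

text \<open>Normal derivative on the edge opposite to \<open>a i\<close>: classical, for shape functions, and in the
  sense of traces of \<open>\<nabla>v\<close>, for \<open>v \<in> H\<^sup>2\<close>.\<close>

definition normal_deriv :: "triangle \<Rightarrow> 3 \<Rightarrow> (real^2 \<Rightarrow> real) \<Rightarrow> real^2 \<Rightarrow> real" where
  "normal_deriv a i p x = frechet_derivative p (at x) (edge_normal a i)"

definition normal_deriv_trace :: "triangle \<Rightarrow> 3 \<Rightarrow> (real^2 \<Rightarrow> real) \<Rightarrow> real^2 \<Rightarrow> real" where
  "normal_deriv_trace a i v x =
     (\<Sum>c\<in>UNIV. edge_normal a i $ c *
        segment_trace (interior (tri a)) (a (i + 1)) (a (i + 2))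
          (weak_deriv (interior (tri a)) [c] v) x)"

definition NTW_interp :: "triangle \<Rightarrow> (real^2 \<Rightarrow> real) \<Rightarrow> real^2 \<Rightarrow> real" where
  "NTW_interp a v =
     (THE p. p \<in> NTW_space a \<and>
        (\<forall>i. p (a i) = cont_rep (tri a) v (a i) \<and>
             p (edge_midpoint a i) = cont_rep (tri a) v (edge_midpoint a i) \<and>
             edge_integral a i (normal_deriv a i p) = edge_integral a i (normal_deriv_trace a i v)))"

end

theory Submission
  imports Defs
begin

text \<open>
  Write \<open>N j w\<close> for the \<open>L\<^sup>2\<close> norm of \<open>\<nabla>\<^sup>j w\<close> on the triangle. The estimates are proved for smooth
  functions and carried over by density.

  They rest on the stability of the interpolation operator \<open>\<Pi>\<close>. It reproduces constants, so that a
  point value of \<open>w\<close> may be subtracted before the degrees of freedom are estimated. The remaining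
  increments of \<open>w\<close> and the fluxes are bounded by integrals of \<open>\<bar>\<nabla>w\<bar>\<close> over the edges (\<open>dof_sum_le\<close>).
  The interpolant with given degrees of freedom is an explicit polynomial in the barycentric
  coordinates (\<open>ntw_fun\<close>): a quadratic Lagrange interpolant, and a bubble part that adjusts each
  flux independently, because the flux through an edge of the bubble times an affine function
  depends only on the midpoint value of the affine function. By shape regularity the derivatives of
  this polynomial have the expected size in \<open>h\<close>. The multiplicative trace inequality \<open>edge_trace\<close>,
  applied to \<open>\<nabla>w\<close>, then bounds \<open>N 1 (\<Pi> w)\<close> and \<open>h N 2 (\<Pi> w)\<close> by a multiple of
  \<open>sqrt ((N 1 w)\<^sup>2 + h N 1 w N 2 w)\<close> (\<open>smooth_interp_N1_le\<close>).

  In the first estimate, the error vanishes at a vertex, so that its \<open>L\<^sup>2\<close> norm is bounded by its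
  derivatives (\<open>N0_le_if_zero_at_vertex\<close>), and these are bounded by stability. As quadratic
  polynomials are reproduced, the function may be replaced by its difference from a polynomial
  chosen such that its first or second derivatives have mean zero. The Poincare inequality on a
  convex set supplies the powers of \<open>h\<close>; this is the Bramble--Hilbert argument with explicit
  polynomials and constants.

  In the second estimate, let \<open>s = sqrt (h N 1 w N 2 w)\<close>. If \<open>N 1 w \<le> h N 2 w\<close>, then \<open>N 1 w \<le> s\<close>,
  and stability bounds the error by a multiple of \<open>s\<close>. Otherwise \<open>h N 2 w \<le> s\<close>, and the first
  estimate with \<open>m = 2\<close> suffices.

  For the passage to the limit, contraction of a bounded convex open set towards an interior point,
  followed by mollification, gives functions that are smooth on the whole space and converge in
  \<open>H\<^sup>m\<close> (\<open>sobolev_smooth_dense\<close>). Along such a sequence the point values converge to those of the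
  continuous representative and the fluxes to those of the trace of the gradient
  (\<open>point_values_converge\<close>, \<open>flux_converges\<close>), since the bounds for smooth functions make both
  Cauchy. Hence the interpolants converge, and the estimates persist.

  The trace inequality, the bound of point values and the Poincare inequality share one device: a
  bound on a segment is integrated over a family of segments, and Fubini's theorem with an affine
  change of variables turns the result into integrals over the triangle.
\<close>

section \<open>The space of square integrable functions\<close>

lemma L2_spaceD:
  assumes "f \<in> L2_space S"
  shows "f \<in> borel_measurable (lebesgue_on S)" "integrable (lebesgue_on S) (\<lambda>x. (f x)\<^sup>2)"
  using assms by (auto simp: L2_space_def)

lemma L2_prod_integrable:
  assumes f: "f \<in> L2_space S" and g: "g \<in> L2_space S"
  shows "integrable (lebesgue_on S) (\<lambda>x. f x * g x)"
proof -
  note [measurable] = L2_spaceD(1)[OF f] L2_spaceD(1)[OF g]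
  have "integrable (lebesgue_on S) (\<lambda>x. (f x)\<^sup>2 + (g x)\<^sup>2)"
    using L2_spaceD(2)[OF f] L2_spaceD(2)[OF g] by simp
  moreover have "\<bar>a * b\<bar> \<le> a\<^sup>2 + b\<^sup>2" for a b :: real
  proof -
    have "2 * \<bar>a\<bar> * \<bar>b\<bar> \<le> \<bar>a\<bar>\<^sup>2 + \<bar>b\<bar>\<^sup>2" by (rule sum_squares_bound)
    then have "2 * \<bar>a * b\<bar> \<le> a\<^sup>2 + b\<^sup>2" by (simp add: abs_mult mult.assoc)
    then show ?thesis using abs_ge_zero[of "a * b"] by linarith
  qed
  ultimately show ?thesis
    by (elim Bochner_Integration.integrable_bound) auto
qed

lemma L2_add: "f \<in> L2_space S \<Longrightarrow> g \<in> L2_space S \<Longrightarrow> (\<lambda>x. f x + g x) \<in> L2_space S"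
  using L2_prod_integrable[of f S g] unfolding L2_space_def
  by (auto simp: power2_sum mult.assoc)

lemma L2_cmult: "f \<in> L2_space S \<Longrightarrow> (\<lambda>x. c * f x) \<in> L2_space S"
  unfolding L2_space_def by (auto simp: power_mult_distrib)

lemma L2_diff: "f \<in> L2_space S \<Longrightarrow> g \<in> L2_space S \<Longrightarrow> (\<lambda>x. f x - g x) \<in> L2_space S"
  using L2_add[of f S "\<lambda>x. (-1) * g x"] L2_cmult[of g S "-1"] by simp

lemma L2_norm_nonneg [simp]: "0 \<le> L2_norm S f"
  unfolding L2_norm_def by simp

lemma L2_norm_sq: "(L2_norm S f)\<^sup>2 = (LINT x|lebesgue_on S. (f x)\<^sup>2)"
  unfolding L2_norm_def by simp

lemma L2_norm_cmult: "L2_norm S (\<lambda>x. c * f x) = \<bar>c\<bar> * L2_norm S f"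
  unfolding L2_norm_def by (simp add: power_mult_distrib real_sqrt_mult)

lemma L2_norm_minus_commute: "L2_norm S (\<lambda>x. f x - g x) = L2_norm S (\<lambda>x. g x - f x)"
  unfolding L2_norm_def by (simp add: power2_commute)

text \<open>The pointwise bound \<open>\<bar>a b\<bar> \<le> (t a\<^sup>2 + b\<^sup>2 / t) / 2\<close> is integrated with the optimal ratio
  \<open>t = B / A\<close> of the two norms. Perturbing both norms by \<open>d\<close> avoids a separate treatment of
  vanishing norms.\<close>

lemma L2_Cauchy_Schwarz_abs:
  assumes f: "f \<in> L2_space S" and g: "g \<in> L2_space S"
  shows "(LINT x|lebesgue_on S. \<bar>f x * g x\<bar>) \<le> L2_norm S f * L2_norm S g"
proof (rule field_le_epsilon)
  fix e :: real assume e: "0 < e"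
  define A B where "A = L2_norm S f" and "B = L2_norm S g"
  define d where "d = e / (A + B + 1)"
  have AB: "0 \<le> A" "0 \<le> B" by (auto simp: A_def B_def)
  have d: "0 < d" using e AB by (simp add: d_def)
  have dAB: "d * (A + B) \<le> e" using e AB by (simp add: d_def field_simps)
  define t where "t = (B + d) / (A + d)"
  have t: "0 < t" using AB d by (simp add: t_def)
  have i: "integrable (lebesgue_on S) (\<lambda>x. t * (f x)\<^sup>2 + (g x)\<^sup>2 / t)"
    using L2_spaceD(2)[OF f] L2_spaceD(2)[OF g] by simp
  have pt: "\<bar>a * b\<bar> \<le> (t * a\<^sup>2 + b\<^sup>2 / t) / 2" for a b :: real
  proof -
    have "2 * (sqrt t * \<bar>a\<bar>) * (\<bar>b\<bar> / sqrt t) \<le> (sqrt t * \<bar>a\<bar>)\<^sup>2 + (\<bar>b\<bar> / sqrt t)\<^sup>2"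
      by (rule sum_squares_bound)
    then show ?thesis using t by (simp add: power_mult_distrib power_divide abs_mult)
  qed
  have "(LINT x|lebesgue_on S. \<bar>f x * g x\<bar>) \<le> (LINT x|lebesgue_on S. (t * (f x)\<^sup>2 + (g x)\<^sup>2 / t) / 2)"
    by (rule integral_mono) (use L2_prod_integrable[OF f g] i pt in auto)
  also have "\<dots> = (t * A\<^sup>2 + B\<^sup>2 / t) / 2"
    unfolding A_def B_def L2_norm_sq using L2_spaceD(2)[OF f] L2_spaceD(2)[OF g] by simp
  also have "\<dots> \<le> (A * (B + d) + B * (A + d)) / 2"
  proof -
    have "t * A\<^sup>2 = A * (B + d) * (A / (A + d))" by (simp add: t_def power2_eq_square)
    also have "\<dots> \<le> A * (B + d) * 1"
      using AB d by (intro mult_left_mono) auto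
    finally have 1: "t * A\<^sup>2 \<le> A * (B + d)" by simp
    have "B\<^sup>2 / t = B * (A + d) * (B / (B + d))" by (simp add: t_def power2_eq_square)
    also have "\<dots> \<le> B * (A + d) * 1"
      using AB d by (intro mult_left_mono) auto
    finally have 2: "B\<^sup>2 / t \<le> B * (A + d)" by simp
    show ?thesis by (intro divide_right_mono add_mono 1 2) simp
  qed
  also have "\<dots> = A * B + d * (A + B) / 2" by (simp add: algebra_simps)
  also have "\<dots> \<le> A * B + e" using dAB e d AB by simp
  finally show "(LINT x|lebesgue_on S. \<bar>f x * g x\<bar>) \<le> L2_norm S f * L2_norm S g + e"
    by (simp add: A_def B_def)
qed

lemma L2_Cauchy_Schwarz:
  assumes "f \<in> L2_space S" and "g \<in> L2_space S"
  shows "\<bar>LINT x|lebesgue_on S. f x * g x\<bar> \<le> L2_norm S f * L2_norm S g"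
  using L2_Cauchy_Schwarz_abs[OF assms] integral_abs_bound[of "lebesgue_on S" "\<lambda>x. f x * g x"]
  by linarith

lemma L2_norm_triangle:
  assumes f: "f \<in> L2_space S" and g: "g \<in> L2_space S"
  shows "L2_norm S (\<lambda>x. f x + g x) \<le> L2_norm S f + L2_norm S g"
proof (rule power2_le_imp_le)
  have "(L2_norm S (\<lambda>x. f x + g x))\<^sup>2 = (LINT x|lebesgue_on S. (f x)\<^sup>2 + (g x)\<^sup>2 + 2 * (f x * g x))"
    unfolding L2_norm_sq by (simp add: power2_sum mult.assoc)
  also have "\<dots> = (L2_norm S f)\<^sup>2 + (L2_norm S g)\<^sup>2 + 2 * (LINT x|lebesgue_on S. f x * g x)"
    unfolding L2_norm_sq using L2_spaceD(2)[OF f] L2_spaceD(2)[OF g] L2_prod_integrable[OF f g] by simp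
  also have "\<dots> \<le> (L2_norm S f + L2_norm S g)\<^sup>2"
    using L2_Cauchy_Schwarz[OF f g] by (simp add: power2_sum)
  finally show "(L2_norm S (\<lambda>x. f x + g x))\<^sup>2 \<le> (L2_norm S f + L2_norm S g)\<^sup>2" .
qed simp

lemma L2_norm_triangle3:
  assumes "f \<in> L2_space S" "g \<in> L2_space S" "k \<in> L2_space S"
  shows "L2_norm S (\<lambda>x. f x - k x) \<le> L2_norm S (\<lambda>x. f x - g x) + L2_norm S (\<lambda>x. g x - k x)"
  using L2_norm_triangle[OF L2_diff[OF assms(1,2)] L2_diff[OF assms(2,3)]] by simp

text \<open>Lebesgue measure is complete, so measurability does not see null sets.\<close>

lemma borel_measurable_AE_lebesgue_on:
  fixes f g :: "'a::euclidean_space \<Rightarrow> real"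
  assumes S: "S \<in> sets lebesgue" and f: "f \<in> borel_measurable (lebesgue_on S)"
    and ae: "AE x in lebesgue_on S. f x = g x"
  shows "g \<in> borel_measurable (lebesgue_on S)"
proof -
  have 1: "(\<lambda>x. if x \<in> S then f x else 0) \<in> borel_measurable lebesgue"
    using f S by (simp add: borel_measurable_if)
  have "AE x in lebesgue. (if x \<in> S then f x else 0) = (if x \<in> S then g x else 0)"
    using ae S by (simp add: AE_restrict_space_iff)
  with borel_measurable_AE[OF 1] have "(\<lambda>x. if x \<in> S then g x else 0) \<in> borel_measurable lebesgue"
    by auto
  then show ?thesis using S by (simp add: borel_measurable_if)
qed

lemma L2_space_cong_AE:
  fixes f g :: "'a::euclidean_space \<Rightarrow> real"
  assumes S: "S \<in> sets lebesgue" and f: "f \<in> L2_space S" and ae: "AE x in lebesgue_on S. f x = g x"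
  shows "g \<in> L2_space S"
proof -
  note m = borel_measurable_AE_lebesgue_on[OF S L2_spaceD(1)[OF f] ae]
  note [measurable] = m L2_spaceD(1)[OF f]
  have "integrable (lebesgue_on S) (\<lambda>x. (g x)\<^sup>2)"
    by (rule integrable_cong_AE_imp[OF L2_spaceD(2)[OF f]]) (use ae in auto)
  with m show ?thesis by (simp add: L2_space_def)
qed

lemma L2_norm_cong_AE:
  fixes f g :: "'a::euclidean_space \<Rightarrow> real"
  assumes S: "S \<in> sets lebesgue" and f: "f \<in> L2_space S" and ae: "AE x in lebesgue_on S. f x = g x"
  shows "L2_norm S g = L2_norm S f"
proof -
  note [measurable] = borel_measurable_AE_lebesgue_on[OF S L2_spaceD(1)[OF f] ae] L2_spaceD(1)[OF f]
  show ?thesis unfolding L2_norm_def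
    by (rule arg_cong[of _ _ sqrt], rule integral_cong_AE) (use ae in auto)
qed

lemma L2_bounded:
  assumes S: "S \<in> lmeasurable" and m: "f \<in> borel_measurable (lebesgue_on S)"
    and b: "\<And>x. x \<in> S \<Longrightarrow> \<bar>f x\<bar> \<le> B"
  shows "f \<in> L2_space S" "L2_norm S f \<le> B * sqrt (measure lebesgue S)"
proof -
  note [measurable] = m
  interpret finite_measure "lebesgue_on S"
    using S by (simp add: finite_measure_lebesgue_on)
  have b2: "(f x)\<^sup>2 \<le> B\<^sup>2" if "x \<in> S" for x
    using power_mono[OF b[OF that], of 2] by simp
  have i: "integrable (lebesgue_on S) (\<lambda>x. (f x)\<^sup>2)"
    by (rule integrable_const_bound[where B = "B\<^sup>2"]) (use b2 in \<open>auto intro!: AE_I2\<close>)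
  then show "f \<in> L2_space S" using m by (simp add: L2_space_def)
  show "L2_norm S f \<le> B * sqrt (measure lebesgue S)"
  proof (cases "S = {}")
    case True then show ?thesis by (simp add: L2_norm_def)
  next
    case False
    then have B: "0 \<le> B" using b by (meson abs_ge_zero all_not_in_conv order_trans)
    have "(LINT x|lebesgue_on S. (f x)\<^sup>2) \<le> (LINT x|lebesgue_on S. B\<^sup>2)"
      by (rule integral_mono[OF i]) (use b2 in auto)
    also have "\<dots> = measure lebesgue S * B\<^sup>2"
      using S by (simp add: measure_restrict_space fmeasurableD)
    finally have "L2_norm S f \<le> sqrt (measure lebesgue S * B\<^sup>2)"
      unfolding L2_norm_def by simp
    then show ?thesis using B by (simp add: real_sqrt_mult mult.commute)
  qed
qed

lemma L2_const: "S \<in> lmeasurable \<Longrightarrow> (\<lambda>x. c) \<in> L2_space S"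
  by (rule L2_bounded(1)[where B = "\<bar>c\<bar>"]) auto

lemma L2_integrable:
  assumes S: "S \<in> lmeasurable" and f: "f \<in> L2_space S"
  shows "integrable (lebesgue_on S) f"
  using L2_prod_integrable[OF f L2_const[OF S, of 1]] by simp

lemma L1_le_L2:
  assumes S: "S \<in> lmeasurable" and f: "f \<in> L2_space S"
  shows "(LINT x|lebesgue_on S. \<bar>f x\<bar>) \<le> sqrt (measure lebesgue S) * L2_norm S f"
proof -
  have "L2_norm S (\<lambda>x. 1) = sqrt (measure lebesgue S)"
    using S by (simp add: L2_norm_def measure_restrict_space fmeasurableD)
  then show ?thesis
    using L2_Cauchy_Schwarz_abs[OF f L2_const[OF S, of 1]] by (simp add: mult.commute)
qed

lemma L2_norm_eq_0_AE:
  assumes f: "f \<in> L2_space S" and 0: "L2_norm S f = 0"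
  shows "AE x in lebesgue_on S. f x = 0"
proof -
  have "(LINT x|lebesgue_on S. (f x)\<^sup>2) = 0" using 0 L2_norm_sq[of S f] by simp
  then have "AE x in lebesgue_on S. (f x)\<^sup>2 = 0"
    using integral_nonneg_eq_0_iff_AE[OF L2_spaceD(2)[OF f]] by simp
  then show ?thesis by simp
qed

lemma L2_nn_integral:
  assumes f: "f \<in> L2_space S"
  shows "(\<integral>\<^sup>+x. ennreal ((f x)\<^sup>2) \<partial>lebesgue_on S) = ennreal ((L2_norm S f)\<^sup>2)"
  unfolding L2_norm_sq by (rule nn_integral_eq_integral) (use L2_spaceD(2)[OF f] in auto)

lemma L2_spaceI_nn:
  assumes m: "f \<in> borel_measurable (lebesgue_on S)"
    and b: "(\<integral>\<^sup>+x. ennreal ((f x)\<^sup>2) \<partial>lebesgue_on S) \<le> ennreal (B\<^sup>2)" and B: "0 \<le> B"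
  shows "f \<in> L2_space S" "L2_norm S f \<le> B"
proof -
  note [measurable] = m
  have i: "integrable (lebesgue_on S) (\<lambda>x. (f x)\<^sup>2)"
    by (rule integrableI_bounded) (use le_less_trans[OF b] in auto)
  then show f: "f \<in> L2_space S" using m by (simp add: L2_space_def)
  have "(L2_norm S f)\<^sup>2 \<le> B\<^sup>2" using b L2_nn_integral[OF f] by simp
  then show "L2_norm S f \<le> B" using B by (rule power2_le_imp_le)
qed

text \<open>The Riesz--Fischer argument: along a fast subsequence the increments satisfy \<open>\<parallel>d\<^sub>k\<parallel> < 4\<^sup>-\<^sup>k\<close>,
  so that even \<open>\<Sum> 4\<^sup>k d\<^sub>k\<^sup>2\<close> is integrable, hence finite almost everywhere; this forces
  \<open>d\<^sub>k = O(2\<^sup>-\<^sup>k)\<close> pointwise. The weight \<open>4\<^sup>k\<close> makes a Minkowski inequality for infinite sums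
  superfluous. Fatou's lemma then identifies the pointwise limit as the limit in the norm.\<close>

lemma L2_complete:
  fixes f :: "nat \<Rightarrow> 'a::euclidean_space \<Rightarrow> real"
  assumes f: "\<And>k. f k \<in> L2_space S"
    and C: "\<And>e. 0 < e \<Longrightarrow> \<exists>N. \<forall>m\<ge>N. \<forall>n\<ge>N. L2_norm S (\<lambda>x. f m x - f n x) < e"
  shows "\<exists>g\<in>L2_space S. (\<lambda>k. L2_norm S (\<lambda>x. f k x - g x)) \<longlonglongrightarrow> 0"
proof -
  let ?M = "lebesgue_on S"
  note [measurable] = L2_spaceD(1)[OF f]
  have "\<exists>N. \<forall>m\<ge>N. \<forall>n\<ge>N. L2_norm S (\<lambda>x. f m x - f n x) < (1/4) ^ k" for k :: nat
    by (rule C) simp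
  then obtain N where N: "\<And>k m n. m \<ge> N k \<Longrightarrow> n \<ge> N k \<Longrightarrow> L2_norm S (\<lambda>x. f m x - f n x) < (1/4) ^ k"
    by metis
  \<comment> \<open>the partial sums are increasing and dominate \<open>N\<close>; the summand \<open>k\<close> makes them unbounded\<close>
  define r where "r k = (\<Sum>j\<le>k. N j) + k" for k
  have rN: "N k \<le> r k" for k
    unfolding r_def by (rule trans_le_add1) (rule member_le_sum, auto)
  have rS: "r k \<le> r (Suc k)" for k by (simp add: r_def)
  have rk: "k \<le> r k" for k by (simp add: r_def)
  define d where "d k x = f (r (Suc k)) x - f (r k) x" for k x
  have d2: "d k \<in> L2_space S" for k unfolding d_def by (intro L2_diff f)
  note [measurable] = L2_spaceD(1)[OF d2]
  have dn: "L2_norm S (d k) < (1/4) ^ k" for k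
    unfolding d_def using N[of k "r (Suc k)" "r k"] rN[of k] rS[of k] by simp
  have "(\<integral>\<^sup>+x. (\<Sum>k. ennreal (4 ^ k * (d k x)\<^sup>2)) \<partial>?M) = (\<Sum>k. \<integral>\<^sup>+x. ennreal (4 ^ k * (d k x)\<^sup>2) \<partial>?M)"
    by (rule nn_integral_suminf) auto
  also have "\<dots> = (\<Sum>k. ennreal (4 ^ k * (L2_norm S (d k))\<^sup>2))"
    using L2_nn_integral[OF d2] by (simp add: ennreal_mult nn_integral_cmult)
  also have "\<dots> \<le> (\<Sum>k. ennreal ((1/4) ^ k))"
  proof (intro suminf_le ennreal_leI)
    fix k
    have "(L2_norm S (d k))\<^sup>2 \<le> ((1/4) ^ k)\<^sup>2" using dn[of k] by (intro power_mono) auto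
    then have "4 ^ k * (L2_norm S (d k))\<^sup>2 \<le> 4 ^ k * ((1/4) ^ k)\<^sup>2" by (intro mult_left_mono) auto
    also have "\<dots> = (1/4) ^ k" by (simp add: power2_eq_square power_mult_distrib[symmetric] mult.assoc[symmetric])
    finally show "4 ^ k * (L2_norm S (d k))\<^sup>2 \<le> (1/4) ^ k" .
  qed auto
  also have "\<dots> = ennreal (\<Sum>k. (1/4) ^ k)"
    by (rule suminf_ennreal2) (auto intro: summable_geometric)
  finally have "(\<integral>\<^sup>+x. (\<Sum>k. ennreal (4 ^ k * (d k x)\<^sup>2)) \<partial>?M) < \<infinity>"
    by (rule le_less_trans) simp
  then have "(\<integral>\<^sup>+x. (\<Sum>k. ennreal (4 ^ k * (d k x)\<^sup>2)) \<partial>?M) \<noteq> \<infinity>"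
    by (rule less_imp_neq)
  then have ae: "AE x in ?M. (\<Sum>k. ennreal (4 ^ k * (d k x)\<^sup>2)) \<noteq> \<infinity>"
    by (intro nn_integral_PInf_AE) auto
  define g where "g x = lim (\<lambda>k. f (r k) x)" for x
  have conv: "(\<lambda>k. f (r k) x) \<longlonglongrightarrow> g x" if fin: "(\<Sum>k. ennreal (4 ^ k * (d k x)\<^sup>2)) \<noteq> \<infinity>" for x
  proof -
    define B where "B = enn2real (\<Sum>k. ennreal (4 ^ k * (d k x)\<^sup>2))"
    have B: "0 \<le> B" "(\<Sum>k. ennreal (4 ^ k * (d k x)\<^sup>2)) = ennreal B"
      unfolding B_def using fin by (simp_all only: enn2real_nonneg ennreal_enn2real less_top infinity_ennreal_def)
    have bnd: "\<bar>d k x\<bar> \<le> sqrt B * (1/2) ^ k" for k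
    proof -
      have "ennreal (4 ^ k * (d k x)\<^sup>2) \<le> (\<Sum>k. ennreal (4 ^ k * (d k x)\<^sup>2))"
        using sum_le_suminf[OF summableI, of "{k}" "\<lambda>k. ennreal (4 ^ k * (d k x)\<^sup>2)"]
        by (simp only: finite.intros sum.insert sum.empty add_0_right zero_le empty_iff simp_thms)
      then have "4 ^ k * (d k x)\<^sup>2 \<le> B" using B by simp
      then have "(2 ^ k * \<bar>d k x\<bar>)\<^sup>2 \<le> B"
        by (simp add: power_mult_distrib power_mult[symmetric] mult.commute[of k 2] power_mult)
      then have "2 ^ k * \<bar>d k x\<bar> \<le> sqrt B" by (rule real_le_rsqrt)
      then show ?thesis by (simp add: field_simps power_divide)
    qed
    have "summable (\<lambda>k. sqrt B * (1/2) ^ k)" by (intro summable_mult summable_geometric) auto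
    then have "summable (\<lambda>k. d k x)"
      by (rule summable_comparison_test') (use bnd in auto)
    then have "(\<lambda>n. \<Sum>k<n. d k x) \<longlonglongrightarrow> (\<Sum>k. d k x)" by (rule summable_LIMSEQ)
    then have "(\<lambda>n. f (r n) x - f (r 0) x) \<longlonglongrightarrow> (\<Sum>k. d k x)"
      unfolding d_def using sum_lessThan_telescope[of "\<lambda>k. f (r k) x"] by simp
    then have "(\<lambda>n. (f (r n) x - f (r 0) x) + f (r 0) x) \<longlonglongrightarrow> (\<Sum>k. d k x) + f (r 0) x"
      by (intro tendsto_intros)
    then have "convergent (\<lambda>k. f (r k) x)" by (auto simp: convergent_def)
    then show ?thesis unfolding g_def by (simp add: convergent_LIMSEQ_iff)
  qed
  have gm [measurable]: "g \<in> borel_measurable ?M" unfolding g_def by measurable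
  have bound: "(\<lambda>x. f n x - g x) \<in> L2_space S \<and> L2_norm S (\<lambda>x. f n x - g x) \<le> (1/4) ^ K" if n: "n \<ge> N K" for n K
  proof -
    have "(\<integral>\<^sup>+x. ennreal ((f n x - g x)\<^sup>2) \<partial>?M) = (\<integral>\<^sup>+x. liminf (\<lambda>k. ennreal ((f n x - f (r k) x)\<^sup>2)) \<partial>?M)"
    proof (rule nn_integral_cong_AE)
      show "AE x in ?M. ennreal ((f n x - g x)\<^sup>2) = liminf (\<lambda>k. ennreal ((f n x - f (r k) x)\<^sup>2))"
        using ae
      proof eventually_elim
        case (elim x)
        have "(\<lambda>k. ennreal ((f n x - f (r k) x)\<^sup>2)) \<longlonglongrightarrow> ennreal ((f n x - g x)\<^sup>2)"
          by (intro tendsto_ennrealI tendsto_intros conv elim)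
        then show ?case by (intro lim_imp_Liminf[symmetric]) auto
      qed
    qed
    also have "\<dots> \<le> liminf (\<lambda>k. \<integral>\<^sup>+x. ennreal ((f n x - f (r k) x)\<^sup>2) \<partial>?M)"
      by (rule nn_integral_liminf) auto
    also have "\<dots> \<le> ennreal (((1/4) ^ K)\<^sup>2)"
    proof -
      have "(\<integral>\<^sup>+x. ennreal ((f n x - f (r k) x)\<^sup>2) \<partial>?M) \<le> ennreal (((1/4) ^ K)\<^sup>2)" if "k \<ge> N K" for k
        using that rk[of k] N[of K n "r k"] n
        by (subst L2_nn_integral[OF L2_diff[OF f f]]) (intro ennreal_leI power_mono, auto)
      then have "\<forall>\<^sub>F k in sequentially. (\<integral>\<^sup>+x. ennreal ((f n x - f (r k) x)\<^sup>2) \<partial>?M) \<le> ennreal (((1/4) ^ K)\<^sup>2)"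
        by (auto simp: eventually_sequentially)
      then show ?thesis by (rule Liminf_le[rotated]) auto
    qed
    finally show ?thesis using L2_spaceI_nn[of "\<lambda>x. f n x - g x" S "(1/4) ^ K"] by simp
  qed
  have "(\<lambda>x. f (N 0) x - g x) \<in> L2_space S" using bound by blast
  from L2_diff[OF f[of "N 0"] this] have g: "g \<in> L2_space S" by simp
  have "(\<lambda>k. L2_norm S (\<lambda>x. f k x - g x)) \<longlonglongrightarrow> 0"
  proof (rule LIMSEQ_I)
    fix e :: real assume "0 < e"
    then obtain K where K: "(1/4) ^ K < e" using real_arch_pow_inv[of e "1/4"] by auto
    show "\<exists>no. \<forall>n\<ge>no. norm (L2_norm S (\<lambda>x. f n x - g x) - 0) < e"
      using bound[of K] K by (intro exI[of _ "N K"]) (auto intro: le_less_trans)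
  qed
  with g show ?thesis by blast
qed

lemma tendsto_0_obtain_less:
  fixes X :: "nat \<Rightarrow> real"
  assumes "X \<longlonglongrightarrow> 0" "0 < e"
  obtains n where "X n < e"
proof -
  have "\<forall>\<^sub>F n in sequentially. X n < e" using assms by (rule order_tendstoD)
  then show ?thesis using that eventually_happens by fastforce
qed

text \<open>The function is first truncated to a bounded one. A Lebesgue measurable function is an almost
  everywhere limit of continuous functions; truncating these at the same level gives a dominated
  sequence.\<close>

lemma L2_density_continuous:
  fixes f :: "'a::euclidean_space \<Rightarrow> real"
  assumes S: "S \<in> lmeasurable" and f: "f \<in> L2_space S" and e: "0 < e"
  shows "\<exists>c. continuous_on UNIV c \<and> (\<exists>B. \<forall>x. \<bar>c x\<bar> \<le> B) \<and> L2_norm S (\<lambda>x. f x - c x) < e"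
proof -
  let ?M = "lebesgue_on S"
  have Ss: "S \<in> sets lebesgue" using S by (simp add: fmeasurableD)
  interpret finite_measure ?M using S by (simp add: finite_measure_lebesgue_on)
  note [measurable] = L2_spaceD(1)[OF f]
  define T where "T N y = max (- real N) (min (real N) y)" for N :: nat and y
  have Tb: "\<bar>T N y\<bar> \<le> real N" for N y by (auto simp: T_def)
  have T2: "(\<lambda>x. T N (h x)) \<in> L2_space S" if [measurable]: "h \<in> borel_measurable ?M" for N h
    by (rule L2_bounded(1)[OF S, where B = "real N"]) (use Tb in \<open>auto simp: T_def\<close>)
  have "(\<lambda>N. LINT x|?M. (f x - T N (f x))\<^sup>2) \<longlonglongrightarrow> (LINT x|?M. 0)"
  proof (rule integral_dominated_convergence[where w = "\<lambda>x. (f x)\<^sup>2"])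
    show "AE x in ?M. (\<lambda>N. (f x - T N (f x))\<^sup>2) \<longlonglongrightarrow> 0"
    proof (rule AE_I2, rule tendsto_eventually)
      fix x
      \<comment> \<open>truncation at a level above \<open>\<bar>f x\<bar>\<close> does not change the value\<close>
      obtain N0 where "\<bar>f x\<bar> \<le> real N0" using real_arch_simple by blast
      then show "\<forall>\<^sub>F N in sequentially. (f x - T N (f x))\<^sup>2 = 0"
        unfolding eventually_sequentially by (intro exI[of _ N0]) (auto simp: T_def)
    qed
    show "AE x in ?M. norm ((f x - T N (f x))\<^sup>2) \<le> (f x)\<^sup>2" for N
    proof (rule AE_I2)
      fix x
      have "\<bar>f x - T N (f x)\<bar> \<le> \<bar>f x\<bar>" by (auto simp: T_def max_def min_def)
      then show "norm ((f x - T N (f x))\<^sup>2) \<le> (f x)\<^sup>2" by (simp add: abs_le_square_iff)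
    qed
  qed (use L2_spaceD(2)[OF f] in \<open>auto simp: T_def\<close>)
  then have "(\<lambda>N. L2_norm S (\<lambda>x. f x - T N (f x))) \<longlonglongrightarrow> 0"
    unfolding L2_norm_def using tendsto_real_sqrt[of _ 0] by simp
  then obtain N where N: "L2_norm S (\<lambda>x. f x - T N (f x)) < e / 2"
    using e by (elim tendsto_0_obtain_less[where e = "e / 2"]) auto
  have "(\<lambda>x. T N (f x)) measurable_on S"
  proof -
    have "(\<lambda>x. if x \<in> S then T N (f x) else 0) \<in> borel_measurable lebesgue"
      using Ss by (subst borel_measurable_if) (auto simp: T_def)
    from lebesgue_measurable_imp_measurable_on[OF this Ss]
    show ?thesis unfolding measurable_on_def by (simp cong: if_cong)
  qed
  then obtain Z g where Z: "negligible Z" and g: "\<And>n. continuous_on UNIV (g n)"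
    and lim: "\<And>x. x \<notin> Z \<Longrightarrow> (\<lambda>n. g n x) \<longlonglongrightarrow> (if x \<in> S then T N (f x) else 0)"
    unfolding measurable_on_def by blast
  have gm [measurable]: "g n \<in> borel_measurable ?M" for n
    by (rule continuous_imp_measurable_on_sets_lebesgue[OF continuous_on_subset[OF g] Ss]) auto
  have ae: "AE x in ?M. x \<notin> Z"
    using AE_not_in[of Z lebesgue] Z Ss
    by (subst AE_restrict_space_iff) (auto simp: negligible_iff_null_sets elim: eventually_mono)
  have "(\<lambda>n. LINT x|?M. (T N (f x) - T N (g n x))\<^sup>2) \<longlonglongrightarrow> (LINT x|?M. 0)"
  proof (rule integral_dominated_convergence[where w = "\<lambda>x. (2 * real N)\<^sup>2"])
    show "AE x in ?M. (\<lambda>n. (T N (f x) - T N (g n x))\<^sup>2) \<longlonglongrightarrow> 0"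
      using ae AE_space
    proof eventually_elim
      case (elim x)
      then have x: "x \<in> S" by simp
      have "(\<lambda>n. T N (g n x)) \<longlonglongrightarrow> T N (T N (f x))"
        unfolding T_def using lim[of x] elim x by (intro tendsto_intros) (auto simp: T_def)
      moreover have "T N (T N (f x)) = T N (f x)" by (auto simp: T_def)
      ultimately have "(\<lambda>n. (T N (f x) - T N (g n x))\<^sup>2) \<longlonglongrightarrow> (T N (f x) - T N (f x))\<^sup>2"
        by (intro tendsto_intros) simp
      then show ?case by simp
    qed
    show "AE x in ?M. norm ((T N (f x) - T N (g n x))\<^sup>2) \<le> (2 * real N)\<^sup>2" for n
    proof (rule AE_I2)
      fix x
      have "\<bar>T N (f x) - T N (g n x)\<bar> \<le> 2 * real N" using Tb[of N "f x"] Tb[of N "g n x"] by linarith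
      then show "norm ((T N (f x) - T N (g n x))\<^sup>2) \<le> (2 * real N)\<^sup>2"
        using power_mono[of "\<bar>T N (f x) - T N (g n x)\<bar>" "2 * real N" 2] by simp
    qed
  qed (auto simp: T_def)
  then have "(\<lambda>n. L2_norm S (\<lambda>x. T N (f x) - T N (g n x))) \<longlonglongrightarrow> 0"
    unfolding L2_norm_def using tendsto_real_sqrt[of _ 0] by simp
  then obtain n where n: "L2_norm S (\<lambda>x. T N (f x) - T N (g n x)) < e / 2"
    using e by (elim tendsto_0_obtain_less[where e = "e / 2"]) auto
  have "L2_norm S (\<lambda>x. f x - T N (g n x)) < e"
    using L2_norm_triangle3[OF f T2[of f N] T2[of "g n" N]] N n by simp
  moreover have "continuous_on UNIV (\<lambda>x. T N (g n x))"
    unfolding T_def by (intro continuous_intros g)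
  ultimately show ?thesis using Tb by blast
qed

section \<open>Calculus of smooth functions\<close>

lemma partial_deriv_eq:
  assumes "(f has_derivative D) (at x)"
  shows "partial_deriv i f x = D (axis i 1)"
  unfolding partial_deriv_def using frechet_derivative_at[OF assms] by simp

lemma has_derivative_partial_deriv:
  fixes f :: "real^'n::finite \<Rightarrow> real"
  assumes "f differentiable (at x)"
  shows "(f has_derivative (\<lambda>h. \<Sum>i\<in>UNIV. h $ i * partial_deriv i f x)) (at x)"
proof -
  let ?D = "frechet_derivative f (at x)"
  have D: "(f has_derivative ?D) (at x)" using assms by (simp add: frechet_derivative_works)
  then interpret linear ?D by (rule has_derivative_linear)
  have "?D h = (\<Sum>i\<in>UNIV. h $ i * partial_deriv i f x)" for h
  proof -
    have "?D h = ?D (\<Sum>i\<in>UNIV. (h $ i) *\<^sub>R axis i 1)"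
      using basis_expansion[of h] by (simp add: scalar_mult_eq_scaleR)
    also have "\<dots> = (\<Sum>i\<in>UNIV. h $ i * partial_deriv i f x)"
      by (simp add: sum scale partial_deriv_def)
    finally show ?thesis .
  qed
  then have "?D = (\<lambda>h. \<Sum>i\<in>UNIV. h $ i * partial_deriv i f x)" by (rule ext)
  with D show ?thesis by simp
qed

lemma partial_deriv_const: "partial_deriv i (\<lambda>x. c) = (\<lambda>x. 0)"
  by (rule ext, subst partial_deriv_eq[OF has_derivative_const]) simp

lemma partial_deriv_add:
  assumes "\<And>x. f differentiable (at x)" "\<And>x. g differentiable (at x)"
  shows "partial_deriv i (\<lambda>x. f x + g x) = (\<lambda>x. partial_deriv i f x + partial_deriv i g x)"
proof
  fix x
  have "((\<lambda>x. f x + g x) has_derivative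
      (\<lambda>h. frechet_derivative f (at x) h + frechet_derivative g (at x) h)) (at x)"
    using assms by (intro has_derivative_add) (auto simp: frechet_derivative_works[symmetric])
  from partial_deriv_eq[OF this, of i]
  show "partial_deriv i (\<lambda>x. f x + g x) x = partial_deriv i f x + partial_deriv i g x"
    by (simp add: partial_deriv_def)
qed

lemma partial_deriv_mult:
  fixes f g :: "real^'n::finite \<Rightarrow> real"
  assumes "\<And>x. f differentiable (at x)" "\<And>x. g differentiable (at x)"
  shows "partial_deriv i (\<lambda>x. f x * g x) = (\<lambda>x. partial_deriv i f x * g x + f x * partial_deriv i g x)"
proof
  fix x
  have "((\<lambda>x. f x * g x) has_derivative
      (\<lambda>h. f x * frechet_derivative g (at x) h + frechet_derivative f (at x) h * g x)) (at x)"
    using assms by (intro has_derivative_mult) (auto simp: frechet_derivative_works[symmetric])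
  from partial_deriv_eq[OF this, of i]
  show "partial_deriv i (\<lambda>x. f x * g x) x = partial_deriv i f x * g x + f x * partial_deriv i g x"
    by (simp add: partial_deriv_def)
qed

lemma partial_deriv_inner: "partial_deriv i (\<lambda>x. v \<bullet> x + c) = (\<lambda>x. v $ i)"
proof
  fix x
  have "((\<lambda>x. v \<bullet> x + c) has_derivative (\<lambda>h. v \<bullet> h + 0)) (at x)"
    by (intro derivative_intros)
  from partial_deriv_eq[OF this, of i] show "partial_deriv i (\<lambda>x. v \<bullet> x + c) x = v $ i"
    by (simp add: inner_axis)
qed

text \<open>Closure properties of smoothness are proved by induction on the order of differentiability,
  which is why the finite-order classes are introduced.\<close>

definition C_order :: "nat \<Rightarrow> (real^'n::finite \<Rightarrow> real) \<Rightarrow> bool" where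
  "C_order k f \<longleftrightarrow> (\<forall>is x. length is \<le> k \<longrightarrow> partial_derivs is f differentiable (at x))"

lemma smooth_iff_C_order: "smooth f \<longleftrightarrow> (\<forall>k. C_order k f)"
  unfolding smooth_def C_order_def by blast

lemma partial_derivs_Nil [simp]: "partial_derivs [] f = f"
  and partial_derivs_Cons [simp]: "partial_derivs (i # is) f = partial_deriv i (partial_derivs is f)"
  and partial_derivs_append: "partial_derivs (is @ js) f = partial_derivs is (partial_derivs js f)"
  by (simp_all add: partial_derivs_def)

lemma C_order_0: "C_order 0 f \<longleftrightarrow> (\<forall>x. f differentiable (at x))"
  by (simp add: C_order_def)

lemma C_order_Suc:
  "C_order (Suc k) f \<longleftrightarrow> (\<forall>x. f differentiable (at x)) \<and> (\<forall>i. C_order k (partial_deriv i f))"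
proof safe
  fix x i
  assume C: "C_order (Suc k) f"
  from C[unfolded C_order_def, rule_format, of "[]"] show "f differentiable (at x)" by simp
  show "C_order k (partial_deriv i f)"
    unfolding C_order_def
  proof safe
    fix "is" x assume "length (is :: 'a list) \<le> k"
    with C[unfolded C_order_def, rule_format, of "is @ [i]" x]
    show "partial_derivs is (partial_deriv i f) differentiable (at x)"
      by (simp add: partial_derivs_append)
  qed
next
  assume d: "\<forall>x. f differentiable (at x)" and C: "\<forall>i. C_order k (partial_deriv i f)"
  show "C_order (Suc k) f"
    unfolding C_order_def
  proof safe
    fix "is" x assume l: "length (is :: 'a list) \<le> Suc k"
    show "partial_derivs is f differentiable (at x)"
    proof (cases "is" rule: rev_cases)
      case Nil then show ?thesis using d by simp
    next
      case (snoc js j)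
      then show ?thesis using C l unfolding C_order_def by (auto simp: partial_derivs_append)
    qed
  qed
qed

lemma C_order_SucD: "C_order (Suc k) f \<Longrightarrow> C_order k f"
  unfolding C_order_def by auto

lemma C_order_const: "C_order k (\<lambda>x. c)"
  by (induction k arbitrary: c) (auto simp: C_order_0 C_order_Suc partial_deriv_const)

lemma C_order_add: "C_order k f \<Longrightarrow> C_order k g \<Longrightarrow> C_order k (\<lambda>x. f x + g x)"
proof (induction k arbitrary: f g)
  case 0 then show ?case by (simp add: C_order_0)
next
  case (Suc k)
  have "f differentiable (at x)" "g differentiable (at x)" for x
    using Suc.prems by (auto simp: C_order_Suc)
  then show ?case
    using Suc by (auto simp: C_order_Suc partial_deriv_add)
qed

lemma C_order_mult: "C_order k f \<Longrightarrow> C_order k g \<Longrightarrow> C_order k (\<lambda>x. f x * g x)"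
proof (induction k arbitrary: f g)
  case 0 then show ?case by (simp add: C_order_0)
next
  case (Suc k)
  have "f differentiable (at x)" "g differentiable (at x)" for x
    using Suc.prems by (auto simp: C_order_Suc)
  moreover have "C_order k f" "C_order k g" using Suc.prems by (auto intro: C_order_SucD)
  ultimately show ?case
    using Suc by (auto simp: C_order_Suc partial_deriv_mult intro!: C_order_add)
qed

lemma C_order_inner: "C_order k (\<lambda>x. v \<bullet> x + c)"
proof -
  have "(\<lambda>x. v \<bullet> x + c) differentiable (at x)" for x
    unfolding differentiable_def by (auto intro!: exI derivative_intros)
  then show ?thesis by (cases k) (auto simp: C_order_0 C_order_Suc partial_deriv_inner C_order_const)
qed

lemma C_order_minus: "C_order k f \<Longrightarrow> C_order k (\<lambda>x. - f x)"
  using C_order_mult[OF C_order_const[of k "-1"], of f] by simp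

lemma C_order_diff: "C_order k f \<Longrightarrow> C_order k g \<Longrightarrow> C_order k (\<lambda>x. f x - g x)"
  using C_order_add[of k f "\<lambda>x. - g x"] C_order_minus[of k g] by simp

lemma partial_deriv_inverse:
  fixes g :: "real^'n::finite \<Rightarrow> real"
  assumes d: "\<And>x. g differentiable (at x)" and nz: "\<And>x. g x \<noteq> 0"
  shows "partial_deriv i (\<lambda>x. inverse (g x)) = (\<lambda>x. - (inverse (g x) * partial_deriv i g x * inverse (g x)))"
proof
  fix x
  have "((\<lambda>x. inverse (g x)) has_derivative
      (\<lambda>h. - (inverse (g x) * frechet_derivative g (at x) h * inverse (g x)))) (at x)"
    using d nz by (intro Deriv.has_derivative_inverse) (auto simp: frechet_derivative_works[symmetric])
  from partial_deriv_eq[OF this, of i]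
  show "partial_deriv i (\<lambda>x. inverse (g x)) x = - (inverse (g x) * partial_deriv i g x * inverse (g x))"
    by (simp add: partial_deriv_def)
qed

lemma C_order_inverse:
  assumes nz: "\<And>x. g x \<noteq> 0"
  shows "C_order k g \<Longrightarrow> C_order k (\<lambda>x. inverse (g x))"
proof (induction k)
  case 0
  have "(\<lambda>x. inverse (g x)) differentiable (at x)" for x
    using 0 nz by (intro differentiable_inverse) (auto simp: C_order_0)
  then show ?case by (simp add: C_order_0)
next
  case (Suc k)
  have d: "g differentiable (at x)" for x using Suc.prems by (auto simp: C_order_Suc)
  then have "(\<lambda>x. inverse (g x)) differentiable (at x)" for x
    using nz by (intro differentiable_inverse) auto
  moreover have "C_order k (\<lambda>x. inverse (g x))" using Suc C_order_SucD by blast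
  ultimately show ?case using Suc.prems
    by (auto simp: C_order_Suc partial_deriv_inverse[OF d nz] intro!: C_order_mult C_order_minus)
qed

lemma smooth_const [intro]: "smooth (\<lambda>x. c)"
  and smooth_add [intro]: "smooth f \<Longrightarrow> smooth g \<Longrightarrow> smooth (\<lambda>x. f x + g x)"
  and smooth_mult [intro]: "smooth f \<Longrightarrow> smooth g \<Longrightarrow> smooth (\<lambda>x. f x * g x)"
  and smooth_inner: "smooth (\<lambda>x. v \<bullet> x + c)"
  and smooth_inverse: "smooth f \<Longrightarrow> (\<And>x. f x \<noteq> 0) \<Longrightarrow> smooth (\<lambda>x. inverse (f x))"
  by (auto simp: smooth_iff_C_order C_order_const C_order_add C_order_mult C_order_inner C_order_inverse)

lemma smooth_cmult [intro]: "smooth f \<Longrightarrow> smooth (\<lambda>x. c * f x)"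
  by auto

lemma smooth_diff [intro]: "smooth f \<Longrightarrow> smooth g \<Longrightarrow> smooth (\<lambda>x. f x - g x)"
  using smooth_add[of f "\<lambda>x. (-1) * g x"] smooth_cmult[of g "-1"] by simp

lemma smooth_sum: "(\<And>i. i \<in> A \<Longrightarrow> smooth (f i)) \<Longrightarrow> smooth (\<lambda>x. \<Sum>i\<in>A. f i x)"
  by (induction A rule: infinite_finite_induct) auto

lemma smooth_prod: "(\<And>i. i \<in> A \<Longrightarrow> smooth (f i)) \<Longrightarrow> smooth (\<lambda>x. \<Prod>i\<in>A. f i x)"
  by (induction A rule: infinite_finite_induct) auto

lemma smooth_nth: "smooth (\<lambda>x. x $ i)"
  using smooth_inner[of "axis i 1" 0] by (simp add: inner_axis')

lemma smooth_differentiable: "smooth f \<Longrightarrow> f differentiable (at x)"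
  using smooth_def[of f] by (metis partial_derivs_Nil)

lemma smooth_partial_derivs: "smooth f \<Longrightarrow> smooth (partial_derivs is f)"
  unfolding smooth_def by (simp add: partial_derivs_append[symmetric])

lemma smooth_partial_deriv: "smooth f \<Longrightarrow> smooth (partial_deriv i f)"
  using smooth_partial_derivs[of f "[i]"] by simp

lemma smooth_continuous: "smooth f \<Longrightarrow> continuous_on S f"
  using smooth_differentiable[of f]
  by (meson continuous_at_imp_continuous_on differentiable_imp_continuous_within)

lemma smooth_borel: "smooth f \<Longrightarrow> f \<in> borel_measurable borel"
  by (intro borel_measurable_continuous_onI smooth_continuous)

lemma smooth_has_derivative:
  "smooth f \<Longrightarrow> (f has_derivative (\<lambda>h. \<Sum>i\<in>UNIV. h $ i * partial_deriv i f x)) (at x)"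
  by (intro has_derivative_partial_deriv smooth_differentiable)

lemma partial_derivs_add:
  "smooth f \<Longrightarrow> smooth g \<Longrightarrow>
    partial_derivs is (\<lambda>x. f x + g x) = (\<lambda>x. partial_derivs is f x + partial_derivs is g x)"
  by (induction "is") (auto simp: partial_deriv_add smooth_differentiable smooth_partial_derivs)

lemma partial_derivs_const: "partial_derivs is (\<lambda>x. c) = (\<lambda>x. if is = [] then c else 0)"
  by (induction "is") (auto simp: partial_deriv_const)

lemma partial_deriv_cmult: "smooth f \<Longrightarrow> partial_deriv i (\<lambda>x. c * f x) = (\<lambda>x. c * partial_deriv i f x)"
  by (subst partial_deriv_mult) (auto simp: smooth_differentiable partial_deriv_const)

lemma partial_derivs_cmult:
  "smooth f \<Longrightarrow> partial_derivs is (\<lambda>x. c * f x) = (\<lambda>x. c * partial_derivs is f x)"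
  by (induction "is") (auto simp: partial_deriv_cmult smooth_partial_derivs)

lemma partial_derivs_diff:
  "smooth f \<Longrightarrow> smooth g \<Longrightarrow>
    partial_derivs is (\<lambda>x. f x - g x) = (\<lambda>x. partial_derivs is f x - partial_derivs is g x)"
  using partial_derivs_add[of f "\<lambda>x. (-1) * g x" "is"] partial_derivs_cmult[of g "is" "-1"]
    smooth_cmult[of g "-1"] by simp

lemma smooth_line_derivative:
  assumes "smooth f"
  shows "((\<lambda>t. f (x + t *\<^sub>R v)) has_real_derivative (\<Sum>i\<in>UNIV. v $ i * partial_deriv i f (x + t *\<^sub>R v))) (at t within S)"
proof -
  have 1: "((\<lambda>t. x + t *\<^sub>R v) has_derivative (\<lambda>s. s *\<^sub>R v)) (at t within S)"
    by (auto intro!: derivative_eq_intros)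
  have "((\<lambda>t. f (x + t *\<^sub>R v)) has_derivative
      (\<lambda>s. \<Sum>i\<in>UNIV. (s *\<^sub>R v) $ i * partial_deriv i f (x + t *\<^sub>R v))) (at t within S)"
    using has_derivative_compose[OF 1 smooth_has_derivative[OF assms]] by simp
  then show ?thesis
    unfolding has_field_derivative_def
    by (rule back_subst[of "\<lambda>D. (_ has_derivative D) _"])
       (auto simp: sum_distrib_left sum_distrib_right fun_eq_iff mult_ac)
qed

text \<open>The second difference over a square is a mixed derivative at a point of the square, by the
  mean value theorem in one variable and then in the other; its symmetry in \<open>i\<close> and \<open>j\<close> yields the
  commutation of partial derivatives.\<close>

lemma smooth_mixed_difference:
  fixes f :: "real^'n::finite \<Rightarrow> real"
  assumes f: "smooth f" and h: "0 < h"
  defines "e \<equiv> \<lambda>k. axis k (1::real)"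
  shows "\<exists>s t. 0 < s \<and> s < h \<and> 0 < t \<and> t < h \<and>
    f (x + h *\<^sub>R e i + h *\<^sub>R e j) - f (x + h *\<^sub>R e i) - f (x + h *\<^sub>R e j) + f x
      = h\<^sup>2 * partial_deriv j (partial_deriv i f) (x + s *\<^sub>R e i + t *\<^sub>R e j)"
proof -
  have e: "(\<Sum>k\<in>UNIV. e l $ k * F k) = F l" for l and F :: "'n \<Rightarrow> real"
  proof -
    have "(\<Sum>k\<in>UNIV. e l $ k * F k) = (\<Sum>k\<in>UNIV. if k = l then F k else 0)"
      by (intro sum.cong) (auto simp: e_def axis_def)
    then show ?thesis by simp
  qed
  define \<phi> where "\<phi> s = f ((x + h *\<^sub>R e j) + s *\<^sub>R e i) - f (x + s *\<^sub>R e i)" for s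
  have "(\<phi> has_real_derivative
      (partial_deriv i f ((x + h *\<^sub>R e j) + s *\<^sub>R e i) - partial_deriv i f (x + s *\<^sub>R e i))) (at s)" for s
    unfolding \<phi>_def
    using DERIV_diff[OF smooth_line_derivative[OF f, of "x + h *\<^sub>R e j" "e i" s UNIV]
        smooth_line_derivative[OF f, of x "e i" s UNIV]] by (simp add: e)
  from MVT2[OF h this] obtain s where s: "0 < s" "s < h"
    "\<phi> h - \<phi> 0 = (h - 0) * (partial_deriv i f ((x + h *\<^sub>R e j) + s *\<^sub>R e i) - partial_deriv i f (x + s *\<^sub>R e i))"
    by blast
  define \<theta> where "\<theta> t = partial_deriv i f ((x + s *\<^sub>R e i) + t *\<^sub>R e j)" for t
  have "(\<theta> has_real_derivative partial_deriv j (partial_deriv i f) ((x + s *\<^sub>R e i) + t *\<^sub>R e j)) (at t)" for t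
    unfolding \<theta>_def
    using smooth_line_derivative[OF smooth_partial_deriv[OF f, of i], of "x + s *\<^sub>R e i" "e j" t UNIV] by (simp add: e)
  from MVT2[OF h this] obtain t where t: "0 < t" "t < h"
    "\<theta> h - \<theta> 0 = (h - 0) * partial_deriv j (partial_deriv i f) ((x + s *\<^sub>R e i) + t *\<^sub>R e j)"
    by blast
  have "f (x + h *\<^sub>R e i + h *\<^sub>R e j) - f (x + h *\<^sub>R e i) - f (x + h *\<^sub>R e j) + f x = \<phi> h - \<phi> 0"
    by (simp add: \<phi>_def add_ac)
  also have "\<dots> = h * (\<theta> h - \<theta> 0)" using s(3) by (simp add: \<theta>_def add_ac)
  also have "\<dots> = h\<^sup>2 * partial_deriv j (partial_deriv i f) (x + s *\<^sub>R e i + t *\<^sub>R e j)"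
    using t(3) by (simp add: power2_eq_square)
  finally show ?thesis using s t by blast
qed

lemma partial_deriv_commute:
  fixes f :: "real^'n::finite \<Rightarrow> real"
  assumes f: "smooth f"
  shows "partial_deriv i (partial_deriv j f) = partial_deriv j (partial_deriv i f)"
proof
  fix x
  define e where "e = (\<lambda>k::'n. axis k (1::real))"
  let ?F = "partial_deriv i (partial_deriv j f)" and ?G = "partial_deriv j (partial_deriv i f)"
  have "\<exists>s t s' t'. 0 < s \<and> s < inverse (Suc n) \<and> 0 < t \<and> t < inverse (Suc n) \<and>
      0 < s' \<and> s' < inverse (Suc n) \<and> 0 < t' \<and> t' < inverse (Suc n) \<and>
      ?G (x + s *\<^sub>R e i + t *\<^sub>R e j) = ?F (x + s' *\<^sub>R e j + t' *\<^sub>R e i)" for n :: nat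
  proof -
    define h where "h = inverse (real (Suc n))"
    have h: "0 < h" by (simp add: h_def)
    obtain s t where 1: "0 < s" "s < h" "0 < t" "t < h"
      "f (x + h *\<^sub>R e i + h *\<^sub>R e j) - f (x + h *\<^sub>R e i) - f (x + h *\<^sub>R e j) + f x
        = h\<^sup>2 * ?G (x + s *\<^sub>R e i + t *\<^sub>R e j)"
      using smooth_mixed_difference[OF f h, of x i j] unfolding e_def by blast
    obtain s' t' where 2: "0 < s'" "s' < h" "0 < t'" "t' < h"
      "f (x + h *\<^sub>R e j + h *\<^sub>R e i) - f (x + h *\<^sub>R e j) - f (x + h *\<^sub>R e i) + f x
        = h\<^sup>2 * ?F (x + s' *\<^sub>R e j + t' *\<^sub>R e i)"
      using smooth_mixed_difference[OF f h, of x j i] unfolding e_def by blast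
    have "h\<^sup>2 * ?G (x + s *\<^sub>R e i + t *\<^sub>R e j) = h\<^sup>2 * ?F (x + s' *\<^sub>R e j + t' *\<^sub>R e i)"
      using 1(5) 2(5) by (simp add: algebra_simps)
    then have "?G (x + s *\<^sub>R e i + t *\<^sub>R e j) = ?F (x + s' *\<^sub>R e j + t' *\<^sub>R e i)" using h by simp
    then show ?thesis using 1 2 unfolding h_def by blast
  qed
  then obtain s t s' t' where st: "\<And>n. 0 < s n" "\<And>n. s n < inverse (Suc n)" "\<And>n. 0 < t n" "\<And>n. t n < inverse (Suc n)"
      "\<And>n. 0 < s' n" "\<And>n. s' n < inverse (Suc n)" "\<And>n. 0 < t' n" "\<And>n. t' n < inverse (Suc n)"
      and eq: "\<And>n. ?G (x + s n *\<^sub>R e i + t n *\<^sub>R e j) = ?F (x + s' n *\<^sub>R e j + t' n *\<^sub>R e i)"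
    by metis
  have z: "r \<longlonglongrightarrow> 0" if "\<And>n. 0 < r n" "\<And>n. r n < inverse (Suc n)" for r :: "nat \<Rightarrow> real"
    by (rule tendsto_sandwich[OF _ _ tendsto_const LIMSEQ_inverse_real_of_nat])
       (use that in \<open>auto intro!: always_eventually less_imp_le\<close>)
  have lim: "(\<lambda>n. x + r n *\<^sub>R a + q n *\<^sub>R b) \<longlonglongrightarrow> x"
    if "r \<longlonglongrightarrow> 0" "q \<longlonglongrightarrow> 0" for r q :: "nat \<Rightarrow> real" and a b
  proof -
    have "(\<lambda>n. x + r n *\<^sub>R a + q n *\<^sub>R b) \<longlonglongrightarrow> x + 0 *\<^sub>R a + 0 *\<^sub>R b"
      by (intro tendsto_intros that)
    then show ?thesis by simp
  qed
  have cont: "isCont ?F x" "isCont ?G x"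
    using smooth_continuous[of ?F UNIV] smooth_continuous[of ?G UNIV] f
    by (auto simp: smooth_partial_deriv continuous_on_eq_continuous_at)
  have "(\<lambda>n. ?G (x + s n *\<^sub>R e i + t n *\<^sub>R e j)) \<longlonglongrightarrow> ?G x"
    by (rule isCont_tendsto_compose[OF cont(2) lim]) (intro z st)+
  moreover have "(\<lambda>n. ?F (x + s' n *\<^sub>R e j + t' n *\<^sub>R e i)) \<longlonglongrightarrow> ?F x"
    by (rule isCont_tendsto_compose[OF cont(1) lim]) (intro z st)+
  ultimately show "?F x = ?G x" unfolding eq by (rule LIMSEQ_unique[symmetric])
qed

lemma smooth_Taylor_bound:
  fixes f :: "real^'n::finite \<Rightarrow> real"
  assumes f: "smooth f" and M: "\<And>i j z. \<bar>partial_deriv j (partial_deriv i f) z\<bar> \<le> M"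
  shows "\<bar>f (x + v) - f x - (\<Sum>i\<in>UNIV. v $ i * partial_deriv i f x)\<bar> \<le> M * (real CARD('n))\<^sup>2 * (norm v)\<^sup>2"
proof -
  define g where "g t = (\<Sum>i\<in>UNIV. v $ i * partial_deriv i f (x + t *\<^sub>R v))" for t
  define k where "k t = (\<Sum>i\<in>UNIV. v $ i * (\<Sum>j\<in>UNIV. v $ j * partial_deriv j (partial_deriv i f) (x + t *\<^sub>R v)))" for t
  have "((\<lambda>t. f (x + t *\<^sub>R v)) has_real_derivative g t) (at t)" for t
    unfolding g_def by (rule smooth_line_derivative[OF f])
  from MVT2[of 0 1, OF _ this] obtain s where s: "0 < s" "s < 1" "f (x + v) - f x = g s" by auto
  have "(g has_real_derivative k t) (at t)" for t
    unfolding g_def k_def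
    by (intro DERIV_sum DERIV_cmult smooth_line_derivative smooth_partial_deriv f)
  from MVT2[of 0 s, OF _ this] obtain r where r: "0 < r" "r < s" "g s - g 0 = s * k r" using s by auto
  have M0: "0 \<le> M" using M[of undefined undefined undefined] abs_ge_zero order_trans by blast
  have "\<bar>k r\<bar> \<le> (\<Sum>i\<in>(UNIV::'n set). norm v * (\<Sum>j\<in>(UNIV::'n set). norm v * M))"
    unfolding k_def
  proof (rule order_trans[OF sum_abs], rule sum_mono)
    fix i :: 'n
    have "\<bar>\<Sum>j\<in>UNIV. v $ j * partial_deriv j (partial_deriv i f) (x + r *\<^sub>R v)\<bar> \<le> (\<Sum>j\<in>(UNIV::'n set). norm v * M)"
      by (rule order_trans[OF sum_abs], rule sum_mono)
         (auto simp: abs_mult intro!: mult_mono component_le_norm_cart M)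
    then show "\<bar>v $ i * (\<Sum>j\<in>UNIV. v $ j * partial_deriv j (partial_deriv i f) (x + r *\<^sub>R v))\<bar>
        \<le> norm v * (\<Sum>j\<in>(UNIV::'n set). norm v * M)"
      unfolding abs_mult by (intro mult_mono component_le_norm_cart) auto
  qed
  also have "\<dots> = M * (real CARD('n))\<^sup>2 * (norm v)\<^sup>2" by (simp add: power2_eq_square)
  finally have kb: "\<bar>k r\<bar> \<le> M * (real CARD('n))\<^sup>2 * (norm v)\<^sup>2" .
  have "f (x + v) - f x - (\<Sum>i\<in>UNIV. v $ i * partial_deriv i f x) = s * k r"
    using s r by (simp add: g_def)
  then have "\<bar>f (x + v) - f x - (\<Sum>i\<in>UNIV. v $ i * partial_deriv i f x)\<bar> \<le> 1 * \<bar>k r\<bar>"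
    using s by (simp add: abs_mult mult_left_le_one_le)
  with kb show ?thesis by linarith
qed

text \<open>The functions \<open>exp (-1/t) / t\<^sup>n\<close> for \<open>t > 0\<close>: each has a derivative that is a combination of
  two others of the family, so all are smooth.\<close>

definition flat_exp :: "nat \<Rightarrow> real \<Rightarrow> real" where
  "flat_exp n t = (if t > 0 then exp (- inverse t) * (inverse t) ^ n else 0)"

text \<open>With the substitution \<open>x = 1/t\<close> this is the fact that \<open>exp x\<close> grows faster than any power.\<close>

lemma flat_exp_tendsto_0: "(flat_exp n \<longlongrightarrow> 0) (at 0)"
proof (rule filterlim_split_at_real)
  show "(flat_exp n \<longlongrightarrow> 0) (at_left 0)"
    by (rule tendsto_eventually) (auto simp: flat_exp_def eventually_at_filter)
  have "((\<lambda>x. x ^ n / exp x) \<longlongrightarrow> 0) (at_top :: real filter)" by (rule tendsto_power_div_exp_0)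
  then have "((\<lambda>t. (inverse t) ^ n / exp (inverse t)) \<longlongrightarrow> 0) (at_right (0::real))"
    by (rule filterlim_compose) (rule filterlim_inverse_at_top_right)
  then show "(flat_exp n \<longlongrightarrow> 0) (at_right 0)"
    by (rule Lim_transform_eventually)
       (auto simp: flat_exp_def eventually_at_filter exp_minus field_simps intro!: always_eventually)
qed

lemma flat_exp_deriv:
  "(flat_exp n has_real_derivative (flat_exp (n + 2) t - real n * flat_exp (n + 1) t)) (at t)"
proof -
  consider "t > 0" | "t < 0" | "t = 0" by linarith
  then show ?thesis
  proof cases
    case 1
    have "((\<lambda>t. exp (- inverse t) * (inverse t) ^ n) has_real_derivative
        (flat_exp (n + 2) t - real n * flat_exp (n + 1) t)) (at t)"
      using 1 by (cases n; cases "n - 1") (auto intro!: derivative_eq_intros simp: flat_exp_def power2_eq_square algebra_simps,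
          metis One_nat_def power_eq_if)
    then show ?thesis
      by (rule DERIV_cong_ev[THEN iffD1, rotated 3])
         (use 1 in \<open>auto simp: flat_exp_def eventually_nhds intro!: exI[of _ "{0<..}"]\<close>)
  next
    case 2
    have "((\<lambda>t. 0) has_real_derivative 0) (at t)" by simp
    then have "(flat_exp n has_real_derivative 0) (at t)"
      by (rule DERIV_cong_ev[THEN iffD1, rotated 3])
         (use 2 in \<open>auto simp: flat_exp_def eventually_nhds intro!: exI[of _ "{..<0}"]\<close>)
    then show ?thesis using 2 by (simp add: flat_exp_def)
  next
    case 3
    have "((\<lambda>h. (flat_exp n (0 + h) - flat_exp n 0) / h) \<longlongrightarrow> 0) (at 0)"
      by (rule Lim_transform_eventually[OF flat_exp_tendsto_0[of "n + 1"]])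
         (auto simp: flat_exp_def eventually_at_filter field_simps)
    then show ?thesis using 3 unfolding DERIV_def by (simp add: flat_exp_def)
  qed
qed

lemma flat_exp_inner_has_derivative:
  "((\<lambda>x. flat_exp n (v \<bullet> x + c)) has_derivative
     (\<lambda>h. (flat_exp (n + 2) (v \<bullet> x + c) - real n * flat_exp (n + 1) (v \<bullet> x + c)) * (v \<bullet> h))) (at x)"
proof -
  have "((\<lambda>x. v \<bullet> x + c) has_derivative (\<lambda>h. v \<bullet> h)) (at x)"
    by (auto intro!: derivative_eq_intros)
  from has_derivative_compose[OF this flat_exp_deriv[unfolded has_field_derivative_def]]
  show ?thesis by (simp add: mult_ac)
qed

lemma C_order_flat_exp: "C_order k (\<lambda>x. flat_exp n (v \<bullet> x + c))"
proof (induction k arbitrary: n)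
  case 0
  show ?case unfolding C_order_0 differentiable_def using flat_exp_inner_has_derivative by blast
next
  case (Suc k)
  have pd: "partial_deriv i (\<lambda>x. flat_exp n (v \<bullet> x + c)) =
     (\<lambda>x. v $ i * (flat_exp (n + 2) (v \<bullet> x + c) - real n * flat_exp (n + 1) (v \<bullet> x + c)))" for i
    using partial_deriv_eq[OF flat_exp_inner_has_derivative, of i] by (simp add: fun_eq_iff inner_axis)
  have "(\<lambda>x. flat_exp n (v \<bullet> x + c)) differentiable (at x)" for x
    unfolding differentiable_def using flat_exp_inner_has_derivative by blast
  then show ?case unfolding C_order_Suc pd
    by (intro conjI allI C_order_mult C_order_diff C_order_const Suc.IH)
qed

definition box_bump :: "real^'n::finite \<Rightarrow> real^'n \<Rightarrow> real^'n \<Rightarrow> real" where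
  "box_bump a b x = (\<Prod>i\<in>UNIV. flat_exp 0 (x $ i - a $ i) * flat_exp 0 (b $ i - x $ i))"

lemma smooth_box_bump: "smooth (box_bump a b)"
proof -
  have 1: "smooth (\<lambda>x. flat_exp 0 (x $ i - a $ i))" for i
    using C_order_flat_exp[of _ 0 "axis i 1" "- a $ i"] by (simp add: smooth_iff_C_order inner_axis')
  have 2: "smooth (\<lambda>x. flat_exp 0 (b $ i - x $ i))" for i
    using C_order_flat_exp[of _ 0 "- axis i 1" "b $ i"] by (simp add: smooth_iff_C_order inner_axis')
  show ?thesis unfolding box_bump_def by (intro smooth_prod smooth_mult 1 2)
qed

lemma box_bump_pos: "x \<in> box a b \<Longrightarrow> 0 < box_bump a b x"
  unfolding box_bump_def mem_box_cart by (auto intro!: prod_pos simp: flat_exp_def)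

lemma box_bump_eq_0: "x \<notin> box a b \<Longrightarrow> box_bump a b x = 0"
  unfolding box_bump_def mem_box_cart by (auto simp: flat_exp_def intro!: prod_zero)

lemma box_bump_nonneg: "0 \<le> box_bump a b x"
  using box_bump_pos[of x a b] box_bump_eq_0[of x a b] by (cases "x \<in> box a b") auto

section \<open>Test functions and the fundamental lemma of the calculus of variations\<close>

lemma test_funI_subset:
  assumes "smooth \<phi>" "{x. \<phi> x \<noteq> 0} \<subseteq> C" "compact C" "C \<subseteq> S"
  shows "test_fun S \<phi>"
proof -
  have "closure {x. \<phi> x \<noteq> 0} \<subseteq> C" using assms by (simp add: closure_minimal compact_imp_closed)
  moreover have "compact (closure {x. \<phi> x \<noteq> 0})"
    using assms by (meson bounded_subset compact_closure compact_imp_bounded)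
  ultimately show ?thesis using assms unfolding test_fun_def by blast
qed

lemma test_fun_smooth: "test_fun S \<phi> \<Longrightarrow> smooth \<phi>"
  by (simp add: test_fun_def)

lemma test_fun_support:
  assumes "test_fun S \<phi>"
  obtains C where "compact C" "C \<subseteq> S" "\<And>x. x \<notin> C \<Longrightarrow> \<phi> x = 0"
  using assms closure_subset[of "{x. \<phi> x \<noteq> 0}"] unfolding test_fun_def by blast

lemma test_fun_partial_deriv:
  assumes \<phi>: "test_fun S \<phi>"
  shows "test_fun S (partial_deriv i \<phi>)"
proof (rule test_funI_subset)
  let ?C = "closure {x. \<phi> x \<noteq> 0}"
  show "{x. partial_deriv i \<phi> x \<noteq> 0} \<subseteq> ?C"
  proof (rule ccontr)
    assume "\<not> ?thesis"
    then obtain x where x: "x \<notin> ?C" "partial_deriv i \<phi> x \<noteq> 0" by blast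
    have "(\<phi> has_derivative (\<lambda>h. 0)) (at x)"
      by (rule has_derivative_transform_within_open[of "\<lambda>x. 0" _ _ _ "- ?C"])
         (use x closure_subset[of "{x. \<phi> x \<noteq> 0}"] in auto)
    then show False using partial_deriv_eq[of \<phi> "\<lambda>h. 0" x i] x by simp
  qed
  show "smooth (partial_deriv i \<phi>)" using \<phi> by (simp add: test_fun_def smooth_partial_deriv)
qed (use \<phi> in \<open>auto simp: test_fun_def\<close>)

lemma test_fun_partial_derivs: "test_fun S \<phi> \<Longrightarrow> test_fun S (partial_derivs is \<phi>)"
  by (induction "is") (auto intro: test_fun_partial_deriv)

lemma test_fun_mono: "test_fun S \<phi> \<Longrightarrow> S \<subseteq> T \<Longrightarrow> test_fun T \<phi>"
  by (auto simp: test_fun_def)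

lemma test_fun_bounded:
  assumes "test_fun S \<phi>"
  obtains M where "\<And>x. \<bar>\<phi> x\<bar> \<le> M"
proof -
  obtain C where C: "compact C" "\<And>x. x \<notin> C \<Longrightarrow> \<phi> x = 0" using test_fun_support[OF assms] by metis
  have "compact (\<phi> ` C)" using C assms by (intro compact_continuous_image smooth_continuous test_fun_smooth)
  then obtain M where M: "\<And>y. y \<in> \<phi> ` C \<Longrightarrow> \<bar>y\<bar> \<le> M"
    using compact_imp_bounded bounded_real by metis
  have "\<bar>\<phi> x\<bar> \<le> max M 0" for x using M C(2)[of x] by (cases "x \<in> C") force+
  then show ?thesis using that by blast
qed

lemma test_fun_second_bound:
  fixes \<phi> :: "real^'n::finite \<Rightarrow> real"
  assumes "test_fun S \<phi>"
  obtains M where "\<And>x v. \<bar>\<phi> (x + v) - \<phi> x - (\<Sum>i\<in>UNIV. v $ i * partial_deriv i \<phi> x)\<bar> \<le> M * (norm v)\<^sup>2"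
proof -
  have "\<forall>i j. \<exists>M. \<forall>z. \<bar>partial_deriv j (partial_deriv i \<phi>) z\<bar> \<le> M"
    using test_fun_bounded[OF test_fun_partial_deriv[OF test_fun_partial_deriv[OF assms]]] by metis
  then obtain M where M: "\<And>i j z. \<bar>partial_deriv j (partial_deriv i \<phi>) z\<bar> \<le> M i j" by metis
  have "\<bar>partial_deriv j (partial_deriv i \<phi>) z\<bar> \<le> (\<Sum>i\<in>UNIV. \<Sum>j\<in>UNIV. M i j)" for i j z
  proof -
    have nn: "0 \<le> M i j" for i j using M[of j i 0] by linarith
    have "M i j \<le> (\<Sum>j\<in>UNIV. M i j)" by (rule member_le_sum) (use nn in auto)
    also have "\<dots> \<le> (\<Sum>i\<in>UNIV. \<Sum>j\<in>UNIV. M i j)"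
      by (rule member_le_sum[where f = "\<lambda>i. \<Sum>j\<in>UNIV. M i j"]) (use nn in \<open>auto intro: sum_nonneg\<close>)
    finally show ?thesis using M[of j i z] by linarith
  qed
  from smooth_Taylor_bound[OF test_fun_smooth[OF assms] this] show ?thesis using that by blast
qed

lemma test_fun_integrable:
  assumes "test_fun S \<phi>"
  shows "integrable lborel \<phi>"
proof -
  obtain C where C: "compact C" "\<And>x. x \<notin> C \<Longrightarrow> \<phi> x = 0" using test_fun_support[OF assms] by metis
  have "integrable lborel (\<lambda>x. indicator C x *\<^sub>R \<phi> x)"
    by (intro borel_integrable_compact C smooth_continuous test_fun_smooth[OF assms])
  moreover have "(\<lambda>x. indicator C x *\<^sub>R \<phi> x) = \<phi>" using C(2) by (auto simp: fun_eq_iff indicator_def)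
  ultimately show ?thesis by simp
qed

lemma AE_lebesgue_on_negligible:
  assumes "negligible N" "S \<in> sets lebesgue" "\<And>x. x \<in> S \<Longrightarrow> x \<notin> N \<Longrightarrow> P x"
  shows "AE x in lebesgue_on S. P x"
proof -
  have "AE x in lebesgue. x \<notin> N" using assms(1) by (simp add: AE_not_in negligible_iff_null_sets)
  then show ?thesis using assms by (subst AE_restrict_space_iff) (auto elim: eventually_mono)
qed

lemma absolutely_integrable_on_iff_integrable:
  fixes f :: "'a::euclidean_space \<Rightarrow> real"
  assumes "S \<in> sets lebesgue"
  shows "f absolutely_integrable_on S \<longleftrightarrow> integrable (lebesgue_on S) f"
  using assms by (simp add: set_integrable_def integrable_restrict_space)

text \<open>Integrals against test functions can be moved from the open set to a compact set that contains
  the support.\<close>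

lemma lebesgue_on_support_cong:
  fixes f :: "'a::euclidean_space \<Rightarrow> real"
  assumes "S \<in> sets lebesgue" "C \<in> sets lebesgue" "C \<subseteq> S" "\<And>x. x \<in> S \<Longrightarrow> x \<notin> C \<Longrightarrow> f x = 0"
  shows "integrable (lebesgue_on S) f \<longleftrightarrow> integrable (lebesgue_on C) f"
    and "(LINT x|lebesgue_on S. f x) = (LINT x|lebesgue_on C. f x)"
proof -
  have "(\<lambda>x. indicator S x *\<^sub>R f x) = (\<lambda>x. indicator C x *\<^sub>R f x)"
    using assms by (auto simp: indicator_def fun_eq_iff)
  then show "integrable (lebesgue_on S) f \<longleftrightarrow> integrable (lebesgue_on C) f"
    "(LINT x|lebesgue_on S. f x) = (LINT x|lebesgue_on C. f x)"
    using assms by (simp_all add: integrable_restrict_space integral_restrict_space)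
qed

lemma lebesgue_on_support_lborel:
  fixes f :: "'a::euclidean_space \<Rightarrow> real"
  assumes "S \<in> sets lebesgue" "f \<in> borel_measurable borel" "\<And>x. x \<notin> S \<Longrightarrow> f x = 0"
  shows "integrable (lebesgue_on S) f \<longleftrightarrow> integrable lborel f"
    and "(LINT x|lebesgue_on S. f x) = (LINT x|lborel. f x)"
proof -
  have "(\<lambda>x. indicator S x *\<^sub>R f x) = f"
    using assms by (auto simp: indicator_def fun_eq_iff)
  then show "integrable (lebesgue_on S) f \<longleftrightarrow> integrable lborel f"
    "(LINT x|lebesgue_on S. f x) = (LINT x|lborel. f x)"
    using assms by (simp_all add: integrable_restrict_space integral_restrict_space integrable_completion integral_completion)
qed

lemma smooth_lebesgue_on_measurable:
  "S \<in> sets lebesgue \<Longrightarrow> smooth f \<Longrightarrow> f \<in> borel_measurable (lebesgue_on S)"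
  by (rule continuous_imp_measurable_on_sets_lebesgue[OF smooth_continuous])

lemma locally_integrable_mult_test_fun:
  fixes u :: "real^'n::finite \<Rightarrow> real"
  assumes S: "open S" and u: "locally_integrable S u" and \<phi>: "test_fun S \<phi>"
  shows "integrable (lebesgue_on S) (\<lambda>x. u x * \<phi> x)"
proof -
  obtain C where C: "compact C" "C \<subseteq> S" "\<And>x. x \<notin> C \<Longrightarrow> \<phi> x = 0" using test_fun_support[OF \<phi>] by metis
  have Cm: "C \<in> sets lebesgue" using C by (meson fmeasurableD lmeasurable_compact)
  obtain M where M: "\<And>x. \<bar>\<phi> x\<bar> \<le> M" using test_fun_bounded[OF \<phi>] by metis
  have "integrable (lebesgue_on C) u"
    using u C unfolding locally_integrable_def absolutely_integrable_on_iff_integrable[OF Cm, symmetric] by blast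
  then have i: "integrable (lebesgue_on C) (\<lambda>x. M * u x)" by simp
  then have "integrable (lebesgue_on C) (\<lambda>x. u x * \<phi> x)"
  proof (rule Bochner_Integration.integrable_bound)
    have [measurable]: "u \<in> borel_measurable (lebesgue_on C)" "\<phi> \<in> borel_measurable (lebesgue_on C)"
      using \<open>integrable (lebesgue_on C) u\<close> smooth_lebesgue_on_measurable[OF Cm test_fun_smooth[OF \<phi>]] by auto
    show "(\<lambda>x. u x * \<phi> x) \<in> borel_measurable (lebesgue_on C)" by measurable
    have "\<bar>u x * \<phi> x\<bar> \<le> \<bar>M * u x\<bar>" for x
      using M[of x] mult_right_mono[of "\<bar>\<phi> x\<bar>" "\<bar>M\<bar>" "\<bar>u x\<bar>"] by (simp add: abs_mult mult.commute)
    then show "AE x in lebesgue_on C. norm (u x * \<phi> x) \<le> norm (M * u x)" by simp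
  qed
  then show ?thesis
    using C Cm S by (subst lebesgue_on_support_cong(1)[of S C]) auto
qed

text \<open>With a bump \<open>B\<close> that is positive exactly on the open box, the functions \<open>B / (B + 1/k)\<close> are
  test functions with values in \<open>[0,1]\<close> and converge to the indicator of the open box.\<close>

lemma integral_cbox_eq_0_if_test_fun:
  fixes u :: "real^'n::finite \<Rightarrow> real"
  assumes S: "open S" and u: "locally_integrable S u"
    and z: "\<And>\<phi>. test_fun S \<phi> \<Longrightarrow> (LINT x|lebesgue_on S. u x * \<phi> x) = 0"
    and ab: "cbox a b \<subseteq> S"
  shows "integral (cbox a b) u = 0"
proof -
  let ?M = "lebesgue_on (cbox a b)"
  define \<phi> where "\<phi> k x = box_bump a b x * inverse (box_bump a b x + inverse (real (Suc k)))" for k x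
  have pos: "0 < box_bump a b x + inverse (real (Suc k))" for k x
    using box_bump_nonneg[of a b x] by (simp add: add_nonneg_pos)
  have bnd: "0 \<le> \<phi> k x \<and> \<phi> k x \<le> 1" for k x
    using box_bump_nonneg[of a b x] pos[of x k] by (auto simp: \<phi>_def field_simps)
  have t: "test_fun S (\<phi> k)" for k
  proof (rule test_funI_subset)
    have "box_bump a b x + inverse (real (Suc k)) \<noteq> 0" for x using pos[of x k] by linarith
    then show "smooth (\<phi> k)"
      unfolding \<phi>_def by (intro smooth_mult smooth_inverse smooth_add smooth_box_bump smooth_const)
    show "{x. \<phi> k x \<noteq> 0} \<subseteq> cbox a b"
      using box_bump_eq_0[of _ a b] box_subset_cbox[of a b] by (auto simp: \<phi>_def)
  qed (use ab in auto)
  have ui: "integrable ?M u"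
    using u ab by (simp add: locally_integrable_def absolutely_integrable_on_iff_integrable[symmetric])
  have [measurable]: "\<phi> k \<in> borel_measurable ?M" for k
    by (rule smooth_lebesgue_on_measurable) (use test_fun_smooth[OF t] in auto)
  have [measurable]: "u \<in> borel_measurable ?M" using ui by simp
  have zero: "(LINT x|?M. u x * \<phi> k x) = 0" for k
  proof -
    have "(LINT x|lebesgue_on S. u x * \<phi> k x) = (LINT x|?M. u x * \<phi> k x)"
      by (rule lebesgue_on_support_cong(2))
         (use S ab box_bump_eq_0[of _ a b] box_subset_cbox[of a b] in \<open>auto simp: \<phi>_def\<close>)
    with z[OF t] show ?thesis by simp
  qed
  have "AE x in ?M. x \<in> box a b"
    by (rule AE_lebesgue_on_negligible[OF negligible_frontier_interval[of a b]]) auto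
  then have lim: "AE x in ?M. (\<lambda>k. u x * \<phi> k x) \<longlonglongrightarrow> u x"
  proof eventually_elim
    case (elim x)
    then have p: "0 < box_bump a b x" by (rule box_bump_pos)
    have "(\<lambda>k. u x * \<phi> k x) \<longlonglongrightarrow> u x * (box_bump a b x * inverse (box_bump a b x + 0))"
      unfolding \<phi>_def using p by (intro tendsto_intros LIMSEQ_inverse_real_of_nat) simp
    then show ?case using p by simp
  qed
  have "(\<lambda>k. LINT x|?M. u x * \<phi> k x) \<longlonglongrightarrow> (LINT x|?M. u x)"
  proof (rule integral_dominated_convergence[where w = "\<lambda>x. \<bar>u x\<bar>"])
    have "\<bar>u x * \<phi> k x\<bar> \<le> \<bar>u x\<bar>" for k x
      using bnd[of k x] by (simp add: abs_mult mult_left_le)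
    then show "AE x in ?M. norm (u x * \<phi> k x) \<le> \<bar>u x\<bar>" for k by simp
  qed (use ui lim in auto)
  then have "(LINT x|?M. u x) = 0" unfolding zero by (simp add: LIMSEQ_const_iff)
  then show ?thesis using lebesgue_integral_eq_integral[OF ui] by simp
qed

text \<open>All integrals over boxes inside \<open>S\<close> vanish, and a function is almost everywhere the limit of
  its means over shrinking cubes. To have integrals over arbitrary boxes, the function is restricted
  to one of countably many boxes that cover \<open>S\<close>.\<close>

lemma AE_eq_0_if_test_fun:
  fixes u :: "real^'n::finite \<Rightarrow> real"
  assumes S: "open S" and u: "locally_integrable S u"
    and z: "\<And>\<phi>. test_fun S \<phi> \<Longrightarrow> (LINT x|lebesgue_on S. u x * \<phi> x) = 0"
  shows "AE x in lebesgue_on S. u x = 0"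
proof -
  obtain \<D> where D: "countable \<D>" "\<D> \<subseteq> Pow S" "\<And>X. X \<in> \<D> \<Longrightarrow> \<exists>a b. X = cbox a b" "\<Union>\<D> = S"
    using open_countable_Union_open_cbox[OF S] by metis
  have "\<exists>N. negligible N \<and> (\<forall>x\<in>X - N. u x = 0)" if X: "X \<in> \<D>" for X
  proof -
    obtain a b where ab: "X = cbox a b" using D X by blast
    have XS: "X \<subseteq> S" using D X by blast
    define f where "f x = (if x \<in> X then u x else 0)" for x
    have box0: "f integrable_on cbox c d \<and> integral (cbox c d) f = 0" for c d
    proof -
      obtain c' d' where cd: "X \<inter> cbox c d = cbox c' d'" using Int_interval[of a b c d] ab by blast
      have sub: "cbox c' d' \<subseteq> S" using cd XS by blast
      then have "u absolutely_integrable_on cbox c' d'" using u by (auto simp: locally_integrable_def)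
      then have "u integrable_on cbox c' d'" by (rule set_lebesgue_integral_eq_integral(1))
      then show ?thesis
        using integral_cbox_eq_0_if_test_fun[OF S u z sub] unfolding f_def
        by (simp add: integrable_restrict_Int Henstock_Kurzweil_Integration.integral_restrict_Int cd)
    qed
    from integrable_ccontinuous_explicit[of f, OF conjunct1[OF box0]]
    obtain N where N: "negligible N" "\<And>x e. \<lbrakk>x \<notin> N; 0 < e\<rbrakk> \<Longrightarrow>
       \<exists>d>0. \<forall>h. 0 < h \<and> h < d \<longrightarrow> norm (integral (cbox x (x + h *\<^sub>R One)) f /\<^sub>R h ^ DIM(real^'n) - f x) < e"
      by blast
    have "f x = 0" if x: "x \<notin> N" for x
    proof (rule ccontr)
      assume "f x \<noteq> 0"
      then obtain d where d: "d > 0" "\<forall>h. 0 < h \<and> h < d \<longrightarrow> norm (integral (cbox x (x + h *\<^sub>R One)) f /\<^sub>R h ^ DIM(real^'n) - f x) < norm (f x)"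
        using N(2)[OF x, of "norm (f x)"] by auto
      from d(2)[rule_format, of "d / 2"] d(1) show False by (simp add: box0)
    qed
    then show ?thesis using N(1) unfolding f_def by (metis DiffE)
  qed
  then obtain N where N: "\<And>X. X \<in> \<D> \<Longrightarrow> negligible (N X)" "\<And>X x. X \<in> \<D> \<Longrightarrow> x \<in> X - N X \<Longrightarrow> u x = 0" by metis
  have "negligible (\<Union>(N ` \<D>))" using D(1) N(1) by (intro negligible_countable_Union) auto
  then show ?thesis
    by (rule AE_lebesgue_on_negligible) (use S D(4) N(2) in auto)
qed

section \<open>Weak derivatives and the Sobolev seminorms\<close>

lemma locally_integrable_add:
  "locally_integrable S f \<Longrightarrow> locally_integrable S g \<Longrightarrow> locally_integrable S (\<lambda>x. f x + g x)"
  unfolding locally_integrable_def by (auto intro: set_integral_add)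

lemma locally_integrable_cmult:
  "locally_integrable S f \<Longrightarrow> locally_integrable S (\<lambda>x. c * f x)"
  unfolding locally_integrable_def by (auto intro: set_integrable_mult_right)

lemma locally_integrable_diff:
  "locally_integrable S f \<Longrightarrow> locally_integrable S g \<Longrightarrow> locally_integrable S (\<lambda>x. f x - g x)"
  using locally_integrable_add[of S f "\<lambda>x. (-1) * g x"] locally_integrable_cmult[of S g "-1"] by simp

lemma L2_locally_integrable:
  assumes "S \<in> lmeasurable" "f \<in> L2_space S"
  shows "locally_integrable S f"
  unfolding locally_integrable_def
proof safe
  fix C assume C: "compact C" "C \<subseteq> S"
  have "f absolutely_integrable_on S"
    using L2_integrable[OF assms] assms by (simp add: absolutely_integrable_on_iff_integrable fmeasurableD)
  then show "f absolutely_integrable_on C"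
    by (rule set_integrable_subset) (use C in \<open>auto intro: fmeasurableD lmeasurable_compact\<close>)
qed

lemma smooth_L2:
  fixes f :: "real^'n::finite \<Rightarrow> real"
  assumes "S \<in> sets lebesgue" "bounded S" "smooth f"
  shows "f \<in> L2_space S"
proof -
  have "compact (f ` closure S)"
    using assms by (intro compact_continuous_image smooth_continuous) (auto simp: compact_closure)
  then obtain B where B: "\<And>y. y \<in> f ` closure S \<Longrightarrow> \<bar>y\<bar> \<le> B"
    using compact_imp_bounded bounded_real by metis
  show ?thesis
  proof (rule L2_bounded(1))
    show "S \<in> lmeasurable" using assms by (simp add: bounded_set_imp_lmeasurable)
    show "\<bar>f x\<bar> \<le> B" if "x \<in> S" for x using B closure_subset[of S] that by blast
  qed (use assms in \<open>simp add: smooth_lebesgue_on_measurable\<close>)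
qed

lemma smooth_locally_integrable:
  fixes f :: "real^'n::finite \<Rightarrow> real"
  assumes f: "smooth f"
  shows "locally_integrable S f"
  unfolding locally_integrable_def
proof safe
  fix C :: "(real^'n) set" assume C: "compact C"
  then have m: "C \<in> lmeasurable" "C \<in> sets lebesgue" "bounded C"
    by (auto simp: lmeasurable_compact fmeasurableD compact_imp_bounded)
  show "f absolutely_integrable_on C"
    using L2_integrable[OF m(1) smooth_L2[OF m(2,3) f]] m by (simp add: absolutely_integrable_on_iff_integrable)
qed

lemma has_weak_deriv_unique:
  fixes v :: "real^'n::finite \<Rightarrow> real"
  assumes S: "open S" and g: "has_weak_deriv S is v g" and g': "has_weak_deriv S is v g'"
  shows "AE x in lebesgue_on S. g x = g' x"
proof -
  have l: "locally_integrable S g" "locally_integrable S g'" using g g' by (auto simp: has_weak_deriv_def)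
  have "AE x in lebesgue_on S. g x - g' x = 0"
  proof (rule AE_eq_0_if_test_fun[OF S locally_integrable_diff[OF l]])
    fix \<phi> assume \<phi>: "test_fun S \<phi>"
    have "(LINT x|lebesgue_on S. v x * partial_derivs is \<phi> x) = (-1) ^ length is * (LINT x|lebesgue_on S. g x * \<phi> x)"
      "(LINT x|lebesgue_on S. v x * partial_derivs is \<phi> x) = (-1) ^ length is * (LINT x|lebesgue_on S. g' x * \<phi> x)"
      using g g' \<phi> unfolding has_weak_deriv_def by blast+
    then have "(LINT x|lebesgue_on S. g x * \<phi> x) = (LINT x|lebesgue_on S. g' x * \<phi> x)" by simp
    then show "(LINT x|lebesgue_on S. (g x - g' x) * \<phi> x) = 0"
      using locally_integrable_mult_test_fun[OF S l(1) \<phi>] locally_integrable_mult_test_fun[OF S l(2) \<phi>]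
      by (simp add: left_diff_distrib)
  qed
  then show ?thesis by simp
qed

lemma has_weak_deriv_weak_deriv: "has_weak_deriv S is v g \<Longrightarrow> has_weak_deriv S is v (weak_deriv S is v)"
  unfolding weak_deriv_def by (rule someI_ex[of "has_weak_deriv S is v"]) blast

lemma weak_deriv_AE:
  "open S \<Longrightarrow> has_weak_deriv S is v g \<Longrightarrow> AE x in lebesgue_on S. g x = weak_deriv S is v x"
  by (rule has_weak_deriv_unique[OF _ _ has_weak_deriv_weak_deriv])

lemma has_weak_deriv_add:
  fixes v :: "real^'n::finite \<Rightarrow> real"
  assumes S: "open S" and g: "has_weak_deriv S is v g" and k: "has_weak_deriv S is w k"
  shows "has_weak_deriv S is (\<lambda>x. v x + w x) (\<lambda>x. g x + k x)"
proof -
  have l: "locally_integrable S v" "locally_integrable S g" "locally_integrable S w" "locally_integrable S k"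
    using g k by (auto simp: has_weak_deriv_def)
  have "(LINT x|lebesgue_on S. (v x + w x) * partial_derivs is \<phi> x)
          = (-1) ^ length is * (LINT x|lebesgue_on S. (g x + k x) * \<phi> x)" if \<phi>: "test_fun S \<phi>" for \<phi>
    using g k \<phi> l locally_integrable_mult_test_fun[OF S _ \<phi>]
      locally_integrable_mult_test_fun[OF S _ test_fun_partial_derivs[OF \<phi>, of "is"]]
    by (simp add: has_weak_deriv_def distrib_right distrib_left)
  then show ?thesis using l by (simp add: has_weak_deriv_def locally_integrable_add)
qed

lemma has_weak_deriv_cmult:
  fixes v :: "real^'n::finite \<Rightarrow> real"
  assumes "has_weak_deriv S is v g"
  shows "has_weak_deriv S is (\<lambda>x. c * v x) (\<lambda>x. c * g x)"
  using assms by (simp add: has_weak_deriv_def locally_integrable_cmult mult.assoc)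

lemma has_weak_deriv_diff:
  fixes v :: "real^'n::finite \<Rightarrow> real"
  assumes "open S" "has_weak_deriv S is v g" "has_weak_deriv S is w k"
  shows "has_weak_deriv S is (\<lambda>x. v x - w x) (\<lambda>x. g x - k x)"
  using has_weak_deriv_add[OF assms(1,2) has_weak_deriv_cmult[OF assms(3), of "-1"]] by simp

text \<open>The test function \<open>\<partial>\<^sup>j\<^sup>s \<phi>\<close> in the identity for \<open>is\<close> turns it into the one for \<open>is @ js\<close>.\<close>

lemma has_weak_deriv_append:
  assumes v: "has_weak_deriv S is v w" and g: "has_weak_deriv S (is @ js) v g"
  shows "has_weak_deriv S js w g"
  unfolding has_weak_deriv_def
proof (intro conjI allI impI)
  show "locally_integrable S w" "locally_integrable S g" using v g by (auto simp: has_weak_deriv_def)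
  fix \<phi> assume \<phi>: "test_fun S \<phi>"
  have "(-1) ^ length is * (LINT x|lebesgue_on S. w x * partial_derivs js \<phi> x)
      = (LINT x|lebesgue_on S. v x * partial_derivs is (partial_derivs js \<phi>) x)"
    using v test_fun_partial_derivs[OF \<phi>, of js] by (simp add: has_weak_deriv_def)
  also have "\<dots> = (-1) ^ length (is @ js) * (LINT x|lebesgue_on S. g x * \<phi> x)"
    using g \<phi> unfolding has_weak_deriv_def partial_derivs_append by blast
  finally show "(LINT x|lebesgue_on S. w x * partial_derivs js \<phi> x) = (-1) ^ length js * (LINT x|lebesgue_on S. g x * \<phi> x)"
    by (simp add: power_add)
qed

text \<open>The integral of \<open>\<phi> (x + v) - \<phi> x\<close> vanishes by translation invariance. For \<open>v = t e\<^sub>i\<close> Taylor's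
  formula says that \<open>\<phi> (x + v) - \<phi> x\<close> equals \<open>t \<partial>\<^sub>i \<phi> x\<close> up to \<open>O(t\<^sup>2)\<close>, uniformly and on a fixed
  ball; dividing by \<open>t\<close> and letting \<open>t\<close> tend to zero gives the claim without an iterated integral.\<close>

lemma integral_partial_deriv_test_fun:
  fixes \<phi> :: "real^'n::finite \<Rightarrow> real"
  assumes \<phi>: "test_fun UNIV \<phi>"
  shows "(LINT x|lborel. partial_deriv i \<phi> x) = 0"
proof -
  obtain M where M: "\<And>x v. \<bar>\<phi> (x + v) - \<phi> x - (\<Sum>i\<in>UNIV. v $ i * partial_deriv i \<phi> x)\<bar> \<le> M * (norm v)\<^sup>2"
    using test_fun_second_bound[OF \<phi>] by metis
  obtain C where C: "compact C" "\<And>x. x \<notin> C \<Longrightarrow> \<phi> x = 0" using test_fun_support[OF \<phi>] by metis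
  obtain C' where C': "compact C'" "\<And>x. x \<notin> C' \<Longrightarrow> partial_deriv i \<phi> x = 0"
    using test_fun_support[OF test_fun_partial_deriv[OF \<phi>]] by metis
  have "bounded (C \<union> C')" using C C' by (simp add: compact_imp_bounded)
  then obtain R where R: "\<And>x. x \<in> C \<union> C' \<Longrightarrow> norm x \<le> R" unfolding bounded_iff by blast
  define K where "K = measure lborel (cball (0::real^'n) (R + 1))"
  let ?I = "LINT x|lborel. partial_deriv i \<phi> x"
  have int: "integrable lborel \<phi>" "integrable lborel (partial_deriv i \<phi>)"
    using test_fun_integrable[OF \<phi>] test_fun_integrable[OF test_fun_partial_deriv[OF \<phi>]] by auto
  have [measurable]: "\<phi> \<in> borel_measurable borel" using smooth_borel test_fun_smooth[OF \<phi>] by blast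
  have est: "\<bar>?I\<bar> \<le> t * (M * K)" if t: "0 < t" "t \<le> 1" for t
  proof -
    define v :: "real^'n" where "v = t *\<^sub>R axis i 1"
    have nv: "norm v = t" using t by (simp add: v_def)
    have sv: "(\<Sum>k\<in>UNIV. v $ k * F k) = t * F i" for F
    proof -
      have "(\<Sum>k\<in>UNIV. v $ k * F k) = (\<Sum>k\<in>UNIV. if k = i then t * F k else 0)"
        by (intro sum.cong) (auto simp: v_def axis_def)
      then show ?thesis by simp
    qed
    have shift: "integrable lborel (\<lambda>x. \<phi> (x + v))" "(LINT x|lborel. \<phi> (x + v)) = (LINT x|lborel. \<phi> x)"
    proof -
      have "integrable (distr lborel borel ((+) v)) \<phi>" using int by (simp add: lborel_distr_plus)
      then show "integrable lborel (\<lambda>x. \<phi> (x + v))" by (simp add: integrable_distr_eq add.commute)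
      have "(LINT x|distr lborel borel ((+) v). \<phi> x) = (LINT x|lborel. \<phi> (x + v))"
        by (subst integral_distr) (auto simp: add.commute)
      then show "(LINT x|lborel. \<phi> (x + v)) = (LINT x|lborel. \<phi> x)" by (simp add: lborel_distr_plus)
    qed
    define r where "r x = \<phi> (x + v) - \<phi> x - t * partial_deriv i \<phi> x" for x
    have ri: "integrable lborel r" unfolding r_def using int shift by simp
    have rI: "(LINT x|lborel. r x) = - t * ?I" unfolding r_def using int shift by simp
    have "\<bar>r x\<bar> \<le> indicator (cball 0 (R + 1)) x * (M * t\<^sup>2)" for x
    proof (cases "x \<in> cball 0 (R + 1)")
      case True
      then show ?thesis using M[of x v] by (simp add: r_def nv sv)
    next
      case False
      then have "norm x > R + 1" by simp
      moreover have "norm x \<le> norm (x + v) + norm v"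
        using norm_triangle_ineq4[of "x + v" v] by simp
      ultimately have "norm (x + v) > R" "norm x > R" using nv t by linarith+
      then have "x + v \<notin> C" "x \<notin> C" "x \<notin> C'" using R by force+
      then show ?thesis using C(2) C'(2) False by (simp add: r_def)
    qed
    then have rb: "\<bar>r x\<bar> \<le> indicat_real (cball (0::real^'n) (R + 1)) x * (M * t\<^sup>2)" for x .
    have "\<bar>LINT x|lborel. r x\<bar> \<le> (LINT x|lborel. \<bar>r x\<bar>)" by (rule integral_abs_bound)
    also have "\<dots> \<le> (LINT x|lborel. indicat_real (cball (0::real^'n) (R + 1)) x * (M * t\<^sup>2))"
      using ri rb by (intro integral_mono integrable_mult_left integrable_real_indicator)
        (auto simp: emeasure_bounded_finite[simplified])
    also have "\<dots> = K * (M * t\<^sup>2)" by (simp add: K_def)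
    finally have "\<bar>LINT x|lborel. r x\<bar> \<le> K * (M * t\<^sup>2)" .
    then have "t * \<bar>?I\<bar> \<le> K * (M * t\<^sup>2)" using t by (simp add: rI abs_mult)
    then have "t * \<bar>?I\<bar> \<le> t * (t * (M * K))" by (simp add: power2_eq_square mult_ac)
    then show ?thesis using t by simp
  qed
  have "(\<lambda>n. inverse (real (Suc n)) * (M * K)) \<longlonglongrightarrow> 0 * (M * K)"
    by (intro tendsto_intros LIMSEQ_inverse_real_of_nat)
  moreover have "\<bar>?I\<bar> \<le> inverse (real (Suc n)) * (M * K)" for n
    by (rule est) (auto simp: field_simps)
  ultimately have "\<bar>?I\<bar> \<le> 0 * (M * K)" by (intro LIMSEQ_le_const) auto
  then show ?thesis by simp
qed

lemma smooth_integration_by_parts: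
  fixes f :: "real^'n::finite \<Rightarrow> real"
  assumes S: "open S" and f: "smooth f" and \<phi>: "test_fun S \<phi>"
  shows "(LINT x|lebesgue_on S. f x * partial_deriv i \<phi> x) = - (LINT x|lebesgue_on S. partial_deriv i f x * \<phi> x)"
proof -
  obtain C where C: "compact C" "C \<subseteq> S" "\<And>x. x \<notin> C \<Longrightarrow> \<phi> x = 0" using test_fun_support[OF \<phi>] by metis
  note s = test_fun_smooth[OF \<phi>]
  have t: "test_fun S (\<lambda>x. f x * \<phi> x)"
    by (rule test_funI_subset[of _ C]) (use C f s in auto)
  have eq: "partial_deriv i (\<lambda>x. f x * \<phi> x) = (\<lambda>x. partial_deriv i f x * \<phi> x + f x * partial_deriv i \<phi> x)"
    by (rule partial_deriv_mult) (auto intro: smooth_differentiable f s)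
  obtain C' where C': "compact C'" "C' \<subseteq> S" "\<And>x. x \<notin> C' \<Longrightarrow> partial_deriv i (\<lambda>x. f x * \<phi> x) x = 0"
    using test_fun_support[OF test_fun_partial_deriv[OF t]] by metis
  have "(LINT x|lebesgue_on S. partial_deriv i (\<lambda>x. f x * \<phi> x) x) = (LINT x|lborel. partial_deriv i (\<lambda>x. f x * \<phi> x) x)"
    by (rule lebesgue_on_support_lborel(2))
       (use S C' in \<open>auto intro!: smooth_borel smooth_partial_deriv smooth_mult f s\<close>)
  also have "\<dots> = 0"
    by (rule integral_partial_deriv_test_fun) (rule test_fun_mono[OF t], simp)
  finally have "(LINT x|lebesgue_on S. partial_deriv i f x * \<phi> x + f x * partial_deriv i \<phi> x) = 0" by (simp add: eq)
  moreover have "integrable (lebesgue_on S) (\<lambda>x. partial_deriv i f x * \<phi> x)"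
    by (intro locally_integrable_mult_test_fun[OF S _ \<phi>] smooth_locally_integrable smooth_partial_deriv f)
  moreover have "integrable (lebesgue_on S) (\<lambda>x. f x * partial_deriv i \<phi> x)"
    by (intro locally_integrable_mult_test_fun[OF S _ test_fun_partial_deriv[OF \<phi>]] smooth_locally_integrable f)
  ultimately show ?thesis by simp
qed

lemma partial_derivs_commute:
  "smooth f \<Longrightarrow> partial_derivs is (partial_deriv i f) = partial_deriv i (partial_derivs is f)"
  by (induction "is") (auto simp: partial_deriv_commute[of _ i] smooth_partial_derivs)

lemma has_weak_deriv_smooth:
  fixes f :: "real^'n::finite \<Rightarrow> real"
  assumes S: "open S" and f: "smooth f"
  shows "has_weak_deriv S is f (partial_derivs is f)"
proof -
  have "(LINT x|lebesgue_on S. f x * partial_derivs is \<phi> x)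
      = (-1) ^ length is * (LINT x|lebesgue_on S. partial_derivs is f x * \<phi> x)" if \<phi>: "test_fun S \<phi>" for \<phi>
    using f
  proof (induction "is" arbitrary: f)
    case Nil then show ?case by simp
  next
    case (Cons i "is")
    show ?case
      using smooth_integration_by_parts[OF S Cons.prems test_fun_partial_derivs[OF \<phi>, of "is"], of i]
        Cons.IH[OF smooth_partial_deriv[OF Cons.prems, of i]]
      by (simp add: partial_derivs_commute[OF Cons.prems])
  qed
  then show ?thesis
    using f by (simp add: has_weak_deriv_def smooth_locally_integrable smooth_partial_derivs)
qed

lemma smooth_sobolev:
  fixes f :: "real^'n::finite \<Rightarrow> real"
  assumes "open S" "bounded S" "smooth f"
  shows "f \<in> sobolev_space m S"
proof -
  have L: "partial_derivs is f \<in> L2_space S" for "is"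
    using assms by (intro smooth_L2 smooth_partial_derivs) auto
  show ?thesis
    using L[of "[]"] L has_weak_deriv_smooth[OF assms(1,3)] by (auto simp: sobolev_space_def)
qed

context
  fixes S :: "(real^'n::finite) set"
  assumes S: "open S" and bS: "bounded S"
begin

lemma sobolev_weak_deriv:
  assumes "v \<in> sobolev_space m S" "length is \<le> m"
  shows "has_weak_deriv S is v (weak_deriv S is v)" "weak_deriv S is v \<in> L2_space S"
proof -
  obtain g where g: "g \<in> L2_space S" "has_weak_deriv S is v g"
    using assms unfolding sobolev_space_def by blast
  show "has_weak_deriv S is v (weak_deriv S is v)" using g by (blast intro: has_weak_deriv_weak_deriv)
  show "weak_deriv S is v \<in> L2_space S"
    by (rule L2_space_cong_AE[OF _ g(1) weak_deriv_AE[OF S g(2)]]) (use S in auto)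
qed

lemma sobolev_add:
  assumes "v \<in> sobolev_space m S" "w \<in> sobolev_space m S"
  shows "(\<lambda>x. v x + w x) \<in> sobolev_space m S"
proof -
  have "\<exists>g\<in>L2_space S. has_weak_deriv S is (\<lambda>x. v x + w x) g" if "length is \<le> m" for "is"
    using sobolev_weak_deriv[OF assms(1) that] sobolev_weak_deriv[OF assms(2) that]
    by (blast intro: L2_add has_weak_deriv_add[OF S])
  moreover have "v \<in> L2_space S" "w \<in> L2_space S" using assms by (auto simp: sobolev_space_def)
  ultimately show ?thesis by (auto simp: sobolev_space_def intro: L2_add)
qed

lemma sobolev_cmult:
  assumes "v \<in> sobolev_space m S"
  shows "(\<lambda>x. c * v x) \<in> sobolev_space m S"
proof -
  have "\<exists>g\<in>L2_space S. has_weak_deriv S is (\<lambda>x. c * v x) g" if "length is \<le> m" for "is"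
    using sobolev_weak_deriv[OF assms(1) that] by (blast intro: L2_cmult has_weak_deriv_cmult)
  moreover have "v \<in> L2_space S" using assms by (auto simp: sobolev_space_def)
  ultimately show ?thesis by (auto simp: sobolev_space_def intro: L2_cmult)
qed

lemma sobolev_diff:
  assumes "v \<in> sobolev_space m S" "w \<in> sobolev_space m S"
  shows "(\<lambda>x. v x - w x) \<in> sobolev_space m S"
  using sobolev_add[OF assms(1) sobolev_cmult[OF assms(2), of "-1"]] by simp

lemma L2_norm_weak_deriv_eq:
  assumes "has_weak_deriv S is v g" "g \<in> L2_space S"
  shows "L2_norm S (weak_deriv S is v) = L2_norm S g"
  by (rule L2_norm_cong_AE[OF _ assms(2) weak_deriv_AE[OF S assms(1)]]) (use S in auto)

lemma grad_norm_L2_set: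
  "grad_norm j S v = L2_set (\<lambda>is. L2_norm S (weak_deriv S is v)) {is. length is = j}"
  unfolding grad_norm_def L2_set_def ..

lemma grad_norm_nonneg: "0 \<le> grad_norm j S v"
  unfolding grad_norm_def by (simp add: sum_nonneg)

lemma finite_multi_indices: "finite {is :: 'n list. length is = j}"
  using finite_lists_length_eq[of "UNIV :: 'n set" j] by simp

lemma grad_norm_triangle:
  assumes v: "v \<in> sobolev_space m S" and w: "w \<in> sobolev_space m S" and j: "j \<le> m"
  shows "grad_norm j S (\<lambda>x. v x + w x) \<le> grad_norm j S v + grad_norm j S w"
proof -
  have "L2_norm S (weak_deriv S is (\<lambda>x. v x + w x)) \<le> L2_norm S (weak_deriv S is v) + L2_norm S (weak_deriv S is w)"
    if "length is = j" for "is"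
  proof -
    have l: "length is \<le> m" using that j by simp
    note a = sobolev_weak_deriv[OF v l] and b = sobolev_weak_deriv[OF w l]
    show ?thesis
      using L2_norm_weak_deriv_eq[OF has_weak_deriv_add[OF S a(1) b(1)] L2_add[OF a(2) b(2)]]
        L2_norm_triangle[OF a(2) b(2)] by simp
  qed
  then have "grad_norm j S (\<lambda>x. v x + w x) \<le>
      L2_set (\<lambda>is. L2_norm S (weak_deriv S is v) + L2_norm S (weak_deriv S is w)) {is. length is = j}"
    unfolding grad_norm_L2_set by (intro L2_set_mono) auto
  also have "\<dots> \<le> grad_norm j S v + grad_norm j S w"
    unfolding grad_norm_L2_set by (rule L2_set_triangle_ineq)
  finally show ?thesis .
qed

lemma grad_norm_cmult:
  assumes v: "v \<in> sobolev_space m S" and j: "j \<le> m"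
  shows "grad_norm j S (\<lambda>x. c * v x) = \<bar>c\<bar> * grad_norm j S v"
proof -
  have "L2_norm S (weak_deriv S is (\<lambda>x. c * v x)) = \<bar>c\<bar> * L2_norm S (weak_deriv S is v)" if "length is = j" for "is"
  proof -
    have l: "length is \<le> m" using that j by simp
    note a = sobolev_weak_deriv[OF v l]
    show ?thesis
      using L2_norm_weak_deriv_eq[OF has_weak_deriv_cmult[OF a(1)] L2_cmult[OF a(2)]]
      by (simp add: L2_norm_cmult)
  qed
  then show ?thesis unfolding grad_norm_L2_set
    by (subst L2_set_right_distrib) (auto intro!: L2_set_cong)
qed

lemma grad_norm_triangle_diff:
  assumes v: "v \<in> sobolev_space m S" and w: "w \<in> sobolev_space m S" and j: "j \<le> m"
  shows "grad_norm j S (\<lambda>x. v x - w x) \<le> grad_norm j S v + grad_norm j S w"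
  using grad_norm_triangle[OF v sobolev_cmult[OF w, of "-1"] j] grad_norm_cmult[OF w j, of "-1"] by simp

lemma grad_norm_diff_commute:
  assumes v: "v \<in> sobolev_space m S" and w: "w \<in> sobolev_space m S" and j: "j \<le> m"
  shows "grad_norm j S (\<lambda>x. v x - w x) = grad_norm j S (\<lambda>x. w x - v x)"
  using grad_norm_cmult[OF sobolev_diff[OF w v] j, of "-1"] by simp

lemma grad_norm_eqI:
  assumes "\<And>is. length is = j \<Longrightarrow> has_weak_deriv S is v (g is)" "\<And>is. length is = j \<Longrightarrow> g is \<in> L2_space S"
  shows "grad_norm j S v = L2_set (\<lambda>is. L2_norm S (g is)) {is. length is = j}"
  unfolding grad_norm_L2_set by (rule L2_set_cong) (auto intro!: L2_norm_weak_deriv_eq assms)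

lemma grad_norm_smooth:
  assumes "smooth f"
  shows "grad_norm j S f = L2_set (\<lambda>is. L2_norm S (partial_derivs is f)) {is. length is = j}"
  by (rule grad_norm_eqI)
     (use assms S bS in \<open>auto intro!: has_weak_deriv_smooth smooth_L2 smooth_partial_derivs\<close>)

end

section \<open>Density of smooth functions on bounded convex open sets\<close>

lemma partial_derivs_reflect:
  fixes f :: "real^'n::finite \<Rightarrow> real"
  assumes f: "smooth f"
  shows "partial_derivs is (\<lambda>z. f (p - z)) = (\<lambda>z. (-1) ^ length is * partial_derivs is f (p - z)) \<and>
    smooth (\<lambda>z. f (p - z))"
proof -
  have 1: "((\<lambda>z. h (p - z)) has_derivative (\<lambda>v. \<Sum>i\<in>UNIV. (- v) $ i * partial_deriv i h (p - z))) (at z)"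
    if "smooth h" for h :: "real^'n \<Rightarrow> real" and z
    using has_derivative_compose[OF has_derivative_diff[OF has_derivative_const has_derivative_ident]
        smooth_has_derivative[OF that], of p z UNIV] by simp
  have pd: "partial_deriv i (\<lambda>z. h (p - z)) = (\<lambda>z. - partial_deriv i h (p - z))"
    if h: "smooth h" for h :: "real^'n \<Rightarrow> real" and i
  proof
    fix z
    have "partial_deriv i (\<lambda>z. h (p - z)) z = (\<Sum>k\<in>UNIV. (- axis i 1) $ k * partial_deriv k h (p - z))"
      by (rule partial_deriv_eq[OF 1[OF h]])
    also have "\<dots> = (\<Sum>k\<in>UNIV. if k = i then - partial_deriv k h (p - z) else 0)"
      by (intro sum.cong) (auto simp: axis_def)
    finally show "partial_deriv i (\<lambda>z. h (p - z)) z = - partial_deriv i h (p - z)" by simp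
  qed
  have all: "partial_derivs is (\<lambda>z. f (p - z)) = (\<lambda>z. (-1) ^ length is * partial_derivs is f (p - z))" for "is"
  proof (induction "is")
    case Nil then show ?case by simp
  next
    case (Cons i "is")
    have d: "(\<lambda>z. partial_derivs is f (p - z)) differentiable (at z)" for z
      using 1[OF smooth_partial_derivs[OF f]] unfolding differentiable_def by blast
    have "partial_deriv i (\<lambda>z. (-1) ^ length is * partial_derivs is f (p - z))
      = (\<lambda>z. (-1) ^ length is * partial_deriv i (\<lambda>z. partial_derivs is f (p - z)) z)"
      by (subst partial_deriv_mult) (use d in \<open>auto simp: partial_deriv_const\<close>)
    then show ?case using Cons by (simp add: pd smooth_partial_derivs f)
  qed
  moreover have "smooth (\<lambda>z. f (p - z))"
    unfolding smooth_def all
  proof safe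
    fix "is" and z
    have "(\<lambda>z. partial_derivs is f (p - z)) differentiable (at z)"
      using 1[OF smooth_partial_derivs[OF f]] unfolding differentiable_def by blast
    then show "(\<lambda>z. (-1) ^ length is * partial_derivs is f (p - z)) differentiable (at z)"
      by (intro differentiable_mult) auto
  qed
  ultimately show ?thesis by blast
qed

text \<open>The mollification of \<open>w\<close> with kernel \<open>\<eta>\<close>, evaluated at the dilated point \<open>c + s x\<close>. One integral for both
  steps lets all derivatives fall on the kernel.\<close>

definition dilated_conv ::
  "(real^'n::finite) set \<Rightarrow> (real^'n \<Rightarrow> real) \<Rightarrow> real^'n \<Rightarrow> real \<Rightarrow> (real^'n \<Rightarrow> real) \<Rightarrow> real^'n \<Rightarrow> real" where
  "dilated_conv S \<eta> c s w x = (LINT z|lebesgue_on S. w z * \<eta> (c + s *\<^sub>R x - z))"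

lemma nn_integral_lborel_affine:
  fixes f :: "real^'n::finite \<Rightarrow> ennreal"
  assumes [measurable]: "f \<in> borel_measurable borel" and c: "c \<noteq> 0"
  shows "(\<integral>\<^sup>+x. f x \<partial>lborel) = ennreal (\<bar>c\<bar> ^ CARD('n)) * (\<integral>\<^sup>+x. f (t + c *\<^sub>R x) \<partial>lborel)"
  by (subst lborel_affine[OF c, of t]) (simp add: nn_integral_density nn_integral_distr nn_integral_cmult)

context
  fixes S :: "(real^'n::finite) set"
  assumes S: "open S" and bS: "bounded S"
begin

lemma S_lmeasurable: "S \<in> lmeasurable" and S_sets: "S \<in> sets lebesgue"
  using S bS by (auto simp: bounded_set_imp_lmeasurable)

lemma dilated_conv_integrable:
  assumes w: "integrable (lebesgue_on S) w" and \<eta>: "test_fun UNIV \<eta>"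
  shows "integrable (lebesgue_on S) (\<lambda>z. w z * \<eta> (p - z))"
proof -
  obtain M where M: "\<And>x. \<bar>\<eta> x\<bar> \<le> M" using test_fun_bounded[OF \<eta>] by metis
  have [measurable]: "w \<in> borel_measurable (lebesgue_on S)" using w by simp
  have [measurable]: "(\<lambda>z. \<eta> (p - z)) \<in> borel_measurable (lebesgue_on S)"
    using partial_derivs_reflect[OF test_fun_smooth[OF \<eta>]] S_sets
    by (blast intro: smooth_lebesgue_on_measurable)
  have "integrable (lebesgue_on S) (\<lambda>z. M * w z)" using w by simp
  then show ?thesis
  proof (rule Bochner_Integration.integrable_bound)
    have "\<bar>w x * \<eta> (p - x)\<bar> \<le> \<bar>M * w x\<bar>" for x
      using M[of "p - x"] mult_right_mono[of "\<bar>\<eta> (p - x)\<bar>" "\<bar>M\<bar>" "\<bar>w x\<bar>"] by (simp add: abs_mult mult.commute)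
    then show "AE x in lebesgue_on S. norm (w x * \<eta> (p - x)) \<le> norm (M * w x)" by simp
  qed measurable
qed

text \<open>The first-order Taylor remainder of the kernel is quadratic, uniformly in its argument, so
  that differentiation under the integral needs no dominated convergence.\<close>

lemma dilated_conv_has_derivative:
  assumes w: "integrable (lebesgue_on S) w" and \<eta>: "test_fun UNIV \<eta>"
  shows "(dilated_conv S \<eta> c s w has_derivative
     (\<lambda>h. \<Sum>i\<in>UNIV. h $ i * (s * dilated_conv S (partial_deriv i \<eta>) c s w x))) (at x)"
proof -
  obtain M where M: "\<And>x v. \<bar>\<eta> (x + v) - \<eta> x - (\<Sum>i\<in>UNIV. v $ i * partial_deriv i \<eta> x)\<bar> \<le> M * (norm v)\<^sup>2"
    using test_fun_second_bound[OF \<eta>] by metis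
  define W where "W = (LINT z|lebesgue_on S. \<bar>w z\<bar>)"
  let ?D = "\<lambda>h. \<Sum>i\<in>UNIV. h $ i * (s * dilated_conv S (partial_deriv i \<eta>) c s w x)"
  note i0 = dilated_conv_integrable[OF w \<eta>]
  note i1 = dilated_conv_integrable[OF w test_fun_partial_deriv[OF \<eta>]]
  have bl: "bounded_linear ?D"
    by (intro bounded_linear_sum bounded_linear_mult_const bounded_linear_vec_nth) 
  have est: "\<bar>dilated_conv S \<eta> c s w (x + h) - dilated_conv S \<eta> c s w x - ?D h\<bar> \<le> (M * s\<^sup>2 * W) * (norm h)\<^sup>2" for h
  proof -
    define p where "p = c + s *\<^sub>R x"
    define r where "r z = \<eta> ((p - z) + s *\<^sub>R h) - \<eta> (p - z) - (\<Sum>i\<in>UNIV. (s *\<^sub>R h) $ i * partial_deriv i \<eta> (p - z))" for z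
    have e: "c + s *\<^sub>R (x + h) - z = (p + s *\<^sub>R h) - z" "(p - z) + s *\<^sub>R h = (p + s *\<^sub>R h) - z" "c + s *\<^sub>R x - z = p - z" for z
      by (auto simp: p_def algebra_simps)
    have wr: "w z * r z = w z * \<eta> ((p + s *\<^sub>R h) - z) - w z * \<eta> (p - z)
        - (\<Sum>i\<in>UNIV. (h $ i * s) * (w z * partial_deriv i \<eta> (p - z)))" for z
      unfolding r_def e by (simp add: right_diff_distrib sum_distrib_left mult_ac)
    have ri: "integrable (lebesgue_on S) (\<lambda>z. w z * r z)"
      unfolding wr by (intro Bochner_Integration.integrable_diff Bochner_Integration.integrable_sum integrable_mult_right i0 i1)
    have "(LINT z|lebesgue_on S. w z * r z) = dilated_conv S \<eta> c s w (x + h) - dilated_conv S \<eta> c s w x - ?D h"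
      unfolding wr dilated_conv_def e
      by (simp add: i0 i1 mult.assoc)
    moreover have "\<bar>LINT z|lebesgue_on S. w z * r z\<bar> \<le> (LINT z|lebesgue_on S. \<bar>w z\<bar> * (M * (norm (s *\<^sub>R h))\<^sup>2))"
    proof (rule order_trans[OF integral_abs_bound], rule integral_mono)
      show "\<bar>w z * r z\<bar> \<le> \<bar>w z\<bar> * (M * (norm (s *\<^sub>R h))\<^sup>2)" for z
        unfolding abs_mult r_def by (intro mult_left_mono M) simp
    qed (use ri w in auto)
    moreover have "(LINT z|lebesgue_on S. \<bar>w z\<bar> * (M * (norm (s *\<^sub>R h))\<^sup>2)) = (M * s\<^sup>2 * W) * (norm h)\<^sup>2"
    proof -
      have "(norm (s *\<^sub>R h))\<^sup>2 = s\<^sup>2 * (norm h)\<^sup>2" by (simp add: power_mult_distrib)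
      then show ?thesis
        unfolding integral_mult_left_zero W_def[symmetric] by (simp only: mult_ac)
    qed
    ultimately show ?thesis by (simp only:)
  qed
  define K where "K = M * s\<^sup>2 * W"
  have "((\<lambda>h. norm (dilated_conv S \<eta> c s w (x + h) - dilated_conv S \<eta> c s w x - ?D h) / norm h) \<longlongrightarrow> 0) (at 0)"
  proof (rule Lim_null_comparison)
    show "\<forall>\<^sub>F h in at 0. norm (norm (dilated_conv S \<eta> c s w (x + h) - dilated_conv S \<eta> c s w x - ?D h) / norm h) \<le> K * norm h"
    proof (rule eventually_mono[OF eventually_neq_at_within[of 0]])
      fix h :: "real^'n" assume h: "h \<noteq> 0"
      show "norm (norm (dilated_conv S \<eta> c s w (x + h) - dilated_conv S \<eta> c s w x - ?D h) / norm h) \<le> K * norm h"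
        using est[of h] h by (simp add: K_def divide_le_eq power2_eq_square mult.assoc)
    qed
    have "((\<lambda>h::real^'n. K * norm h) \<longlongrightarrow> K * norm (0::real^'n)) (at 0)" by (intro tendsto_intros)
    then show "((\<lambda>h::real^'n. K * norm h) \<longlongrightarrow> 0) (at 0)" by simp
  qed
  with bl show ?thesis unfolding has_derivative_at by simp
qed

lemma dilated_conv_partial_derivs:
  assumes w: "integrable (lebesgue_on S) w" and \<eta>: "test_fun UNIV \<eta>"
  shows "partial_derivs is (dilated_conv S \<eta> c s w) = (\<lambda>x. s ^ length is * dilated_conv S (partial_derivs is \<eta>) c s w x)"
proof (induction "is")
  case Nil then show ?case by simp
next
  case (Cons i "is")
  note \<eta>' = test_fun_partial_derivs[OF \<eta>, of "is"]
  note D = dilated_conv_has_derivative[OF w \<eta>', of c s]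
  have d: "dilated_conv S (partial_derivs is \<eta>) c s w differentiable (at x)" for x
    using D unfolding differentiable_def by blast
  have "partial_deriv i (dilated_conv S (partial_derivs is \<eta>) c s w) x = s * dilated_conv S (partial_derivs (i # is) \<eta>) c s w x" for x
  proof -
    have "partial_deriv i (dilated_conv S (partial_derivs is \<eta>) c s w) x
      = (\<Sum>k\<in>UNIV. axis i 1 $ k * (s * dilated_conv S (partial_deriv k (partial_derivs is \<eta>)) c s w x))"
      by (rule partial_deriv_eq[OF D])
    also have "\<dots> = (\<Sum>k\<in>UNIV. if k = i then s * dilated_conv S (partial_deriv k (partial_derivs is \<eta>)) c s w x else 0)"
      by (intro sum.cong) (auto simp: axis_def)
    finally show ?thesis by simp
  qed
  moreover have "partial_deriv i (\<lambda>x. s ^ length is * dilated_conv S (partial_derivs is \<eta>) c s w x)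
    = (\<lambda>x. s ^ length is * partial_deriv i (dilated_conv S (partial_derivs is \<eta>) c s w) x)"
    by (subst partial_deriv_mult) (use d in \<open>auto simp: partial_deriv_const\<close>)
  ultimately show ?case using Cons by (simp add: mult_ac)
qed

lemma smooth_dilated_conv:
  assumes w: "integrable (lebesgue_on S) w" and \<eta>: "test_fun UNIV \<eta>"
  shows "smooth (dilated_conv S \<eta> c s w)"
  unfolding smooth_def dilated_conv_partial_derivs[OF w \<eta>]
proof safe
  fix "is" :: "'n list" and x
  have "(dilated_conv S (partial_derivs is \<eta>) c s w) differentiable (at x)"
    using dilated_conv_has_derivative[OF w test_fun_partial_derivs[OF \<eta>]] unfolding differentiable_def by blast
  then show "(\<lambda>x. s ^ length is * dilated_conv S (partial_derivs is \<eta>) c s w x) differentiable (at x)"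
    by (intro differentiable_mult) auto
qed

text \<open>Differentiation of the dilated convolution can be moved onto the convolved function as long
  as the kernel, centred at the dilated point, is a test function of the domain.\<close>

lemma dilated_conv_weak_deriv:
  assumes \<eta>: "smooth \<eta>" and v: "has_weak_deriv S is v g"
    and t: "test_fun S (\<lambda>z. \<eta> (c + s *\<^sub>R x - z))"
  shows "dilated_conv S (partial_derivs is \<eta>) c s v x = dilated_conv S \<eta> c s g x"
proof -
  have "(LINT z|lebesgue_on S. v z * partial_derivs is (\<lambda>z. \<eta> (c + s *\<^sub>R x - z)) z)
      = (-1) ^ length is * (LINT z|lebesgue_on S. g z * \<eta> (c + s *\<^sub>R x - z))"
    using v t unfolding has_weak_deriv_def by blast
  then have "(-1) ^ length is * dilated_conv S (partial_derivs is \<eta>) c s v x = (-1) ^ length is * dilated_conv S \<eta> c s g x"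
    unfolding dilated_conv_def conjunct1[OF partial_derivs_reflect[OF \<eta>]]
    by (simp only: mult.left_commute[of _ "(-1) ^ length is"] integral_mult_right_zero)
  then show ?thesis by simp
qed

text \<open>Fubini's theorem is available for Borel functions on the product of Borel measures, whereas
  elements of \<open>L\<^sup>2\<close> are only Lebesgue measurable.\<close>

lemma L2_borel_representative:
  assumes f: "f \<in> L2_space S"
  obtains f' where "f' \<in> borel_measurable borel"
    "\<And>k. k \<in> borel_measurable borel \<Longrightarrow>
      (\<integral>\<^sup>+z. ennreal \<bar>f z\<bar> * k z \<partial>lebesgue_on S) = (\<integral>\<^sup>+z. ennreal \<bar>f' z\<bar> * k z \<partial>lborel)"
    "(\<integral>\<^sup>+z. ennreal ((f' z)\<^sup>2) \<partial>lborel) = ennreal ((L2_norm S f)\<^sup>2)"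
proof -
  define f0 where "f0 z = indicator S z * f z" for z
  have f0: "f0 \<in> borel_measurable (completion lborel)"
    using L2_spaceD(1)[OF f] borel_measurable_restrict_space_iff[of S lebesgue f] S_sets
    by (simp add: f0_def mult.commute cong: measurable_cong)
  obtain f' where f': "f' \<in> borel_measurable lborel" "AE z in lborel. f0 z = f' z"
    using completion_ex_borel_measurable_real[OF f0] by blast
  have [measurable]: "f' \<in> borel_measurable borel" using f' by simp
  have ae: "AE z in lebesgue. f0 z = f' z" using f'(2) by (rule AE_completion)
  have "(\<integral>\<^sup>+z. ennreal \<bar>f z\<bar> * k z \<partial>lebesgue_on S) = (\<integral>\<^sup>+z. ennreal \<bar>f' z\<bar> * k z \<partial>lborel)"
    if k [measurable]: "k \<in> borel_measurable borel" for k
  proof -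
    have "(\<integral>\<^sup>+z. ennreal \<bar>f z\<bar> * k z \<partial>lebesgue_on S) = (\<integral>\<^sup>+z. ennreal \<bar>f z\<bar> * k z * indicator S z \<partial>lebesgue)"
      using S_sets by (subst nn_integral_restrict_space) auto
    also have "\<dots> = (\<integral>\<^sup>+z. ennreal \<bar>f' z\<bar> * k z \<partial>lebesgue)"
      by (rule nn_integral_cong_AE) (use ae in eventually_elim, auto simp: f0_def indicator_def split: if_splits)
    finally show ?thesis by (simp add: nn_integral_completion)
  qed
  moreover have "(\<integral>\<^sup>+z. ennreal ((f' z)\<^sup>2) \<partial>lborel) = ennreal ((L2_norm S f)\<^sup>2)"
  proof -
    have "(\<integral>\<^sup>+z. ennreal ((f z)\<^sup>2) \<partial>lebesgue_on S) = (\<integral>\<^sup>+z. ennreal ((f z)\<^sup>2) * indicator S z \<partial>lebesgue)"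
      using S_sets by (subst nn_integral_restrict_space) auto
    also have "\<dots> = (\<integral>\<^sup>+z. ennreal ((f' z)\<^sup>2) \<partial>lebesgue)"
      by (rule nn_integral_cong_AE) (use ae in eventually_elim, auto simp: f0_def indicator_def split: if_splits)
    finally show ?thesis using L2_nn_integral[OF f] by (simp add: nn_integral_completion)
  qed
  ultimately show ?thesis using that[of f'] by simp
qed

text \<open>This is Schur's test: the integral of the kernel in \<open>z\<close> is \<open>1\<close>, and in \<open>x\<close> it is
  \<open>s\<^sup>-\<^sup>n \<le> 2\<^sup>n\<close>.\<close>

lemma dilated_conv_L2:
  assumes f: "f \<in> L2_space S" and \<eta>: "test_fun UNIV \<eta>" and nn: "\<And>y. 0 \<le> \<eta> y"
    and one: "(LINT y|lborel. \<eta> y) = 1" and s: "1/2 \<le> s"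
  shows "dilated_conv S \<eta> c s f \<in> L2_space S"
    and "L2_norm S (dilated_conv S \<eta> c s f) \<le> sqrt (2 ^ CARD('n)) * L2_norm S f"
proof -
  have fi: "integrable (lebesgue_on S) f" by (rule L2_integrable[OF S_lmeasurable f])
  have [measurable]: "\<eta> \<in> borel_measurable borel" using smooth_borel test_fun_smooth[OF \<eta>] by blast
  obtain f' where [measurable]: "f' \<in> borel_measurable borel"
    and f'1: "\<And>k. k \<in> borel_measurable borel \<Longrightarrow>
      (\<integral>\<^sup>+z. ennreal \<bar>f z\<bar> * k z \<partial>lebesgue_on S) = (\<integral>\<^sup>+z. ennreal \<bar>f' z\<bar> * k z \<partial>lborel)"
    and f'2: "(\<integral>\<^sup>+z. ennreal ((f' z)\<^sup>2) \<partial>lborel) = ennreal ((L2_norm S f)\<^sup>2)"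
    using L2_borel_representative[OF f] by blast
  have n1: "(\<integral>\<^sup>+y. ennreal (\<eta> y) \<partial>lborel) = 1"
    using nn_integral_eq_integral[OF test_fun_integrable[OF \<eta>]] nn one by simp
  have n2: "(\<integral>\<^sup>+z. ennreal (\<eta> (p - z)) \<partial>lborel) = 1" for p
    using nn_integral_lborel_affine[of "\<lambda>y. ennreal (\<eta> y)" "-1" p] n1 by simp
  have n3: "(\<integral>\<^sup>+x. ennreal (\<eta> (p + s *\<^sub>R x)) \<partial>lborel) \<le> ennreal (2 ^ CARD('n))" for p
  proof -
    let ?I = "\<integral>\<^sup>+x. ennreal (\<eta> (p + s *\<^sub>R x)) \<partial>lborel"
    have "1 = ennreal (s ^ CARD('n)) * ?I"
      using nn_integral_lborel_affine[of "\<lambda>y. ennreal (\<eta> y)" s p] n1 s by simp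
    then have "ennreal (2 ^ CARD('n)) = ennreal (2 ^ CARD('n) * s ^ CARD('n)) * ?I"
      using s by (simp add: ennreal_mult mult.assoc)
    moreover have "1 \<le> ennreal (2 ^ CARD('n) * s ^ CARD('n))"
      using s one_le_power[of "2 * s" "CARD('n)"] by (simp add: power_mult_distrib)
    ultimately show ?thesis using mult_right_mono[of 1 "ennreal (2 ^ CARD('n) * s ^ CARD('n))" ?I] by simp
  qed
  let ?A = "dilated_conv S \<eta> c s f"
  have sq: "ennreal ((?A x)\<^sup>2) \<le> (\<integral>\<^sup>+z. ennreal ((f' z)\<^sup>2) * ennreal (\<eta> (c + s *\<^sub>R x - z)) \<partial>lborel)" for x
  proof -
    let ?k = "\<lambda>z. \<eta> (c + s *\<^sub>R x - z)"
    have "ennreal \<bar>?A x\<bar> \<le> (\<integral>\<^sup>+z. ennreal (norm (f z * ?k z)) \<partial>lebesgue_on S)"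
      using integral_norm_bound_ennreal[OF dilated_conv_integrable[OF fi \<eta>, of "c + s *\<^sub>R x"]]
      by (simp add: dilated_conv_def)
    also have "\<dots> = (\<integral>\<^sup>+z. ennreal \<bar>f z\<bar> * ennreal (?k z) \<partial>lebesgue_on S)"
      using nn by (simp add: abs_mult ennreal_mult)
    also have "\<dots> = (\<integral>\<^sup>+z. ennreal \<bar>f' z\<bar> * ennreal (?k z) \<partial>lborel)" by (rule f'1) measurable
    also have "\<dots> = (\<integral>\<^sup>+z. ennreal (\<bar>f' z\<bar> * sqrt (?k z)) * ennreal (sqrt (?k z)) \<partial>lborel)"
      using nn by (simp add: ennreal_mult[symmetric] mult.assoc)
    finally have "(ennreal \<bar>?A x\<bar>)\<^sup>2 \<le> (\<integral>\<^sup>+z. ennreal (\<bar>f' z\<bar> * sqrt (?k z)) * ennreal (sqrt (?k z)) \<partial>lborel)\<^sup>2"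
      by (rule power_mono_ennreal)
    also have "\<dots> \<le> (\<integral>\<^sup>+z. (ennreal (\<bar>f' z\<bar> * sqrt (?k z)))\<^sup>2 \<partial>lborel) * (\<integral>\<^sup>+z. (ennreal (sqrt (?k z)))\<^sup>2 \<partial>lborel)"
      by (rule Cauchy_Schwarz_nn_integral) measurable
    also have "\<dots> = (\<integral>\<^sup>+z. ennreal ((f' z)\<^sup>2) * ennreal (?k z) \<partial>lborel)"
      using nn n2 by (simp add: ennreal_power power_mult_distrib ennreal_mult)
    finally show ?thesis by (simp add: ennreal_power)
  qed
  have "(\<integral>\<^sup>+x. ennreal ((?A x)\<^sup>2) \<partial>lebesgue_on S) \<le> (\<integral>\<^sup>+x. ennreal ((?A x)\<^sup>2) \<partial>lborel)"
  proof -
    have m: "?A \<in> borel_measurable borel" by (intro smooth_borel smooth_dilated_conv fi \<eta>)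
    have "(\<integral>\<^sup>+x. ennreal ((?A x)\<^sup>2) \<partial>lebesgue_on S) = (\<integral>\<^sup>+x. ennreal ((?A x)\<^sup>2) * indicator S x \<partial>lebesgue)"
      using S_sets by (subst nn_integral_restrict_space) auto
    also have "\<dots> \<le> (\<integral>\<^sup>+x. ennreal ((?A x)\<^sup>2) \<partial>lebesgue)"
      by (rule nn_integral_mono) (auto simp: indicator_def)
    finally show ?thesis by (simp add: nn_integral_completion)
  qed
  also have "\<dots> \<le> (\<integral>\<^sup>+x. (\<integral>\<^sup>+z. ennreal ((f' z)\<^sup>2) * ennreal (\<eta> (c + s *\<^sub>R x - z)) \<partial>lborel) \<partial>lborel)"
    by (rule nn_integral_mono) (rule sq)
  also have "\<dots> = (\<integral>\<^sup>+z. (\<integral>\<^sup>+x. ennreal ((f' z)\<^sup>2) * ennreal (\<eta> (c + s *\<^sub>R x - z)) \<partial>lborel) \<partial>lborel)"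
    by (rule lborel_pair.Fubini') measurable
  also have "\<dots> = (\<integral>\<^sup>+z. ennreal ((f' z)\<^sup>2) * (\<integral>\<^sup>+x. ennreal (\<eta> ((c - z) + s *\<^sub>R x)) \<partial>lborel) \<partial>lborel)"
    by (simp add: nn_integral_cmult algebra_simps)
  also have "\<dots> \<le> (\<integral>\<^sup>+z. ennreal ((f' z)\<^sup>2) * ennreal (2 ^ CARD('n)) \<partial>lborel)"
    by (intro nn_integral_mono mult_left_mono n3) auto
  also have "\<dots> = ennreal ((sqrt (2 ^ CARD('n)) * L2_norm S f)\<^sup>2)"
    by (simp add: nn_integral_multc f'2 power_mult_distrib ennreal_mult mult.commute)
  finally have fin: "(\<integral>\<^sup>+x. ennreal ((?A x)\<^sup>2) \<partial>lebesgue_on S) \<le> ennreal ((sqrt (2 ^ CARD('n)) * L2_norm S f)\<^sup>2)" .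
  have "?A \<in> borel_measurable (lebesgue_on S)"
    by (intro smooth_lebesgue_on_measurable S_sets smooth_dilated_conv fi \<eta>)
  from L2_spaceI_nn[OF this fin] show "?A \<in> L2_space S" "L2_norm S ?A \<le> sqrt (2 ^ CARD('n)) * L2_norm S f"
    by simp_all
qed

lemma dilated_conv_close:
  assumes g: "continuous_on UNIV g" and gi: "integrable (lebesgue_on S) g"
    and \<eta>: "test_fun UNIV \<eta>" and nn: "\<And>y. 0 \<le> \<eta> y" and one: "(LINT y|lborel. \<eta> y) = 1"
    and sup: "\<And>z. \<eta> (c + s *\<^sub>R x - z) \<noteq> 0 \<Longrightarrow> z \<in> S \<and> \<bar>g z - g x\<bar> \<le> e"
  shows "\<bar>dilated_conv S \<eta> c s g x - g x\<bar> \<le> e"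
proof -
  let ?k = "\<lambda>z. \<eta> (c + s *\<^sub>R x - z)"
  note [measurable] = smooth_borel[OF test_fun_smooth[OF \<eta>]]
  have refl: "(LINT z|lborel. ?k z) = 1" "integrable lborel ?k"
  proof -
    have eq: "lborel = distr lborel borel (\<lambda>z. c + s *\<^sub>R x - z)"
      using lborel_affine[of "-1" "c + s *\<^sub>R x"] by (simp add: density_1)
    have "(LINT y|distr lborel borel (\<lambda>z. c + s *\<^sub>R x - z). \<eta> y) = (LINT z|lborel. ?k z)"
      by (rule integral_distr) measurable
    then show "(LINT z|lborel. ?k z) = 1" using one eq by simp
    have "integrable (distr lborel borel (\<lambda>z. c + s *\<^sub>R x - z)) \<eta>"
      using test_fun_integrable[OF \<eta>] eq by simp
    then show "integrable lborel ?k" by (simp add: integrable_distr_eq)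
  qed
  have k1: "integrable (lebesgue_on S) ?k" "(LINT z|lebesgue_on S. ?k z) = 1"
    using lebesgue_on_support_lborel[of S ?k] S_sets sup refl by auto
  note gk = dilated_conv_integrable[OF gi \<eta>, of "c + s *\<^sub>R x"]
  have "dilated_conv S \<eta> c s g x - g x = (LINT z|lebesgue_on S. (g z - g x) * ?k z)"
    using gk k1 by (simp add: dilated_conv_def left_diff_distrib)
  also have "\<bar>\<dots>\<bar> \<le> (LINT z|lebesgue_on S. e * ?k z)"
  proof (rule order_trans[OF integral_abs_bound], rule integral_mono)
    show "integrable (lebesgue_on S) (\<lambda>z. \<bar>(g z - g x) * ?k z\<bar>)"
      using gk k1 by (simp add: left_diff_distrib)
    show "\<bar>(g z - g x) * ?k z\<bar> \<le> e * ?k z" for z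
      using sup[of z] nn[of "c + s *\<^sub>R x - z"] by (cases "?k z = 0") (auto simp: abs_mult intro!: mult_right_mono)
  qed (use k1 in simp)
  also have "\<dots> = e" using k1 by simp
  finally show ?thesis .
qed

end

text \<open>A normalised box bump.\<close>

lemma mollifier_exists:
  assumes e: "0 < e"
  shows "\<exists>\<eta> :: real^'n::finite \<Rightarrow> real. test_fun UNIV \<eta> \<and> (\<forall>y. 0 \<le> \<eta> y) \<and> (LINT y|lborel. \<eta> y) = 1 \<and>
    (\<forall>y. \<eta> y \<noteq> 0 \<longrightarrow> norm y < e)"
proof -
  define d where "d = e / (real CARD('n) + 1)"
  have d: "0 < d" "real CARD('n) * d < e" using e by (auto simp: d_def field_simps)
  define a b :: "real^'n" where "a = (\<chi> i. - d)" and "b = (\<chi> i. d)"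
  have small: "norm y < e" if "y \<in> box a b" for y
  proof -
    have "norm y \<le> (\<Sum>i\<in>UNIV. \<bar>y $ i\<bar>)" by (rule norm_le_l1_cart)
    also have "\<dots> \<le> (\<Sum>i\<in>(UNIV::'n set). d)"
      using that by (intro sum_mono) (auto simp: mem_box_cart a_def b_def abs_le_iff less_imp_le minus_le_iff)
    finally show ?thesis using d by simp
  qed
  define \<beta> where "\<beta> = box_bump a b"
  have t: "test_fun UNIV \<beta>"
    unfolding \<beta>_def using box_bump_eq_0[of _ a b] box_subset_cbox[of a b]
    by (intro test_funI_subset[of _ "cbox a b"] smooth_box_bump) auto
  have nn: "0 \<le> \<beta> y" for y by (simp add: \<beta>_def box_bump_nonneg)
  define I where "I = (LINT y|lborel. \<beta> y)"
  have "I \<noteq> 0"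
  proof
    assume "I = 0"
    then have "AE y in lborel. \<beta> y = 0"
      using integral_nonneg_eq_0_iff_AE[OF test_fun_integrable[OF t]] nn by (simp add: I_def)
    then have "AE y in lebesgue. y \<in> {y. \<beta> y = 0}" by (simp add: AE_completion_iff)
    moreover have "closed {y. \<beta> y = 0}"
      by (intro closed_Collect_eq smooth_continuous test_fun_smooth[OF t] continuous_on_const)
    ultimately have "0 \<in> {y. \<beta> y = 0}" by (rule mem_closed_if_AE_lebesgue[rotated])
    moreover have "(0 :: real^'n) \<in> box a b" using d by (simp add: mem_box_cart a_def b_def)
    ultimately show False using box_bump_pos[of 0 a b] by (simp add: \<beta>_def)
  qed
  moreover have "0 \<le> I" unfolding I_def by (intro integral_nonneg_AE) (use nn in auto)
  ultimately have I: "0 < I" by simp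
  define \<eta> where "\<eta> y = inverse I * \<beta> y" for y
  have sup: "\<eta> y \<noteq> 0 \<Longrightarrow> y \<in> box a b" for y using box_bump_eq_0[of y a b] by (auto simp: \<eta>_def \<beta>_def)
  have "smooth \<eta>" unfolding \<eta>_def by (intro smooth_cmult test_fun_smooth[OF t])
  then have "test_fun UNIV \<eta>"
    by (rule test_funI_subset[of _ "cbox a b"]) (use sup box_subset_cbox[of a b] in auto)
  moreover have "(LINT y|lborel. \<eta> y) = 1" using I by (simp add: \<eta>_def I_def[symmetric])
  ultimately show ?thesis using sup small nn I by (intro exI[of _ \<eta>]) (auto simp: \<eta>_def)
qed

text \<open>With a ball of radius \<open>\<rho>\<close> about \<open>x\<^sub>0\<close> inside the convex set \<open>S\<close>, the contraction
  \<open>x \<mapsto> (1 - t) x + t x\<^sub>0\<close> maps \<open>S\<close> to points whose distance from the complement is at least \<open>t \<rho>\<close>.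
  Composing with it before mollifying at scale \<open>t \<rho>\<close> therefore never leaves \<open>S\<close>, and the result is a
  smooth function on the whole space. This is where convexity replaces a partition of unity along
  the boundary. Since the operators are uniformly bounded on \<open>L\<^sup>2(S)\<close>, convergence on continuous
  functions suffices.\<close>

theorem sobolev_smooth_dense:
  fixes S :: "(real^'n::finite) set"
  assumes S: "open S" and bS: "bounded S" and cS: "convex S" and ne: "S \<noteq> {}"
    and v: "v \<in> sobolev_space m S"
  shows "\<exists>u. (\<forall>k. smooth (u k)) \<and> (\<forall>j\<le>m. (\<lambda>k. grad_norm j S (\<lambda>x. u k x - v x)) \<longlonglongrightarrow> 0)"
proof -
  note lm = S_lmeasurable[OF S bS]
  obtain x0 where "x0 \<in> S" using ne by blast
  then obtain \<rho> where \<rho>: "0 < \<rho>" "cball x0 \<rho> \<subseteq> S" using S open_contains_cball by blast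
  obtain R where R: "\<And>x. x \<in> S \<Longrightarrow> norm x \<le> R" using bS bounded_iff by metis
  define t where "t k = inverse (real (Suc (Suc k)))" for k
  have t: "0 < t k" "t k \<le> 1/2" for k by (auto simp: t_def field_simps)
  have t0: "t \<longlonglongrightarrow> 0" unfolding t_def by (rule LIMSEQ_Suc[OF LIMSEQ_inverse_real_of_nat])
  define s where "s k = 1 - t k" for k
  define c where "c k = t k *\<^sub>R x0" for k
  have s: "1/2 \<le> s k" "0 < s k" "s k \<le> 1" for k using t[of k] by (auto simp: s_def)
  have "\<forall>k. \<exists>\<eta> :: real^'n \<Rightarrow> real. test_fun UNIV \<eta> \<and> (\<forall>y. 0 \<le> \<eta> y) \<and> (LINT y|lborel. \<eta> y) = 1 \<and>
    (\<forall>y. \<eta> y \<noteq> 0 \<longrightarrow> norm y < t k * \<rho>)"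
    using mollifier_exists[OF mult_pos_pos[OF t(1) \<rho>(1)], where 'n = 'n] by blast
  then obtain \<eta> :: "nat \<Rightarrow> real^'n \<Rightarrow> real" where \<eta>: "\<And>k. test_fun UNIV (\<eta> k)" "\<And>k y. 0 \<le> \<eta> k y"
    "\<And>k. (LINT y|lborel. \<eta> k y) = 1" "\<And>k y. \<eta> k y \<noteq> 0 \<Longrightarrow> norm y < t k * \<rho>" by metis
  \<comment> \<open>a point within \<open>t \<rho>\<close> of the dilated point is \<open>(1 - t) x + t y\<close> with \<open>y\<close> in the ball about \<open>x0\<close>\<close>
  have inS: "z \<in> S" if x: "x \<in> S" and z: "norm (c k + s k *\<^sub>R x - z) \<le> t k * \<rho>" for k x z
  proof -
    define y where "y = (1 / t k) *\<^sub>R (z - s k *\<^sub>R x)"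
    have y: "t k *\<^sub>R y = z - s k *\<^sub>R x" using t[of k] by (simp add: y_def)
    have "t k * norm (x0 - y) = norm (t k *\<^sub>R (x0 - y))" using t[of k] by simp
    also have "t k *\<^sub>R (x0 - y) = c k + s k *\<^sub>R x - z" using y by (simp add: c_def scaleR_diff_right)
    finally have "t k * norm (x0 - y) \<le> t k * \<rho>" using z by simp
    then have "norm (x0 - y) \<le> \<rho>" using t[of k] by simp
    then have "y \<in> S" using \<rho>(2) by (auto simp: dist_norm)
    then have "s k *\<^sub>R x + t k *\<^sub>R y \<in> S"
      using x cS s[of k] t[of k] by (intro convexD) (auto simp: s_def)
    then show ?thesis using y by simp
  qed
  have kt: "test_fun S (\<lambda>z. \<eta> k (c k + s k *\<^sub>R x - z))" if x: "x \<in> S" for k x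
  proof (rule test_funI_subset)
    show "smooth (\<lambda>z. \<eta> k (c k + s k *\<^sub>R x - z))"
      using partial_derivs_reflect[OF test_fun_smooth[OF \<eta>(1)]] by blast
    show "{z. \<eta> k (c k + s k *\<^sub>R x - z) \<noteq> 0} \<subseteq> cball (c k + s k *\<^sub>R x) (t k * \<rho>)"
      using \<eta>(4) by (force simp: dist_norm)
    show "cball (c k + s k *\<^sub>R x) (t k * \<rho>) \<subseteq> S" using inS[OF x] by (auto simp: dist_norm)
  qed auto
  define A where "A k f = dilated_conv S (\<eta> k) (c k) (s k) f" for k f
  have A2: "A k f \<in> L2_space S" "L2_norm S (A k f) \<le> sqrt (2 ^ CARD('n)) * L2_norm S f"
    if f: "f \<in> L2_space S" for k f
    unfolding A_def using dilated_conv_L2[OF S bS f \<eta>(1,2,3) s(1)] by auto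
  have Adiff: "A k (\<lambda>x. f x - g x) x = A k f x - A k g x"
    if f: "f \<in> L2_space S" and g: "g \<in> L2_space S" for k f g x
    unfolding A_def dilated_conv_def left_diff_distrib
    by (intro Bochner_Integration.integral_diff dilated_conv_integrable[OF S bS _ \<eta>(1)] L2_integrable lm f g)
  have lim: "(\<lambda>k. L2_norm S (\<lambda>x. A k f x - f x)) \<longlonglongrightarrow> 0" if f: "f \<in> L2_space S" for f
  proof (rule LIMSEQ_I)
    fix e :: real assume e: "0 < e"
    define B where "B = sqrt (2 ^ CARD('n)) + 1"
    have B: "0 < B" by (simp add: B_def add_nonneg_pos)
    have "0 < e / (2 * B)" using e B by simp
    then obtain g where g: "continuous_on UNIV g" "\<exists>b. \<forall>x. \<bar>g x\<bar> \<le> b" "L2_norm S (\<lambda>x. f x - g x) < e / (2 * B)"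
      using L2_density_continuous[OF lm f] by blast
    have g2: "g \<in> L2_space S"
      using g(2) lm continuous_imp_measurable_on_sets_lebesgue[OF continuous_on_subset[OF g(1)], of S]
      by (auto intro: L2_bounded(1) fmeasurableD)
    define q where "q = e / (2 * (sqrt (measure lebesgue S) + 1))"
    have q: "0 < q" using e by (simp add: q_def add_nonneg_pos)
    have "uniformly_continuous_on (closure S) g"
      using bS g(1) by (intro compact_uniformly_continuous) (auto simp: compact_closure intro: continuous_on_subset)
    from this[unfolded uniformly_continuous_on_def, rule_format, OF q]
    obtain d where d: "0 < d" "\<And>x z. x \<in> closure S \<Longrightarrow> z \<in> closure S \<Longrightarrow> dist z x < d \<Longrightarrow> dist (g z) (g x) < q"
      by blast
    have "(\<lambda>k. t k * (2 * R + \<rho>)) \<longlonglongrightarrow> 0 * (2 * R + \<rho>)" by (intro tendsto_intros t0)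
    then have "\<forall>\<^sub>F k in sequentially. t k * (2 * R + \<rho>) < d" using d(1) by (intro order_tendstoD(2)) auto
    then obtain N where N: "\<And>k. k \<ge> N \<Longrightarrow> t k * (2 * R + \<rho>) < d" unfolding eventually_sequentially by blast
    have close: "\<bar>A k g x - g x\<bar> \<le> q" if k: "k \<ge> N" and x: "x \<in> S" for k x
      unfolding A_def
    proof (rule dilated_conv_close[OF S bS g(1) L2_integrable[OF lm g2] \<eta>(1,2,3)])
      fix z assume nz: "\<eta> k (c k + s k *\<^sub>R x - z) \<noteq> 0"
      have nz': "norm (c k + s k *\<^sub>R x - z) < t k * \<rho>" by (rule \<eta>(4)[OF nz])
      then have z: "z \<in> S" using inS[OF x, of k z] by simp
      have eq: "z - x = t k *\<^sub>R (x0 - x) - (c k + s k *\<^sub>R x - z)" by (simp add: c_def s_def algebra_simps)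
      have "norm (z - x) \<le> norm (t k *\<^sub>R (x0 - x)) + norm (c k + s k *\<^sub>R x - z)"
        unfolding eq by (rule norm_triangle_ineq4)
      also have "\<dots> = t k * norm (x0 - x) + norm (c k + s k *\<^sub>R x - z)" using t[of k] by simp
      also have "\<dots> \<le> t k * (2 * R) + t k * \<rho>"
        using R[OF x] R[OF \<open>x0 \<in> S\<close>] norm_triangle_ineq4[of x0 x] t[of k] nz'
        by (intro add_mono mult_left_mono) auto
      also have "\<dots> < d" using N[OF k] by (simp add: distrib_left)
      finally have "dist z x < d" by (simp add: dist_norm)
      then have "dist (g z) (g x) < q" using d(2) x z closure_subset by blast
      then show "z \<in> S \<and> \<bar>g z - g x\<bar> \<le> q" using z by (simp add: dist_real_def)
    qed
    show "\<exists>N. \<forall>k\<ge>N. norm (L2_norm S (\<lambda>x. A k f x - f x) - 0) < e"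
    proof (intro exI allI impI)
      fix k assume k: "N \<le> k"
      note Af = A2[OF f, of k] and Ag = A2[OF g2, of k]
      have "L2_norm S (\<lambda>x. A k g x - g x) \<le> q * sqrt (measure lebesgue S)"
        using close[OF k] L2_spaceD(1)[OF L2_diff[OF Ag(1) g2]] by (intro L2_bounded(2) lm) auto
      also have "\<dots> < q * (sqrt (measure lebesgue S) + 1)" using q by (simp add: distrib_left)
      also have "\<dots> = e / 2"
      proof -
        have "e / (2 * r) * r = e / 2" if "0 < r" for r :: real using that by simp
        moreover have "0 < sqrt (measure lebesgue S) + 1" by (simp add: add_nonneg_pos)
        ultimately show ?thesis unfolding q_def by blast
      qed
      finally have 1: "L2_norm S (\<lambda>x. A k g x - g x) < e / 2" .
      have 2: "L2_norm S (\<lambda>x. A k f x - A k g x) \<le> sqrt (2 ^ CARD('n)) * L2_norm S (\<lambda>x. f x - g x)"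
      proof -
        have "A k (\<lambda>x. f x - g x) = (\<lambda>x. A k f x - A k g x)" by (rule ext) (rule Adiff[OF f g2])
        then show ?thesis using A2(2)[OF L2_diff[OF f g2], of k] by simp
      qed
      have "L2_norm S (\<lambda>x. A k f x - f x) \<le> L2_norm S (\<lambda>x. A k f x - A k g x) + L2_norm S (\<lambda>x. A k g x - f x)"
        by (rule L2_norm_triangle3[OF Af(1) Ag(1) f])
      also have "\<dots> \<le> L2_norm S (\<lambda>x. A k f x - A k g x) + (L2_norm S (\<lambda>x. A k g x - g x) + L2_norm S (\<lambda>x. g x - f x))"
        using L2_norm_triangle3[OF Ag(1) g2 f] by simp
      also have "\<dots> \<le> B * L2_norm S (\<lambda>x. f x - g x) + L2_norm S (\<lambda>x. A k g x - g x)"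
        using 2 L2_norm_minus_commute[of S g f] by (simp add: B_def algebra_simps)
      also have "\<dots> < e / 2 + e / 2"
        using 1 g(3) B by (intro add_strict_mono) (auto simp: field_simps)
      finally show "norm (L2_norm S (\<lambda>x. A k f x - f x) - 0) < e" by simp
    qed
  qed
  have v2: "v \<in> L2_space S" using v by (simp add: sobolev_space_def)
  have vi: "integrable (lebesgue_on S) v" by (rule L2_integrable[OF lm v2])
  define u where "u k = A k v" for k
  have us: "smooth (u k)" for k unfolding u_def A_def by (rule smooth_dilated_conv[OF S bS vi \<eta>(1)])
  define w where "w is = weak_deriv S is v" for "is"
  have w: "has_weak_deriv S is v (w is)" "w is \<in> L2_space S" if "length is \<le> m" for "is"
    unfolding w_def using sobolev_weak_deriv[OF S bS v that] by auto
  have ud: "partial_derivs is (u k) x = s k ^ length is * A k (w is) x" if l: "length is \<le> m" and x: "x \<in> S" for k x "is"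
    unfolding u_def A_def dilated_conv_partial_derivs[OF S bS vi \<eta>(1)]
    using dilated_conv_weak_deriv[OF S bS test_fun_smooth[OF \<eta>(1)] w(1)[OF l] kt[OF x]] by simp
  have ulim: "(\<lambda>k. L2_norm S (\<lambda>x. partial_derivs is (u k) x - w is x)) \<longlonglongrightarrow> 0" if l: "length is \<le> m" for "is"
  proof (rule tendsto_sandwich[OF _ _ tendsto_const])
    let ?f = "\<lambda>k. L2_norm S (\<lambda>x. A k (w is) x - w is x) + (1 - s k ^ length is) * L2_norm S (w is)"
    have "s \<longlonglongrightarrow> 1 - 0" unfolding s_def by (intro tendsto_intros t0)
    then have "?f \<longlonglongrightarrow> 0 + (1 - (1 - 0) ^ length is) * L2_norm S (w is)"
      by (intro tendsto_intros lim w(2) l)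
    then show "?f \<longlonglongrightarrow> 0" by simp
    show "\<forall>\<^sub>F k in sequentially. L2_norm S (\<lambda>x. partial_derivs is (u k) x - w is x) \<le> ?f k"
    proof (rule always_eventually, rule allI)
      fix k
      let ?r = "s k ^ length is"
      have r: "0 \<le> ?r" "?r \<le> 1" using s[of k] by (auto intro: power_le_one)
      note A3 = A2(1)[OF w(2)[OF l], of k]
      have "L2_norm S (\<lambda>x. partial_derivs is (u k) x - w is x)
          = L2_norm S (\<lambda>x. ?r * (A k (w is) x - w is x) + (?r - 1) * w is x)"
        unfolding L2_norm_def
        by (rule arg_cong[of _ _ sqrt], rule Bochner_Integration.integral_cong) (auto simp: ud[OF l] algebra_simps)
      also have "\<dots> \<le> L2_norm S (\<lambda>x. ?r * (A k (w is) x - w is x)) + L2_norm S (\<lambda>x. (?r - 1) * w is x)"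
        by (intro L2_norm_triangle L2_cmult L2_diff A3 w(2) l)
      also have "\<dots> = ?r * L2_norm S (\<lambda>x. A k (w is) x - w is x) + (1 - ?r) * L2_norm S (w is)"
        using r by (simp add: L2_norm_cmult)
      also have "\<dots> \<le> ?f k" using r by (simp add: mult_left_le_one_le)
      finally show "L2_norm S (\<lambda>x. partial_derivs is (u k) x - w is x) \<le> ?f k" .
    qed
  qed simp
  have "(\<lambda>k. grad_norm j S (\<lambda>x. u k x - v x)) \<longlonglongrightarrow> 0" if j: "j \<le> m" for j
  proof -
    have "grad_norm j S (\<lambda>x. u k x - v x) = L2_set (\<lambda>is. L2_norm S (\<lambda>x. partial_derivs is (u k) x - w is x)) {is. length is = j}" for k
    proof (rule grad_norm_eqI[OF S bS])
      fix "is" :: "'n list" assume l: "length is = j"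
      show "has_weak_deriv S is (\<lambda>x. u k x - v x) (\<lambda>x. partial_derivs is (u k) x - w is x)"
        using w(1) l j by (intro has_weak_deriv_diff has_weak_deriv_smooth S us) auto
      show "(\<lambda>x. partial_derivs is (u k) x - w is x) \<in> L2_space S"
        by (rule L2_diff[OF smooth_L2[OF _ bS smooth_partial_derivs[OF us]] w(2)]) (use l j S in auto)
    qed
    moreover have "(\<lambda>k. L2_set (\<lambda>is. L2_norm S (\<lambda>x. partial_derivs is (u k) x - w is x)) {is. length is = j})
        \<longlonglongrightarrow> sqrt (\<Sum>is | length (is :: 'n list) = j. 0\<^sup>2)"
      unfolding L2_set_def using j by (intro tendsto_intros ulim) auto
    ultimately show ?thesis by simp
  qed
  then show ?thesis using us by blast
qed

section \<open>Barycentric coordinates and shape regularity\<close>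

lemma type3_add [simp]: "(i::3) + 1 + 1 = i + 2" "(i::3) + 1 + 2 = i" "(i::3) + 2 + 1 = i" "(i::3) + 2 + 2 = i + 1"
proof -
  have "(1::3) + 1 = 2" "(1::3) + 2 = 0" "(2::3) + 1 = 0" "(2::3) + 2 = 1" by simp_all
  then show "(i::3) + 1 + 1 = i + 2" "(i::3) + 1 + 2 = i" "(i::3) + 2 + 1 = i" "(i::3) + 2 + 2 = i + 1"
    by (simp_all only: add.assoc) simp_all
qed

lemma type3_cases:
  fixes i j :: 3
  obtains "j = i" | "j = i + 1" | "j = i + 2"
proof -
  have "\<forall>i j :: 3. j = i \<or> j = i + 1 \<or> j = i + 2" unfolding forall_3 by simp
  then show ?thesis using that by blast
qed

lemma UNIV_type3: "(UNIV :: 3 set) = {i, i + 1, i + 2}"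
  using type3_cases by blast

lemma all_type3: "(\<forall>j. P j) \<longleftrightarrow> P i \<and> P (i + 1) \<and> P (i + 2)" for i :: 3
  using type3_cases by metis

lemma sum_type3: "(\<Sum>j\<in>UNIV. f j) = f i + f (i + 1) + f (i + 2)" for i :: 3 and f :: "3 \<Rightarrow> 'a::comm_monoid_add"
  unfolding UNIV_type3[of i] by (simp add: add.assoc)

lemma prod_type3: "(\<Prod>j\<in>UNIV. f j) = f i * f (i + 1) * f (i + 2)" for i :: 3 and f :: "3 \<Rightarrow> 'a::comm_monoid_mult"
  unfolding UNIV_type3[of i] by (simp add: mult.assoc)

definition cross2 :: "real^2 \<Rightarrow> real^2 \<Rightarrow> real" where
  "cross2 u v = u $ 1 * v $ 2 - u $ 2 * v $ 1"

lemma norm_real2: "norm (u :: real^2) = sqrt ((u $ 1)\<^sup>2 + (u $ 2)\<^sup>2)"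
  by (simp add: norm_vec_def L2_set_def sum_2)

lemma inner_real2: "(u :: real^2) \<bullet> v = u $ 1 * v $ 1 + u $ 2 * v $ 2"
  by (simp add: inner_vec_def sum_2)

lemma abs_cross2_le: "\<bar>cross2 u v\<bar> \<le> norm u * norm v"
proof (rule abs_le_square_iff[THEN iffD2, of _ "norm u * norm v", simplified abs_mult abs_norm_cancel])
  have "(cross2 u v)\<^sup>2 + (u \<bullet> v)\<^sup>2 = (u \<bullet> u) * (v \<bullet> v)"
    by (simp add: cross2_def inner_real2 power2_eq_square algebra_simps)
  then have "(cross2 u v)\<^sup>2 \<le> (u \<bullet> u) * (v \<bullet> v)" using zero_le_power2[of "u \<bullet> v"] by linarith
  then show "(cross2 u v)\<^sup>2 \<le> (norm u * norm v)\<^sup>2" by (simp add: power_mult_distrib power2_norm_eq_inner)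
qed

text \<open>Twice the signed area of the triangle; it does not depend on the vertex used as origin.\<close>

definition tri_det :: "triangle \<Rightarrow> real" where
  "tri_det a = cross2 (a 1 - a 0) (a 2 - a 0)"

lemma tri_det_eq: "tri_det a = cross2 (a (i + 1) - a i) (a (i + 2) - a i)"
proof -
  have "\<forall>i. tri_det a = cross2 (a (i + 1) - a i) (a (i + 2) - a i)"
    unfolding all_type3[of _ 0] type3_add by (simp add: tri_det_def cross2_def algebra_simps)
  then show ?thesis by blast
qed

lemma tri_det_nz:
  assumes "nondegenerate a"
  shows "tri_det a \<noteq> 0"
proof
  assume 0: "tri_det a = 0"
  define u v where "u = a 1 - a 0" and "v = a 2 - a 0"
  have c: "u $ 1 * v $ 2 = u $ 2 * v $ 1" using 0 by (simp add: tri_det_def cross2_def u_def v_def)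
  have "\<exists>c. v = c *\<^sub>R u" if "u \<noteq> 0"
  proof (cases "u $ 1 = 0")
    case True
    then have "u $ 2 \<noteq> 0" using that by (auto simp: vec_eq_iff forall_2)
    then show ?thesis using c True
      by (intro exI[of _ "v $ 2 / u $ 2"]) (auto simp: vec_eq_iff forall_2 field_simps)
  next
    case False
    then show ?thesis using c
      by (intro exI[of _ "v $ 1 / u $ 1"]) (auto simp: vec_eq_iff forall_2 field_simps)
  qed
  then have "collinear {0, u, v}" unfolding collinear_lemma by blast
  then have "collinear {a 1, a 0, a 2}" by (subst collinear_3) (simp_all add: u_def v_def)
  moreover have "range a = {a 1, a 0, a 2}"
    unfolding UNIV_type3[of 0] by auto
  ultimately show False using assms by (simp add: nondegenerate_def)
qed

text \<open>Cramer's rule: the ratio of the signed areas of the triangle with \<open>a\<^sub>i\<close> replaced by \<open>x\<close> and of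
  the triangle itself.\<close>

definition bary :: "triangle \<Rightarrow> 3 \<Rightarrow> real^2 \<Rightarrow> real" where
  "bary a i x = cross2 (a (i + 1) - x) (a (i + 2) - x) / tri_det a"

definition bary_grad :: "triangle \<Rightarrow> 3 \<Rightarrow> real^2" where
  "bary_grad a i = vector [(a (i + 1) - a (i + 2)) $ 2, (a (i + 2) - a (i + 1)) $ 1] /\<^sub>R tri_det a"

lemma bary_affine: "bary a i x = bary_grad a i \<bullet> x + cross2 (a (i + 1)) (a (i + 2)) / tri_det a"
proof (cases "tri_det a = 0")
  case False
  then show ?thesis
    by (simp add: bary_def bary_grad_def inner_real2 cross2_def field_simps)
qed (simp add: bary_def bary_grad_def)

lemma bary_diff: "bary a i x - bary a i y = bary_grad a i \<bullet> (x - y)"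
  by (simp add: bary_affine inner_diff_right)

lemma norm_bary_grad: "norm (bary_grad a i) = dist (a (i + 1)) (a (i + 2)) / \<bar>tri_det a\<bar>"
proof -
  have "norm (vector [(a (i + 1) - a (i + 2)) $ 2, (a (i + 2) - a (i + 1)) $ 1] :: real^2) = dist (a (i + 1)) (a (i + 2))"
    unfolding dist_norm norm_real2 by (simp add: power2_commute add.commute)
  then show ?thesis by (simp add: bary_grad_def divide_inverse mult.commute)
qed

lemma cross2_scale: "cross2 (c *\<^sub>R u) w = c * cross2 u w" "cross2 w (c *\<^sub>R u) = c * cross2 w u"
  by (simp_all add: cross2_def algebra_simps)

context
  fixes a :: triangle
  assumes nd: "nondegenerate a"
begin

lemma bary_sum: "(\<Sum>i\<in>UNIV. bary a i x) = 1"
proof -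
  have "cross2 (a (0+1) - x) (a (0+2) - x) + cross2 (a (0+1+1) - x) (a (0+1+2) - x) + cross2 (a (0+2+1) - x) (a (0+2+2) - x) = tri_det a"
    by (simp only: type3_add) (simp add: tri_det_def cross2_def algebra_simps)
  then show ?thesis using tri_det_nz[OF nd]
    unfolding sum_type3[of _ 0] bary_def add_divide_distrib[symmetric] by simp
qed

lemma bary_sum3: "bary a i x + bary a (i + 1) x + bary a (i + 2) x = 1"
  using bary_sum[of x] sum_type3[of "\<lambda>i. bary a i x" i] by simp

lemma bary_expansion: "(\<Sum>i\<in>UNIV. bary a i x *\<^sub>R a i) = x"
proof -
  have "tri_det a *\<^sub>R (\<Sum>i\<in>UNIV. bary a i x *\<^sub>R a i) = (\<Sum>i\<in>UNIV. cross2 (a (i + 1) - x) (a (i + 2) - x) *\<^sub>R a i)"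
    using tri_det_nz[OF nd] by (simp add: bary_def scaleR_sum_right)
  also have "\<dots> = tri_det a *\<^sub>R x"
    unfolding sum_type3[of _ 0] type3_add
    by (simp add: tri_det_def cross2_def vec_eq_iff forall_2 algebra_simps)
  finally show ?thesis using tri_det_nz[OF nd] by simp
qed

lemma bary_affine_comb:
  assumes "(\<Sum>j\<in>UNIV. u j) = 1"
  shows "bary a i (\<Sum>j\<in>UNIV. u j *\<^sub>R y j) = (\<Sum>j\<in>UNIV. u j * bary a i (y j))"
proof -
  have "(\<Sum>j\<in>UNIV. u j * bary a i (y j)) = (\<Sum>j\<in>UNIV. u j * (bary_grad a i \<bullet> y j)) + (\<Sum>j\<in>UNIV. u j) * (cross2 (a (i + 1)) (a (i + 2)) / tri_det a)"
    by (simp add: bary_affine distrib_left sum.distrib sum_distrib_right sum_divide_distrib)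
  then show ?thesis using assms by (simp add: bary_affine inner_sum_right)
qed

lemma bary_vertex: "bary a i (a j) = (if i = j then 1 else 0)"
proof -
  have 0: "bary a i (a (i + 1)) = 0" "bary a i (a (i + 2)) = 0" by (simp_all add: bary_def cross2_def)
  have "bary a i (a i) = 1" using tri_det_nz[OF nd] tri_det_eq[of a i] by (simp add: bary_def)
  with 0 show ?thesis by (cases rule: type3_cases[of j i]) auto
qed

lemma bary_comb: "(\<Sum>j\<in>UNIV. u j) = 1 \<Longrightarrow> bary a i (\<Sum>j\<in>UNIV. u j *\<^sub>R a j) = u i"
  by (simp add: bary_affine_comb bary_vertex if_distrib cong: if_cong)

lemma barycentric_eq: "barycentric a x i = bary a i x"
proof -
  have "barycentric a x = (\<lambda>i. bary a i x)"
    unfolding barycentric_def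
  proof (rule the_equality)
    show "(\<Sum>i\<in>UNIV. bary a i x) = 1 \<and> (\<Sum>i\<in>UNIV. bary a i x *\<^sub>R a i) = x"
      using bary_sum bary_expansion by blast
    fix l assume "(\<Sum>i\<in>UNIV. l i) = 1 \<and> (\<Sum>i\<in>UNIV. l i *\<^sub>R a i) = x"
    then show "l = (\<lambda>i. bary a i x)" using bary_comb[of l] by auto
  qed
  then show ?thesis by simp
qed

lemma tri_iff: "x \<in> tri a \<longleftrightarrow> (\<forall>i. 0 \<le> bary a i x)"
proof
  assume "x \<in> tri a"
  moreover have "convex {x. \<forall>i. 0 \<le> bary a i x}"
  proof -
    have "0 \<le> bary a i x \<longleftrightarrow> bary_grad a i \<bullet> x \<ge> - (cross2 (a (i + 1)) (a (i + 2)) / tri_det a)" for i x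
      unfolding bary_affine by linarith
    then have "{x. \<forall>i. 0 \<le> bary a i x} = (\<Inter>i. {x. bary_grad a i \<bullet> x \<ge> - (cross2 (a (i + 1)) (a (i + 2)) / tri_det a)})"
      by auto
    then show ?thesis by (auto intro!: convex_INT convex_halfspace_ge)
  qed
  moreover have "range a \<subseteq> {x. \<forall>i. 0 \<le> bary a i x}" by (auto simp: bary_vertex)
  ultimately show "\<forall>i. 0 \<le> bary a i x" unfolding tri_def using hull_minimal by blast
next
  assume nn: "\<forall>i. 0 \<le> bary a i x"
  have "(\<Sum>i\<in>UNIV. bary a i x *\<^sub>R a i) \<in> convex hull (range a)"
    by (rule convex_sum) (use nn bary_sum in \<open>auto intro: hull_inc\<close>)
  then show "x \<in> tri a" by (simp add: tri_def bary_expansion)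
qed

lemma bary_le_1: "x \<in> tri a \<Longrightarrow> bary a i x \<le> 1"
  using bary_sum3[of i x] unfolding tri_iff all_type3[of _ i] by linarith

lemma vertex_in_tri: "a i \<in> tri a"
  unfolding tri_def by (auto intro: hull_inc)

lemma compact_tri: "compact (tri a)"
  unfolding tri_def by (rule compact_convex_hull) (simp add: finite_imp_compact)

lemma convex_tri: "convex (tri a)"
  unfolding tri_def by (rule convex_convex_hull)

lemma bary_continuous: "continuous_on S (bary a i)"
  unfolding bary_affine by (intro continuous_intros)

lemma interior_tri_nonempty: "interior (tri a) \<noteq> {}"
proof -
  let ?U = "\<Inter>i. {x. 0 < bary a i x}"
  have "open ?U" by (intro open_INT ballI open_Collect_less continuous_on_const bary_continuous) simp_all
  moreover have "?U \<subseteq> tri a" unfolding subset_iff tri_iff by (auto intro: less_imp_le)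
  ultimately have "?U \<subseteq> interior (tri a)" by (rule interior_maximal[rotated])
  moreover have "(\<Sum>j\<in>UNIV. (1/3) *\<^sub>R a j) \<in> ?U"
  proof -
    have c: "bary a i (\<Sum>j\<in>UNIV. (1/3) *\<^sub>R a j) = 1/3" for i
      by (rule bary_comb) simp
    show ?thesis unfolding INT_iff mem_Collect_eq c by simp
  qed
  ultimately show ?thesis by blast
qed

lemma closure_interior_tri: "closure (interior (tri a)) = tri a"
  using convex_closure_interior[OF convex_tri interior_tri_nonempty] compact_tri
  by (simp add: compact_imp_closed)

lemma tri_negligible_boundary: "negligible (tri a - interior (tri a))"
proof -
  have "negligible (frontier (tri a))" by (rule negligible_convex_frontier[OF convex_tri])
  then show ?thesis using compact_tri by (simp add: frontier_def compact_imp_closed)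
qed

definition diam where "diam = diameter (tri a)"

lemma dist_le_diam: "x \<in> tri a \<Longrightarrow> y \<in> tri a \<Longrightarrow> dist x y \<le> diam"
  unfolding diam_def by (rule diameter_bounded_bound) (simp_all add: compact_imp_bounded compact_tri)

lemma vertices_distinct: "i \<noteq> j \<Longrightarrow> a i \<noteq> a j"
  using bary_vertex[of i i] bary_vertex[of i j] by auto

lemma diam_pos: "0 < diam"
  using dist_le_diam[OF vertex_in_tri[of 0] vertex_in_tri[of 1]] vertices_distinct[of 0 1]
  by (metis dual_order.strict_trans1 zero_less_dist_iff zero_neq_one)

lemma bary_grad_nz: "bary_grad a i \<noteq> 0"
  using bary_diff[of a i "a i" "a (i + 1)"] by (auto simp: bary_vertex)

text \<open>Across a ball inside the triangle a barycentric coordinate varies by \<open>2 r \<bar>\<nabla>\<lambda>\<^sub>i\<bar>\<close>, and it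
  takes values in \<open>[0,1]\<close>.\<close>

lemma inscribed_cball_bound:
  assumes "cball x r \<subseteq> tri a"
  shows "diameter (cball x r) \<le> 1 / norm (bary_grad a i)"
proof (cases "r < 0")
  case False
  let ?g = "bary_grad a i"
  define v where "v = (r / norm ?g) *\<^sub>R ?g"
  have nv: "norm v = r" using False bary_grad_nz[of i] by (simp add: v_def)
  have "x + v \<in> cball x r" "x - v \<in> cball x r" by (simp_all add: dist_norm nv)
  then have in_tri: "x + v \<in> tri a" "x - v \<in> tri a" using assms by blast+
  have "0 \<le> bary a i (x - v)" using in_tri(2) tri_iff by blast
  then have "bary a i (x + v) - bary a i (x - v) \<le> 1" using bary_le_1[OF in_tri(1), of i] by linarith
  moreover have "bary a i (x + v) - bary a i (x - v) = 2 * (?g \<bullet> v)"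
    unfolding bary_diff inner_diff_right inner_add_right by simp
  moreover have "?g \<bullet> v = r * norm ?g"
    using bary_grad_nz[of i] by (simp add: v_def dot_square_norm power2_eq_square)
  ultimately have "2 * r * norm ?g \<le> 1" by simp
  then show ?thesis using False bary_grad_nz[of i] by (simp add: field_simps)
qed simp

lemma inscribed_diameter_bounds:
  "0 < inscribed_diameter (tri a)" "inscribed_diameter (tri a) \<le> 1 / norm (bary_grad a i)"
proof -
  let ?D = "{diameter (cball x r) | x r. cball x r \<subseteq> tri a}"
  have bd: "bdd_above ?D" unfolding bdd_above_def using inscribed_cball_bound by blast
  obtain x where "x \<in> interior (tri a)" using interior_tri_nonempty by blast
  then obtain r where r: "0 < r" "cball x r \<subseteq> tri a" unfolding mem_interior_cball by blast
  then have "diameter (cball x r) \<in> ?D" by blast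
  moreover have "0 < diameter (cball x r)" using r by simp
  ultimately show "0 < inscribed_diameter (tri a)"
    unfolding inscribed_diameter_def using bd by (meson cSup_upper less_le_trans)
  show "inscribed_diameter (tri a) \<le> 1 / norm (bary_grad a i)"
    unfolding inscribed_diameter_def
    by (rule cSup_least) (use \<open>diameter (cball x r) \<in> ?D\<close> inscribed_cball_bound in blast)+
qed

end

text \<open>Shape regularity is used through lower bounds, in terms of the diameter, for the heights (which are the
  reciprocals of the lengths of the barycentric gradients), the edges and the area.\<close>

locale regular_triangle =
  fixes a :: triangle and \<gamma> :: real
  assumes nd: "nondegenerate a"
    and shape: "diameter (tri a) / inscribed_diameter (tri a) \<le> \<gamma>"
begin

abbreviation K where "K \<equiv> tri a"
abbreviation T where "T \<equiv> interior (tri a)"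
abbreviation h where "h \<equiv> diameter (tri a)"

lemma h_pos: "0 < h"
  using diam_pos[OF nd] by (simp add: diam_def[OF nd])

lemma dist_le_h: "x \<in> K \<Longrightarrow> y \<in> K \<Longrightarrow> dist x y \<le> h"
  using dist_le_diam[OF nd] by (simp add: diam_def[OF nd])

lemma bary_grad_le: "norm (bary_grad a i) \<le> \<gamma> / h"
proof -
  note r = inscribed_diameter_bounds[OF nd]
  have g: "0 < norm (bary_grad a i)" using bary_grad_nz[OF nd] by simp
  have "0 \<le> \<gamma>" using shape divide_pos_pos[OF h_pos r(1)] by linarith
  have "h \<le> \<gamma> * inscribed_diameter K" using shape r(1) by (simp add: divide_le_eq)
  also have "\<dots> \<le> \<gamma> * (1 / norm (bary_grad a i))" using r(2) \<open>0 \<le> \<gamma>\<close> by (rule mult_left_mono)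
  finally show ?thesis using g h_pos by (simp add: field_simps)
qed

text \<open>\<open>\<lambda>\<^sub>i\<close> changes by \<open>1\<close> along an edge at \<open>a\<^sub>i\<close>, and its gradient is at most \<open>\<gamma> / h\<close>.\<close>

lemma edge_ge:
  assumes "i \<noteq> j"
  shows "h / \<gamma> \<le> dist (a i) (a j)" "1 \<le> \<gamma>"
proof -
  have 1: "1 = bary_grad a i \<bullet> (a i - a j)"
    using bary_diff[of a i "a i" "a j"] assms by (simp add: bary_vertex[OF nd])
  also have "\<dots> \<le> norm (bary_grad a i) * norm (a i - a j)" by (rule norm_cauchy_schwarz)
  also have "\<dots> \<le> \<gamma> / h * norm (a i - a j)" by (intro mult_right_mono bary_grad_le) simp
  finally have 2: "1 \<le> \<gamma> / h * norm (a i - a j)" .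
  have "0 < \<gamma>"
  proof (rule ccontr)
    assume "\<not> 0 < \<gamma>"
    then have "\<gamma> / h \<le> 0" using h_pos by (simp add: divide_nonpos_pos)
    then have "\<gamma> / h * norm (a i - a j) \<le> 0" by (rule mult_nonpos_nonneg) simp
    then show False using 2 by linarith
  qed
  then show "h / \<gamma> \<le> dist (a i) (a j)" using 2 h_pos by (simp add: field_simps dist_norm)
  have "norm (a i - a j) \<le> h" using dist_le_h[OF vertex_in_tri[OF nd] vertex_in_tri[OF nd]] by (simp add: dist_norm)
  then have "\<gamma> / h * norm (a i - a j) \<le> \<gamma> / h * h" using \<open>0 < \<gamma>\<close> h_pos by (intro mult_left_mono) auto
  moreover have "\<gamma> / h * h = \<gamma>" using h_pos by simp
  ultimately show "1 \<le> \<gamma>" using 2 by linarith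
qed

lemma gamma_ge_1: "1 \<le> \<gamma>"
  using edge_ge(2)[of 0 1] by simp

lemma tri_det_ge: "h\<^sup>2 / \<gamma>\<^sup>2 \<le> \<bar>tri_det a\<bar>"
proof -
  have d: "0 < \<bar>tri_det a\<bar>" using tri_det_nz[OF nd] by simp
  have "h / \<gamma> \<le> dist (a (0 + 1)) (a (0 + 2))" by (rule edge_ge(1)) simp
  also have "\<dots> = norm (bary_grad a 0) * \<bar>tri_det a\<bar>" using d by (simp add: norm_bary_grad)
  also have "\<dots> \<le> \<gamma> / h * \<bar>tri_det a\<bar>" using bary_grad_le by (rule mult_right_mono) simp
  finally have "(h / \<gamma>) * (h / \<gamma>) \<le> \<bar>tri_det a\<bar>" using h_pos gamma_ge_1 by (simp add: field_simps)
  then show ?thesis by (simp add: power2_eq_square)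
qed

lemma T_props: "open T" "bounded T" "convex T" "T \<noteq> {}" "T \<in> lmeasurable" "T \<in> sets lebesgue" "T \<subseteq> K"
proof -
  show "bounded T" using compact_tri[OF nd] by (meson bounded_subset compact_imp_bounded interior_subset)
  then show "T \<in> lmeasurable" by (simp add: bounded_set_imp_lmeasurable)
  then show "T \<in> sets lebesgue" by (rule fmeasurableD)
qed (use interior_tri_nonempty[OF nd] convex_tri[OF nd] interior_subset in \<open>auto intro: convex_interior\<close>)

lemma measure_T_le: "measure lebesgue T \<le> 4 * h\<^sup>2"
proof -
  define b :: "real^2" where "b = (\<chi> i. h)"
  have sub: "T \<subseteq> cbox (a 0 - b) (a 0 + b)"
  proof
    fix x assume "x \<in> T"
    then have d: "norm (x - a 0) \<le> h"
      using dist_le_h[OF _ vertex_in_tri[OF nd]] T_props(7) by (auto simp: dist_norm)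
    have "\<bar>x $ i - a 0 $ i\<bar> \<le> h" for i
      using component_le_norm_cart[of "x - a 0" i] d by simp
    then show "x \<in> cbox (a 0 - b) (a 0 + b)" by (auto simp: mem_box_cart b_def abs_diff_le_iff)
  qed
  have "measure lebesgue T \<le> measure lebesgue (cbox (a 0 - b) (a 0 + b))"
    by (rule measure_mono_fmeasurable[OF sub T_props(6)]) simp
  also have "\<dots> = 4 * h\<^sup>2"
    using h_pos by (simp add: content_cbox_if_cart interval_ne_empty_cart b_def prod_2 power2_eq_square UNIV_2)
  finally show ?thesis .
qed

lemma sqrt_measure_T_le: "sqrt (measure lebesgue T) \<le> 2 * h"
  using real_sqrt_le_mono[OF measure_T_le] h_pos by (simp add: real_sqrt_mult)

lemma measure_T_pos: "0 < measure lebesgue T"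
proof -
  obtain x r where "0 < r" "ball x r \<subseteq> T" using T_props(1,4) open_contains_ball by blast
  moreover have "measure lebesgue (ball x r) \<le> measure lebesgue T"
    using calculation T_props(5) by (intro measure_mono_fmeasurable) auto
  moreover have "measure lebesgue (ball x r) = measure lborel (ball x r)" by (rule measure_completion) simp
  ultimately show ?thesis using content_ball_pos[of r x] by linarith
qed

text \<open>The normal points away from \<open>a\<^sub>i\<close>, hence opposite to \<open>\<nabla>\<lambda>\<^sub>i\<close>; in the plane being orthogonal to
  the edge determines a vector up to a factor.\<close>

lemma edge_normal_eq: "edge_normal a i = - (bary_grad a i /\<^sub>R norm (bary_grad a i))"
proof -
  let ?g = "bary_grad a i"
  have g: "0 < norm ?g" using bary_grad_nz[OF nd] by simp
  have 1: "?g \<bullet> (a (i + 2) - a (i + 1)) = 0" "?g \<bullet> (a i - a (i + 1)) = 1"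
    using bary_diff[of a i "a (i + 2)" "a (i + 1)"] bary_diff[of a i "a i" "a (i + 1)"]
    by (simp_all add: bary_vertex[OF nd])
  define e where "e = a (i + 2) - a (i + 1)"
  have e: "e \<noteq> 0" using vertices_distinct[OF nd, of "i + 2" "i + 1"] by (simp add: e_def)
  show ?thesis
    unfolding edge_normal_def
  proof (rule the_equality)
    show "norm (- (?g /\<^sub>R norm ?g)) = 1 \<and> - (?g /\<^sub>R norm ?g) \<bullet> (a (i + 2) - a (i + 1)) = 0 \<and>
      - (?g /\<^sub>R norm ?g) \<bullet> (a i - a (i + 1)) < 0" using 1 g by simp
    fix n assume n: "norm n = 1 \<and> n \<bullet> (a (i + 2) - a (i + 1)) = 0 \<and> n \<bullet> (a i - a (i + 1)) < 0"
    have ne: "n $ 1 * e $ 1 + n $ 2 * e $ 2 = 0" "?g $ 1 * e $ 1 + ?g $ 2 * e $ 2 = 0"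
      using n 1(1) by (simp_all add: inner_real2 e_def)
    have "(n $ 1 * ?g $ 2 - n $ 2 * ?g $ 1) * e $ 1 = 0" "(n $ 1 * ?g $ 2 - n $ 2 * ?g $ 1) * e $ 2 = 0"
      using ne by algebra+
    then have x0: "n $ 1 * ?g $ 2 - n $ 2 * ?g $ 1 = 0" using e by (auto simp: vec_eq_iff forall_2)
    define c where "c = (n \<bullet> ?g) / (?g \<bullet> ?g)"
    have gg: "?g \<bullet> ?g \<noteq> 0" using bary_grad_nz[OF nd] by simp
    have "(?g \<bullet> ?g) *\<^sub>R n = (n \<bullet> ?g) *\<^sub>R ?g"
      using x0 by (simp add: vec_eq_iff forall_2 inner_real2) algebra
    then have "(?g \<bullet> ?g) *\<^sub>R n = (?g \<bullet> ?g) *\<^sub>R (c *\<^sub>R ?g)" using gg by (simp add: c_def)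
    then have nc: "n = c *\<^sub>R ?g" using gg by (simp only: scaleR_cancel_left) simp
    have "c < 0" using n 1(2) by (simp add: nc)
    moreover have "\<bar>c\<bar> * norm ?g = 1" using n by (simp add: nc)
    ultimately have "c = - inverse (norm ?g)" using g by (simp add: field_simps)
    then show "n = - (?g /\<^sub>R norm ?g)" using nc by simp
  qed
qed

lemma norm_edge_normal: "norm (edge_normal a i) = 1"
  using bary_grad_nz[OF nd] by (simp add: edge_normal_eq)

end

section \<open>Integration over parallelograms and traces on lines\<close>

lemma lborel_real2: "distr (lborel \<Otimes>\<^sub>M lborel) borel (\<lambda>z. fst z *\<^sub>R axis 1 1 + snd z *\<^sub>R axis 2 1 :: real^2) = lborel"
  (is "distr _ _ ?J = _")
proof (rule lborel_eqI[symmetric])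
  have m [measurable]: "?J \<in> borel_measurable (lborel \<Otimes>\<^sub>M lborel)" by measurable
  fix l u :: "real^2"
  assume lu: "\<And>b. b \<in> Basis \<Longrightarrow> l \<bullet> b \<le> u \<bullet> b"
  have le: "l $ i \<le> u $ i" for i using lu[of "axis i 1"] by (simp add: inner_axis axis_in_Basis_iff)
  have "?J -` box l u \<inter> space (lborel \<Otimes>\<^sub>M lborel) = {l $ 1<..<u $ 1} \<times> {l $ 2<..<u $ 2}"
    by (auto simp: mem_box_cart forall_2 space_pair_measure axis_def)
  then have "emeasure (distr (lborel \<Otimes>\<^sub>M lborel) borel ?J) (box l u)
     = emeasure (lborel \<Otimes>\<^sub>M lborel) ({l $ 1<..<u $ 1} \<times> {l $ 2<..<u $ 2})"
    by (subst emeasure_distr) auto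
  also have "\<dots> = ennreal (u $ 1 - l $ 1) * ennreal (u $ 2 - l $ 2)"
    using le by (subst lborel.emeasure_pair_measure_Times) auto
  also have "\<dots> = ennreal ((u $ 1 - l $ 1) * (u $ 2 - l $ 2))" using le by (simp add: ennreal_mult)
  also have "(u $ 1 - l $ 1) * (u $ 2 - l $ 2) = (\<Prod>b\<in>Basis. (u - l) \<bullet> b)"
  proof -
    have B: "(Basis :: (real^2) set) = {axis 1 1, axis 2 1}" by (auto simp: Basis_vec_def UNIV_2)
    show ?thesis unfolding B by (subst prod.insert) (auto simp: axis_eq_axis inner_axis)
  qed
  finally show "emeasure (distr (lborel \<Otimes>\<^sub>M lborel) borel ?J) (box l u) = ennreal (\<Prod>b\<in>Basis. (u - l) \<bullet> b)" .
qed simp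

lemma nn_integral_real2:
  fixes G :: "real^2 \<Rightarrow> ennreal"
  assumes [measurable]: "G \<in> borel_measurable borel"
  shows "(\<integral>\<^sup>+x. G x \<partial>lborel) = (\<integral>\<^sup>+s. \<integral>\<^sup>+t. G (s *\<^sub>R axis 1 1 + t *\<^sub>R axis 2 1) \<partial>lborel \<partial>lborel)"
proof -
  have "(\<integral>\<^sup>+x. G x \<partial>lborel) = (\<integral>\<^sup>+z. G (fst z *\<^sub>R axis 1 1 + snd z *\<^sub>R axis 2 1) \<partial>(lborel \<Otimes>\<^sub>M lborel))"
    by (subst lborel_real2[symmetric], subst nn_integral_distr) measurable
  also have "\<dots> = (\<integral>\<^sup>+s. \<integral>\<^sup>+t. G (fst (s, t) *\<^sub>R axis 1 1 + snd (s, t) *\<^sub>R axis 2 1) \<partial>lborel \<partial>lborel)"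
    by (rule lborel.nn_integral_fst[symmetric]) measurable
  finally show ?thesis by simp
qed

text \<open>The substitutions \<open>\<sigma> = (x + s p + t q)\<^sub>1\<close> for fixed \<open>t\<close>, and then \<open>\<tau> = (x + s p + t q)\<^sub>2\<close> for
  fixed \<open>\<sigma>\<close>, have Jacobians \<open>p\<^sub>1\<close> and \<open>d\<close>, whose product is the determinant.\<close>

lemma nn_integral_skew_aux:
  fixes G :: "real^2 \<Rightarrow> ennreal"
  assumes G [measurable]: "G \<in> borel_measurable borel" and c: "cross2 p q \<noteq> 0" and p1: "p $ 1 \<noteq> 0"
  shows "ennreal \<bar>cross2 p q\<bar> * (\<integral>\<^sup>+s. \<integral>\<^sup>+t. G (x + s *\<^sub>R p + t *\<^sub>R q) \<partial>lborel \<partial>lborel) = (\<integral>\<^sup>+x. G x \<partial>lborel)"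
proof -
  define d where "d = q $ 2 - q $ 1 * (p $ 2 / p $ 1)"
  have pd: "p $ 1 * d = cross2 p q" using p1 by (simp add: d_def cross2_def field_simps)
  then have d: "d \<noteq> 0" using c by auto
  have cd: "ennreal \<bar>cross2 p q\<bar> = ennreal \<bar>p $ 1\<bar> * ennreal \<bar>d\<bar>"
    by (simp add: pd[symmetric] abs_mult ennreal_mult)
  define H where "H t \<sigma> = G (\<sigma> *\<^sub>R axis 1 1 + (x $ 2 + (\<sigma> - x $ 1 - t * q $ 1) * (p $ 2 / p $ 1) + t * q $ 2) *\<^sub>R axis 2 1)" for t \<sigma>
  have [measurable]: "(\<lambda>(t, \<sigma>). H t \<sigma>) \<in> borel_measurable (lborel \<Otimes>\<^sub>M lborel)"
    "(\<lambda>(\<sigma>, t). H t \<sigma>) \<in> borel_measurable (lborel \<Otimes>\<^sub>M lborel)" unfolding H_def by measurable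
  have eq1: "x + s *\<^sub>R p + t *\<^sub>R q = ((x $ 1 + t * q $ 1) + p $ 1 * s) *\<^sub>R axis 1 1 +
     (x $ 2 + (((x $ 1 + t * q $ 1) + p $ 1 * s) - x $ 1 - t * q $ 1) * (p $ 2 / p $ 1) + t * q $ 2) *\<^sub>R axis 2 1" for s t
    using p1 by (simp add: vec_eq_iff forall_2 axis_def)
  have eq2: "x $ 2 + (\<sigma> - x $ 1 - t * q $ 1) * (p $ 2 / p $ 1) + t * q $ 2 = (x $ 2 + (\<sigma> - x $ 1) * (p $ 2 / p $ 1)) + d * t" for \<sigma> t
    by (simp add: d_def algebra_simps add_divide_distrib diff_divide_distrib)
  have "(\<integral>\<^sup>+s. \<integral>\<^sup>+t. G (x + s *\<^sub>R p + t *\<^sub>R q) \<partial>lborel \<partial>lborel) = (\<integral>\<^sup>+t. \<integral>\<^sup>+s. G (x + s *\<^sub>R p + t *\<^sub>R q) \<partial>lborel \<partial>lborel)"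
    by (rule lborel_pair.Fubini') measurable
  also have "ennreal \<bar>p $ 1\<bar> * \<dots> = (\<integral>\<^sup>+t. ennreal \<bar>p $ 1\<bar> * (\<integral>\<^sup>+s. H t ((x $ 1 + t * q $ 1) + p $ 1 * s) \<partial>lborel) \<partial>lborel)"
    unfolding H_def eq1[symmetric] by (rule nn_integral_cmult[symmetric]) measurable
  also have "\<dots> = (\<integral>\<^sup>+t. \<integral>\<^sup>+\<sigma>. H t \<sigma> \<partial>lborel \<partial>lborel)"
    by (intro nn_integral_cong nn_integral_real_affine[symmetric] p1) measurable
  also have "\<dots> = (\<integral>\<^sup>+\<sigma>. \<integral>\<^sup>+t. H t \<sigma> \<partial>lborel \<partial>lborel)"
    by (rule lborel_pair.Fubini') measurable
  also have "ennreal \<bar>d\<bar> * \<dots> = (\<integral>\<^sup>+\<sigma>. ennreal \<bar>d\<bar> * (\<integral>\<^sup>+t. H t \<sigma> \<partial>lborel) \<partial>lborel)"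
    by (rule nn_integral_cmult[symmetric]) measurable
  also have "\<dots> = (\<integral>\<^sup>+\<sigma>. \<integral>\<^sup>+\<tau>. G (\<sigma> *\<^sub>R axis 1 1 + \<tau> *\<^sub>R axis 2 1) \<partial>lborel \<partial>lborel)"
    unfolding H_def eq2
    by (intro nn_integral_cong nn_integral_real_affine[symmetric, where f = "\<lambda>\<tau>. G (_ *\<^sub>R axis 1 1 + \<tau> *\<^sub>R axis 2 1)"] d) measurable
  also have "\<dots> = (\<integral>\<^sup>+x. G x \<partial>lborel)" by (rule nn_integral_real2[symmetric]) measurable
  finally show ?thesis unfolding cd by (simp add: mult_ac)
qed

lemma nn_integral_skew:
  fixes G :: "real^2 \<Rightarrow> ennreal"
  assumes G [measurable]: "G \<in> borel_measurable borel" and c: "cross2 p q \<noteq> 0"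
  shows "ennreal \<bar>cross2 p q\<bar> * (\<integral>\<^sup>+s. \<integral>\<^sup>+t. G (x + s *\<^sub>R p + t *\<^sub>R q) \<partial>lborel \<partial>lborel) = (\<integral>\<^sup>+x. G x \<partial>lborel)"
proof (cases "p $ 1 = 0")
  case False then show ?thesis by (rule nn_integral_skew_aux[OF G c])
next
  case True
  then have q: "q $ 1 \<noteq> 0" using c by (auto simp: cross2_def)
  have cs: "cross2 q p = - cross2 p q" by (simp add: cross2_def)
  have "(\<integral>\<^sup>+s. \<integral>\<^sup>+t. G (x + s *\<^sub>R p + t *\<^sub>R q) \<partial>lborel \<partial>lborel) = (\<integral>\<^sup>+t. \<integral>\<^sup>+s. G (x + s *\<^sub>R p + t *\<^sub>R q) \<partial>lborel \<partial>lborel)"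
    by (rule lborel_pair.Fubini') measurable
  also have "\<dots> = (\<integral>\<^sup>+t. \<integral>\<^sup>+s. G (x + t *\<^sub>R q + s *\<^sub>R p) \<partial>lborel \<partial>lborel)" by (simp only: add_ac)
  finally show ?thesis using nn_integral_skew_aux[OF G _ q, of p x] c cs by simp
qed

lemma nn_integral_Icc:
  fixes k :: "real \<Rightarrow> real"
  assumes k: "continuous_on UNIV k" and nn: "\<And>t. 0 \<le> k t"
  shows "(\<integral>\<^sup>+t. ennreal (k t) * indicator {0..1} t \<partial>lborel) = ennreal (LINT t|lebesgue_on {0..1}. k t)"
    and "integrable (lebesgue_on {0..1}) k"
proof -
  have [measurable]: "k \<in> borel_measurable borel" by (rule borel_measurable_continuous_onI[OF k])
  have i: "integrable lborel (\<lambda>x. indicator {0..1} x *\<^sub>R k x)"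
    by (rule borel_integrable_compact) (auto intro: continuous_on_subset[OF k])
  then have "integrable lebesgue (\<lambda>x. indicator {0..1} x *\<^sub>R k x)" by (simp add: integrable_completion)
  then show i': "integrable (lebesgue_on {0..1}) k" by (simp add: integrable_restrict_space)
  have "ennreal (LINT t|lebesgue_on {0..1}. k t) = ennreal (LINT t|lborel. indicator {0..1} t *\<^sub>R k t)"
    by (subst integral_restrict_space) (auto intro!: arg_cong[of _ _ ennreal] integral_completion)
  also have "\<dots> = (\<integral>\<^sup>+t. ennreal (indicator {0..1} t *\<^sub>R k t) \<partial>lborel)"
    by (rule nn_integral_eq_integral[symmetric, OF i]) (use nn in auto)
  also have "\<dots> = (\<integral>\<^sup>+t. ennreal (k t) * indicator {0..1} t \<partial>lborel)"
    by (intro nn_integral_cong) (auto simp: indicator_def)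
  finally show "(\<integral>\<^sup>+t. ennreal (k t) * indicator {0..1} t \<partial>lborel) = ennreal (LINT t|lebesgue_on {0..1}. k t)" by simp
qed

text \<open>The weight \<open>1 - t\<close> vanishes at the other end, so that \<open>g 0 = \<integral> (g t - (1 - t) g' t) dt\<close> over
  \<open>[0,1]\<close>.\<close>

lemma abs_at_0_le_nn_integral:
  fixes g g' :: "real \<Rightarrow> real"
  assumes g: "\<And>t. (g has_real_derivative g' t) (at t)" and g': "continuous_on UNIV g'"
  shows "ennreal \<bar>g 0\<bar> \<le> (\<integral>\<^sup>+t. ennreal (\<bar>g t\<bar> + \<bar>g' t\<bar>) * indicator {0..1} t \<partial>lborel)"
proof -
  have gc: "continuous_on UNIV g" by (rule DERIV_continuous_on) (use g in \<open>auto intro: has_field_derivative_at_within\<close>)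
  define k where "k t = g t - (1 - t) * g' t" for t
  have "((\<lambda>t. - ((1 - t) * g t)) has_real_derivative k t) (at t within {0..1})" for t
    unfolding k_def by (rule has_field_derivative_at_within) (auto intro!: derivative_eq_intros g)
  then have "(k has_integral (- ((1 - 1) * g 1) - - ((1 - 0) * g 0))) {0..1}"
    by (intro fundamental_theorem_of_calculus) (auto simp: has_real_derivative_iff_has_vector_derivative)
  then have k: "(k has_integral g 0) {0..1}" by simp
  have kc: "continuous_on UNIV k" unfolding k_def by (intro continuous_intros gc g')
  have mc: "continuous_on UNIV (\<lambda>t. \<bar>g t\<bar> + \<bar>g' t\<bar>)" by (intro continuous_intros gc g')
  have "\<bar>g 0\<bar> = norm (integral {0..1} k)" using k by (simp add: integral_unique)
  also have "\<dots> \<le> integral {0..1} (\<lambda>t. \<bar>g t\<bar> + \<bar>g' t\<bar>)"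
  proof (rule integral_norm_bound_integral)
    show "k integrable_on {0..1}" using k by blast
    show "(\<lambda>t. \<bar>g t\<bar> + \<bar>g' t\<bar>) integrable_on {0..1}"
      by (rule integrable_continuous_interval) (rule continuous_on_subset[OF mc], simp)
    fix t :: real assume t: "t \<in> {0..1}"
    have "\<bar>(1 - t) * g' t\<bar> \<le> \<bar>g' t\<bar>" using t by (simp add: abs_mult mult_left_le_one_le)
    then show "norm (k t) \<le> \<bar>g t\<bar> + \<bar>g' t\<bar>" unfolding k_def real_norm_def by linarith
  qed
  also have "\<dots> = (LINT t|lebesgue_on {0..1}. \<bar>g t\<bar> + \<bar>g' t\<bar>)"
    by (rule lebesgue_integral_eq_integral[symmetric]) (use nn_integral_Icc(2)[OF mc] in auto)
  finally have "\<bar>g 0\<bar> \<le> (LINT t|lebesgue_on {0..1}. \<bar>g t\<bar> + \<bar>g' t\<bar>)" .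
  then show ?thesis using nn_integral_Icc(1)[OF mc] by (simp add: ennreal_leI)
qed

definition dir_deriv :: "real^'n::finite \<Rightarrow> (real^'n \<Rightarrow> real) \<Rightarrow> real^'n \<Rightarrow> real" where
  "dir_deriv p f x = (\<Sum>c\<in>UNIV. p $ c * partial_deriv c f x)"

lemma smooth_dir_deriv: "smooth f \<Longrightarrow> smooth (dir_deriv p f)"
  unfolding dir_deriv_def by (intro smooth_sum smooth_cmult smooth_partial_deriv)

lemma smooth_line_dir_deriv:
  "smooth f \<Longrightarrow> ((\<lambda>t. f (x + t *\<^sub>R v)) has_real_derivative dir_deriv v f (x + t *\<^sub>R v)) (at t within S)"
  unfolding dir_deriv_def by (rule smooth_line_derivative)

lemma smooth_continuous_line: "smooth f \<Longrightarrow> continuous_on S (\<lambda>t::real. f (x + t *\<^sub>R v))"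
  by (rule continuous_on_compose2[of UNIV f]) (auto intro!: smooth_continuous continuous_intros)

context regular_triangle
begin

abbreviation N where "N j f \<equiv> grad_norm j T f"

lemma N_nonneg [simp]: "0 \<le> N j f"
  by (rule grad_norm_nonneg[OF T_props(1,2)])

lemma smooth_T_L2: "smooth f \<Longrightarrow> f \<in> L2_space T"
  using T_props by (intro smooth_L2)

lemma N_eq: "smooth f \<Longrightarrow> N j f = L2_set (\<lambda>is. L2_norm T (partial_derivs is f)) {is. length is = j}"
  by (rule grad_norm_smooth[OF T_props(1,2)])

lemma L2_partial_derivs_le: "smooth f \<Longrightarrow> length is = j \<Longrightarrow> L2_norm T (partial_derivs is f) \<le> N j f"
  unfolding N_eq
  by (rule member_le_L2_set[where f = "\<lambda>is. L2_norm T (partial_derivs is f)"])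
     (use finite_multi_indices[OF T_props(1,2)] in auto)

lemma N_0: "smooth f \<Longrightarrow> N 0 f = L2_norm T f"
  by (simp add: N_eq L2_set_def)

lemma N_Suc:
  assumes f: "smooth f"
  shows "(N (Suc j) f)\<^sup>2 = (\<Sum>i\<in>UNIV. (N j (partial_deriv i f))\<^sup>2)"
proof -
  have "(N (Suc j) f)\<^sup>2 = (\<Sum>is | length is = Suc j. (L2_norm T (partial_derivs is f))\<^sup>2)"
    by (simp add: N_eq f L2_set_def sum_nonneg)
  also have "\<dots> = (\<Sum>(i, is)\<in>UNIV \<times> {is. length is = j}. (L2_norm T (partial_derivs (is @ [i]) f))\<^sup>2)"
  proof (rule sum.reindex_bij_witness[where i = "\<lambda>(i, is). is @ [i]" and j = "\<lambda>is. (last is, butlast is)"])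
    fix "is" :: "2 list" assume "is \<in> {is. length is = Suc j}"
    then have "is \<noteq> []" by auto
    then show "(case (last is, butlast is) of (i, is) \<Rightarrow> is @ [i]) = is"
      "(case (last is, butlast is) of (i, is) \<Rightarrow> (L2_norm T (partial_derivs (is @ [i]) f))\<^sup>2) = (L2_norm T (partial_derivs is f))\<^sup>2"
      by simp_all
  qed auto
  also have "\<dots> = (\<Sum>i\<in>UNIV. \<Sum>is | length is = j. (L2_norm T (partial_derivs is (partial_deriv i f)))\<^sup>2)"
    by (simp add: sum.cartesian_product[symmetric] partial_derivs_append)
  also have "\<dots> = (\<Sum>i\<in>UNIV. (N j (partial_deriv i f))\<^sup>2)"
    by (simp add: N_eq smooth_partial_deriv f L2_set_def sum_nonneg)
  finally show ?thesis .
qed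

lemma N_partial_deriv_le: "smooth f \<Longrightarrow> N j (partial_deriv i f) \<le> N (Suc j) f"
proof (rule power2_le_imp_le)
  assume f: "smooth f"
  show "(N j (partial_deriv i f))\<^sup>2 \<le> (N (Suc j) f)\<^sup>2"
    unfolding N_Suc[OF f] by (rule member_le_sum[where f = "\<lambda>i. (N j (partial_deriv i f))\<^sup>2"]) auto
qed simp

lemma L2_partial_deriv_le: "smooth f \<Longrightarrow> L2_norm T (partial_deriv c f) \<le> N 1 f"
  using L2_partial_derivs_le[of f "[c]" 1] by simp

lemma L2_dir_deriv_le:
  assumes f: "smooth f"
  shows "L2_norm T (dir_deriv p f) \<le> 2 * norm p * N 1 f"
proof -
  have L: "partial_deriv c f \<in> L2_space T" for c by (intro smooth_T_L2 smooth_partial_deriv f)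
  have "L2_norm T (\<lambda>x. p $ 1 * partial_deriv 1 f x + p $ 2 * partial_deriv 2 f x)
      \<le> \<bar>p $ 1\<bar> * L2_norm T (partial_deriv 1 f) + \<bar>p $ 2\<bar> * L2_norm T (partial_deriv 2 f)"
    using L2_norm_triangle[OF L2_cmult[OF L] L2_cmult[OF L], of "p $ 1" 1 "p $ 2" 2] by (simp add: L2_norm_cmult)
  also have "\<dots> \<le> norm p * N 1 f + norm p * N 1 f"
    by (intro add_mono mult_mono component_le_norm_cart L2_partial_deriv_le f) auto
  finally show ?thesis unfolding dir_deriv_def sum_2 by simp
qed

lemma N1_dir_deriv_le:
  assumes f: "smooth f"
  shows "N 1 (dir_deriv p f) \<le> 2 * norm p * N 2 f"
proof -
  have S: "partial_deriv c f \<in> sobolev_space 1 T" for c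
    using T_props(1,2) by (intro smooth_sobolev smooth_partial_deriv f)
  have "N 1 (\<lambda>x. p $ 1 * partial_deriv 1 f x + p $ 2 * partial_deriv 2 f x)
      \<le> \<bar>p $ 1\<bar> * N 1 (partial_deriv 1 f) + \<bar>p $ 2\<bar> * N 1 (partial_deriv 2 f)"
    using grad_norm_triangle[OF T_props(1,2) sobolev_cmult[OF T_props(1,2) S] sobolev_cmult[OF T_props(1,2) S] order_refl, of "p $ 1" 1 "p $ 2" 2]
      grad_norm_cmult[OF T_props(1,2) S order_refl]
    by simp
  also have "\<dots> \<le> norm p * N 2 f + norm p * N 2 f"
    using N_partial_deriv_le[OF f, of 1] by (intro add_mono mult_mono component_le_norm_cart) (auto simp: numeral_2_eq_2)
  finally show ?thesis unfolding dir_deriv_def sum_2 by simp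
qed

text \<open>The basic device for traces and point values: an integral over a parallelogram in the
  triangle, written as an iterated integral along its sides, is an integral over a part of the
  triangle.\<close>

lemma parallelogram_bound:
  assumes F: "F \<in> borel_measurable borel" and nn: "\<And>y. 0 \<le> F y" and Fi: "integrable (lebesgue_on T) F"
    and sub: "\<And>s t. 0 \<le> s \<Longrightarrow> s \<le> 1 \<Longrightarrow> 0 \<le> t \<Longrightarrow> t \<le> 1 \<Longrightarrow> x + s *\<^sub>R p + t *\<^sub>R q \<in> K"
    and c: "cross2 p q \<noteq> 0"
  shows "ennreal \<bar>cross2 p q\<bar> * (\<integral>\<^sup>+s. (\<integral>\<^sup>+t. ennreal (F (x + s *\<^sub>R p + t *\<^sub>R q)) * indicator {0..1} t \<partial>lborel) * indicator {0..1} s \<partial>lborel)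
    \<le> ennreal (LINT x|lebesgue_on T. F x)"
proof -
  note [measurable] = F
  have K: "closed K" using compact_tri[OF nd] by (rule compact_imp_closed)
  then have [measurable]: "K \<in> sets borel" by (rule borel_closed)
  define G where "G y = ennreal (F y) * indicator K y" for y
  have [measurable]: "G \<in> borel_measurable borel" unfolding G_def by measurable
  have "(\<integral>\<^sup>+s. (\<integral>\<^sup>+t. ennreal (F (x + s *\<^sub>R p + t *\<^sub>R q)) * indicator {0..1} t \<partial>lborel) * indicator {0..1} s \<partial>lborel)
     = (\<integral>\<^sup>+s. (\<integral>\<^sup>+t. ennreal (F (x + s *\<^sub>R p + t *\<^sub>R q)) * indicator {0..1} t * indicator {0..1} s \<partial>lborel) \<partial>lborel)"
    by (subst nn_integral_multc) auto
  also have "\<dots> \<le> (\<integral>\<^sup>+s. \<integral>\<^sup>+t. G (x + s *\<^sub>R p + t *\<^sub>R q) \<partial>lborel \<partial>lborel)"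
    by (intro nn_integral_mono) (auto simp: G_def indicator_def sub)
  finally have "ennreal \<bar>cross2 p q\<bar> * (\<integral>\<^sup>+s. (\<integral>\<^sup>+t. ennreal (F (x + s *\<^sub>R p + t *\<^sub>R q)) * indicator {0..1} t \<partial>lborel) * indicator {0..1} s \<partial>lborel)
    \<le> ennreal \<bar>cross2 p q\<bar> * (\<integral>\<^sup>+s. \<integral>\<^sup>+t. G (x + s *\<^sub>R p + t *\<^sub>R q) \<partial>lborel \<partial>lborel)"
    by (rule mult_left_mono) simp
  also have "\<dots> = (\<integral>\<^sup>+y. G y \<partial>lborel)" by (rule nn_integral_skew) (auto simp: c)
  also have "\<dots> = (\<integral>\<^sup>+y. G y \<partial>lebesgue)" by (simp add: nn_integral_completion)
  also have "\<dots> = (\<integral>\<^sup>+y. ennreal (F y) * indicator T y \<partial>lebesgue)"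
  proof (rule nn_integral_cong_AE)
    have "AE y in lebesgue. y \<notin> K - T"
      using tri_negligible_boundary[OF nd] unfolding negligible_iff_null_sets by (rule AE_not_in)
    then show "AE y in lebesgue. G y = ennreal (F y) * indicator T y"
      by eventually_elim (use T_props(7) in \<open>auto simp: G_def indicator_def\<close>)
  qed
  also have "\<dots> = (\<integral>\<^sup>+y. ennreal (F y) \<partial>lebesgue_on T)"
    using T_props(6) by (subst nn_integral_restrict_space) auto
  also have "\<dots> = ennreal (LINT x|lebesgue_on T. F x)"
    by (rule nn_integral_eq_integral[OF Fi]) (use nn in auto)
  finally show ?thesis .
qed

lemma L1_mult_le: "smooth f \<Longrightarrow> smooth g \<Longrightarrow> (LINT x|lebesgue_on T. \<bar>f x * g x\<bar>) \<le> L2_norm T f * L2_norm T g"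
  by (intro L2_Cauchy_Schwarz_abs smooth_T_L2)

text \<open>The multiplicative trace inequality on one side of a parallelogram. Applying the
  one-dimensional bound across the parallelogram to \<open>f\<^sup>2\<close>, whose derivative is \<open>2 f f'\<close>, gives the
  product \<open>N 0 f * N 1 f\<close> and no square of \<open>N 1 f\<close>; this is what makes the second estimate of the
  theorem possible.\<close>

lemma line_trace:
  assumes f: "smooth f"
    and sub: "\<And>s t. 0 \<le> s \<Longrightarrow> s \<le> 1 \<Longrightarrow> 0 \<le> t \<Longrightarrow> t \<le> 1 \<Longrightarrow> x + s *\<^sub>R p + t *\<^sub>R q \<in> K"
    and c: "cross2 p q \<noteq> 0"
  shows "\<bar>cross2 p q\<bar> * (LINT s|lebesgue_on {0..1}. (f (x + s *\<^sub>R p))\<^sup>2) \<le> (N 0 f)\<^sup>2 + 4 * norm q * N 0 f * N 1 f"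
proof -
  note d = smooth_dir_deriv[OF f, of q]
  define F where "F y = \<bar>f y * f y\<bar> + 2 * \<bar>f y * dir_deriv q f y\<bar>" for y
  note [measurable] = smooth_borel[OF f] smooth_borel[OF d]
  have Fm: "F \<in> borel_measurable borel" unfolding F_def by measurable
  have i: "integrable (lebesgue_on T) (\<lambda>y. \<bar>f y * f y\<bar>)" "integrable (lebesgue_on T) (\<lambda>y. 2 * \<bar>f y * dir_deriv q f y\<bar>)"
    using L2_prod_integrable[OF smooth_T_L2[OF f] smooth_T_L2[OF f]] L2_prod_integrable[OF smooth_T_L2[OF f] smooth_T_L2[OF d]]
    by auto
  then have Fi: "integrable (lebesgue_on T) F" unfolding F_def by simp
  have 1: "ennreal ((f (x + s *\<^sub>R p))\<^sup>2) \<le> (\<integral>\<^sup>+t. ennreal (F (x + s *\<^sub>R p + t *\<^sub>R q)) * indicator {0..1} t \<partial>lborel)" for s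
  proof -
    let ?g = "\<lambda>t. f (x + s *\<^sub>R p + t *\<^sub>R q) * f (x + s *\<^sub>R p + t *\<^sub>R q)"
    let ?g' = "\<lambda>t. 2 * (f (x + s *\<^sub>R p + t *\<^sub>R q) * dir_deriv q f (x + s *\<^sub>R p + t *\<^sub>R q))"
    have "(?g has_real_derivative ?g' t) (at t)" for t
      using DERIV_mult[OF smooth_line_dir_deriv[OF f, of "x + s *\<^sub>R p" q t UNIV] smooth_line_dir_deriv[OF f, of "x + s *\<^sub>R p" q t UNIV]]
      by (simp add: mult.commute)
    moreover have "continuous_on UNIV ?g'"
      by (intro continuous_intros smooth_continuous_line f d)
    ultimately have "ennreal \<bar>?g 0\<bar> \<le> (\<integral>\<^sup>+t. ennreal (\<bar>?g t\<bar> + \<bar>?g' t\<bar>) * indicator {0..1} t \<partial>lborel)"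
      by (rule abs_at_0_le_nn_integral)
    then show ?thesis by (simp add: F_def power2_eq_square abs_mult)
  qed
  have "(\<integral>\<^sup>+s. ennreal ((f (x + s *\<^sub>R p))\<^sup>2) * indicator {0..1} s \<partial>lborel) \<le>
    (\<integral>\<^sup>+s. (\<integral>\<^sup>+t. ennreal (F (x + s *\<^sub>R p + t *\<^sub>R q)) * indicator {0..1} t \<partial>lborel) * indicator {0..1} s \<partial>lborel)"
    by (intro nn_integral_mono mult_right_mono 1) simp
  then have "ennreal \<bar>cross2 p q\<bar> * (\<integral>\<^sup>+s. ennreal ((f (x + s *\<^sub>R p))\<^sup>2) * indicator {0..1} s \<partial>lborel) \<le> ennreal (LINT x|lebesgue_on T. F x)"
    by (intro order_trans[OF mult_left_mono parallelogram_bound[OF Fm _ Fi sub c]]) (auto simp: F_def)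
  moreover have "(\<integral>\<^sup>+s. ennreal ((f (x + s *\<^sub>R p))\<^sup>2) * indicator {0..1} s \<partial>lborel) = ennreal (LINT s|lebesgue_on {0..1}. (f (x + s *\<^sub>R p))\<^sup>2)"
    by (intro nn_integral_Icc(1) continuous_intros smooth_continuous_line f) auto
  moreover have Fnn: "0 \<le> (LINT x|lebesgue_on T. F x)" by (intro integral_nonneg_AE) (auto simp: F_def)
  ultimately have "\<bar>cross2 p q\<bar> * (LINT s|lebesgue_on {0..1}. (f (x + s *\<^sub>R p))\<^sup>2) \<le> (LINT x|lebesgue_on T. F x)"
    by (simp add: ennreal_mult'[symmetric])
  also have "\<dots> = (LINT x|lebesgue_on T. \<bar>f x * f x\<bar>) + 2 * (LINT x|lebesgue_on T. \<bar>f x * dir_deriv q f x\<bar>)"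
    unfolding F_def using i by simp
  also have "\<dots> \<le> L2_norm T f * L2_norm T f + 2 * (L2_norm T f * (2 * norm q * N 1 f))"
    by (intro add_mono mult_left_mono L1_mult_le order_trans[OF L1_mult_le] L2_dir_deriv_le f d) auto
  finally show ?thesis by (simp add: N_0 f power2_eq_square mult_ac)
qed

text \<open>The one-dimensional bound, applied first along \<open>p\<close> and then along \<open>q\<close>, controls a corner value
  by integrals of \<open>f\<close>, its first derivatives and one mixed second derivative over the parallelogram.\<close>

lemma point_bound:
  assumes f: "smooth f"
    and sub: "\<And>s t. 0 \<le> s \<Longrightarrow> s \<le> 1 \<Longrightarrow> 0 \<le> t \<Longrightarrow> t \<le> 1 \<Longrightarrow> x + s *\<^sub>R p + t *\<^sub>R q \<in> K"
    and c: "cross2 p q \<noteq> 0"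
  shows "\<bar>cross2 p q\<bar> * \<bar>f x\<bar> \<le> 2 * h * (N 0 f + 2 * (norm p + norm q) * N 1 f + 4 * norm p * norm q * N 2 f)"
proof -
  note dp = smooth_dir_deriv[OF f, of p] and dq = smooth_dir_deriv[OF f, of q]
  note dd = smooth_dir_deriv[OF dp, of q]
  note [measurable] = smooth_borel[OF f] smooth_borel[OF dp] smooth_borel[OF dq] smooth_borel[OF dd]
  define F1 where "F1 y = \<bar>f y\<bar> + \<bar>dir_deriv q f y\<bar>" for y
  define F2 where "F2 y = \<bar>dir_deriv p f y\<bar> + \<bar>dir_deriv q (dir_deriv p f) y\<bar>" for y
  have i: "integrable (lebesgue_on T) (\<lambda>y. \<bar>g y\<bar>)" if "smooth g" for g
    using L2_integrable[OF T_props(5) smooth_T_L2[OF that]] by simp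
  define F where "F y = F1 y + F2 y" for y
  have Fm: "F1 \<in> borel_measurable borel" "F2 \<in> borel_measurable borel" "F \<in> borel_measurable borel"
    unfolding F_def F1_def F2_def by measurable
  note [measurable] = Fm
  have Fi: "integrable (lebesgue_on T) F"
    unfolding F_def F1_def F2_def by (intro Bochner_Integration.integrable_add i f dp dq dd)
  have l: "ennreal \<bar>g (x + s *\<^sub>R p)\<bar> \<le> (\<integral>\<^sup>+t. ennreal (\<bar>g (x + s *\<^sub>R p + t *\<^sub>R q)\<bar> + \<bar>dir_deriv q g (x + s *\<^sub>R p + t *\<^sub>R q)\<bar>) * indicator {0..1} t \<partial>lborel)"
    if g: "smooth g" for g s
    using abs_at_0_le_nn_integral[OF smooth_line_dir_deriv[OF g, of "x + s *\<^sub>R p" q _ UNIV] smooth_continuous_line[OF smooth_dir_deriv[OF g]]]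
    by simp
  have "ennreal \<bar>f x\<bar> \<le> (\<integral>\<^sup>+s. ennreal (\<bar>f (x + s *\<^sub>R p)\<bar> + \<bar>dir_deriv p f (x + s *\<^sub>R p)\<bar>) * indicator {0..1} s \<partial>lborel)"
    using abs_at_0_le_nn_integral[OF smooth_line_dir_deriv[OF f, of x p _ UNIV] smooth_continuous_line[OF dp]] by simp
  also have "\<dots> \<le> (\<integral>\<^sup>+s. (\<integral>\<^sup>+t. ennreal (F (x + s *\<^sub>R p + t *\<^sub>R q)) * indicator {0..1} t \<partial>lborel) * indicator {0..1} s \<partial>lborel)"
  proof (intro nn_integral_mono mult_right_mono)
    fix s
    have "ennreal (\<bar>f (x + s *\<^sub>R p)\<bar> + \<bar>dir_deriv p f (x + s *\<^sub>R p)\<bar>) = ennreal \<bar>f (x + s *\<^sub>R p)\<bar> + ennreal \<bar>dir_deriv p f (x + s *\<^sub>R p)\<bar>"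
      by simp
    also have "\<dots> \<le> (\<integral>\<^sup>+t. ennreal (F1 (x + s *\<^sub>R p + t *\<^sub>R q)) * indicator {0..1} t \<partial>lborel)
        + (\<integral>\<^sup>+t. ennreal (F2 (x + s *\<^sub>R p + t *\<^sub>R q)) * indicator {0..1} t \<partial>lborel)"
      unfolding F1_def F2_def by (intro add_mono l f dp)
    also have "\<dots> = (\<integral>\<^sup>+t. ennreal (F1 (x + s *\<^sub>R p + t *\<^sub>R q)) * indicator {0..1} t + ennreal (F2 (x + s *\<^sub>R p + t *\<^sub>R q)) * indicator {0..1} t \<partial>lborel)"
      by (rule nn_integral_add[symmetric]) measurable
    also have "\<dots> = (\<integral>\<^sup>+t. ennreal (F (x + s *\<^sub>R p + t *\<^sub>R q)) * indicator {0..1} t \<partial>lborel)"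
      by (intro nn_integral_cong) (auto simp: F_def F1_def F2_def indicator_def)
    finally show "ennreal (\<bar>f (x + s *\<^sub>R p)\<bar> + \<bar>dir_deriv p f (x + s *\<^sub>R p)\<bar>) \<le> (\<integral>\<^sup>+t. ennreal (F (x + s *\<^sub>R p + t *\<^sub>R q)) * indicator {0..1} t \<partial>lborel)" .
  qed simp
  finally have "ennreal \<bar>cross2 p q\<bar> * ennreal \<bar>f x\<bar> \<le> ennreal (LINT x|lebesgue_on T. F x)"
    by (intro order_trans[OF mult_left_mono parallelogram_bound[OF Fm(3) _ Fi sub c]]) (auto simp: F_def F1_def F2_def)
  moreover have "0 \<le> (LINT x|lebesgue_on T. F x)" by (intro integral_nonneg_AE) (auto simp: F_def F1_def F2_def)
  ultimately have "\<bar>cross2 p q\<bar> * \<bar>f x\<bar> \<le> (LINT x|lebesgue_on T. F x)"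
    by (simp add: ennreal_mult'[symmetric])
  also have "\<dots> = (LINT x|lebesgue_on T. \<bar>f x\<bar>) + (LINT x|lebesgue_on T. \<bar>dir_deriv q f x\<bar>)
      + ((LINT x|lebesgue_on T. \<bar>dir_deriv p f x\<bar>) + (LINT x|lebesgue_on T. \<bar>dir_deriv q (dir_deriv p f) x\<bar>))"
    unfolding F_def F1_def F2_def using i f dp dq dd by simp
  also have "\<dots> \<le> 2 * h * L2_norm T f + 2 * h * L2_norm T (dir_deriv q f)
      + (2 * h * L2_norm T (dir_deriv p f) + 2 * h * L2_norm T (dir_deriv q (dir_deriv p f)))"
    using L1_le_L2[OF T_props(5) smooth_T_L2] sqrt_measure_T_le f dp dq dd
    by (intro add_mono) (meson L2_norm_nonneg mult_right_mono order_trans)+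
  also have "\<dots> \<le> 2 * h * L2_norm T f + 2 * h * (2 * norm q * N 1 f)
      + (2 * h * (2 * norm p * N 1 f) + 2 * h * (2 * norm q * (2 * norm p * N 2 f)))"
    using h_pos
    by (intro add_mono mult_left_mono order_refl L2_dir_deriv_le f order_trans[OF L2_dir_deriv_le[OF dp]] N1_dir_deriv_le) auto
  also have "\<dots> = 2 * h * (N 0 f + 2 * (norm p + norm q) * N 1 f + 4 * norm p * norm q * N 2 f)"
    by (simp add: N_0 f algebra_simps)
  finally show ?thesis .
qed

end

section \<open>Edge traces and point values on the triangle\<close>

lemma integral_halves_le:
  fixes k :: "real \<Rightarrow> real"
  assumes k: "continuous_on UNIV k" and nn: "\<And>t. 0 \<le> k t"
  shows "(LINT t|lebesgue_on {0..1}. k t) \<le>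
    ((LINT s|lebesgue_on {0..1}. k (s / 2)) + (LINT s|lebesgue_on {0..1}. k (1 - s / 2))) / 2"
proof -
  have [measurable]: "k \<in> borel_measurable borel" by (rule borel_measurable_continuous_onI[OF k])
  have c: "continuous_on UNIV (\<lambda>s. k (s / 2))" "continuous_on UNIV (\<lambda>s. k (1 - s / 2))"
    by (rule continuous_on_compose2[OF k]; auto intro!: continuous_intros)+
  have 1: "(\<integral>\<^sup>+t. ennreal (k t) * indicator {0..1/2} t \<partial>lborel) = ennreal (1/2) * ennreal (LINT s|lebesgue_on {0..1}. k (s / 2))"
  proof -
    have "(\<integral>\<^sup>+t. ennreal (k t) * indicator {0..1/2} t \<partial>lborel) = ennreal \<bar>1/2\<bar> * (\<integral>\<^sup>+s. ennreal (k (0 + 1/2 * s)) * indicator {0..1/2} (0 + 1/2 * s) \<partial>lborel)"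
      by (rule nn_integral_real_affine) auto
    also have "(\<integral>\<^sup>+s. ennreal (k (0 + 1/2 * s)) * indicator {0..1/2} (0 + 1/2 * s) \<partial>lborel) = (\<integral>\<^sup>+s. ennreal (k (s / 2)) * indicator {0..1} s \<partial>lborel)"
      by (intro nn_integral_cong) (auto simp: indicator_def)
    finally show ?thesis using nn_integral_Icc(1)[OF c(1)] nn by simp
  qed
  have 2: "(\<integral>\<^sup>+t. ennreal (k t) * indicator {1/2..1} t \<partial>lborel) = ennreal (1/2) * ennreal (LINT s|lebesgue_on {0..1}. k (1 - s / 2))"
  proof -
    have "(\<integral>\<^sup>+t. ennreal (k t) * indicator {1/2..1} t \<partial>lborel) = ennreal \<bar>- (1/2)\<bar> * (\<integral>\<^sup>+s. ennreal (k (1 + - (1/2) * s)) * indicator {1/2..1} (1 + - (1/2) * s) \<partial>lborel)"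
      by (rule nn_integral_real_affine) auto
    also have "(\<integral>\<^sup>+s. ennreal (k (1 + - (1/2) * s)) * indicator {1/2..1} (1 + - (1/2) * s) \<partial>lborel) = (\<integral>\<^sup>+s. ennreal (k (1 - s / 2)) * indicator {0..1} s \<partial>lborel)"
      by (intro nn_integral_cong) (auto simp: indicator_def)
    finally show ?thesis using nn_integral_Icc(1)[OF c(2)] nn by simp
  qed
  have I: "0 \<le> (LINT s|lebesgue_on {0..1}. k (s / 2))" "0 \<le> (LINT s|lebesgue_on {0..1}. k (1 - s / 2))"
    by (intro integral_nonneg_AE; use nn in simp)+
  have "ennreal (LINT t|lebesgue_on {0..1}. k t) = (\<integral>\<^sup>+t. ennreal (k t) * indicator {0..1} t \<partial>lborel)"
    by (rule nn_integral_Icc(1)[OF k nn, symmetric])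
  also have "\<dots> \<le> (\<integral>\<^sup>+t. ennreal (k t) * indicator {0..1/2} t + ennreal (k t) * indicator {1/2..1} t \<partial>lborel)"
    by (intro nn_integral_mono) (auto simp: indicator_def)
  also have "\<dots> = ennreal (1/2) * ennreal (LINT s|lebesgue_on {0..1}. k (s / 2)) + ennreal (1/2) * ennreal (LINT s|lebesgue_on {0..1}. k (1 - s / 2))"
    by (subst nn_integral_add) (auto simp: 1 2)
  also have "\<dots> = ennreal (((LINT s|lebesgue_on {0..1}. k (s / 2)) + (LINT s|lebesgue_on {0..1}. k (1 - s / 2))) / 2)"
  proof -
    have "ennreal (1/2) * ennreal r = ennreal (r / 2)" if "0 \<le> r" for r :: real
      using ennreal_mult[of "1/2" r] that by simp
    then show ?thesis using I by (simp only: add_divide_distrib) (simp add: ennreal_plus)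
  qed
  finally show ?thesis using I by simp
qed

context regular_triangle
begin

text \<open>Moving along the two edges at \<open>a\<^sub>i\<close>, away from \<open>a\<^sub>i\<close>, lowers \<open>\<lambda>\<^sub>i\<close> by \<open>s + t\<close> and lowers no
  other barycentric coordinate.\<close>

lemma corner_in_tri:
  assumes x: "x \<in> K" and st: "0 \<le> s" "0 \<le> t" "s + t \<le> bary a i x"
  shows "x + s *\<^sub>R (a (i + 1) - a i) + t *\<^sub>R (a (i + 2) - a i) \<in> K"
proof -
  let ?y = "x + s *\<^sub>R (a (i + 1) - a i) + t *\<^sub>R (a (i + 2) - a i)"
  have "bary a j ?y - bary a j x = s * (bary_grad a j \<bullet> (a (i + 1) - a i)) + t * (bary_grad a j \<bullet> (a (i + 2) - a i))" for j
    unfolding bary_diff by (simp add: inner_add_right)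
  then have "bary a j ?y = bary a j x + s * (bary a j (a (i + 1)) - bary a j (a i)) + t * (bary a j (a (i + 2)) - bary a j (a i))" for j
    unfolding bary_diff[of a j "a (i + 1)" "a i"] bary_diff[of a j "a (i + 2)" "a i"] by (simp add: algebra_simps)
  then have b: "bary a j ?y = bary a j x + s * ((if j = i + 1 then 1 else 0) - (if j = i then 1 else 0))
      + t * ((if j = i + 2 then 1 else 0) - (if j = i then 1 else 0))" for j
    by (simp only: bary_vertex[OF nd])
  have nn: "0 \<le> bary a j x" for j using x tri_iff[OF nd] by blast
  show ?thesis
    unfolding tri_iff[OF nd] all_type3[of _ i] b using nn[of "i + 1"] nn[of "i + 2"] st by simp
qed

text \<open>Each half of the edge is a side of a parallelogram inside the triangle, spanned from an
  endpoint by the half edges; its area is a quarter of the determinant, to which shape regularity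
  gives a lower bound.\<close>

lemma edge_trace:
  assumes f: "smooth f"
  shows "(LINT t|lebesgue_on {0..1}. (f (linepath (a (i + 1)) (a (i + 2)) t))\<^sup>2)
    \<le> 8 * \<gamma>\<^sup>2 / h\<^sup>2 * ((N 0 f)\<^sup>2 + h * N 0 f * N 1 f)"
proof -
  let ?D = "\<bar>tri_det a\<bar>"
  have D: "0 < ?D" using tri_det_nz[OF nd] by simp
  have half: "?D / 4 * (LINT s|lebesgue_on {0..1}. (f (x + s *\<^sub>R p))\<^sup>2) \<le> (N 0 f)\<^sup>2 + 2 * h * N 0 f * N 1 f"
    if c: "\<bar>cross2 p q\<bar> = ?D / 4" and q: "norm q \<le> h / 2"
      and sub: "\<And>s t. 0 \<le> s \<Longrightarrow> s \<le> 1 \<Longrightarrow> 0 \<le> t \<Longrightarrow> t \<le> 1 \<Longrightarrow> x + s *\<^sub>R p + t *\<^sub>R q \<in> K" for x p q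
  proof -
    have "\<bar>cross2 p q\<bar> * (LINT s|lebesgue_on {0..1}. (f (x + s *\<^sub>R p))\<^sup>2) \<le> (N 0 f)\<^sup>2 + 4 * norm q * N 0 f * N 1 f"
      by (rule line_trace[OF f sub]) (use c D in auto)
    also have "4 * norm q * N 0 f * N 1 f \<le> 2 * h * N 0 f * N 1 f"
      using q by (intro mult_right_mono) auto
    finally show ?thesis using c by simp
  qed
  define x y z where "x = a (i + 1)" and "y = a (i + 2)" and "z = a i"
  have nz: "norm ((1/2) *\<^sub>R (z - w)) \<le> h / 2" if "w \<in> K" for w
    using dist_le_h[OF vertex_in_tri[OF nd, of i] that] by (simp add: z_def dist_norm)
  have 1: "?D / 4 * (LINT s|lebesgue_on {0..1}. (f (x + s *\<^sub>R ((1/2) *\<^sub>R (y - x))))\<^sup>2) \<le> (N 0 f)\<^sup>2 + 2 * h * N 0 f * N 1 f"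
  proof (rule half[where q = "(1/2) *\<^sub>R (z - x)"])
    have "cross2 (y - x) (z - x) = tri_det a" using tri_det_eq[of a "i + 1"] by (simp add: x_def y_def z_def)
    then show "\<bar>cross2 ((1/2) *\<^sub>R (y - x)) ((1/2) *\<^sub>R (z - x))\<bar> = ?D / 4" by (simp add: cross2_scale)
    show "norm ((1/2) *\<^sub>R (z - x)) \<le> h / 2" by (rule nz) (simp add: x_def vertex_in_tri[OF nd])
    fix s t :: real assume "0 \<le> s" "s \<le> 1" "0 \<le> t" "t \<le> 1"
    then show "x + s *\<^sub>R ((1/2) *\<^sub>R (y - x)) + t *\<^sub>R ((1/2) *\<^sub>R (z - x)) \<in> K"
      using corner_in_tri[of x "s / 2" "t / 2" "i + 1"] by (simp add: x_def y_def z_def vertex_in_tri[OF nd] bary_vertex[OF nd])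
  qed
  have 2: "?D / 4 * (LINT s|lebesgue_on {0..1}. (f (y + s *\<^sub>R ((1/2) *\<^sub>R (x - y))))\<^sup>2) \<le> (N 0 f)\<^sup>2 + 2 * h * N 0 f * N 1 f"
  proof (rule half[where q = "(1/2) *\<^sub>R (z - y)"])
    have "cross2 (z - y) (x - y) = tri_det a" using tri_det_eq[of a "i + 2"] by (simp add: x_def y_def z_def)
    moreover have "cross2 (x - y) (z - y) = - cross2 (z - y) (x - y)" by (simp add: cross2_def)
    ultimately show "\<bar>cross2 ((1/2) *\<^sub>R (x - y)) ((1/2) *\<^sub>R (z - y))\<bar> = ?D / 4" by (simp add: cross2_scale)
    show "norm ((1/2) *\<^sub>R (z - y)) \<le> h / 2" by (rule nz) (simp add: y_def vertex_in_tri[OF nd])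
    fix s t :: real assume st: "0 \<le> s" "s \<le> 1" "0 \<le> t" "t \<le> 1"
    have "y + (t / 2) *\<^sub>R (z - y) + (s / 2) *\<^sub>R (x - y) \<in> K"
      using st corner_in_tri[of y "t / 2" "s / 2" "i + 2"] by (simp add: x_def y_def z_def vertex_in_tri[OF nd] bary_vertex[OF nd])
    then show "y + s *\<^sub>R ((1/2) *\<^sub>R (x - y)) + t *\<^sub>R ((1/2) *\<^sub>R (z - y)) \<in> K"
      by (simp add: add_ac)
  qed
  have lp: "linepath x y t = x + t *\<^sub>R (y - x)" for t by (simp add: linepath_def algebra_simps)
  have lp2: "linepath x y (s / 2) = x + s *\<^sub>R ((1/2) *\<^sub>R (y - x))" "linepath x y (1 - s / 2) = y + s *\<^sub>R ((1/2) *\<^sub>R (x - y))" for s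
    by (simp_all add: linepath_def algebra_simps)
  have "(LINT t|lebesgue_on {0..1}. (f (linepath x y t))\<^sup>2) \<le>
     ((LINT s|lebesgue_on {0..1}. (f (linepath x y (s / 2)))\<^sup>2) + (LINT s|lebesgue_on {0..1}. (f (linepath x y (1 - s / 2)))\<^sup>2)) / 2"
    unfolding lp by (rule integral_halves_le, rule continuous_on_power, rule smooth_continuous_line[OF f]) simp
  then have "?D / 4 * (LINT t|lebesgue_on {0..1}. (f (linepath x y t))\<^sup>2) \<le> ?D / 4 *
     (((LINT s|lebesgue_on {0..1}. (f (linepath x y (s / 2)))\<^sup>2) + (LINT s|lebesgue_on {0..1}. (f (linepath x y (1 - s / 2)))\<^sup>2)) / 2)"
    by (rule mult_left_mono) simp
  also have "\<dots> \<le> (N 0 f)\<^sup>2 + 2 * h * N 0 f * N 1 f"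
    using 1 2 unfolding lp2[symmetric] by (simp add: distrib_left)
  also have "\<dots> \<le> 2 * ((N 0 f)\<^sup>2 + h * N 0 f * N 1 f)" by simp
  finally have "?D * (LINT t|lebesgue_on {0..1}. (f (linepath x y t))\<^sup>2) \<le> 8 * ((N 0 f)\<^sup>2 + h * N 0 f * N 1 f)"
    by simp
  moreover have "h\<^sup>2 / \<gamma>\<^sup>2 * (LINT t|lebesgue_on {0..1}. (f (linepath x y t))\<^sup>2) \<le> ?D * (LINT t|lebesgue_on {0..1}. (f (linepath x y t))\<^sup>2)"
    by (rule mult_right_mono[OF tri_det_ge]) (auto intro!: integral_nonneg_AE)
  ultimately have "h\<^sup>2 / \<gamma>\<^sup>2 * (LINT t|lebesgue_on {0..1}. (f (linepath x y t))\<^sup>2) \<le> 8 * ((N 0 f)\<^sup>2 + h * N 0 f * N 1 f)"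
    by linarith
  then show ?thesis using h_pos gamma_ge_1 unfolding x_def y_def by (simp add: field_simps)
qed

text \<open>Some \<open>\<lambda>\<^sub>i\<close> is at least \<open>1/3\<close> at the given point, so there is room for a parallelogram with a
  corner at this point whose sides are parallel to the edges at \<open>a\<^sub>i\<close> and have a sixth of their
  lengths.\<close>

lemma sup_bound:
  assumes f: "smooth f" and x: "x \<in> K"
  shows "\<bar>f x\<bar> \<le> 72 * \<gamma>\<^sup>2 / h * (N 0 f + h * N 1 f + h\<^sup>2 * N 2 f)"
proof -
  let ?D = "\<bar>tri_det a\<bar>"
  have D: "0 < ?D" using tri_det_nz[OF nd] by simp
  obtain i where i: "1/3 \<le> bary a i x"
  proof -
    have "\<exists>i. 1/3 \<le> bary a i x"
    proof (rule ccontr)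
      assume "\<not> ?thesis"
      then have "bary a i x < 1/3" for i by (simp add: not_le)
      from this[of 0] this[of "0 + 1"] this[of "0 + 2"] bary_sum3[OF nd, of 0 x] show False by linarith
    qed
    then show ?thesis using that by blast
  qed
  define p q where "p = (1/6) *\<^sub>R (a (i + 1) - a i)" and "q = (1/6) *\<^sub>R (a (i + 2) - a i)"
  have c: "\<bar>cross2 p q\<bar> = ?D / 36" using tri_det_eq[of a i] by (simp add: p_def q_def cross2_scale)
  have np: "norm p \<le> h / 6" "norm q \<le> h / 6"
    using dist_le_h[OF vertex_in_tri[OF nd] vertex_in_tri[OF nd]] by (simp_all add: p_def q_def dist_norm)
  have "\<bar>cross2 p q\<bar> * \<bar>f x\<bar> \<le> 2 * h * (N 0 f + 2 * (norm p + norm q) * N 1 f + 4 * norm p * norm q * N 2 f)"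
  proof (rule point_bound[OF f])
    fix s t :: real assume "0 \<le> s" "s \<le> 1" "0 \<le> t" "t \<le> 1"
    then show "x + s *\<^sub>R p + t *\<^sub>R q \<in> K"
      using corner_in_tri[OF x, of "s / 6" "t / 6" i] i by (simp add: p_def q_def)
  qed (use c D in auto)
  also have "\<dots> \<le> 2 * h * (N 0 f + h * N 1 f + h\<^sup>2 * N 2 f)"
  proof -
    have "2 * (norm p + norm q) * N 1 f \<le> h * N 1 f" using np h_pos by (intro mult_right_mono) auto
    moreover have "4 * norm p * norm q * N 2 f \<le> h\<^sup>2 * N 2 f"
    proof (rule mult_right_mono)
      have "norm p * norm q \<le> (h / 6) * (h / 6)" using np h_pos by (intro mult_mono) auto
      moreover have "4 * ((h / 6) * (h / 6)) \<le> h\<^sup>2" using zero_le_power2[of h] by (simp add: power2_eq_square)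
      ultimately show "4 * norm p * norm q \<le> h\<^sup>2" by simp
    qed simp
    ultimately show ?thesis using h_pos by (intro mult_left_mono) auto
  qed
  finally have "?D * \<bar>f x\<bar> \<le> 72 * h * (N 0 f + h * N 1 f + h\<^sup>2 * N 2 f)" unfolding c by simp
  moreover have "h\<^sup>2 / \<gamma>\<^sup>2 * \<bar>f x\<bar> \<le> ?D * \<bar>f x\<bar>" by (rule mult_right_mono[OF tri_det_ge]) simp
  ultimately have "h\<^sup>2 / \<gamma>\<^sup>2 * \<bar>f x\<bar> \<le> 72 * h * (N 0 f + h * N 1 f + h\<^sup>2 * N 2 f)" by linarith
  then have "h * (h * \<bar>f x\<bar>) \<le> h * (72 * \<gamma>\<^sup>2 * (N 0 f + h * N 1 f + h\<^sup>2 * N 2 f))"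
    using gamma_ge_1 by (simp add: divide_le_eq power2_eq_square mult_ac)
  then have "h * \<bar>f x\<bar> \<le> 72 * \<gamma>\<^sup>2 * (N 0 f + h * N 1 f + h\<^sup>2 * N 2 f)" using h_pos by (simp only: mult_le_cancel_left_pos)
  then show ?thesis using h_pos by (simp add: field_simps)
qed

section \<open>The Poincare inequality on the triangle\<close>

definition grad_sq :: "(real^2 \<Rightarrow> real) \<Rightarrow> real^2 \<Rightarrow> real" where
  "grad_sq f x = (\<Sum>c\<in>UNIV. (partial_deriv c f x)\<^sup>2)"

lemma grad_sq_props:
  assumes f: "smooth f"
  shows "smooth (grad_sq f)" "0 \<le> grad_sq f x" "(LINT x|lebesgue_on T. grad_sq f x) = (N 1 f)\<^sup>2"
    "integrable (lebesgue_on T) (grad_sq f)"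
proof -
  show "smooth (grad_sq f)" unfolding grad_sq_def power2_eq_square
    by (intro smooth_sum smooth_mult smooth_partial_deriv f)
  then show "integrable (lebesgue_on T) (grad_sq f)" by (intro L2_integrable T_props smooth_T_L2)
  show "0 \<le> grad_sq f x" by (simp add: grad_sq_def sum_nonneg)
  have i: "integrable (lebesgue_on T) (\<lambda>x. (partial_deriv c f x)\<^sup>2)" for c
    by (intro L2_spaceD(2) smooth_T_L2 smooth_partial_deriv f)
  have "(N 1 f)\<^sup>2 = (\<Sum>c\<in>UNIV. (L2_norm T (partial_deriv c f))\<^sup>2)"
    using N_Suc[OF f, of 0] by (simp add: N_0 smooth_partial_deriv f)
  then show "(LINT x|lebesgue_on T. grad_sq f x) = (N 1 f)\<^sup>2"
    unfolding grad_sq_def L2_norm_sq using i by simp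
qed

text \<open>The fundamental theorem of calculus on the segment, with the Cauchy--Schwarz inequality for
  the integral and for the sum over the directions.\<close>

lemma increment_sq_le:
  assumes f: "smooth f"
  shows "ennreal ((f y - f x)\<^sup>2) \<le> (\<integral>\<^sup>+t. ennreal ((dist x y)\<^sup>2 * grad_sq f (x + t *\<^sub>R (y - x))) * indicator {0..1} t \<partial>lborel)"
proof -
  let ?v = "y - x"
  let ?g = "\<lambda>t. dir_deriv ?v f (x + t *\<^sub>R ?v)"
  have gc: "continuous_on UNIV ?g" by (rule smooth_continuous_line[OF smooth_dir_deriv[OF f]])
  have [measurable]: "?g \<in> borel_measurable borel" by (rule borel_measurable_continuous_onI[OF gc])
  have "((\<lambda>t. f (x + t *\<^sub>R ?v)) has_real_derivative ?g t) (at t within {0..1})" for t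
    by (rule smooth_line_dir_deriv[OF f])
  then have "(?g has_integral f (x + 1 *\<^sub>R ?v) - f (x + 0 *\<^sub>R ?v)) {0..1}"
    by (intro fundamental_theorem_of_calculus) (auto simp: has_real_derivative_iff_has_vector_derivative)
  then have hi: "(?g has_integral f y - f x) {0..1}" by simp
  have ac: "continuous_on UNIV (\<lambda>t. \<bar>?g t\<bar>)" by (intro continuous_intros gc)
  have "\<bar>f y - f x\<bar> = norm (integral {0..1} ?g)" using hi by (simp add: integral_unique)
  also have "\<dots> \<le> integral {0..1} (\<lambda>t. \<bar>?g t\<bar>)"
  proof (rule integral_norm_bound_integral)
    show "?g integrable_on {0..1}" using hi by blast
    show "(\<lambda>t. \<bar>?g t\<bar>) integrable_on {0..1}"
      by (rule integrable_continuous_interval) (rule continuous_on_subset[OF ac], simp)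
  qed simp
  also have "\<dots> = (LINT t|lebesgue_on {0..1}. \<bar>?g t\<bar>)"
    by (rule lebesgue_integral_eq_integral[symmetric]) (use nn_integral_Icc(2)[OF ac] in auto)
  finally have "ennreal \<bar>f y - f x\<bar> \<le> (\<integral>\<^sup>+t. ennreal \<bar>?g t\<bar> * indicator {0..1} t \<partial>lborel)"
    using nn_integral_Icc(1)[OF ac] by (simp add: ennreal_leI)
  also have "\<dots> = (\<integral>\<^sup>+t. (ennreal \<bar>?g t\<bar> * indicator {0..1} t) * indicator {0..1} t \<partial>lborel)"
    by (intro nn_integral_cong) (auto simp: indicator_def)
  finally have "(ennreal \<bar>f y - f x\<bar>)\<^sup>2 \<le> (\<integral>\<^sup>+t. (ennreal \<bar>?g t\<bar> * indicator {0..1} t) * indicator {0..1} t \<partial>lborel)\<^sup>2"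
    by (rule power_mono_ennreal)
  also have "\<dots> \<le> (\<integral>\<^sup>+t. (ennreal \<bar>?g t\<bar> * indicator {0..1} t)\<^sup>2 \<partial>lborel) * (\<integral>\<^sup>+t. (indicator {0..1::real} t)\<^sup>2 \<partial>lborel)"
    by (rule Cauchy_Schwarz_nn_integral) measurable
  also have "(\<integral>\<^sup>+t. (indicator {0..1::real} t)\<^sup>2 \<partial>lborel) = (\<integral>\<^sup>+t. indicator {0..1::real} t \<partial>lborel)"
    by (intro nn_integral_cong) (auto simp: indicator_def)
  also have "\<dots> = 1" by simp
  also have "(\<integral>\<^sup>+t. (ennreal \<bar>?g t\<bar> * indicator {0..1} t)\<^sup>2 \<partial>lborel) * 1
    \<le> (\<integral>\<^sup>+t. ennreal ((dist x y)\<^sup>2 * grad_sq f (x + t *\<^sub>R (y - x))) * indicator {0..1} t \<partial>lborel)"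
    unfolding mult_1_right
  proof (rule nn_integral_mono)
    fix t
    have "(?g t)\<^sup>2 \<le> (\<Sum>c\<in>UNIV. (?v $ c)\<^sup>2) * grad_sq f (x + t *\<^sub>R ?v)"
      unfolding dir_deriv_def grad_sq_def by (rule Cauchy_Schwarz_ineq_sum)
    also have "(\<Sum>c\<in>UNIV. (?v $ c)\<^sup>2) = (dist x y)\<^sup>2"
      by (simp add: dist_norm norm_vec_def L2_set_def sum_nonneg power2_commute)
    finally have "ennreal ((?g t)\<^sup>2) \<le> ennreal ((dist x y)\<^sup>2 * grad_sq f (x + t *\<^sub>R ?v))" by (rule ennreal_leI)
    then show "(ennreal \<bar>?g t\<bar> * indicator {0..1} t)\<^sup>2 \<le> ennreal ((dist x y)\<^sup>2 * grad_sq f (x + t *\<^sub>R (y - x))) * indicator {0..1} t"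
      by (auto simp: indicator_def ennreal_power)
  qed
  finally show ?thesis by (simp add: ennreal_power)
qed

lemma nn_integral_T: 
  assumes "F \<in> borel_measurable borel"
  shows "(\<integral>\<^sup>+x. F x * indicator T x \<partial>lborel) = (\<integral>\<^sup>+x. F x \<partial>lebesgue_on T)"
proof -
  have [measurable]: "F \<in> borel_measurable borel" "T \<in> sets borel" using assms T_props(1) by auto
  have "(\<integral>\<^sup>+x. F x * indicator T x \<partial>lborel) = (\<integral>\<^sup>+x. F x * indicator T x \<partial>lebesgue)" by (simp add: nn_integral_completion)
  also have "\<dots> = (\<integral>\<^sup>+x. F x \<partial>lebesgue_on T)"
    using T_props(6) by (subst nn_integral_restrict_space) auto
  finally show ?thesis .
qed

text \<open>The contraction maps \<open>T\<close> into itself by convexity, and its Jacobian is \<open>(1 - t)\<^sup>2 \<ge> 1/4\<close>.\<close>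

lemma contraction_integral_le:
  assumes G [measurable]: "G \<in> borel_measurable borel" and t: "0 \<le> t" "t \<le> 1/2" and y: "y \<in> T"
  shows "(\<integral>\<^sup>+x. G ((1 - t) *\<^sub>R x + t *\<^sub>R y) * indicator T x \<partial>lborel) \<le> 4 * (\<integral>\<^sup>+x. G x * indicator T x \<partial>lborel)"
proof -
  have [measurable]: "T \<in> sets borel" using T_props(1) by auto
  let ?J = "\<integral>\<^sup>+x. G (t *\<^sub>R y + (1 - t) *\<^sub>R x) * indicator T (t *\<^sub>R y + (1 - t) *\<^sub>R x) \<partial>lborel"
  have "(\<integral>\<^sup>+x. G ((1 - t) *\<^sub>R x + t *\<^sub>R y) * indicator T x \<partial>lborel) \<le> ?J"
  proof (rule nn_integral_mono)
    fix x
    have "t *\<^sub>R y + (1 - t) *\<^sub>R x \<in> T" if "x \<in> T"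
      using that y t T_props(3) by (intro convexD) auto
    then show "G ((1 - t) *\<^sub>R x + t *\<^sub>R y) * indicator T x \<le> G (t *\<^sub>R y + (1 - t) *\<^sub>R x) * indicator T (t *\<^sub>R y + (1 - t) *\<^sub>R x)"
      by (cases "x \<in> T") (simp_all add: add.commute)
  qed
  also have "?J \<le> 4 * (ennreal (\<bar>1 - t\<bar> ^ CARD(2)) * ?J)"
  proof -
    have "1/4 \<le> (1 - t)\<^sup>2" using t power_mono[of "1/2" "1 - t" 2] by (simp add: power2_eq_square)
    then have "1 \<le> ennreal (4 * (1 - t)\<^sup>2)" by simp
    then have "1 * ?J \<le> ennreal (4 * (1 - t)\<^sup>2) * ?J" by (rule mult_right_mono) simp
    then show ?thesis by (simp add: ennreal_mult mult.assoc)
  qed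
  also have "ennreal (\<bar>1 - t\<bar> ^ CARD(2)) * ?J = (\<integral>\<^sup>+x. G x * indicator T x \<partial>lborel)"
    using nn_integral_lborel_affine[of "\<lambda>x. G x * indicator T x" "1 - t" "t *\<^sub>R y"] t by simp
  finally show ?thesis .
qed

text \<open>In the integral of \<open>\<bar>\<nabla>f\<bar>\<^sup>2\<close> at \<open>(1 - t) x + t y\<close> over \<open>x\<close>, \<open>y\<close> and \<open>t\<close>, one substitutes for
  \<open>x\<close> if \<open>t \<le> 1/2\<close> and for \<open>y\<close> otherwise, so that the Jacobian stays away from zero.\<close>

lemma double_increment_le:
  assumes f: "smooth f"
  shows "(\<integral>\<^sup>+x. (\<integral>\<^sup>+y. ennreal ((f y - f x)\<^sup>2) * indicator T y \<partial>lborel) * indicator T x \<partial>lborel)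
    \<le> ennreal (4 * h\<^sup>2 * measure lebesgue T * (N 1 f)\<^sup>2)"
proof -
  have Tb [measurable]: "T \<in> sets borel" using T_props(1) by auto
  define G where "G x = ennreal (grad_sq f x)" for x
  have [measurable]: "grad_sq f \<in> borel_measurable borel" by (rule smooth_borel[OF grad_sq_props(1)[OF f]])
  have Gm [measurable]: "G \<in> borel_measurable borel" unfolding G_def by measurable
  let ?I = "\<integral>\<^sup>+x. G x * indicator T x \<partial>lborel"
  let ?\<mu> = "ennreal (measure lebesgue T)"
  have I: "?I = ennreal ((N 1 f)\<^sup>2)"
    unfolding nn_integral_T[OF Gm] unfolding G_def
    using nn_integral_eq_integral[OF grad_sq_props(4)[OF f]] grad_sq_props(2,3)[OF f] by simp
  have mu: "(\<integral>\<^sup>+y. indicator T y \<partial>lborel) = ?\<mu>"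
  proof -
    have "(\<integral>\<^sup>+y. indicator T y \<partial>lborel) = emeasure lebesgue T" using Tb by simp
    also have "\<dots> = ?\<mu>" using T_props(5) by (simp add: emeasure_eq_measure2)
    finally show ?thesis .
  qed
  let ?R = "\<lambda>x y t. G (x + t *\<^sub>R (y - x)) * indicator T x * indicator T y * indicator {0..1} t"
  have J: "(\<integral>\<^sup>+x. \<integral>\<^sup>+y. ?R x y t \<partial>lborel \<partial>lborel) \<le> 4 * ?I * ?\<mu> * indicator {0..1} t" for t :: real
  proof (cases "t \<in> {0..1}")
    case True
    have e: "x + t *\<^sub>R (y - x) = (1 - t) *\<^sub>R x + t *\<^sub>R y" for x y :: "real^2" by (simp add: algebra_simps)
    show ?thesis
    proof (cases "t \<le> 1/2")
      case t: True
      have "(\<integral>\<^sup>+x. \<integral>\<^sup>+y. ?R x y t \<partial>lborel \<partial>lborel) = (\<integral>\<^sup>+y. \<integral>\<^sup>+x. ?R x y t \<partial>lborel \<partial>lborel)"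
        by (rule lborel_pair.Fubini') measurable
      also have "\<dots> = (\<integral>\<^sup>+y. (\<integral>\<^sup>+x. G ((1 - t) *\<^sub>R x + t *\<^sub>R y) * indicator T x \<partial>lborel) * indicator T y \<partial>lborel)"
        unfolding e using True by (intro nn_integral_cong) (subst nn_integral_multc[symmetric], auto)
      also have "\<dots> \<le> (\<integral>\<^sup>+y. 4 * ?I * indicator T y \<partial>lborel)"
        using contraction_integral_le[OF Gm, of t] True t by (intro nn_integral_mono) (auto simp: indicator_def)
      also have "\<dots> = 4 * ?I * ?\<mu>" by (subst nn_integral_cmult) (auto simp: mu)
      finally show ?thesis using True by simp
    next
      case t: False
      have e2: "(1 - t) *\<^sub>R x + t *\<^sub>R y = (1 - (1 - t)) *\<^sub>R y + (1 - t) *\<^sub>R x" for x y :: "real^2" by (simp add: add.commute)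
      have "(\<integral>\<^sup>+x. \<integral>\<^sup>+y. ?R x y t \<partial>lborel \<partial>lborel) = (\<integral>\<^sup>+x. (\<integral>\<^sup>+y. G ((1 - (1 - t)) *\<^sub>R y + (1 - t) *\<^sub>R x) * indicator T y \<partial>lborel) * indicator T x \<partial>lborel)"
        unfolding e e2 using True by (intro nn_integral_cong) (subst nn_integral_multc[symmetric], auto intro!: nn_integral_cong simp: mult_ac)
      also have "\<dots> \<le> (\<integral>\<^sup>+x. 4 * ?I * indicator T x \<partial>lborel)"
        using contraction_integral_le[OF Gm, of "1 - t"] True t by (intro nn_integral_mono) (auto simp: indicator_def)
      also have "\<dots> = 4 * ?I * ?\<mu>" by (subst nn_integral_cmult) (auto simp: mu)
      finally show ?thesis using True by simp
    qed
  qed simp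
  have "(\<integral>\<^sup>+x. (\<integral>\<^sup>+y. ennreal ((f y - f x)\<^sup>2) * indicator T y \<partial>lborel) * indicator T x \<partial>lborel)
    \<le> (\<integral>\<^sup>+x. (\<integral>\<^sup>+y. (\<integral>\<^sup>+t. ennreal (h\<^sup>2) * ?R x y t \<partial>lborel) \<partial>lborel) \<partial>lborel)"
  proof (rule nn_integral_mono)
    fix x
    have [measurable]: "f \<in> borel_measurable borel" by (rule smooth_borel[OF f])
    have "(\<integral>\<^sup>+y. ennreal ((f y - f x)\<^sup>2) * indicator T y \<partial>lborel) * indicator T x = (\<integral>\<^sup>+y. ennreal ((f y - f x)\<^sup>2) * indicator T y * indicator T x \<partial>lborel)"
      by (rule nn_integral_multc[symmetric]) measurable
    also have "\<dots> \<le> (\<integral>\<^sup>+y. (\<integral>\<^sup>+t. ennreal (h\<^sup>2) * ?R x y t \<partial>lborel) \<partial>lborel)"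
    proof (rule nn_integral_mono)
      fix y
      show "ennreal ((f y - f x)\<^sup>2) * indicator T y * indicator T x \<le> (\<integral>\<^sup>+t. ennreal (h\<^sup>2) * ?R x y t \<partial>lborel)"
      proof (cases "x \<in> T \<and> y \<in> T")
        case True
        then have d: "(dist x y)\<^sup>2 \<le> h\<^sup>2" using dist_le_h T_props(7) by (intro power_mono) auto
        have "ennreal ((f y - f x)\<^sup>2) \<le> (\<integral>\<^sup>+t. ennreal ((dist x y)\<^sup>2 * grad_sq f (x + t *\<^sub>R (y - x))) * indicator {0..1} t \<partial>lborel)"
          by (rule increment_sq_le[OF f])
        also have "\<dots> \<le> (\<integral>\<^sup>+t. ennreal (h\<^sup>2) * ?R x y t \<partial>lborel)"
        proof (rule nn_integral_mono)
          fix t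
          have "ennreal ((dist x y)\<^sup>2 * grad_sq f (x + t *\<^sub>R (y - x))) \<le> ennreal (h\<^sup>2 * grad_sq f (x + t *\<^sub>R (y - x)))"
            by (intro ennreal_leI mult_right_mono d grad_sq_props(2) f)
          also have "\<dots> = ennreal (h\<^sup>2) * G (x + t *\<^sub>R (y - x))"
            unfolding G_def by (rule ennreal_mult) (simp_all add: grad_sq_props(2) f)
          finally show "ennreal ((dist x y)\<^sup>2 * grad_sq f (x + t *\<^sub>R (y - x))) * indicator {0..1} t \<le> ennreal (h\<^sup>2) * ?R x y t"
            using True by (auto simp: indicator_def)
        qed
        finally show ?thesis using True by simp
      qed auto
    qed
    finally show "(\<integral>\<^sup>+y. ennreal ((f y - f x)\<^sup>2) * indicator T y \<partial>lborel) * indicator T x \<le> (\<integral>\<^sup>+y. (\<integral>\<^sup>+t. ennreal (h\<^sup>2) * ?R x y t \<partial>lborel) \<partial>lborel)" .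
  qed
  also have "\<dots> = (\<integral>\<^sup>+x. (\<integral>\<^sup>+t. (\<integral>\<^sup>+y. ennreal (h\<^sup>2) * ?R x y t \<partial>lborel) \<partial>lborel) \<partial>lborel)"
    by (intro nn_integral_cong lborel_pair.Fubini') measurable
  also have "\<dots> = (\<integral>\<^sup>+t. (\<integral>\<^sup>+x. (\<integral>\<^sup>+y. ennreal (h\<^sup>2) * ?R x y t \<partial>lborel) \<partial>lborel) \<partial>lborel)"
    by (rule lborel_pair.Fubini') measurable
  also have "\<dots> = (\<integral>\<^sup>+t. ennreal (h\<^sup>2) * (\<integral>\<^sup>+x. (\<integral>\<^sup>+y. ?R x y t \<partial>lborel) \<partial>lborel) \<partial>lborel)"
    by (intro nn_integral_cong) (simp add: nn_integral_cmult)
  also have "\<dots> \<le> (\<integral>\<^sup>+t. ennreal (h\<^sup>2) * (4 * ?I * ?\<mu> * indicator {0..1::real} t) \<partial>lborel)"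
    by (intro nn_integral_mono mult_left_mono J) simp
  also have "\<dots> = ennreal (h\<^sup>2) * (4 * ?I * ?\<mu>)"
    by (simp add: nn_integral_cmult mult.assoc)
  also have "\<dots> = ennreal (4 * h\<^sup>2 * measure lebesgue T * (N 1 f)\<^sup>2)"
    unfolding I by (simp add: ennreal_mult mult_ac)
  finally show ?thesis .
qed

text \<open>If \<open>f\<close> has mean zero, then the double integral of \<open>(f y - f x)\<^sup>2\<close> is \<open>2 \<bar>T\<bar> \<parallel>f\<parallel>\<^sup>2\<close>.\<close>

lemma Poincare:
  assumes f: "smooth f" and z: "(LINT x|lebesgue_on T. f x) = 0"
  shows "N 0 f \<le> 2 * h * N 1 f"
proof -
  let ?m = "measure lebesgue T"
  have [measurable]: "f \<in> borel_measurable borel" by (rule smooth_borel[OF f])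
  interpret finite_measure "lebesgue_on T"
    using T_props(5) by (simp add: finite_measure_lebesgue_on)
  have fi: "integrable (lebesgue_on T) f" by (rule L2_integrable[OF T_props(5) smooth_T_L2[OF f]])
  have f2: "integrable (lebesgue_on T) (\<lambda>x. (f x)\<^sup>2)" by (rule L2_spaceD(2)[OF smooth_T_L2[OF f]])
  have ms: "measure (lebesgue_on T) T = ?m"
    using T_props(6) by (simp add: measure_restrict_space)
  have in1: "(\<integral>\<^sup>+y. ennreal ((f y - f x)\<^sup>2) * indicator T y \<partial>lborel) = ennreal ((N 0 f)\<^sup>2 + ?m * (f x)\<^sup>2)" for x
  proof -
    have eq: "(f y - f x)\<^sup>2 = (f y)\<^sup>2 - 2 * f x * f y + (f x)\<^sup>2" for y by (simp add: power2_diff mult_ac)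
    have i: "integrable (lebesgue_on T) (\<lambda>y. (f y - f x)\<^sup>2)" unfolding eq using fi f2 by simp
    have "(\<integral>\<^sup>+y. ennreal ((f y - f x)\<^sup>2) * indicator T y \<partial>lborel) = (\<integral>\<^sup>+y. ennreal ((f y - f x)\<^sup>2) \<partial>lebesgue_on T)"
      by (rule nn_integral_T) measurable
    also have "\<dots> = ennreal (LINT y|lebesgue_on T. (f y - f x)\<^sup>2)" by (rule nn_integral_eq_integral[OF i]) simp
    also have "(LINT y|lebesgue_on T. (f y - f x)\<^sup>2) = (N 0 f)\<^sup>2 + ?m * (f x)\<^sup>2"
      unfolding eq using fi f2 z by (simp add: N_0 f L2_norm_sq ms)
    finally show ?thesis .
  qed
  have "(\<integral>\<^sup>+x. (\<integral>\<^sup>+y. ennreal ((f y - f x)\<^sup>2) * indicator T y \<partial>lborel) * indicator T x \<partial>lborel) = ennreal (2 * ?m * (N 0 f)\<^sup>2)"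
  proof -
    have "(\<integral>\<^sup>+x. ennreal ((N 0 f)\<^sup>2 + ?m * (f x)\<^sup>2) * indicator T x \<partial>lborel) = (\<integral>\<^sup>+x. ennreal ((N 0 f)\<^sup>2 + ?m * (f x)\<^sup>2) \<partial>lebesgue_on T)"
      by (rule nn_integral_T) measurable
    also have "\<dots> = ennreal (LINT x|lebesgue_on T. (N 0 f)\<^sup>2 + ?m * (f x)\<^sup>2)"
      by (rule nn_integral_eq_integral) (use f2 in auto)
    also have "(LINT x|lebesgue_on T. (N 0 f)\<^sup>2 + ?m * (f x)\<^sup>2) = 2 * ?m * (N 0 f)\<^sup>2"
      using f2 by (simp add: N_0 f L2_norm_sq ms)
    finally show ?thesis unfolding in1 .
  qed
  then have "ennreal (2 * ?m * (N 0 f)\<^sup>2) \<le> ennreal (4 * h\<^sup>2 * ?m * (N 1 f)\<^sup>2)" using double_increment_le[OF f] by simp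
  then have "2 * ?m * (N 0 f)\<^sup>2 \<le> 4 * h\<^sup>2 * ?m * (N 1 f)\<^sup>2" by simp
  then have "?m * (2 * (N 0 f)\<^sup>2) \<le> ?m * (4 * h\<^sup>2 * (N 1 f)\<^sup>2)" by (simp add: mult_ac)
  then have "2 * (N 0 f)\<^sup>2 \<le> 4 * h\<^sup>2 * (N 1 f)\<^sup>2" using measure_T_pos by (simp only: mult_le_cancel_left_pos)
  moreover have "0 \<le> h\<^sup>2 * (N 1 f)\<^sup>2" "(2 * h * N 1 f)\<^sup>2 = 4 * h\<^sup>2 * (N 1 f)\<^sup>2" by (simp_all add: power_mult_distrib)
  ultimately have "(N 0 f)\<^sup>2 \<le> (2 * h * N 1 f)\<^sup>2" by linarith
  then show ?thesis by (rule power2_le_imp_le) (use h_pos in simp)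
qed

lemma Poincare_grad:
  assumes f: "smooth f" and z: "\<And>i. (LINT x|lebesgue_on T. partial_deriv i f x) = 0"
  shows "N 1 f \<le> 2 * h * N 2 f"
proof (rule power2_le_imp_le)
  have "(N 1 f)\<^sup>2 = (\<Sum>i\<in>UNIV. (N 0 (partial_deriv i f))\<^sup>2)" using N_Suc[OF f, of 0] by simp
  also have "\<dots> \<le> (\<Sum>i\<in>UNIV. (2 * h * N 1 (partial_deriv i f))\<^sup>2)"
    by (intro sum_mono power_mono Poincare smooth_partial_deriv f z) simp
  also have "\<dots> = (2 * h)\<^sup>2 * (\<Sum>i\<in>UNIV. (N 1 (partial_deriv i f))\<^sup>2)"
    by (simp only: power_mult_distrib[of "2 * h"] sum_distrib_left)
  also have "\<dots> = (2 * h * N 2 f)\<^sup>2"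
    using N_Suc[OF f, of 1] by (simp add: power_mult_distrib flip: numeral_2_eq_2)
  finally show "(N 1 f)\<^sup>2 \<le> (2 * h * N 2 f)\<^sup>2" .
qed (use h_pos in simp)

lemma Poincare_hessian:
  assumes f: "smooth f" and z: "\<And>i j. (LINT x|lebesgue_on T. partial_deriv i (partial_deriv j f) x) = 0"
  shows "N 2 f \<le> 2 * h * N 3 f"
proof (rule power2_le_imp_le)
  have "(N 2 f)\<^sup>2 = (\<Sum>i\<in>UNIV. (N 1 (partial_deriv i f))\<^sup>2)" using N_Suc[OF f, of 1] by (simp add: numeral_2_eq_2)
  also have "\<dots> \<le> (\<Sum>i\<in>UNIV. (2 * h * N 2 (partial_deriv i f))\<^sup>2)"
    by (intro sum_mono power_mono Poincare_grad smooth_partial_deriv f z) simp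
  also have "\<dots> = (2 * h)\<^sup>2 * (\<Sum>i\<in>UNIV. (N 2 (partial_deriv i f))\<^sup>2)"
    by (simp only: power_mult_distrib[of "2 * h"] sum_distrib_left)
  also have "\<dots> = (2 * h * N 3 f)\<^sup>2"
    using N_Suc[OF f, of 2] by (simp add: power_mult_distrib)
  finally show "(N 2 f)\<^sup>2 \<le> (2 * h * N 3 f)\<^sup>2" .
qed (use h_pos in simp)

end

section \<open>Unisolvence and an explicit interpolant\<close>

lemma poly_space_1_iff: "q \<in> poly_space 1 \<longleftrightarrow> (\<exists>c0 c1 c2. q = (\<lambda>x. c0 + c1 * x $ 1 + c2 * x $ 2))"
proof
  assume "q \<in> poly_space 1"
  then obtain c where q: "q = (\<lambda>x. \<Sum>i\<le>1. \<Sum>j\<le>1 - i. c i j * (x $ 1) ^ i * (x $ 2) ^ j)"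
    unfolding poly_space_def by blast
  have "q = (\<lambda>x. c 0 0 + c 1 0 * x $ 1 + c 0 1 * x $ 2)"
    unfolding q by (simp add: atMost_Suc algebra_simps)
  then show "\<exists>c0 c1 c2. q = (\<lambda>x. c0 + c1 * x $ 1 + c2 * x $ 2)" by blast
next
  assume "\<exists>c0 c1 c2. q = (\<lambda>x. c0 + c1 * x $ 1 + c2 * x $ 2)"
  then obtain c0 c1 c2 where q: "q = (\<lambda>x. c0 + c1 * x $ 1 + c2 * x $ 2)" by blast
  define c :: "nat \<Rightarrow> nat \<Rightarrow> real" where "c i j = (if i = 0 then (if j = 0 then c0 else c2) else c1)" for i j
  have "q = (\<lambda>x. \<Sum>i\<le>1. \<Sum>j\<le>1 - i. c i j * (x $ 1) ^ i * (x $ 2) ^ j)"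
    unfolding q by (simp add: atMost_Suc algebra_simps c_def)
  then show "q \<in> poly_space 1" unfolding poly_space_def by blast
qed

lemma poly_space_2_iff: "q \<in> poly_space 2 \<longleftrightarrow>
  (\<exists>c0 c1 c2 c3 c4 c5. q = (\<lambda>x. c0 + c1 * x $ 1 + c2 * x $ 2 + c3 * (x $ 1 * x $ 1) + c4 * (x $ 1 * x $ 2) + c5 * (x $ 2 * x $ 2)))"
proof
  assume "q \<in> poly_space 2"
  then obtain c where q: "q = (\<lambda>x. \<Sum>i\<le>2. \<Sum>j\<le>2 - i. c i j * (x $ 1) ^ i * (x $ 2) ^ j)"
    unfolding poly_space_def by blast
  have "q = (\<lambda>x. c 0 0 + c 1 0 * x $ 1 + c 0 1 * x $ 2 + c 2 0 * (x $ 1 * x $ 1) + c 1 1 * (x $ 1 * x $ 2) + c 0 2 * (x $ 2 * x $ 2))"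
    unfolding q by (simp add: numeral_2_eq_2 atMost_Suc algebra_simps)
  then show "\<exists>c0 c1 c2 c3 c4 c5. q = (\<lambda>x. c0 + c1 * x $ 1 + c2 * x $ 2 + c3 * (x $ 1 * x $ 1) + c4 * (x $ 1 * x $ 2) + c5 * (x $ 2 * x $ 2))"
    by blast
next
  assume "\<exists>c0 c1 c2 c3 c4 c5. q = (\<lambda>x. c0 + c1 * x $ 1 + c2 * x $ 2 + c3 * (x $ 1 * x $ 1) + c4 * (x $ 1 * x $ 2) + c5 * (x $ 2 * x $ 2))"
  then obtain c0 c1 c2 c3 c4 c5 where
    q: "q = (\<lambda>x. c0 + c1 * x $ 1 + c2 * x $ 2 + c3 * (x $ 1 * x $ 1) + c4 * (x $ 1 * x $ 2) + c5 * (x $ 2 * x $ 2))" by blast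
  define c :: "nat \<Rightarrow> nat \<Rightarrow> real" where "c i j = (if i = 0 then (if j = 0 then c0 else if j = 1 then c2 else c5)
    else if i = 1 then (if j = 0 then c1 else c4) else c3)" for i j
  have "q = (\<lambda>x. \<Sum>i\<le>2. \<Sum>j\<le>2 - i. c i j * (x $ 1) ^ i * (x $ 2) ^ j)"
    unfolding q by (simp add: numeral_2_eq_2 atMost_Suc algebra_simps c_def)
  then show "q \<in> poly_space 2" unfolding poly_space_def by blast
qed

lemma poly_space_2_add: "p \<in> poly_space 2 \<Longrightarrow> q \<in> poly_space 2 \<Longrightarrow> (\<lambda>x. p x + q x) \<in> poly_space 2"
proof -
  assume "p \<in> poly_space 2" "q \<in> poly_space 2"
  then obtain c0 c1 c2 c3 c4 c5 d0 d1 d2 d3 d4 d5 where pq: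
    "p = (\<lambda>x. c0 + c1 * x $ 1 + c2 * x $ 2 + c3 * (x $ 1 * x $ 1) + c4 * (x $ 1 * x $ 2) + c5 * (x $ 2 * x $ 2))"
    "q = (\<lambda>x. d0 + d1 * x $ 1 + d2 * x $ 2 + d3 * (x $ 1 * x $ 1) + d4 * (x $ 1 * x $ 2) + d5 * (x $ 2 * x $ 2))"
    unfolding poly_space_2_iff by (elim exE) (rule that)
  show ?thesis unfolding pq poly_space_2_iff
    by (rule exI[of _ "c0 + d0"], rule exI[of _ "c1 + d1"], rule exI[of _ "c2 + d2"], rule exI[of _ "c3 + d3"], rule exI[of _ "c4 + d4"], rule exI[of _ "c5 + d5"])
       (simp add: algebra_simps)
qed

lemma poly_space_2_mult: "p \<in> poly_space 1 \<Longrightarrow> q \<in> poly_space 1 \<Longrightarrow> (\<lambda>x. p x * q x) \<in> poly_space 2"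
proof -
  assume "p \<in> poly_space 1" "q \<in> poly_space 1"
  then obtain c0 c1 c2 d0 d1 d2 where pq:
    "p = (\<lambda>x. c0 + c1 * x $ 1 + c2 * x $ 2)" "q = (\<lambda>x. d0 + d1 * x $ 1 + d2 * x $ 2)"
    unfolding poly_space_1_iff by (elim exE) (rule that)
  show ?thesis unfolding pq poly_space_2_iff
    by (rule exI[of _ "c0 * d0"], rule exI[of _ "c1 * d0 + c0 * d1"], rule exI[of _ "c2 * d0 + c0 * d2"], rule exI[of _ "c1 * d1"], rule exI[of _ "c1 * d2 + c2 * d1"], rule exI[of _ "c2 * d2"])
       (simp add: algebra_simps)
qed

lemma poly_space_1_add: "p \<in> poly_space 1 \<Longrightarrow> q \<in> poly_space 1 \<Longrightarrow> (\<lambda>x. p x + q x) \<in> poly_space 1"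
proof -
  assume "p \<in> poly_space 1" "q \<in> poly_space 1"
  then obtain c0 c1 c2 d0 d1 d2 where pq:
    "p = (\<lambda>x. c0 + c1 * x $ 1 + c2 * x $ 2)" "q = (\<lambda>x. d0 + d1 * x $ 1 + d2 * x $ 2)"
    unfolding poly_space_1_iff by (elim exE) (rule that)
  show ?thesis unfolding pq poly_space_1_iff
    by (rule exI[of _ "c0 + d0"], rule exI[of _ "c1 + d1"], rule exI[of _ "c2 + d2"]) (simp add: algebra_simps)
qed

lemma poly_space_1_const: "(\<lambda>x. c) \<in> poly_space 1"
  unfolding poly_space_1_iff by (rule exI[of _ c], rule exI[of _ 0], rule exI[of _ 0]) simp

lemma poly_space_1_cmult: "p \<in> poly_space 1 \<Longrightarrow> (\<lambda>x. c * p x) \<in> poly_space 1"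
proof -
  assume "p \<in> poly_space 1"
  then obtain c0 c1 c2 where pq: "p = (\<lambda>x. c0 + c1 * x $ 1 + c2 * x $ 2)" unfolding poly_space_1_iff by (elim exE) (rule that)
  show ?thesis unfolding pq poly_space_1_iff
    by (rule exI[of _ "c * c0"], rule exI[of _ "c * c1"], rule exI[of _ "c * c2"]) (simp add: algebra_simps)
qed

lemma poly_space_smooth: "q \<in> poly_space 1 \<Longrightarrow> smooth q" "q \<in> poly_space 2 \<Longrightarrow> smooth q"
  unfolding poly_space_1_iff poly_space_2_iff
  by (elim exE, simp only:, intro smooth_add smooth_cmult smooth_mult smooth_nth smooth_const)+

lemma bary_poly: "bary a i \<in> poly_space 1"
  unfolding poly_space_1_iff
  by (rule exI[of _ "cross2 (a (i + 1)) (a (i + 2)) / tri_det a"], rule exI[of _ "bary_grad a i $ 1"], rule exI[of _ "bary_grad a i $ 2"])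
     (simp add: fun_eq_iff bary_affine inner_real2)

lemma smooth_bary: "smooth (bary a i)"
  by (rule poly_space_smooth(1)[OF bary_poly])

lemma partial_deriv_bary: "partial_deriv c (bary a i) = (\<lambda>x. bary_grad a i $ c)"
  unfolding bary_affine[abs_def] by (rule partial_deriv_inner)

lemma dir_deriv_add: "smooth f \<Longrightarrow> smooth g \<Longrightarrow> dir_deriv p (\<lambda>x. f x + g x) = (\<lambda>x. dir_deriv p f x + dir_deriv p g x)"
  by (simp add: fun_eq_iff dir_deriv_def partial_deriv_add smooth_differentiable distrib_left sum.distrib)

lemma dir_deriv_cmult: "smooth f \<Longrightarrow> dir_deriv p (\<lambda>x. c * f x) = (\<lambda>x. c * dir_deriv p f x)"
  by (simp add: fun_eq_iff dir_deriv_def partial_deriv_cmult sum_distrib_left mult_ac)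

lemma dir_deriv_mult:
  "smooth f \<Longrightarrow> smooth g \<Longrightarrow> dir_deriv p (\<lambda>x. f x * g x) = (\<lambda>x. dir_deriv p f x * g x + f x * dir_deriv p g x)"
  by (simp add: fun_eq_iff dir_deriv_def partial_deriv_mult smooth_differentiable distrib_left sum.distrib sum_distrib_left sum_distrib_right mult_ac)

lemma dir_deriv_const: "dir_deriv p (\<lambda>x. c) = (\<lambda>x. 0)"
  by (simp add: fun_eq_iff dir_deriv_def partial_deriv_const)

lemma dir_deriv_bary: "dir_deriv p (bary a i) = (\<lambda>x. p \<bullet> bary_grad a i)"
  by (simp add: fun_eq_iff dir_deriv_def partial_deriv_bary inner_vec_def)

lemma normal_deriv_eq: "smooth p \<Longrightarrow> normal_deriv a i p = dir_deriv (edge_normal a i) p"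
  by (rule ext) (simp add: normal_deriv_def dir_deriv_def frechet_derivative_at[OF smooth_has_derivative, symmetric])

lemma continuous_linepath_integrable:
  assumes "smooth f"
  shows "integrable (lebesgue_on {0..1}) (\<lambda>t. f (linepath x y t))"
proof -
  have "continuous_on UNIV (\<lambda>t. f (linepath x y t))"
    by (rule continuous_on_compose2[OF smooth_continuous[OF assms]])
       (auto simp: linepath_def intro!: continuous_intros)
  then have "(\<lambda>t. f (linepath x y t)) absolutely_integrable_on {0..1}"
    by (intro absolutely_integrable_continuous_real) (rule continuous_on_subset, auto)
  then show ?thesis by (simp add: absolutely_integrable_imp_integrable)
qed

definition flux :: "triangle \<Rightarrow> 3 \<Rightarrow> (real^2 \<Rightarrow> real) \<Rightarrow> real" where
  "flux a i p = edge_integral a i (normal_deriv a i p)"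

definition quad_lagrange :: "triangle \<Rightarrow> (3 \<Rightarrow> real) \<Rightarrow> (3 \<Rightarrow> real) \<Rightarrow> real^2 \<Rightarrow> real" where
  "quad_lagrange a A B x = (\<Sum>i\<in>UNIV. A i * (bary a i x * (2 * bary a i x + (-1)))) +
     (\<Sum>i\<in>UNIV. B i * (4 * (bary a (i + 1) x * bary a (i + 2) x)))"

text \<open>The midpoint value of the affine factor of the bubble for which the flux through the edge
  becomes \<open>D i\<close>. On this edge the normal derivative of the bubble is \<open>- \<bar>\<nabla>\<lambda>\<^sub>i\<bar>\<close> times the product of
  the other two barycentric coordinates, whose mean value is \<open>1/6\<close>.\<close>

definition flux_coeff :: "triangle \<Rightarrow> (3 \<Rightarrow> real) \<Rightarrow> (3 \<Rightarrow> real) \<Rightarrow> (3 \<Rightarrow> real) \<Rightarrow> 3 \<Rightarrow> real" where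
  "flux_coeff a A B D i =
     - 6 * (D i - flux a i (quad_lagrange a A B)) / (dist (a (i + 1)) (a (i + 2)) * norm (bary_grad a i))"

text \<open>The affine function with the value \<open>R i\<close> at the midpoint of the \<open>i\<close>th edge.\<close>

definition midpoint_affine :: "triangle \<Rightarrow> (3 \<Rightarrow> real) \<Rightarrow> real^2 \<Rightarrow> real" where
  "midpoint_affine a R x = (\<Sum>i\<in>UNIV. R i * (1 + (-2) * bary a i x))"

definition bubble3 :: "triangle \<Rightarrow> real^2 \<Rightarrow> real" where
  "bubble3 a x = bary a 0 x * bary a 1 x * bary a 2 x"

text \<open>The bubble vanishes at the vertices and the midpoints, so the quadratic part is determined by
  the point values alone and the bubble part corrects the fluxes.\<close>

definition ntw_fun :: "triangle \<Rightarrow> (3 \<Rightarrow> real) \<Rightarrow> (3 \<Rightarrow> real) \<Rightarrow> (3 \<Rightarrow> real) \<Rightarrow> real^2 \<Rightarrow> real" where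
  "ntw_fun a A B D x = quad_lagrange a A B x + bubble3 a x * midpoint_affine a (flux_coeff a A B D) x"

lemma smooth_quad_lagrange: "smooth (quad_lagrange a A B)"
  unfolding quad_lagrange_def by (intro smooth_add smooth_sum smooth_cmult smooth_mult smooth_const smooth_bary)

lemma smooth_midpoint_affine: "smooth (midpoint_affine a R)"
  unfolding midpoint_affine_def by (intro smooth_add smooth_sum smooth_cmult smooth_mult smooth_const smooth_bary)

lemma smooth_bubble3: "smooth (bubble3 a)"
  unfolding bubble3_def by (intro smooth_mult smooth_bary)

lemma smooth_ntw_fun: "smooth (ntw_fun a A B D)"
  unfolding ntw_fun_def by (intro smooth_add smooth_mult smooth_quad_lagrange smooth_midpoint_affine smooth_bubble3)

lemma bubble3_rotate: "bubble3 a x = bary a i x * (bary a (i + 1) x * bary a (i + 2) x)"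
  using prod_type3[of "\<lambda>i. bary a i x" i] prod_type3[of "\<lambda>i. bary a i x" 0]
  by (simp add: bubble3_def mult_ac)

lemma flux_add: "smooth f \<Longrightarrow> smooth g \<Longrightarrow> flux a i (\<lambda>x. f x + g x) = flux a i f + flux a i g"
  unfolding flux_def edge_integral_def segment_integral_def
  by (simp add: normal_deriv_eq smooth_add dir_deriv_add continuous_linepath_integrable smooth_dir_deriv distrib_left)

lemma flux_cmult: "smooth f \<Longrightarrow> flux a i (\<lambda>x. c * f x) = c * flux a i f"
  unfolding flux_def edge_integral_def segment_integral_def
  by (simp add: normal_deriv_eq smooth_cmult dir_deriv_cmult)

lemma flux_diff: "smooth f \<Longrightarrow> smooth g \<Longrightarrow> flux a i (\<lambda>x. f x - g x) = flux a i f - flux a i g"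
  using flux_add[of f "\<lambda>x. (-1) * g x" a i] flux_cmult[of g a i "-1"] smooth_cmult[of g "-1"] by simp

lemma midpoint_affine_diff: "midpoint_affine a (\<lambda>i. R i - R' i) x = midpoint_affine a R x - midpoint_affine a R' x"
  by (simp add: midpoint_affine_def left_diff_distrib sum_subtractf)

lemma flux_const: "flux a i (\<lambda>x. c) = 0"
  unfolding flux_def edge_integral_def segment_integral_def
  by (simp add: normal_deriv_eq smooth_const dir_deriv_const)

text \<open>The weight \<open>t (1 - t)\<close> is symmetric about the midpoint, so that the linear part of the factor
  integrates to zero: the flux of a bubble function sees only the midpoint value of its affine
  factor. This decouples the three edges.\<close>

lemma integral_bubble_edge:
  fixes r0 r1 :: real
  shows "(LINT t|lebesgue_on {0..1}. (1 - t) * t * (r0 + r1 * (2 * t - 1))) = r0 / 6"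
proof -
  let ?F = "\<lambda>t::real. r0 * (t^2 / 2 - t^3 / 3) + r1 * (t^3 - t^4 / 2 - t^2 / 2)"
  have "(?F has_real_derivative (1 - t) * t * (r0 + r1 * (2 * t - 1))) (at t within {0..1})" for t
    by (auto intro!: derivative_eq_intros simp: algebra_simps power2_eq_square power3_eq_cube)
  then have "((\<lambda>t. (1 - t) * t * (r0 + r1 * (2 * t - 1))) has_integral ?F 1 - ?F 0) {0..1}"
    by (intro fundamental_theorem_of_calculus) (auto simp: has_real_derivative_iff_has_vector_derivative)
  then have "integral {0..1} (\<lambda>t. (1 - t) * t * (r0 + r1 * (2 * t - 1))) = r0 / 6"
    by (simp add: integral_unique)
  moreover have "(\<lambda>t. (1 - t) * t * (r0 + r1 * (2 * t - 1))) absolutely_integrable_on {0..1}"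
    by (intro absolutely_integrable_continuous_real continuous_intros)
  then have "integrable (lebesgue_on {0..1}) (\<lambda>t. (1 - t) * t * (r0 + r1 * (2 * t - 1)))"
    by (simp add: absolutely_integrable_imp_integrable)
  ultimately show ?thesis by (simp add: lebesgue_integral_eq_integral)
qed

context
  fixes a :: triangle
  assumes nd: "nondegenerate a"
begin

lemma bary_linepath: "bary a j (linepath x y t) = (1 - t) * bary a j x + t * bary a j y"
proof -
  have "bary a j (linepath x y t) - bary a j x = t * (bary_grad a j \<bullet> (y - x))"
    unfolding bary_diff by (simp add: linepath_def algebra_simps)
  then show ?thesis unfolding bary_diff[symmetric] by (simp add: algebra_simps)
qed

lemma edge_midpoint_linepath: "edge_midpoint a i = linepath (a (i + 1)) (a (i + 2)) (1/2)"
  by (simp add: edge_midpoint_def midpoint_def linepath_def algebra_simps)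

lemma bary_midpoint: "bary a j (edge_midpoint a i) = (if j = i then 0 else 1/2)"
  unfolding edge_midpoint_linepath bary_linepath bary_vertex[OF nd]
  by (cases rule: type3_cases[of j i]) auto

lemma quad_lagrange_vertex: "quad_lagrange a A B (a i) = A i"
  unfolding quad_lagrange_def sum_type3[of _ i] by (simp add: bary_vertex[OF nd])

lemma quad_lagrange_midpoint: "quad_lagrange a A B (edge_midpoint a i) = B i"
  unfolding quad_lagrange_def sum_type3[of _ i] by (simp add: bary_midpoint)

lemma bubble3_vertex: "bubble3 a (a i) = 0"
  unfolding bubble3_rotate[of a _ i] by (simp add: bary_vertex[OF nd])

lemma bubble3_midpoint: "bubble3 a (edge_midpoint a i) = 0"
  unfolding bubble3_rotate[of a _ i] by (simp add: bary_midpoint)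

lemma affine_bary:
  assumes "f \<in> poly_space 1"
  shows "f x = f (a i) * bary a i x + f (a (i + 1)) * bary a (i + 1) x + f (a (i + 2)) * bary a (i + 2) x"
proof -
  obtain c0 c1 c2 where f: "f = (\<lambda>x. c0 + c1 * x $ 1 + c2 * x $ 2)" using assms unfolding poly_space_1_iff by blast
  have x: "x $ k = a i $ k * bary a i x + a (i + 1) $ k * bary a (i + 1) x + a (i + 2) $ k * bary a (i + 2) x" for k
    using arg_cong[OF bary_expansion[OF nd, of x], of "\<lambda>y. y $ k"]
    unfolding sum_type3[of _ i] by (simp add: mult.commute)
  have s: "c0 = c0 * (bary a i x + bary a (i + 1) x + bary a (i + 2) x)" using bary_sum3[OF nd, of i x] by simp
  show ?thesis unfolding f by (subst x[of 1], subst x[of 2], subst s) (simp add: algebra_simps)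
qed

lemma affine_midpoint:
  assumes "f \<in> poly_space 1"
  shows "f (edge_midpoint a i) = (f (a (i + 1)) + f (a (i + 2))) / 2"
  using affine_bary[OF assms, of "edge_midpoint a i" i] by (simp add: bary_midpoint)

text \<open>Products of affine functions span the quadratic polynomials, and for them the identity is
  polynomial in the barycentric coordinates.\<close>

lemma quad_lagrange_product:
  assumes f: "f \<in> poly_space 1" and g: "g \<in> poly_space 1"
  shows "quad_lagrange a (\<lambda>i. f (a i) * g (a i)) (\<lambda>i. f (edge_midpoint a i) * g (edge_midpoint a i)) x = f x * g x"
proof -
  have l2: "bary a (0 + 2) x = 1 - bary a 0 x - bary a (0 + 1) x" using bary_sum3[OF nd, of 0 x] by linarith
  show ?thesis
    unfolding quad_lagrange_def sum_type3[of _ 0] type3_add affine_midpoint[OF f] affine_midpoint[OF g]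
      affine_bary[OF f, of x 0] affine_bary[OF g, of x 0] l2
    by (simp add: field_simps)
qed

lemma quad_lagrange_add: "quad_lagrange a (\<lambda>i. A i + A' i) (\<lambda>i. B i + B' i) x = quad_lagrange a A B x + quad_lagrange a A' B' x"
  unfolding quad_lagrange_def by (simp add: distrib_right sum.distrib)

lemma quad_lagrange_cmult: "quad_lagrange a (\<lambda>i. c * A i) (\<lambda>i. c * B i) x = c * quad_lagrange a A B x"
  unfolding quad_lagrange_def by (simp add: distrib_left sum_distrib_left mult.assoc)

lemma quad_lagrange_poly:
  assumes "q \<in> poly_space 2"
  shows "quad_lagrange a (\<lambda>i. q (a i)) (\<lambda>i. q (edge_midpoint a i)) = q"
proof
  fix x
  obtain c0 c1 c2 c3 c4 c5 where
    q: "q = (\<lambda>x. c0 + c1 * x $ 1 + c2 * x $ 2 + c3 * (x $ 1 * x $ 1) + c4 * (x $ 1 * x $ 2) + c5 * (x $ 2 * x $ 2))"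
    using assms unfolding poly_space_2_iff by blast
  have P: "(\<lambda>x::real^2. 1) \<in> poly_space 1" "(\<lambda>x::real^2. c) \<in> poly_space 1" "(\<lambda>x. x $ 1) \<in> poly_space 1" "(\<lambda>x. x $ 2) \<in> poly_space 1" for c
    unfolding poly_space_1_iff
    by (intro exI[of _ 1] exI[of _ 0], simp, intro exI[of _ c] exI[of _ 0], simp, intro exI[of _ 0] exI[of _ 1] , simp, rule exI[of _ 0], rule exI[of _ 0], rule exI[of _ 1], simp)
  show "quad_lagrange a (\<lambda>i. q (a i)) (\<lambda>i. q (edge_midpoint a i)) x = q x"
    unfolding q quad_lagrange_add quad_lagrange_cmult
      quad_lagrange_product[OF P(3) P(3)] quad_lagrange_product[OF P(3) P(4)] quad_lagrange_product[OF P(4) P(4)]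
    using quad_lagrange_product[OF P(2) P(1), of c0 x] quad_lagrange_product[OF P(3) P(1), of x] quad_lagrange_product[OF P(4) P(1), of x]
    by simp
qed

lemma midpoint_affine_poly:
  assumes r: "r \<in> poly_space 1"
  shows "midpoint_affine a (\<lambda>i. r (edge_midpoint a i)) = r"
proof
  fix x
  have l2: "bary a (0 + 2) x = 1 - bary a 0 x - bary a (0 + 1) x" using bary_sum3[OF nd, of 0 x] by linarith
  show "midpoint_affine a (\<lambda>i. r (edge_midpoint a i)) x = r x"
    unfolding midpoint_affine_def sum_type3[of _ 0] type3_add affine_midpoint[OF r] affine_bary[OF r, of x 0] l2
    by (simp add: field_simps)
qed

lemma quad_lagrange_in_poly: "quad_lagrange a A B \<in> poly_space 2"
proof -
  have 1: "(\<lambda>x. A i * (bary a i x * (2 * bary a i x + (-1)))) \<in> poly_space 2" for i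
    using poly_space_2_mult[OF poly_space_1_cmult[OF bary_poly[of a i], of "A i"] poly_space_1_add[OF poly_space_1_cmult[OF bary_poly[of a i], of 2] poly_space_1_const[of "-1"]]]
    by (simp add: mult.assoc)
  have 2: "(\<lambda>x. B i * (4 * (bary a (i + 1) x * bary a (i + 2) x))) \<in> poly_space 2" for i
    using poly_space_2_mult[OF poly_space_1_cmult[OF bary_poly[of a "i + 1"], of "B i * 4"] bary_poly[of a "i + 2"]]
    by (simp add: mult.assoc)
  show ?thesis unfolding quad_lagrange_def[abs_def] sum_type3[of _ 0]
    by (intro poly_space_2_add 1 2)
qed

lemma midpoint_affine_in_poly: "midpoint_affine a R \<in> poly_space 1"
  unfolding midpoint_affine_def[abs_def] sum_type3[of _ 0]
  by (intro poly_space_1_add poly_space_1_cmult poly_space_1_const bary_poly)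

lemma bubble_eq: "bubble a = bubble3 a"
  by (simp add: fun_eq_iff bubble_def barycentric_eq[OF nd] prod_type3[of _ 0] bubble3_def)

lemma ntw_fun_in_space: "ntw_fun a A B D \<in> NTW_space a"
  unfolding NTW_space_def ntw_fun_def[abs_def] bubble_eq using quad_lagrange_in_poly midpoint_affine_in_poly by blast

text \<open>On the edge \<open>\<lambda>\<^sub>i = 0\<close>, so only the derivative of the factor \<open>\<lambda>\<^sub>i\<close> survives.\<close>

lemma flux_bubble:
  assumes n: "edge_normal a i \<bullet> bary_grad a i = - norm (bary_grad a i)" and r: "r \<in> poly_space 1"
  shows "flux a i (\<lambda>x. bubble3 a x * r x) = - (dist (a (i + 1)) (a (i + 2)) * norm (bary_grad a i) * r (edge_midpoint a i) / 6)"
proof -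
  let ?L = "linepath (a (i + 1)) (a (i + 2))"
  let ?g = "norm (bary_grad a i)"
  note rs = poly_space_smooth(1)[OF r]
  let ?k = "\<lambda>x. bary a (i + 1) x * bary a (i + 2) x * r x"
  have ks: "smooth ?k" by (intro smooth_mult smooth_bary rs)
  have eq: "(\<lambda>x. bubble3 a x * r x) = (\<lambda>x. bary a i x * ?k x)"
    unfolding bubble3_rotate[of a _ i] by (simp add: mult_ac)
  have b: "bary a i (?L t) = 0" "bary a (i + 1) (?L t) = 1 - t" "bary a (i + 2) (?L t) = t" for t
    by (simp_all add: bary_linepath bary_vertex[OF nd])
  have rL: "r (?L t) = r (edge_midpoint a i) + (r (a (i + 2)) - r (a (i + 1))) / 2 * (2 * t - 1)" for t
    unfolding affine_bary[OF r, of "?L t" i] b affine_midpoint[OF r] by (simp add: field_simps)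
  have nd': "normal_deriv a i (\<lambda>x. bubble3 a x * r x) (?L t) =
     - ?g * ((1 - t) * t * (r (edge_midpoint a i) + (r (a (i + 2)) - r (a (i + 1))) / 2 * (2 * t - 1)))" for t
  proof -
    have "normal_deriv a i (\<lambda>x. bubble3 a x * r x) (?L t) = dir_deriv (edge_normal a i) (\<lambda>x. bary a i x * ?k x) (?L t)"
      unfolding eq by (subst normal_deriv_eq) (auto intro: smooth_mult smooth_bary ks)
    also have "\<dots> = - ?g * ?k (?L t)"
      by (simp add: dir_deriv_mult[OF smooth_bary ks] dir_deriv_bary n b)
    finally show ?thesis by (simp add: b rL)
  qed
  show ?thesis unfolding flux_def edge_integral_def segment_integral_def nd'
    by (simp only: integral_mult_right_zero integral_bubble_edge)
qed

end

context regular_triangle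
begin

lemma normal_inner_grad: "edge_normal a i \<bullet> bary_grad a i = - norm (bary_grad a i)"
  using bary_grad_nz[OF nd, of i] by (simp add: edge_normal_eq dot_square_norm power2_eq_square)

lemma edge_grad_pos: "0 < dist (a (i + 1)) (a (i + 2)) * norm (bary_grad a i)"
  using bary_grad_nz[OF nd, of i] vertices_distinct[OF nd, of "i + 1" "i + 2"] by simp

lemma ntw_fun_dofs:
  "ntw_fun a A B D (a i) = A i" "ntw_fun a A B D (edge_midpoint a i) = B i" "flux a i (ntw_fun a A B D) = D i"
proof -
  show "ntw_fun a A B D (a i) = A i" "ntw_fun a A B D (edge_midpoint a i) = B i"
    by (simp_all add: ntw_fun_def quad_lagrange_vertex[OF nd] quad_lagrange_midpoint[OF nd] bubble3_vertex[OF nd] bubble3_midpoint[OF nd])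
  let ?r = "midpoint_affine a (flux_coeff a A B D)"
  have rm: "?r (edge_midpoint a i) = flux_coeff a A B D i"
    unfolding midpoint_affine_def sum_type3[of _ i] by (simp add: bary_midpoint[OF nd])
  have "flux a i (ntw_fun a A B D) = flux a i (quad_lagrange a A B) + flux a i (\<lambda>x. bubble3 a x * ?r x)"
    unfolding ntw_fun_def[abs_def]
    by (intro flux_add smooth_mult smooth_quad_lagrange smooth_bubble3 smooth_midpoint_affine)
  also have "\<dots> = D i"
  proof -
    have c: "- (X * (- 6 * y / X) / 6) = y" if "X \<noteq> 0" for X y :: real using that by simp
    have "dist (a (i + 1)) (a (i + 2)) * norm (bary_grad a i) \<noteq> 0"
      by (rule less_imp_neq[OF edge_grad_pos, symmetric])
    from c[OF this, of "D i - flux a i (quad_lagrange a A B)"] show ?thesis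
      unfolding flux_bubble[OF nd normal_inner_grad midpoint_affine_in_poly[OF nd]] rm flux_coeff_def
      by simp
  qed
  finally show "flux a i (ntw_fun a A B D) = D i" .
qed

text \<open>Unisolvence: the point values determine the quadratic part, and the fluxes then determine the
  affine factor of the bubble through its midpoint values.\<close>

lemma NTW_space_eq_ntw_fun:
  assumes "p \<in> NTW_space a"
  shows "p = ntw_fun a (\<lambda>i. p (a i)) (\<lambda>i. p (edge_midpoint a i)) (\<lambda>i. flux a i p)"
proof -
  obtain q r where q: "q \<in> poly_space 2" and r: "r \<in> poly_space 1" and p: "p = (\<lambda>x. q x + bubble3 a x * r x)"
    using assms unfolding NTW_space_def bubble_eq[OF nd] by blast
  have A: "(\<lambda>i. p (a i)) = (\<lambda>i. q (a i))" by (simp add: p bubble3_vertex[OF nd])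
  have B: "(\<lambda>i. p (edge_midpoint a i)) = (\<lambda>i. q (edge_midpoint a i))" by (simp add: p bubble3_midpoint[OF nd])
  have "flux a i p = flux a i q + flux a i (\<lambda>x. bubble3 a x * r x)" for i
    unfolding p by (intro flux_add smooth_mult smooth_bubble3 poly_space_smooth q r)
  then have F: "flux a i p - flux a i q = - (dist (a (i + 1)) (a (i + 2)) * norm (bary_grad a i) * r (edge_midpoint a i) / 6)" for i
    unfolding flux_bubble[OF nd normal_inner_grad r] by simp
  have "flux_coeff a (\<lambda>i. p (a i)) (\<lambda>i. p (edge_midpoint a i)) (\<lambda>i. flux a i p) = (\<lambda>i. r (edge_midpoint a i))"
  proof
    fix i
    have c: "- 6 * (- (X * y / 6)) / X = y" if "X \<noteq> 0" for X y :: real using that by simp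
    have "dist (a (i + 1)) (a (i + 2)) * norm (bary_grad a i) \<noteq> 0"
      by (rule less_imp_neq[OF edge_grad_pos, symmetric])
    from c[OF this, of "r (edge_midpoint a i)"]
    show "flux_coeff a (\<lambda>i. p (a i)) (\<lambda>i. p (edge_midpoint a i)) (\<lambda>i. flux a i p) i = r (edge_midpoint a i)"
      unfolding flux_coeff_def A B quad_lagrange_poly[OF nd q] F .
  qed
  then show ?thesis
    unfolding ntw_fun_def[abs_def] unfolding A B quad_lagrange_poly[OF nd q]
    by (simp add: p midpoint_affine_poly[OF nd r])
qed

lemma NTW_interp_eq:
  "NTW_interp a v = ntw_fun a (\<lambda>i. cont_rep K v (a i)) (\<lambda>i. cont_rep K v (edge_midpoint a i))
     (\<lambda>i. edge_integral a i (normal_deriv_trace a i v))"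
  unfolding NTW_interp_def
proof (rule the_equality)
  show "ntw_fun a (\<lambda>i. cont_rep K v (a i)) (\<lambda>i. cont_rep K v (edge_midpoint a i)) (\<lambda>i. edge_integral a i (normal_deriv_trace a i v)) \<in> NTW_space a \<and> 
    (\<forall>i. ntw_fun a (\<lambda>i. cont_rep K v (a i)) (\<lambda>i. cont_rep K v (edge_midpoint a i)) (\<lambda>i. edge_integral a i (normal_deriv_trace a i v)) (a i) = cont_rep K v (a i) \<and>
      ntw_fun a (\<lambda>i. cont_rep K v (a i)) (\<lambda>i. cont_rep K v (edge_midpoint a i)) (\<lambda>i. edge_integral a i (normal_deriv_trace a i v)) (edge_midpoint a i) = cont_rep K v (edge_midpoint a i) \<and>
      edge_integral a i (normal_deriv a i (ntw_fun a (\<lambda>i. cont_rep K v (a i)) (\<lambda>i. cont_rep K v (edge_midpoint a i)) (\<lambda>i. edge_integral a i (normal_deriv_trace a i v)))) = edge_integral a i (normal_deriv_trace a i v))"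
    using ntw_fun_dofs[unfolded flux_def] ntw_fun_in_space[OF nd] by blast
next
  fix p
  assume "p \<in> NTW_space a \<and>
        (\<forall>i. p (a i) = cont_rep K v (a i) \<and>
             p (edge_midpoint a i) = cont_rep K v (edge_midpoint a i) \<and>
             edge_integral a i (normal_deriv a i p) = edge_integral a i (normal_deriv_trace a i v))"
  then show "p = ntw_fun a (\<lambda>i. cont_rep K v (a i)) (\<lambda>i. cont_rep K v (edge_midpoint a i)) (\<lambda>i. edge_integral a i (normal_deriv_trace a i v))"
    using NTW_space_eq_ntw_fun[of p] by (simp add: flux_def)
qed

lemma ntw_fun_diff:
  "ntw_fun a (\<lambda>i. A i - A' i) (\<lambda>i. B i - B' i) (\<lambda>i. D i - D' i) x = ntw_fun a A B D x - ntw_fun a A' B' D' x"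
proof -
  have q: "quad_lagrange a (\<lambda>i. A i - A' i) (\<lambda>i. B i - B' i) = (\<lambda>x. quad_lagrange a A B x - quad_lagrange a A' B' x)"
    using quad_lagrange_add[OF nd, of A "\<lambda>i. (-1) * A' i" B "\<lambda>i. (-1) * B' i"] quad_lagrange_cmult[OF nd, of "-1" A' B']
    by (simp add: fun_eq_iff)
  have "flux a i (quad_lagrange a (\<lambda>i. A i - A' i) (\<lambda>i. B i - B' i)) = flux a i (quad_lagrange a A B) - flux a i (quad_lagrange a A' B')" for i
    unfolding q by (intro flux_diff smooth_quad_lagrange)
  then have "flux_coeff a (\<lambda>i. A i - A' i) (\<lambda>i. B i - B' i) (\<lambda>i. D i - D' i) = (\<lambda>i. flux_coeff a A B D i - flux_coeff a A' B' D' i)"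
    by (simp add: flux_coeff_def fun_eq_iff diff_divide_distrib[symmetric] right_diff_distrib)
  then show ?thesis
    by (simp add: ntw_fun_def q midpoint_affine_diff right_diff_distrib)
qed

lemma ntw_fun_const: "ntw_fun a (\<lambda>i. c) (\<lambda>i. c) (\<lambda>i. 0) x = c"
proof -
  have "(\<lambda>x. c + bubble3 a x * 0) \<in> NTW_space a"
    unfolding NTW_space_def bubble_eq[OF nd]
  proof (rule CollectI, intro exI conjI)
    show "(\<lambda>x. c + bubble3 a x * 0) = (\<lambda>x. (\<lambda>x. c) x + bubble3 a x * (\<lambda>x. 0) x)" by simp
    show "(\<lambda>x. c) \<in> poly_space 2"
      using poly_space_2_mult[OF poly_space_1_const[of c] poly_space_1_const[of 1]] by simp
    show "(\<lambda>x. 0) \<in> poly_space 1" by (rule poly_space_1_const)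
  qed
  then have "(\<lambda>x. c) \<in> NTW_space a" by simp
  from NTW_space_eq_ntw_fun[OF this] show ?thesis by (simp add: flux_const fun_eq_iff)
qed

section \<open>Stability of the interpolation\<close>

text \<open>The derivatives are measured in units of \<open>h\<close>, so that such bounds are stable under sums and
  products, with constants independent of the triangle, and hold for the barycentric coordinates.\<close>

definition scaled_bound :: "real \<Rightarrow> (real^2 \<Rightarrow> real) \<Rightarrow> bool" where
  "scaled_bound M f \<longleftrightarrow> smooth f \<and> (\<forall>x\<in>K. \<bar>f x\<bar> \<le> M \<and> (\<forall>c. \<bar>partial_deriv c f x\<bar> \<le> M / h) \<and>
     (\<forall>c d. \<bar>partial_deriv d (partial_deriv c f) x\<bar> \<le> M / h\<^sup>2))"

lemma scaled_bound_nonneg: "scaled_bound M f \<Longrightarrow> 0 \<le> M"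
  using vertex_in_tri[OF nd, of 0] unfolding scaled_bound_def by (meson abs_ge_zero order_trans)

lemma scaled_bound_mono:
  assumes f: "scaled_bound M f" and M: "M \<le> M'"
  shows "scaled_bound M' f"
proof -
  have "M / h \<le> M' / h" "M / h\<^sup>2 \<le> M' / h\<^sup>2" using M h_pos by (simp_all add: divide_right_mono)
  then show ?thesis using f M unfolding scaled_bound_def by (meson order_trans)
qed

lemma scaled_bound_const: "scaled_bound \<bar>c\<bar> (\<lambda>x. c)"
  using h_pos unfolding scaled_bound_def by (auto simp: partial_deriv_const)

lemma scaled_bound_bary: "scaled_bound \<gamma> (bary a i)"
  unfolding scaled_bound_def partial_deriv_bary partial_deriv_const
proof (intro conjI ballI allI smooth_bary)
  fix x assume x: "x \<in> K"
  show "\<bar>bary a i x\<bar> \<le> \<gamma>"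
    using bary_le_1[OF nd x, of i] x gamma_ge_1 unfolding tri_iff[OF nd] by (metis abs_of_nonneg order_trans)
  show "\<bar>bary_grad a i $ c\<bar> \<le> \<gamma> / h" for c
    using component_le_norm_cart[of "bary_grad a i" c] bary_grad_le[of i] by linarith
  show "\<bar>0 :: real\<bar> \<le> \<gamma> / h\<^sup>2" using gamma_ge_1 by simp
qed

lemma scaled_bound_add:
  assumes f: "scaled_bound M f" and g: "scaled_bound M' g"
  shows "scaled_bound (M + M') (\<lambda>x. f x + g x)"
proof -
  have s: "smooth f" "smooth g" using f g by (auto simp: scaled_bound_def)
  have pd: "partial_deriv c (\<lambda>x. f x + g x) = (\<lambda>x. partial_deriv c f x + partial_deriv c g x)" for c
    using s by (simp add: partial_deriv_add smooth_differentiable)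
  have pd2: "partial_deriv d (\<lambda>x. partial_deriv c f x + partial_deriv c g x)
      = (\<lambda>x. partial_deriv d (partial_deriv c f) x + partial_deriv d (partial_deriv c g) x)" for c d
    using s by (simp add: partial_deriv_add smooth_differentiable smooth_partial_deriv)
  show ?thesis
    unfolding scaled_bound_def pd pd2 add_divide_distrib
    using f g unfolding scaled_bound_def
    by (intro conjI ballI allI smooth_add s order_trans[OF abs_triangle_ineq] add_mono) auto
qed

lemma scaled_bound_cmult:
  assumes f: "scaled_bound M f"
  shows "scaled_bound (\<bar>c\<bar> * M) (\<lambda>x. c * f x)"
proof -
  have s: "smooth f" using f by (auto simp: scaled_bound_def)
  have pd: "partial_deriv d (\<lambda>x. c * f x) = (\<lambda>x. c * partial_deriv d f x)"
     "partial_deriv e (\<lambda>x. c * partial_deriv d f x) = (\<lambda>x. c * partial_deriv e (partial_deriv d f) x)" for d e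
    using s by (simp_all add: partial_deriv_cmult smooth_partial_deriv)
  show ?thesis
    unfolding scaled_bound_def pd abs_mult times_divide_eq_right[symmetric]
    using f unfolding scaled_bound_def
    by (intro conjI ballI allI smooth_cmult s mult_left_mono) auto
qed

lemma scaled_bound_mult:
  assumes f: "scaled_bound M f" and g: "scaled_bound M' g"
  shows "scaled_bound (4 * M * M') (\<lambda>x. f x * g x)"
proof -
  have s: "smooth f" "smooth g" using f g by (auto simp: scaled_bound_def)
  note nn = scaled_bound_nonneg[OF f] scaled_bound_nonneg[OF g]
  have pd: "partial_deriv c (\<lambda>x. f x * g x) = (\<lambda>x. partial_deriv c f x * g x + f x * partial_deriv c g x)" for c
    using s by (simp add: partial_deriv_mult smooth_differentiable)
  have pd2: "partial_deriv d (\<lambda>x. partial_deriv c f x * g x + f x * partial_deriv c g x)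
      = (\<lambda>x. (partial_deriv d (partial_deriv c f) x * g x + partial_deriv c f x * partial_deriv d g x)
        + (partial_deriv d f x * partial_deriv c g x + f x * partial_deriv d (partial_deriv c g) x))" for c d
    using s by (simp add: partial_deriv_add partial_deriv_mult smooth_differentiable smooth_partial_deriv smooth_mult)
  show ?thesis
    unfolding scaled_bound_def pd pd2
  proof (intro conjI ballI allI smooth_mult s)
    fix x assume x: "x \<in> K"
    have F: "\<bar>f x\<bar> \<le> M" "\<bar>partial_deriv c f x\<bar> \<le> M / h" "\<bar>partial_deriv d (partial_deriv c f) x\<bar> \<le> M / h\<^sup>2" for c d
      using f x unfolding scaled_bound_def by auto
    have G: "\<bar>g x\<bar> \<le> M'" "\<bar>partial_deriv c g x\<bar> \<le> M' / h" "\<bar>partial_deriv d (partial_deriv c g) x\<bar> \<le> M' / h\<^sup>2" for c d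
      using g x unfolding scaled_bound_def by auto
    have m: "\<bar>u * v\<bar> \<le> U * V" if "\<bar>u\<bar> \<le> U" "\<bar>v\<bar> \<le> V" for u v U V :: real
      unfolding abs_mult using that by (intro mult_mono) auto
    have MM: "0 \<le> M * M'" using nn by simp
    show "\<bar>f x * g x\<bar> \<le> 4 * M * M'" using m[OF F(1) G(1)] MM by linarith
    have "\<bar>partial_deriv c f x * g x + f x * partial_deriv c g x\<bar> \<le> M / h * M' + M * (M' / h)" for c
      by (intro order_trans[OF abs_triangle_ineq] add_mono m F G)
    moreover have "M / h * M' + M * (M' / h) \<le> 4 * M * M' / h" using MM h_pos by (simp add: field_simps)
    ultimately show "\<bar>partial_deriv c f x * g x + f x * partial_deriv c g x\<bar> \<le> 4 * M * M' / h" for c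
      by (rule order_trans)
    have "\<bar>(partial_deriv d (partial_deriv c f) x * g x + partial_deriv c f x * partial_deriv d g x)
        + (partial_deriv d f x * partial_deriv c g x + f x * partial_deriv d (partial_deriv c g) x)\<bar>
        \<le> (M / h\<^sup>2 * M' + M / h * (M' / h)) + (M / h * (M' / h) + M * (M' / h\<^sup>2))" for c d
      by (intro order_trans[OF abs_triangle_ineq] add_mono m F G)
    moreover have "(M / h\<^sup>2 * M' + M / h * (M' / h)) + (M / h * (M' / h) + M * (M' / h\<^sup>2)) = 4 * M * M' / h\<^sup>2"
      by (simp add: power2_eq_square)
    ultimately show "\<bar>(partial_deriv d (partial_deriv c f) x * g x + partial_deriv c f x * partial_deriv d g x)
        + (partial_deriv d f x * partial_deriv c g x + f x * partial_deriv d (partial_deriv c g) x)\<bar> \<le> 4 * M * M' / h\<^sup>2" for c d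
      by simp
  qed
qed

lemma scaled_bound_sum3:
  assumes "\<And>i. scaled_bound (M i) (f i)"
  shows "scaled_bound (\<Sum>i\<in>UNIV. M i) (\<lambda>x. \<Sum>i\<in>(UNIV :: 3 set). f i x)"
  unfolding sum_type3[of _ 0] by (intro scaled_bound_add assms)

lemma scaled_bound_N_le:
  assumes f: "scaled_bound M f" and j: "j \<le> 2"
  shows "N j f \<le> 8 * M * (h / h ^ j)"
proof -
  have s: "smooth f" using f by (auto simp: scaled_bound_def)
  have L: "L2_norm T (partial_derivs is f) \<le> (M / h ^ j) * (2 * h)" if l: "length is = j" for "is"
  proof -
    have "L2_norm T (partial_derivs is f) \<le> (M / h ^ j) * sqrt (measure lebesgue T)"
    proof (rule L2_bounded(2)[OF T_props(5)])
      show "partial_derivs is f \<in> borel_measurable (lebesgue_on T)"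
        by (intro smooth_lebesgue_on_measurable T_props smooth_partial_derivs s)
      fix x assume "x \<in> T"
      then have x: "x \<in> K" using T_props(7) by blast
      consider "is = []" | c where "is = [c]" | d c where "is = [d, c]"
        using l j by (cases "is" rule: list.exhaust[case_names N C]; cases "tl is") auto
      then show "\<bar>partial_derivs is f x\<bar> \<le> M / h ^ j"
        using f x l unfolding scaled_bound_def by cases (auto simp: numeral_2_eq_2)
    qed
    also have "\<dots> \<le> (M / h ^ j) * (2 * h)"
      using scaled_bound_nonneg[OF f] h_pos by (intro mult_left_mono sqrt_measure_T_le) auto
    finally show ?thesis .
  qed
  have card: "card {is :: 2 list. length is = j} = 2 ^ j"
    using card_lists_length_eq[of "UNIV :: 2 set" j] by simp
  have "N j f \<le> (\<Sum>is | length is = j. L2_norm T (partial_derivs is f))"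
    unfolding N_eq[OF s] by (rule L2_set_le_sum) simp
  also have "\<dots> \<le> (\<Sum>is | length (is :: 2 list) = j. (M / h ^ j) * (2 * h))"
    by (rule sum_mono) (use L in auto)
  also have "\<dots> = 2 ^ j * ((M / h ^ j) * (2 * h))" by (simp add: card)
  also have "\<dots> \<le> 4 * ((M / h ^ j) * (2 * h))"
  proof (rule mult_right_mono)
    show "(2::real) ^ j \<le> 4" using power_increasing[OF j, of "2::real"] by simp
  qed (use scaled_bound_nonneg[OF f] h_pos in simp)
  finally show ?thesis by (simp add: mult_ac)
qed

lemma linepath_in_tri: "0 \<le> t \<Longrightarrow> t \<le> 1 \<Longrightarrow> linepath (a i) (a j) t \<in> K"
  using convexD[OF convex_tri[OF nd] vertex_in_tri[OF nd, of i] vertex_in_tri[OF nd, of j], of "1 - t" t]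
  by (simp add: linepath_def)

lemma measure_unit_interval: "measure (lebesgue_on {0..1::real}) {0..1} = 1"
  by (simp add: measure_restrict_space)

lemma flux_le:
  assumes f: "scaled_bound M f"
  shows "\<bar>flux a i f\<bar> \<le> 2 * M"
proof -
  let ?L = "linepath (a (i + 1)) (a (i + 2))"
  let ?g = "dir_deriv (edge_normal a i) f"
  have s: "smooth f" using f by (auto simp: scaled_bound_def)
  have b: "\<bar>?g (?L t)\<bar> \<le> 2 * M / h" if "t \<in> {0..1}" for t
  proof -
    have x: "?L t \<in> K" using linepath_in_tri that by simp
    have "\<bar>edge_normal a i $ c * partial_deriv c f (?L t)\<bar> \<le> 1 * (M / h)" for c
      unfolding abs_mult using f x component_le_norm_cart[of "edge_normal a i" c] norm_edge_normal[of i]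
      unfolding scaled_bound_def by (intro mult_mono) auto
    from this[of 1] this[of 2] show ?thesis unfolding dir_deriv_def sum_2 by linarith
  qed
  have "\<bar>LINT t|lebesgue_on {0..1}. ?g (?L t)\<bar> \<le> (LINT t|lebesgue_on {0..1::real}. 2 * M / h)"
  proof (rule order_trans[OF integral_abs_bound], rule integral_mono)
    show "integrable (lebesgue_on {0..1}) (\<lambda>t. \<bar>?g (?L t)\<bar>)"
      by (intro integrable_abs continuous_linepath_integrable smooth_dir_deriv s)
  qed (use b in auto)
  also have "\<dots> = 2 * M / h" by (simp add: measure_unit_interval)
  finally have "dist (a (i + 1)) (a (i + 2)) * \<bar>LINT t|lebesgue_on {0..1}. ?g (?L t)\<bar> \<le> h * (2 * M / h)"
    using dist_le_h[OF vertex_in_tri[OF nd] vertex_in_tri[OF nd]] h_pos by (intro mult_mono) auto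
  then show ?thesis using h_pos
    unfolding flux_def edge_integral_def segment_integral_def normal_deriv_eq[OF s] abs_mult by simp
qed

text \<open>The product is the ratio of an edge to its height, and hence is independent of scaling.\<close>

lemma edge_grad_ge: "1 / \<gamma>\<^sup>2 \<le> dist (a (i + 1)) (a (i + 2)) * norm (bary_grad a i)"
proof -
  let ?d = "dist (a (i + 1)) (a (i + 2))"
  have D: "0 < \<bar>tri_det a\<bar>" using tri_det_nz[OF nd] by simp
  have v: "norm (a k - a i) \<le> h" for k
    using dist_le_h[OF vertex_in_tri[OF nd] vertex_in_tri[OF nd]] by (simp add: dist_norm)
  have "\<bar>tri_det a\<bar> \<le> norm (a (i + 1) - a i) * norm (a (i + 2) - a i)"
    unfolding tri_det_eq[of a i] by (rule abs_cross2_le)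
  also have "\<dots> \<le> h * h" using h_pos by (intro mult_mono v) auto
  finally have Dh: "\<bar>tri_det a\<bar> \<le> h\<^sup>2" by (simp add: power2_eq_square)
  have "h / \<gamma> \<le> ?d" by (rule edge_ge(1)) simp
  then have "(h / \<gamma>)\<^sup>2 \<le> ?d\<^sup>2" using h_pos gamma_ge_1 by (intro power_mono) auto
  moreover have "1 / \<gamma>\<^sup>2 * \<bar>tri_det a\<bar> \<le> 1 / \<gamma>\<^sup>2 * h\<^sup>2" by (intro mult_left_mono Dh) simp
  ultimately have "1 / \<gamma>\<^sup>2 * \<bar>tri_det a\<bar> \<le> ?d\<^sup>2" by (simp add: power_divide)
  then show ?thesis using D by (simp add: norm_bary_grad field_simps power2_eq_square)
qed

definition dof_sum :: "(3 \<Rightarrow> real) \<Rightarrow> (3 \<Rightarrow> real) \<Rightarrow> (3 \<Rightarrow> real) \<Rightarrow> real" where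
  "dof_sum A B D = (\<Sum>i\<in>UNIV. \<bar>A i\<bar>) + (\<Sum>i\<in>UNIV. \<bar>B i\<bar>) + (\<Sum>i\<in>UNIV. \<bar>D i\<bar>)"

lemma scaled_bound_quad_lagrange:
  "scaled_bound (16 * \<gamma>\<^sup>2 * ((\<Sum>i\<in>UNIV. \<bar>A i\<bar>) + (\<Sum>i\<in>UNIV. \<bar>B i\<bar>))) (quad_lagrange a A B)"
proof -
  have g: "2 * \<gamma> + 1 \<le> 3 * \<gamma>" using gamma_ge_1 by simp
  have 1: "scaled_bound (\<bar>A i\<bar> * (16 * \<gamma>\<^sup>2)) (\<lambda>x. A i * (bary a i x * (2 * bary a i x + (-1))))" for i
  proof (rule scaled_bound_cmult)
    have "scaled_bound (4 * \<gamma> * (\<bar>2\<bar> * \<gamma> + \<bar>-1\<bar>)) (\<lambda>x. bary a i x * (2 * bary a i x + (-1)))"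
      by (intro scaled_bound_mult scaled_bound_add scaled_bound_cmult scaled_bound_const scaled_bound_bary)
    moreover have "4 * \<gamma> * (\<bar>2\<bar> * \<gamma> + \<bar>-1\<bar>) \<le> 16 * \<gamma>\<^sup>2"
    proof -
      have "4 * \<gamma> * (\<bar>2\<bar> * \<gamma> + \<bar>-1\<bar>) \<le> 4 * \<gamma> * (4 * \<gamma>)" using gamma_ge_1 by (intro mult_left_mono) auto
      then show ?thesis by (simp add: power2_eq_square)
    qed
    ultimately show "scaled_bound (16 * \<gamma>\<^sup>2) (\<lambda>x. bary a i x * (2 * bary a i x + (-1)))"
      by (rule scaled_bound_mono)
  qed
  have 2: "scaled_bound (\<bar>B i\<bar> * (16 * \<gamma>\<^sup>2)) (\<lambda>x. B i * (4 * (bary a (i + 1) x * bary a (i + 2) x)))" for i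
  proof (rule scaled_bound_cmult)
    have "scaled_bound (\<bar>4\<bar> * (4 * \<gamma> * \<gamma>)) (\<lambda>x. 4 * (bary a (i + 1) x * bary a (i + 2) x))"
      by (intro scaled_bound_mult scaled_bound_cmult scaled_bound_bary)
    then show "scaled_bound (16 * \<gamma>\<^sup>2) (\<lambda>x. 4 * (bary a (i + 1) x * bary a (i + 2) x))"
      by (simp add: power2_eq_square)
  qed
  have "scaled_bound ((\<Sum>i\<in>UNIV. \<bar>A i\<bar> * (16 * \<gamma>\<^sup>2)) + (\<Sum>i\<in>UNIV. \<bar>B i\<bar> * (16 * \<gamma>\<^sup>2))) (quad_lagrange a A B)"
    unfolding quad_lagrange_def[abs_def] by (intro scaled_bound_add scaled_bound_sum3 1 2)
  moreover have "(\<Sum>i\<in>UNIV. \<bar>A i\<bar> * (16 * \<gamma>\<^sup>2)) + (\<Sum>i\<in>UNIV. \<bar>B i\<bar> * (16 * \<gamma>\<^sup>2)) = 16 * \<gamma>\<^sup>2 * ((\<Sum>i\<in>UNIV. \<bar>A i\<bar>) + (\<Sum>i\<in>UNIV. \<bar>B i\<bar>))"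
    by (simp add: sum_distrib_right[symmetric] algebra_simps)
  ultimately show ?thesis by simp
qed

lemma flux_coeff_le:
  "\<bar>flux_coeff a A B D i\<bar> \<le> 6 * \<gamma>\<^sup>2 * (\<bar>D i\<bar> + 32 * \<gamma>\<^sup>2 * ((\<Sum>i\<in>UNIV. \<bar>A i\<bar>) + (\<Sum>i\<in>UNIV. \<bar>B i\<bar>)))"
proof -
  let ?S = "(\<Sum>i\<in>UNIV. \<bar>A i\<bar>) + (\<Sum>i\<in>UNIV. \<bar>B i\<bar>)"
  let ?X = "dist (a (i + 1)) (a (i + 2)) * norm (bary_grad a i)"
  let ?y = "D i - flux a i (quad_lagrange a A B)"
  have y: "\<bar>?y\<bar> \<le> \<bar>D i\<bar> + 32 * \<gamma>\<^sup>2 * ?S"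
    using flux_le[OF scaled_bound_quad_lagrange, of i A B] by linarith
  have g: "0 < \<gamma>\<^sup>2" using gamma_ge_1 by simp
  have "1 \<le> \<gamma>\<^sup>2 * ?X" using edge_grad_ge[of i] g by (simp add: field_simps)
  then have "\<bar>?y\<bar> * 1 \<le> \<bar>?y\<bar> * (\<gamma>\<^sup>2 * ?X)" by (rule mult_left_mono) simp
  then have "\<bar>?y\<bar> / ?X \<le> \<gamma>\<^sup>2 * \<bar>?y\<bar>" using edge_grad_pos[of i] by (simp add: divide_le_eq mult_ac)
  also have "\<dots> \<le> \<gamma>\<^sup>2 * (\<bar>D i\<bar> + 32 * \<gamma>\<^sup>2 * ?S)" using y g by (intro mult_left_mono) auto
  finally have "6 * (\<bar>?y\<bar> / ?X) \<le> 6 * \<gamma>\<^sup>2 * (\<bar>D i\<bar> + 32 * \<gamma>\<^sup>2 * ?S)" by simp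
  moreover have "\<bar>flux_coeff a A B D i\<bar> = 6 * (\<bar>?y\<bar> / ?X)"
  proof -
    have "\<bar>- 6 * y / X\<bar> = 6 * (\<bar>y\<bar> / X)" if "0 < X" for y X :: real
      using that by (simp add: abs_mult)
    from this[OF edge_grad_pos] show ?thesis unfolding flux_coeff_def .
  qed
  ultimately show ?thesis by simp
qed

text \<open>The power of \<open>\<gamma>\<close> is that of the bubble part: \<open>\<gamma>\<^sup>3\<close> from the bubble, \<open>\<gamma>\<close> from the affine
  factor, and \<open>\<gamma>\<^sup>4\<close> from its coefficients, which contain the flux of the quadratic part.\<close>

definition C_interp where "C_interp = 120000 * \<gamma> ^ 8"

lemma scaled_bound_ntw_fun: "scaled_bound (C_interp * dof_sum A B D) (ntw_fun a A B D)"
proof -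
  define S where "S = (\<Sum>i\<in>UNIV. \<bar>A i\<bar>) + (\<Sum>i\<in>UNIV. \<bar>B i\<bar>)"
  define E where "E = (\<Sum>i\<in>UNIV. \<bar>D i\<bar>)"
  have nn: "0 \<le> S" "0 \<le> E" by (simp_all add: S_def E_def sum_nonneg)
  let ?R = "flux_coeff a A B D"
  have g: "1 \<le> \<gamma>" by (rule gamma_ge_1)
  have 1: "scaled_bound (\<bar>?R i\<bar> * (3 * \<gamma>)) (\<lambda>x. ?R i * (1 + (-2) * bary a i x))" for i
  proof (rule scaled_bound_cmult)
    have "scaled_bound (\<bar>1\<bar> + \<bar>-2\<bar> * \<gamma>) (\<lambda>x. 1 + (-2) * bary a i x)"
      by (intro scaled_bound_add scaled_bound_const scaled_bound_cmult scaled_bound_bary)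
    then show "scaled_bound (3 * \<gamma>) (\<lambda>x. 1 + (-2) * bary a i x)" by (rule scaled_bound_mono) (use g in simp)
  qed
  have 2: "scaled_bound (\<Sum>i\<in>UNIV. \<bar>?R i\<bar> * (3 * \<gamma>)) (midpoint_affine a ?R)"
    unfolding midpoint_affine_def[abs_def] by (intro scaled_bound_sum3 1)
  have 3: "scaled_bound (4 * (4 * \<gamma> * \<gamma>) * \<gamma>) (bubble3 a)"
    unfolding bubble3_def[abs_def] by (intro scaled_bound_mult scaled_bound_bary)
  have 4: "scaled_bound (16 * \<gamma>\<^sup>2 * S + 4 * (4 * (4 * \<gamma> * \<gamma>) * \<gamma>) * (\<Sum>i\<in>UNIV. \<bar>?R i\<bar> * (3 * \<gamma>))) (ntw_fun a A B D)"
    unfolding ntw_fun_def[abs_def] S_def by (intro scaled_bound_add scaled_bound_mult 2 3 scaled_bound_quad_lagrange)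
  have R: "(\<Sum>i\<in>UNIV. \<bar>?R i\<bar>) \<le> 6 * \<gamma>\<^sup>2 * (E + 96 * \<gamma>\<^sup>2 * S)"
  proof -
    have "(\<Sum>i\<in>UNIV. \<bar>?R i\<bar>) \<le> (\<Sum>i\<in>UNIV. 6 * \<gamma>\<^sup>2 * (\<bar>D i\<bar> + 32 * \<gamma>\<^sup>2 * S))"
      unfolding S_def by (intro sum_mono flux_coeff_le)
    also have "\<dots> = 6 * \<gamma>\<^sup>2 * (E + 96 * \<gamma>\<^sup>2 * S)"
      by (simp add: sum_distrib_left[symmetric] sum.distrib E_def)
    finally show ?thesis .
  qed
  have p: "\<gamma> ^ k \<le> \<gamma> ^ 8" if "k \<le> 8" for k by (rule power_increasing[OF that g])
  have "16 * \<gamma>\<^sup>2 * S + 4 * (4 * (4 * \<gamma> * \<gamma>) * \<gamma>) * (\<Sum>i\<in>UNIV. \<bar>?R i\<bar> * (3 * \<gamma>))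
      = 16 * \<gamma>\<^sup>2 * S + 192 * \<gamma> ^ 4 * (\<Sum>i\<in>UNIV. \<bar>?R i\<bar>)"
    by (simp add: sum_distrib_right[symmetric] eval_nat_numeral)
  also have "\<dots> \<le> 16 * \<gamma>\<^sup>2 * S + 192 * \<gamma> ^ 4 * (6 * \<gamma>\<^sup>2 * (E + 96 * \<gamma>\<^sup>2 * S))"
    using R g by (intro add_mono mult_left_mono) auto
  also have "\<dots> = 16 * (\<gamma> ^ 2 * S) + 1152 * (\<gamma> ^ 6 * E) + 110592 * (\<gamma> ^ 8 * S)"
    by (simp add: algebra_simps flip: power_add)
  also have "\<dots> \<le> 16 * (\<gamma> ^ 8 * S) + 1152 * (\<gamma> ^ 8 * E) + 110592 * (\<gamma> ^ 8 * S)"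
    using nn by (intro add_mono mult_left_mono mult_right_mono p) auto
  also have "\<dots> \<le> 120000 * (\<gamma> ^ 8 * S) + 120000 * (\<gamma> ^ 8 * E)"
  proof -
    have "0 \<le> \<gamma> ^ 8 * S" "0 \<le> \<gamma> ^ 8 * E" using nn g by simp_all
    then show ?thesis by linarith
  qed
  also have "\<dots> = C_interp * dof_sum A B D"
    by (simp add: C_interp_def dof_sum_def S_def E_def algebra_simps)
  finally show ?thesis by (rule scaled_bound_mono[OF 4])
qed

lemma ntw_fun_N_le: "j \<le> 2 \<Longrightarrow> N j (ntw_fun a A B D) \<le> 8 * C_interp * dof_sum A B D * (h / h ^ j)"
  using scaled_bound_N_le[OF scaled_bound_ntw_fun] by (simp add: mult.assoc)

text \<open>The averages of \<open>\<bar>\<nabla>w\<bar>\<close> over the edges. Up to an additive constant of \<open>w\<close> they control all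
  degrees of freedom, and the multiplicative trace inequality bounds them by \<open>N 1 w\<close> and only the
  first power of \<open>N 2 w\<close> under the root.\<close>

definition edge_grad :: "(real^2 \<Rightarrow> real) \<Rightarrow> real" where
  "edge_grad w = (\<Sum>i\<in>UNIV. \<Sum>c\<in>UNIV. LINT t|lebesgue_on {0..1}. \<bar>partial_deriv c w (linepath (a (i + 1)) (a (i + 2)) t)\<bar>)"

lemma edge_partial_le:
  assumes w: "smooth w"
  shows "(LINT t|lebesgue_on {0..1}. \<bar>partial_deriv c w (linepath (a (i + 1)) (a (i + 2)) t)\<bar>)
    \<le> 3 * \<gamma> / h * sqrt ((N 1 w)\<^sup>2 + h * N 1 w * N 2 w)"
proof -
  let ?f = "\<lambda>t. partial_deriv c w (linepath (a (i + 1)) (a (i + 2)) t)"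
  note s = smooth_partial_deriv[OF w, of c]
  have f2: "?f \<in> L2_space {0..1}"
  proof -
    have "integrable (lebesgue_on {0..1}) (\<lambda>t. (\<lambda>x. partial_deriv c w x * partial_deriv c w x) (linepath (a (i + 1)) (a (i + 2)) t))"
      by (intro continuous_linepath_integrable smooth_mult s)
    then show ?thesis
      using continuous_linepath_integrable[OF s, of "a (i + 1)" "a (i + 2)"] by (simp add: L2_space_def power2_eq_square)
  qed
  have "(LINT t|lebesgue_on {0..1}. \<bar>?f t\<bar>) \<le> L2_norm {0..1} ?f"
    using L1_le_L2[OF _ f2] by simp
  also have "\<dots> \<le> sqrt ((3 * \<gamma> / h)\<^sup>2 * ((N 1 w)\<^sup>2 + h * N 1 w * N 2 w))"
    unfolding L2_norm_def
  proof (rule real_sqrt_le_mono)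
    have "(LINT t|lebesgue_on {0..1}. (?f t)\<^sup>2) \<le> 8 * \<gamma>\<^sup>2 / h\<^sup>2 * ((N 0 (partial_deriv c w))\<^sup>2 + h * N 0 (partial_deriv c w) * N 1 (partial_deriv c w))"
      by (rule edge_trace[OF s])
    also have "\<dots> \<le> (3 * \<gamma> / h)\<^sup>2 * ((N 1 w)\<^sup>2 + h * N 1 w * N 2 w)"
    proof (rule mult_mono)
      show "8 * \<gamma>\<^sup>2 / h\<^sup>2 \<le> (3 * \<gamma> / h)\<^sup>2" by (simp add: power_divide power_mult_distrib divide_right_mono)
      have n: "N 0 (partial_deriv c w) \<le> N 1 w" "N 1 (partial_deriv c w) \<le> N 2 w"
        using N_partial_deriv_le[OF w, of 0 c] N_partial_deriv_le[OF w, of 1 c] by (simp_all add: numeral_2_eq_2)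
      show "(N 0 (partial_deriv c w))\<^sup>2 + h * N 0 (partial_deriv c w) * N 1 (partial_deriv c w) \<le> (N 1 w)\<^sup>2 + h * N 1 w * N 2 w"
        using n h_pos by (intro add_mono power_mono mult_mono) auto
    qed (use h_pos in auto)
    finally show "(LINT t|lebesgue_on {0..1}. (?f t)\<^sup>2) \<le> (3 * \<gamma> / h)\<^sup>2 * ((N 1 w)\<^sup>2 + h * N 1 w * N 2 w)" .
  qed
  also have "\<dots> = 3 * \<gamma> / h * sqrt ((N 1 w)\<^sup>2 + h * N 1 w * N 2 w)"
    using h_pos gamma_ge_1 by (simp only: real_sqrt_mult real_sqrt_abs) simp
  finally show ?thesis .
qed

lemma edge_grad_le:
  assumes w: "smooth w"
  shows "edge_grad w \<le> 18 * \<gamma> / h * sqrt ((N 1 w)\<^sup>2 + h * N 1 w * N 2 w)"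
proof -
  have "edge_grad w \<le> (\<Sum>i\<in>(UNIV::3 set). \<Sum>c\<in>(UNIV::2 set). 3 * \<gamma> / h * sqrt ((N 1 w)\<^sup>2 + h * N 1 w * N 2 w))"
    unfolding edge_grad_def by (intro sum_mono edge_partial_le w)
  also have "\<dots> = 18 * \<gamma> / h * sqrt ((N 1 w)\<^sup>2 + h * N 1 w * N 2 w)" by simp
  finally show ?thesis .
qed

lemma edge_dir_deriv_le:
  assumes w: "smooth w"
  shows "(LINT t|lebesgue_on {0..1}. \<bar>dir_deriv v w (linepath (a (i + 1)) (a (i + 2)) t)\<bar>) \<le> norm v * edge_grad w"
proof -
  let ?L = "linepath (a (i + 1)) (a (i + 2))"
  have i: "integrable (lebesgue_on {0..1}) (\<lambda>t. \<bar>partial_deriv c w (?L t)\<bar>)" for c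
    by (intro integrable_abs continuous_linepath_integrable smooth_partial_deriv w)
  have "(LINT t|lebesgue_on {0..1}. \<bar>dir_deriv v w (?L t)\<bar>) \<le> (LINT t|lebesgue_on {0..1}. norm v * (\<Sum>c\<in>UNIV. \<bar>partial_deriv c w (?L t)\<bar>))"
  proof (rule integral_mono)
    show "integrable (lebesgue_on {0..1}) (\<lambda>t. \<bar>dir_deriv v w (?L t)\<bar>)"
      by (intro integrable_abs continuous_linepath_integrable smooth_dir_deriv w)
    show "integrable (lebesgue_on {0..1}) (\<lambda>t. norm v * (\<Sum>c\<in>UNIV. \<bar>partial_deriv c w (?L t)\<bar>))"
      by (intro integrable_mult_right Bochner_Integration.integrable_sum i)
    show "\<bar>dir_deriv v w (?L t)\<bar> \<le> norm v * (\<Sum>c\<in>UNIV. \<bar>partial_deriv c w (?L t)\<bar>)" for t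
      unfolding dir_deriv_def sum_distrib_left
      by (rule order_trans[OF sum_abs], rule sum_mono) (simp add: abs_mult mult_right_mono component_le_norm_cart)
  qed
  also have "\<dots> = norm v * (\<Sum>c\<in>UNIV. LINT t|lebesgue_on {0..1}. \<bar>partial_deriv c w (?L t)\<bar>)"
    using i by simp
  also have "\<dots> \<le> norm v * edge_grad w"
  proof (rule mult_left_mono)
    show "(\<Sum>c\<in>UNIV. LINT t|lebesgue_on {0..1}. \<bar>partial_deriv c w (?L t)\<bar>) \<le> edge_grad w"
      unfolding edge_grad_def
      by (rule member_le_sum[where f = "\<lambda>i. \<Sum>c\<in>UNIV. LINT t|lebesgue_on {0..1}. \<bar>partial_deriv c w (linepath (a (i + 1)) (a (i + 2)) t)\<bar>"])
         (auto intro!: sum_nonneg integral_nonneg_AE)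
  qed simp
  finally show ?thesis .
qed

lemma edge_grad_nonneg: "0 \<le> edge_grad w"
  unfolding edge_grad_def by (intro sum_nonneg integral_nonneg_AE) auto

lemma edge_increment_le:
  assumes w: "smooth w" and s: "0 \<le> s" "s \<le> 1"
  shows "\<bar>w (linepath (a (i + 1)) (a (i + 2)) s) - w (a (i + 1))\<bar> \<le> h * edge_grad w"
proof -
  let ?x = "a (i + 1)" and ?v = "a (i + 2) - a (i + 1)"
  let ?L = "linepath (a (i + 1)) (a (i + 2))"
  have L: "?L t = ?x + t *\<^sub>R ?v" for t by (simp add: linepath_def algebra_simps)
  let ?g = "\<lambda>t. dir_deriv ?v w (?x + t *\<^sub>R ?v)"
  have gc: "continuous_on S ?g" for S by (rule smooth_continuous_line[OF smooth_dir_deriv[OF w]])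
  have ac: "continuous_on S (\<lambda>t. \<bar>?g t\<bar>)" for S by (intro continuous_intros gc)
  have "(?g has_integral w (?x + s *\<^sub>R ?v) - w (?x + 0 *\<^sub>R ?v)) {0..s}"
    by (intro fundamental_theorem_of_calculus)
       (use s smooth_line_dir_deriv[OF w] in \<open>auto simp: has_real_derivative_iff_has_vector_derivative[symmetric]\<close>)
  then have hi: "(?g has_integral w (?L s) - w ?x) {0..s}" by (simp add: L)
  have "\<bar>w (?L s) - w ?x\<bar> = norm (integral {0..s} ?g)" using hi by (simp add: integral_unique)
  also have "\<dots> \<le> integral {0..s} (\<lambda>t. \<bar>?g t\<bar>)"
    by (rule integral_norm_bound_integral) (auto intro!: integrable_continuous_interval gc ac)
  also have "\<dots> \<le> integral {0..1} (\<lambda>t. \<bar>?g t\<bar>)"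
    by (rule integral_subset_le) (use s in \<open>auto intro!: integrable_continuous_interval ac\<close>)
  also have "\<dots> = (LINT t|lebesgue_on {0..1}. \<bar>?g t\<bar>)"
    by (rule lebesgue_integral_eq_integral[symmetric]) (use nn_integral_Icc(2)[OF ac] in auto)
  also have "\<dots> \<le> norm ?v * edge_grad w" using edge_dir_deriv_le[OF w, of ?v i] by (simp add: L)
  also have "\<dots> \<le> h * edge_grad w"
    using dist_le_h[OF vertex_in_tri[OF nd] vertex_in_tri[OF nd]] by (intro mult_right_mono edge_grad_nonneg) (simp add: dist_norm)
  finally show ?thesis .
qed

text \<open>Interpolation reproduces constants, so the value at one vertex may be subtracted. The
  remaining point values are increments along at most two edges, and like the fluxes they are
  bounded by integrals of the gradient over edges.\<close>

lemma dof_sum_le: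
  assumes w: "smooth w"
  shows "dof_sum (\<lambda>i. w (a i) - w (a 0)) (\<lambda>i. w (edge_midpoint a i) - w (a 0)) (\<lambda>i. flux a i w) \<le> 12 * h * edge_grad w"
proof -
  let ?e = "h * edge_grad w"
  have e0: "0 \<le> ?e" using h_pos edge_grad_nonneg by simp
  have v: "\<bar>w (a i) - w (a 0)\<bar> \<le> ?e" for i
  proof (cases rule: type3_cases[of i 0])
    case 1 then show ?thesis using e0 by simp
  next
    case 2
    then show ?thesis using edge_increment_le[OF w, of 1 "0 + 2"] by (simp only: type3_add) (simp add: linepath_def abs_minus_commute)
  next
    case 3
    then show ?thesis using edge_increment_le[OF w, of 1 "0 + 1"] by (simp only: type3_add) (simp add: linepath_def abs_minus_commute)
  qed
  have m: "\<bar>w (edge_midpoint a i) - w (a 0)\<bar> \<le> 2 * ?e" for i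
    using edge_increment_le[OF w, of "1/2" i] v[of "i + 1"] unfolding edge_midpoint_linepath[OF nd] by linarith
  have f: "\<bar>flux a i w\<bar> \<le> ?e" for i
  proof -
    let ?L = "linepath (a (i + 1)) (a (i + 2))"
    have "\<bar>LINT t|lebesgue_on {0..1}. dir_deriv (edge_normal a i) w (?L t)\<bar> \<le> norm (edge_normal a i) * edge_grad w"
      by (rule order_trans[OF integral_abs_bound edge_dir_deriv_le[OF w]])
    then have "dist (a (i + 1)) (a (i + 2)) * \<bar>LINT t|lebesgue_on {0..1}. dir_deriv (edge_normal a i) w (?L t)\<bar> \<le> h * edge_grad w"
      using h_pos by (intro mult_mono dist_le_h vertex_in_tri[OF nd]) (auto simp: norm_edge_normal)
    then show ?thesis
      unfolding flux_def edge_integral_def segment_integral_def normal_deriv_eq[OF w] abs_mult by simp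
  qed
  have "dof_sum (\<lambda>i. w (a i) - w (a 0)) (\<lambda>i. w (edge_midpoint a i) - w (a 0)) (\<lambda>i. flux a i w)
    \<le> (\<Sum>i\<in>(UNIV::3 set). ?e) + (\<Sum>i\<in>(UNIV::3 set). 2 * ?e) + (\<Sum>i\<in>(UNIV::3 set). ?e)"
    unfolding dof_sum_def by (intro add_mono sum_mono v m f)
  also have "\<dots> = 12 * h * edge_grad w" by simp
  finally show ?thesis .
qed

definition smooth_interp :: "(real^2 \<Rightarrow> real) \<Rightarrow> real^2 \<Rightarrow> real" where
  "smooth_interp w = ntw_fun a (\<lambda>i. w (a i)) (\<lambda>i. w (edge_midpoint a i)) (\<lambda>i. flux a i w)"

lemma smooth_smooth_interp: "smooth (smooth_interp w)"
  unfolding smooth_interp_def by (rule smooth_ntw_fun)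

lemma N_diff_const: "smooth f \<Longrightarrow> N (Suc j) (\<lambda>x. f x - c) = N (Suc j) f"
  by (auto simp: N_eq smooth_diff smooth_const partial_derivs_diff partial_derivs_const intro!: L2_set_cong)

lemma N_triangle_diff: "smooth f \<Longrightarrow> smooth g \<Longrightarrow> N j (\<lambda>x. f x - g x) \<le> N j f + N j g"
  using T_props(1,2) by (intro grad_norm_triangle_diff[where m = j] smooth_sobolev) auto

lemma N_triangle: "smooth f \<Longrightarrow> smooth g \<Longrightarrow> N j (\<lambda>x. f x + g x) \<le> N j f + N j g"
  using T_props(1,2) by (intro grad_norm_triangle[where m = j] smooth_sobolev) auto

lemma smooth_interp_N_le:
  assumes w: "smooth w" and j: "Suc j \<le> 2"
  shows "N (Suc j) (smooth_interp w) \<le> 96 * C_interp * h\<^sup>2 / h ^ Suc j * edge_grad w"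
proof -
  let ?P = "ntw_fun a (\<lambda>i. w (a i) - w (a 0)) (\<lambda>i. w (edge_midpoint a i) - w (a 0)) (\<lambda>i. flux a i w)"
  have eq: "?P = (\<lambda>x. smooth_interp w x - w (a 0))"
    using ntw_fun_diff[of "\<lambda>i. w (a i)" "\<lambda>i. w (a 0)" "\<lambda>i. w (edge_midpoint a i)" "\<lambda>i. w (a 0)" "\<lambda>i. flux a i w" "\<lambda>i. 0"]
    by (simp add: smooth_interp_def ntw_fun_const fun_eq_iff)
  have "N (Suc j) (smooth_interp w) = N (Suc j) ?P"
    unfolding eq by (rule N_diff_const[symmetric]) (rule smooth_smooth_interp)
  also have "\<dots> \<le> 8 * C_interp * dof_sum (\<lambda>i. w (a i) - w (a 0)) (\<lambda>i. w (edge_midpoint a i) - w (a 0)) (\<lambda>i. flux a i w) * (h / h ^ Suc j)"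
    by (rule ntw_fun_N_le[OF j])
  also have "\<dots> \<le> 8 * C_interp * (12 * h * edge_grad w) * (h / h ^ Suc j)"
    using h_pos gamma_ge_1 by (intro mult_right_mono mult_left_mono dof_sum_le w) (auto simp: C_interp_def)
  also have "\<dots> = 96 * C_interp * h\<^sup>2 / h ^ Suc j * edge_grad w" by (simp add: power2_eq_square)
  finally show ?thesis .
qed

definition C_stab where "C_stab = 1728 * \<gamma> * C_interp"

lemma C_stab_nonneg: "0 \<le> C_stab"
  using gamma_ge_1 by (simp add: C_stab_def C_interp_def)

text \<open>A multiplicative form of stability, which the second estimate of the theorem needs: if \<open>N 1 w\<close>
  is small against \<open>h * N 2 w\<close>, then the right-hand side is essentially their geometric mean.\<close>

lemma smooth_interp_N1_le:
  assumes w: "smooth w"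
  shows "N 1 (smooth_interp w) \<le> C_stab * sqrt ((N 1 w)\<^sup>2 + h * N 1 w * N 2 w)"
    and "h * N 2 (smooth_interp w) \<le> C_stab * sqrt ((N 1 w)\<^sup>2 + h * N 1 w * N 2 w)"
proof -
  let ?q = "sqrt ((N 1 w)\<^sup>2 + h * N 1 w * N 2 w)"
  have C: "0 \<le> 96 * C_interp * h" using gamma_ge_1 h_pos by (simp add: C_interp_def)
  have "96 * C_interp * h * edge_grad w \<le> 96 * C_interp * h * (18 * \<gamma> / h * ?q)"
    by (intro mult_left_mono edge_grad_le w C)
  also have "\<dots> = C_stab * ?q" using h_pos by (simp add: C_stab_def)
  finally have b: "96 * C_interp * h * edge_grad w \<le> C_stab * ?q" .
  have "N 1 (smooth_interp w) \<le> 96 * C_interp * h * edge_grad w"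
    using smooth_interp_N_le[OF w, of 0] h_pos by (simp add: power2_eq_square)
  with b show "N 1 (smooth_interp w) \<le> C_stab * ?q" by linarith
  have "N 2 (smooth_interp w) \<le> 96 * C_interp * edge_grad w"
    using smooth_interp_N_le[OF w, of 1] h_pos by (simp add: power2_eq_square flip: numeral_2_eq_2)
  then have "h * N 2 (smooth_interp w) \<le> h * (96 * C_interp * edge_grad w)" using h_pos by (intro mult_left_mono) auto
  with b show "h * N 2 (smooth_interp w) \<le> C_stab * ?q" by (simp add: mult_ac)
qed

text \<open>The Poincare inequality applies after the mean value \<open>m\<close> is subtracted. Since \<open>e\<close> vanishes at
  a vertex, \<open>- m\<close> is a point value of \<open>e - m\<close>, and is bounded by the norms of \<open>e - m\<close>.\<close>

lemma N0_le_if_zero_at_vertex: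
  assumes e: "smooth e" and z: "e (a 0) = 0"
  shows "N 0 e \<le> h * ((2 + 432 * \<gamma>\<^sup>2) * N 1 e + 144 * \<gamma>\<^sup>2 * h * N 2 e)"
proof -
  define m where "m = (LINT x|lebesgue_on T. e x) / measure lebesgue T"
  let ?f = "\<lambda>x. e x - m"
  have f: "smooth ?f" by (intro smooth_diff e smooth_const)
  have ei: "integrable (lebesgue_on T) e" by (rule L2_integrable[OF T_props(5) smooth_T_L2[OF e]])
  interpret finite_measure "lebesgue_on T"
    using T_props(5) by (simp add: finite_measure_lebesgue_on)
  have ms: "measure (lebesgue_on T) T = measure lebesgue T"
    using T_props(6) by (simp add: measure_restrict_space)
  have "(LINT x|lebesgue_on T. ?f x) = 0"
    using ei measure_T_pos by (simp add: ms m_def)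
  from Poincare[OF f this] have P: "N 0 ?f \<le> 2 * h * N 1 e" using N_diff_const[OF e, of 0] by simp
  have n2: "N 1 ?f = N 1 e" "N 2 ?f = N 2 e" using N_diff_const[OF e] by (simp_all add: numeral_2_eq_2)
  have "\<bar>m\<bar> = \<bar>?f (a 0)\<bar>" using z by simp
  also have "\<dots> \<le> 72 * \<gamma>\<^sup>2 / h * (N 0 ?f + h * N 1 ?f + h\<^sup>2 * N 2 ?f)" by (rule sup_bound[OF f vertex_in_tri[OF nd]])
  also have "\<dots> \<le> 72 * \<gamma>\<^sup>2 / h * (2 * h * N 1 e + h * N 1 e + h\<^sup>2 * N 2 e)"
    unfolding n2 using P h_pos by (intro mult_left_mono add_mono) auto
  also have "\<dots> = 72 * \<gamma>\<^sup>2 * (3 * N 1 e + h * N 2 e)" using h_pos by (simp add: field_simps power2_eq_square)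
  finally have m: "\<bar>m\<bar> \<le> 72 * \<gamma>\<^sup>2 * (3 * N 1 e + h * N 2 e)" .
  have "N 0 (\<lambda>x. m) = L2_norm T (\<lambda>x. m)" by (rule N_0) (rule smooth_const)
  also have "\<dots> \<le> \<bar>m\<bar> * sqrt (measure lebesgue T)" by (rule L2_bounded(2)[OF T_props(5)]) auto
  also have "\<dots> \<le> \<bar>m\<bar> * (2 * h)" by (intro mult_left_mono sqrt_measure_T_le) simp
  also have "\<dots> \<le> 72 * \<gamma>\<^sup>2 * (3 * N 1 e + h * N 2 e) * (2 * h)" using h_pos by (intro mult_right_mono m) simp
  finally have "N 0 (\<lambda>x. m) \<le> 72 * \<gamma>\<^sup>2 * (3 * N 1 e + h * N 2 e) * (2 * h)" .
  moreover have "N 0 e \<le> N 0 ?f + N 0 (\<lambda>x. m)" using N_triangle[OF f smooth_const, of 0 m] by simp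
  ultimately show ?thesis using P by (simp add: algebra_simps)
qed

definition C_est where "C_est = (1 + C_stab) * (4 + 576 * \<gamma>\<^sup>2)"

lemma C_est_nonneg: "0 \<le> C_est"
  unfolding C_est_def using C_stab_nonneg by simp

lemma smooth_interp_vertex: "smooth_interp w (a i) = w (a i)"
  by (simp add: smooth_interp_def ntw_fun_dofs)

text \<open>Stability and the triangle inequality bound the derivatives of the error, which in turn bound
  its \<open>L\<^sup>2\<close> norm because it vanishes at a vertex.\<close>

lemma smooth_interp_error:
  assumes w: "smooth w"
  defines "e \<equiv> \<lambda>x. w x - smooth_interp w x"
  shows "N 0 e + h * N 1 e + h\<^sup>2 * N 2 e \<le> C_est * h * (N 1 w + h * N 2 w)"
proof -
  define X where "X = N 1 w + h * N 2 w"
  have e: "smooth e" unfolding e_def by (intro smooth_diff w smooth_smooth_interp)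
  have "(N 1 w)\<^sup>2 + h * N 1 w * N 2 w \<le> X\<^sup>2"
    unfolding X_def using h_pos by (simp add: power2_sum power2_eq_square[of "h * N 2 w"])
  then have q: "sqrt ((N 1 w)\<^sup>2 + h * N 1 w * N 2 w) \<le> X"
    unfolding X_def using h_pos by (intro real_le_lsqrt) auto
  have P1: "N 1 (smooth_interp w) \<le> C_stab * X" "h * N 2 (smooth_interp w) \<le> C_stab * X"
    using smooth_interp_N1_le[OF w] mult_left_mono[OF q C_stab_nonneg] by linarith+
  have X: "N 1 w \<le> X" "h * N 2 w \<le> X" unfolding X_def using h_pos by auto
  have e1: "N 1 e \<le> (1 + C_stab) * X"
    using N_triangle_diff[OF w smooth_smooth_interp, of 1 w] P1(1) X(1) unfolding e_def distrib_right by linarith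
  have "h * N 2 e \<le> h * (N 2 w + N 2 (smooth_interp w))"
    unfolding e_def using h_pos by (intro mult_left_mono N_triangle_diff w smooth_smooth_interp) simp
  then have e2: "h * N 2 e \<le> (1 + C_stab) * X"
    using P1(2) X(2) unfolding distrib_right distrib_left[of h "N 2 w"] by linarith
  have "N 0 e \<le> h * ((2 + 432 * \<gamma>\<^sup>2) * N 1 e + 144 * \<gamma>\<^sup>2 * h * N 2 e)"
    by (rule N0_le_if_zero_at_vertex[OF e]) (simp add: e_def smooth_interp_vertex)
  then have "N 0 e + h * N 1 e + h\<^sup>2 * N 2 e \<le> h * ((3 + 432 * \<gamma>\<^sup>2) * N 1 e + (1 + 144 * \<gamma>\<^sup>2) * (h * N 2 e))"
    by (simp add: algebra_simps power2_eq_square)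
  also have "\<dots> \<le> h * ((3 + 432 * \<gamma>\<^sup>2) * ((1 + C_stab) * X) + (1 + 144 * \<gamma>\<^sup>2) * ((1 + C_stab) * X))"
    using h_pos by (intro mult_left_mono add_mono e1 e2) auto
  also have "\<dots> = C_est * h * X" by (simp add: C_est_def algebra_simps)
  finally show ?thesis by (simp only: X_def)
qed

section \<open>Error estimates for smooth functions\<close>

text \<open>Quadratic polynomials are reproduced, so the error does not change when one is subtracted.\<close>

lemma smooth_interp_minus_poly:
  assumes u: "smooth u" and q: "q \<in> poly_space 2"
  shows "(\<lambda>x. (u x - q x) - smooth_interp (\<lambda>x. u x - q x) x) = (\<lambda>x. u x - smooth_interp u x)"
proof -
  have qs: "smooth q" by (rule poly_space_smooth(2)[OF q])
  have "(\<lambda>x. q x + bubble3 a x * 0) \<in> NTW_space a"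
    unfolding NTW_space_def bubble_eq[OF nd]
  proof (rule CollectI, intro exI conjI)
    show "(\<lambda>x. q x + bubble3 a x * 0) = (\<lambda>x. q x + bubble3 a x * (\<lambda>x. 0) x)" by simp
    show "(\<lambda>x. 0) \<in> poly_space 1" by (rule poly_space_1_const)
  qed (rule q)
  then have "q \<in> NTW_space a" by simp
  then have "smooth_interp q = q" using NTW_space_eq_ntw_fun[of q] by (simp add: smooth_interp_def)
  moreover have "smooth_interp (\<lambda>x. u x - q x) x = smooth_interp u x - smooth_interp q x" for x
    unfolding smooth_interp_def flux_diff[OF u qs] by (rule ntw_fun_diff)
  ultimately show ?thesis by (simp add: fun_eq_iff)
qed

lemma mean_zero:
  assumes f: "smooth f"
  shows "(LINT x|lebesgue_on T. f x - (LINT x|lebesgue_on T. f x) / measure lebesgue T) = 0"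
proof -
  interpret finite_measure "lebesgue_on T"
    using T_props(5) by (simp add: finite_measure_lebesgue_on)
  have "measure (lebesgue_on T) T = measure lebesgue T"
    using T_props(6) by (simp add: measure_restrict_space)
  then show ?thesis using measure_T_pos L2_integrable[OF T_props(5) smooth_T_L2[OF f]] by simp
qed

text \<open>Here \<open>q\<close> is linear, and its gradient is the mean value of the gradient of \<open>u\<close>.\<close>

lemma affine_correction:
  assumes u: "smooth u"
  shows "\<exists>q\<in>poly_space 2. N 1 (\<lambda>x. u x - q x) \<le> 2 * h * N 2 u \<and> N 2 (\<lambda>x. u x - q x) = N 2 u"
proof -
  define c where "c = (\<chi> i. (LINT x|lebesgue_on T. partial_deriv i u x) / measure lebesgue T)"
  define q where "q x = c \<bullet> x + 0" for x
  have qp: "q \<in> poly_space 2"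
    unfolding poly_space_2_iff q_def[abs_def] inner_real2
    by (rule exI[of _ 0], rule exI[of _ "c $ 1"], rule exI[of _ "c $ 2"], rule exI[of _ 0], rule exI[of _ 0], rule exI[of _ 0]) simp
  have qs: "smooth q" by (rule poly_space_smooth(2)[OF qp])
  have w: "smooth (\<lambda>x. u x - q x)" by (intro smooth_diff u qs)
  have pd: "partial_deriv i (\<lambda>x. u x - q x) = (\<lambda>x. partial_deriv i u x - c $ i)" for i
    using partial_derivs_diff[OF u qs, of "[i]"] by (simp add: q_def[abs_def] partial_deriv_inner del: add_0_right)
  have "N 2 (\<lambda>x. u x - q x) = N 2 u"
  proof (rule power2_eq_imp_eq)
    have "(N (Suc 1) (\<lambda>x. u x - q x))\<^sup>2 = (N (Suc 1) u)\<^sup>2"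
      unfolding N_Suc[OF w] N_Suc[OF u] pd
      using N_diff_const[OF smooth_partial_deriv[OF u], of 0] by simp
    then show "(N 2 (\<lambda>x. u x - q x))\<^sup>2 = (N 2 u)\<^sup>2" by (simp flip: numeral_2_eq_2)
  qed auto
  moreover have "N 1 (\<lambda>x. u x - q x) \<le> 2 * h * N 2 (\<lambda>x. u x - q x)"
    by (rule Poincare_grad[OF w]) (unfold pd c_def vec_lambda_beta, rule mean_zero[OF smooth_partial_deriv[OF u]])
  ultimately show ?thesis using qp by auto
qed

lemma partial_deriv_nth: "partial_deriv i (\<lambda>x. x $ k) = (\<lambda>x. if i = k then 1 else 0)"
proof -
  have "partial_deriv i (\<lambda>x. x $ k) = (\<lambda>x. axis k 1 $ i)"
    using partial_deriv_inner[of i "axis k 1" 0] by (simp add: inner_axis')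
  then show ?thesis by (simp add: axis_def)
qed

text \<open>Here the second derivatives of \<open>q\<close> are the mean values of those of \<open>u\<close>. Such a \<open>q\<close> exists
  because the mixed derivatives commute.\<close>

lemma quadratic_correction:
  assumes u: "smooth u"
  shows "\<exists>q\<in>poly_space 2. N 2 (\<lambda>x. u x - q x) \<le> 2 * h * N 3 u"
proof -
  define c where "c i j = (LINT x|lebesgue_on T. partial_deriv i (partial_deriv j u) x) / measure lebesgue T" for i j
  have cs: "c i j = c j i" for i j unfolding c_def partial_deriv_commute[OF u, of i j] ..
  \<comment> \<open>by symmetry of \<open>c\<close> the mixed coefficient is \<open>(c 1 2 + c 2 1) / 2 = c 1 2\<close>\<close>
  define q where "q = (\<lambda>x::real^2. c 1 1 / 2 * (x $ 1 * x $ 1) + c 1 2 * (x $ 1 * x $ 2) + c 2 2 / 2 * (x $ 2 * x $ 2))"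
  have qp: "q \<in> poly_space 2"
    unfolding poly_space_2_iff q_def
    by (rule exI[of _ 0], rule exI[of _ 0], rule exI[of _ 0], rule exI[of _ "c 1 1 / 2"], rule exI[of _ "c 1 2"], rule exI[of _ "c 2 2 / 2"]) simp
  have qs: "smooth q" by (rule poly_space_smooth(2)[OF qp])
  have q1: "partial_deriv j q = (\<lambda>x. c j 1 * x $ 1 + c j 2 * x $ 2)" for j
  proof -
    have sm: "smooth (\<lambda>x::real^2. x $ k * x $ l)" for k l by (intro smooth_mult smooth_nth)
    have m: "partial_deriv j (\<lambda>x::real^2. x $ k * x $ l) = (\<lambda>x. (if j = k then 1 else 0) * x $ l + x $ k * (if j = l then 1 else 0))" for k l
      using partial_deriv_mult[of "\<lambda>x. x $ k" "\<lambda>x. x $ l" j] by (simp add: smooth_differentiable smooth_nth partial_deriv_nth)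
    have "partial_deriv j q = (\<lambda>x. c 1 1 / 2 * ((if j = 1 then 1 else 0) * x $ 1 + x $ 1 * (if j = 1 then 1 else 0))
        + c 1 2 * ((if j = 1 then 1 else 0) * x $ 2 + x $ 1 * (if j = 2 then 1 else 0))
        + c 2 2 / 2 * ((if j = 2 then 1 else 0) * x $ 2 + x $ 2 * (if j = 2 then 1 else 0)))"
      unfolding q_def
      by (subst partial_deriv_add; (intro smooth_differentiable smooth_add smooth_cmult sm)?)+
         (simp only: partial_deriv_cmult[OF sm] m)
    moreover have "j = 1 \<or> j = 2" by (rule exhaust_2)
    ultimately show ?thesis using cs[of 2 1] by (auto simp: fun_eq_iff)
  qed
  have q2: "partial_deriv i (partial_deriv j q) = (\<lambda>x. c i j)" for i j
  proof -
    have "(\<lambda>x::real^2. c j 1 * x $ 1 + c j 2 * x $ 2) = (\<lambda>x. (\<chi> k. c j k) \<bullet> x + 0)" by (simp add: inner_real2)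
    then have "partial_deriv i (partial_deriv j q) = (\<lambda>x. c j i)" unfolding q1 by (simp only: partial_deriv_inner) simp
    then show ?thesis by (simp add: cs[of i j])
  qed
  have w: "smooth (\<lambda>x. u x - q x)" by (intro smooth_diff u qs)
  have pd2: "partial_deriv i (partial_deriv j (\<lambda>x. u x - q x)) = (\<lambda>x. partial_deriv i (partial_deriv j u) x - c i j)" for i j
    using partial_derivs_diff[OF u qs, of "[i, j]"] by (simp add: q2)
  have "N 3 (\<lambda>x. u x - q x) = N 3 u"
  proof (rule power2_eq_imp_eq)
    have "(N (Suc (Suc 1)) (\<lambda>x. u x - q x))\<^sup>2 = (N (Suc (Suc 1)) u)\<^sup>2"
      unfolding N_Suc[OF w] N_Suc[OF u] N_Suc[OF smooth_partial_deriv[OF w]] N_Suc[OF smooth_partial_deriv[OF u]] pd2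
      using N_diff_const[OF smooth_partial_deriv[OF smooth_partial_deriv[OF u]], of 0] by simp
    then show "(N 3 (\<lambda>x. u x - q x))\<^sup>2 = (N 3 u)\<^sup>2" by (simp flip: numeral_3_eq_3)
  qed auto
  moreover have "N 2 (\<lambda>x. u x - q x) \<le> 2 * h * N 3 (\<lambda>x. u x - q x)"
    by (rule Poincare_hessian[OF w]) (unfold pd2 c_def, rule mean_zero[OF smooth_partial_deriv[OF smooth_partial_deriv[OF u]]])
  ultimately show ?thesis using qp by auto
qed

definition interp_error_sum :: "(real^2 \<Rightarrow> real) \<Rightarrow> real" where
  "interp_error_sum e = N 0 e + h * N 1 e + h\<^sup>2 * N 2 e"

lemma smooth_estimate_2:
  assumes u: "smooth u"
  shows "interp_error_sum (\<lambda>x. u x - smooth_interp u x) \<le> 3 * C_est * h\<^sup>2 * N 2 u"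
proof -
  obtain q where q: "q \<in> poly_space 2" "N 1 (\<lambda>x. u x - q x) \<le> 2 * h * N 2 u" "N 2 (\<lambda>x. u x - q x) = N 2 u"
    using affine_correction[OF u] by blast
  let ?w = "\<lambda>x. u x - q x"
  have w: "smooth ?w" by (intro smooth_diff u poly_space_smooth(2) q)
  have "interp_error_sum (\<lambda>x. u x - smooth_interp u x) \<le> C_est * h * (N 1 ?w + h * N 2 ?w)"
    using smooth_interp_error[OF w] unfolding smooth_interp_minus_poly[OF u q(1)] interp_error_sum_def .
  also have "\<dots> \<le> C_est * h * (2 * h * N 2 u + h * N 2 u)"
    using q(2,3) C_est_nonneg h_pos by (intro mult_left_mono) auto
  also have "\<dots> = 3 * C_est * h\<^sup>2 * N 2 u" by (simp add: power2_eq_square)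
  finally show ?thesis .
qed

text \<open>After subtraction of a quadratic polynomial the second-order estimate applies, with a second
  derivative that is bounded by the third.\<close>

lemma smooth_estimate_3:
  assumes u: "smooth u"
  shows "interp_error_sum (\<lambda>x. u x - smooth_interp u x) \<le> 6 * C_est * h ^ 3 * N 3 u"
proof -
  obtain q1 where q1: "q1 \<in> poly_space 2" "N 2 (\<lambda>x. u x - q1 x) \<le> 2 * h * N 3 u"
    using quadratic_correction[OF u] by blast
  let ?u1 = "\<lambda>x. u x - q1 x"
  have u1: "smooth ?u1" by (intro smooth_diff u poly_space_smooth(2) q1)
  have "interp_error_sum (\<lambda>x. ?u1 x - smooth_interp ?u1 x) \<le> 3 * C_est * h\<^sup>2 * N 2 ?u1"
    by (rule smooth_estimate_2[OF u1])
  also have "\<dots> \<le> 3 * C_est * h\<^sup>2 * (2 * h * N 3 u)"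
    using C_est_nonneg by (intro mult_left_mono q1) auto
  also have "\<dots> = 6 * C_est * h ^ 3 * N 3 u" by (simp add: power2_eq_square power3_eq_cube)
  finally show ?thesis unfolding smooth_interp_minus_poly[OF u q1(1)] .
qed

definition C_mult where "C_mult = 1 + 2 * C_stab + 3 * C_est"

text \<open>If \<open>N 1 u \<le> h * N 2 u\<close>, then \<open>N 1 u\<close> is at most the geometric mean \<open>s\<close> of the two, and
  stability suffices; otherwise \<open>h * N 2 u\<close> is at most \<open>s\<close>, and the estimate by the second
  derivatives suffices.\<close>

lemma smooth_estimate_mult:
  assumes u: "smooth u"
  shows "N 1 (\<lambda>x. u x - smooth_interp u x) \<le> C_mult * sqrt h * sqrt (N 1 u) * sqrt (N 2 u)"
proof -
  let ?e = "\<lambda>x. u x - smooth_interp u x"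
  define s where "s = sqrt h * sqrt (N 1 u) * sqrt (N 2 u)"
  have s: "s = sqrt (h * N 1 u * N 2 u)" "0 \<le> s" using h_pos by (simp_all add: s_def real_sqrt_mult)
  have n: "0 \<le> C_stab" "0 \<le> C_est" by (rule C_stab_nonneg C_est_nonneg)+
  have "N 1 ?e \<le> C_mult * s"
  proof (cases "N 1 u \<le> h * N 2 u")
    case True
    have "(N 1 u)\<^sup>2 \<le> h * N 1 u * N 2 u"
      using mult_left_mono[OF True N_nonneg, of 1 u] by (simp add: power2_eq_square mult_ac)
    then have 1: "N 1 u \<le> s" unfolding s(1) by (rule real_le_rsqrt)
    have "(N 1 u)\<^sup>2 + h * N 1 u * N 2 u \<le> (2 * s)\<^sup>2"
    proof -
      have "0 \<le> h * N 1 u * N 2 u" using h_pos by simp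
      moreover from this have "(2 * s)\<^sup>2 = 4 * (h * N 1 u * N 2 u)" by (simp only: s(1) power_mult_distrib) simp
      ultimately show ?thesis using \<open>(N 1 u)\<^sup>2 \<le> h * N 1 u * N 2 u\<close> by linarith
    qed
    then have 2: "sqrt ((N 1 u)\<^sup>2 + h * N 1 u * N 2 u) \<le> 2 * s"
      using s(2) by (intro real_le_lsqrt) auto
    have "N 1 ?e \<le> N 1 u + N 1 (smooth_interp u)" by (intro N_triangle_diff u smooth_smooth_interp)
    also have "\<dots> \<le> s + C_stab * (2 * s)"
      by (intro add_mono 1 order_trans[OF smooth_interp_N1_le(1)[OF u]] mult_left_mono 2 n)
    also have "\<dots> \<le> C_mult * s"
    proof -
      have "0 \<le> 3 * C_est * s" using n s(2) by simp
      then show ?thesis by (simp add: C_mult_def algebra_simps)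
    qed
    finally show ?thesis .
  next
    case False
    have "h * N 1 ?e \<le> interp_error_sum ?e"
      unfolding interp_error_sum_def by simp
    also have "\<dots> \<le> 3 * C_est * h\<^sup>2 * N 2 u" by (rule smooth_estimate_2[OF u])
    finally have "h * N 1 ?e \<le> h * (3 * C_est * (h * N 2 u))" by (simp add: power2_eq_square mult_ac)
    then have "N 1 ?e \<le> 3 * C_est * (h * N 2 u)" using h_pos by simp
    also have "\<dots> \<le> 3 * C_est * s"
    proof (rule mult_left_mono)
      have "(h * N 2 u)\<^sup>2 \<le> h * N 1 u * N 2 u"
        using mult_left_mono[of "h * N 2 u" "N 1 u" "h * N 2 u"] False h_pos by (simp add: power2_eq_square mult_ac)
      then show "h * N 2 u \<le> s" unfolding s(1) by (rule real_le_rsqrt)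
    qed (use n in simp)
    also have "\<dots> \<le> C_mult * s" using n s(2) by (intro mult_right_mono) (auto simp: C_mult_def)
    finally show ?thesis .
  qed
  then show ?thesis by (simp add: s_def mult.assoc)
qed

section \<open>Passage to the limit\<close>

lemma N_0_L2:
  assumes f: "f \<in> L2_space T"
  shows "N 0 f = L2_norm T f"
proof -
  have "has_weak_deriv T [] f f"
    using L2_locally_integrable[OF T_props(5) f] by (simp add: has_weak_deriv_def)
  then have "N 0 f = L2_set (\<lambda>is. L2_norm T f) {is :: 2 list. length is = 0}"
    by (intro grad_norm_eqI[OF T_props(1,2)]) (use f in auto)
  then show ?thesis by (simp add: L2_set_def)
qed

lemma continuous_eq_if_AE:
  assumes f: "continuous_on K f" and g: "continuous_on K g" and ae: "AE x in lebesgue_on T. f x = (g x :: real)"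
    and x: "x \<in> K"
  shows "f x = g x"
proof -
  let ?C = "{x \<in> K. f x = g x}"
  have C: "closed ?C"
  proof -
    have "closed (K \<inter> (\<lambda>x. f x - g x) -` {0})"
      by (rule continuous_closed_preimage[OF continuous_on_diff[OF f g] compact_imp_closed[OF compact_tri[OF nd]]]) simp
    moreover have "K \<inter> (\<lambda>x. f x - g x) -` {0} = ?C" by auto
    ultimately show ?thesis by simp
  qed
  have "AE x in lebesgue. x \<in> T \<longrightarrow> x \<in> ?C"
    using ae T_props(6,7) by (subst (asm) AE_restrict_space_iff) (auto elim!: eventually_mono)
  then have "T \<subseteq> ?C" using mem_closed_if_AE_lebesgue_open[OF T_props(1) C] by blast
  then have "closure T \<subseteq> ?C" using C by (rule closure_minimal)
  then show ?thesis using x closure_interior_tri[OF nd] by blast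
qed

context
  fixes v and u :: "nat \<Rightarrow> real^2 \<Rightarrow> real" and m
  assumes m: "2 \<le> m" and v: "v \<in> sobolev_space m T" and u: "\<And>k. smooth (u k)"
    and lim: "\<And>j. j \<le> m \<Longrightarrow> (\<lambda>k. N j (\<lambda>x. u k x - v x)) \<longlonglongrightarrow> 0"
begin

lemma u_sobolev: "u k \<in> sobolev_space m T"
  using T_props(1,2) u by (rule smooth_sobolev)

lemma v_L2: "v \<in> L2_space T"
  using v by (simp add: sobolev_space_def)

lemma N_u_diff_le:
  assumes "j \<le> m"
  shows "N j (\<lambda>x. u k x - u l x) \<le> N j (\<lambda>x. u k x - v x) + N j (\<lambda>x. u l x - v x)"
proof -
  note d = sobolev_diff[OF T_props(1,2) u_sobolev v]
  show ?thesis using grad_norm_triangle_diff[OF T_props(1,2) d d assms, of k l] by simp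
qed

text \<open>By the bound for point values the approximations are uniformly Cauchy on the closed triangle.
  Their uniform limit is continuous and almost everywhere equal to \<open>v\<close>, and these two properties
  determine it.\<close>

lemma point_values_converge:
  assumes x: "x \<in> K"
  shows "(\<lambda>k. u k x) \<longlonglongrightarrow> cont_rep K v x"
proof -
  define C where "C = 72 * \<gamma>\<^sup>2 / h"
  define d where "d k = N 0 (\<lambda>x. u k x - v x) + h * N 1 (\<lambda>x. u k x - v x) + h\<^sup>2 * N 2 (\<lambda>x. u k x - v x)" for k
  have C: "0 \<le> C" using h_pos by (simp add: C_def)
  have dn: "0 \<le> d k" for k using h_pos by (simp add: d_def)
  have "d \<longlonglongrightarrow> 0 + h * 0 + h\<^sup>2 * 0" unfolding d_def using m by (intro tendsto_intros lim) auto
  then have "(\<lambda>k. C * d k) \<longlonglongrightarrow> C * 0" by (intro tendsto_intros) simp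
  then have Cd: "(\<lambda>k. C * d k) \<longlonglongrightarrow> 0" by simp
  have b: "\<bar>u k x - u l x\<bar> \<le> C * d k + C * d l" if "x \<in> K" for k l x
  proof -
    have "\<bar>u k x - u l x\<bar> \<le> C * (N 0 (\<lambda>x. u k x - u l x) + h * N 1 (\<lambda>x. u k x - u l x) + h\<^sup>2 * N 2 (\<lambda>x. u k x - u l x))"
      unfolding C_def by (rule sup_bound[OF smooth_diff[OF u u] that])
    also have "\<dots> \<le> C * ((N 0 (\<lambda>x. u k x - v x) + N 0 (\<lambda>x. u l x - v x)) + h * (N 1 (\<lambda>x. u k x - v x) + N 1 (\<lambda>x. u l x - v x))
        + h\<^sup>2 * (N 2 (\<lambda>x. u k x - v x) + N 2 (\<lambda>x. u l x - v x)))"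
      using C h_pos m by (intro mult_left_mono add_mono N_u_diff_le) auto
    also have "\<dots> = C * d k + C * d l" by (simp add: d_def algebra_simps)
    finally show ?thesis .
  qed
  have "uniformly_Cauchy_on K u"
    unfolding uniformly_Cauchy_on_def
  proof (intro allI impI)
    fix e :: real assume "0 < e"
    then have "\<forall>\<^sub>F k in sequentially. C * d k < e / 2" by (intro order_tendstoD(2)[OF Cd]) simp
    then obtain M where M: "\<And>k. k \<ge> M \<Longrightarrow> C * d k < e / 2" unfolding eventually_sequentially by blast
    show "\<exists>M. \<forall>x\<in>K. \<forall>k\<ge>M. \<forall>n\<ge>M. dist (u k x) (u n x) < e"
    proof (intro exI[of _ M] ballI allI impI)
      fix x k n assume "x \<in> K" "M \<le> k" "M \<le> n"
      then show "dist (u k x) (u n x) < e"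
        using b[of x k n] M[of k] M[of n] unfolding dist_real_def by linarith
    qed
  qed
  then obtain g where g: "uniform_limit K u g sequentially"
    using Cauchy_uniformly_convergent uniformly_convergent_on_def by blast
  have gc: "continuous_on K g"
    by (rule uniform_limit_theorem[OF _ g]) (auto intro!: always_eventually smooth_continuous u)
  have pt: "(\<lambda>k. u k x) \<longlonglongrightarrow> g x" if "x \<in> K" for x
    by (rule tendsto_uniform_limitI[OF g that])
  have gm: "g \<in> borel_measurable (lebesgue_on T)"
    by (rule continuous_imp_measurable_on_sets_lebesgue[OF continuous_on_subset[OF gc T_props(7)] T_props(6)])
  have gb: "\<bar>u k x - g x\<bar> \<le> C * d k" if x: "x \<in> K" for k x
  proof -
    have "(\<lambda>l. \<bar>u k x - u l x\<bar>) \<longlonglongrightarrow> \<bar>u k x - g x\<bar>" by (intro tendsto_intros pt x)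
    moreover have "(\<lambda>l. C * d k + C * d l) \<longlonglongrightarrow> C * d k + 0" by (intro tendsto_intros Cd)
    ultimately show ?thesis using b[OF x] by (intro LIMSEQ_le[of _ "\<bar>u k x - g x\<bar>" _ "C * d k"]) auto
  qed
  have um: "u k \<in> borel_measurable (lebesgue_on T)" for k
    by (intro smooth_lebesgue_on_measurable T_props u)
  have ug: "(\<lambda>x. u k x - g x) \<in> L2_space T" "L2_norm T (\<lambda>x. u k x - g x) \<le> C * d k * sqrt (measure lebesgue T)" for k
    by (rule L2_bounded[OF T_props(5)]; use gb T_props(7) um gm in auto)+
  have gL: "g \<in> L2_space T" using L2_diff[OF smooth_T_L2[OF u] ug(1), of 0 0] by simp
  have "L2_norm T (\<lambda>x. g x - v x) \<le> 0"
  proof (rule LIMSEQ_le_const)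
    have "(\<lambda>k. C * d k * sqrt (measure lebesgue T) + N 0 (\<lambda>x. u k x - v x)) \<longlonglongrightarrow> 0 * sqrt (measure lebesgue T) + 0"
      using m by (intro tendsto_intros Cd lim) auto
    then show "(\<lambda>k. C * d k * sqrt (measure lebesgue T) + N 0 (\<lambda>x. u k x - v x)) \<longlonglongrightarrow> 0" by simp
    have "L2_norm T (\<lambda>x. g x - v x) \<le> C * d k * sqrt (measure lebesgue T) + N 0 (\<lambda>x. u k x - v x)" for k
      using L2_norm_triangle3[OF gL smooth_T_L2[OF u] v_L2, of k] ug(2)[of k] L2_norm_minus_commute[of T g "u k"]
        N_0_L2[OF L2_diff[OF smooth_T_L2[OF u] v_L2], of k] by simp
    then show "\<exists>M. \<forall>k\<ge>M. L2_norm T (\<lambda>x. g x - v x) \<le> C * d k * sqrt (measure lebesgue T) + N 0 (\<lambda>x. u k x - v x)" by blast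
  qed
  then have "L2_norm T (\<lambda>x. g x - v x) = 0" using L2_norm_nonneg by (rule antisym)
  from L2_norm_eq_0_AE[OF L2_diff[OF gL v_L2] this] have ae: "AE x in lebesgue_on T. g x = v x" by simp
  have cr: "continuous_on K (cont_rep K v) \<and> (AE x in lebesgue_on T. cont_rep K v x = v x)"
    unfolding cont_rep_def by (rule someI[of _ g]) (use gc ae in blast)
  have "AE x in lebesgue_on T. cont_rep K v x = g x"
    using conjunct2[OF cr] ae by eventually_elim simp
  from continuous_eq_if_AE[OF conjunct1[OF cr] gc this x] show ?thesis using pt[OF x] by simp
qed

end

abbreviation edge_path where "edge_path i \<equiv> linepath (a (i + 1)) (a (i + 2))"

lemma linepath_L2: "smooth f \<Longrightarrow> (\<lambda>t. f (linepath x y t)) \<in> L2_space {0..1}"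
  using continuous_linepath_integrable[of f x y] continuous_linepath_integrable[OF smooth_mult, of f f x y]
  by (simp add: L2_space_def power2_eq_square)

lemma edge_L2_le:
  assumes f: "smooth f"
  shows "L2_norm {0..1} (\<lambda>t. f (edge_path i t)) \<le> 3 * \<gamma> / h * (N 0 f + h * N 1 f)"
proof (rule power2_le_imp_le)
  have "(L2_norm {0..1} (\<lambda>t. f (edge_path i t)))\<^sup>2 \<le> 8 * \<gamma>\<^sup>2 / h\<^sup>2 * ((N 0 f)\<^sup>2 + h * N 0 f * N 1 f)"
    unfolding L2_norm_sq by (rule edge_trace[OF f])
  also have "\<dots> \<le> (3 * \<gamma> / h)\<^sup>2 * (N 0 f + h * N 1 f)\<^sup>2"
  proof (rule mult_mono)
    show "8 * \<gamma>\<^sup>2 / h\<^sup>2 \<le> (3 * \<gamma> / h)\<^sup>2" by (simp add: power_divide power_mult_distrib divide_right_mono)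
    show "(N 0 f)\<^sup>2 + h * N 0 f * N 1 f \<le> (N 0 f + h * N 1 f)\<^sup>2"
      using h_pos by (simp add: power2_sum)
  qed (use h_pos in auto)
  finally show "(L2_norm {0..1} (\<lambda>t. f (edge_path i t)))\<^sup>2 \<le> (3 * \<gamma> / h * (N 0 f + h * N 1 f))\<^sup>2"
    by (simp only: power_mult_distrib)
qed (use h_pos gamma_ge_1 in simp)

lemma grad_norm_le_sobolev_norm: "j \<le> m \<Longrightarrow> N j f \<le> sobolev_norm m T f"
  unfolding sobolev_norm_def
  by (rule real_le_rsqrt) (rule member_le_sum[where f = "\<lambda>j. (N j f)\<^sup>2"], auto)

lemma edge_L2_diff_le:
  assumes f: "smooth f" and g: "smooth g" and w: "w \<in> sobolev_space 1 T"
  shows "L2_norm {0..1} (\<lambda>t. f (edge_path i t) - g (edge_path i t))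
    \<le> 3 * \<gamma> / h * (1 + h) * (sobolev_norm 1 T (\<lambda>z. f z - w z) + sobolev_norm 1 T (\<lambda>z. g z - w z))"
proof -
  let ?X = "sobolev_norm 1 T (\<lambda>z. f z - w z) + sobolev_norm 1 T (\<lambda>z. g z - w z)"
  have fs: "f \<in> sobolev_space 1 T" "g \<in> sobolev_space 1 T" using T_props(1,2) f g by (auto intro: smooth_sobolev)
  note d = sobolev_diff[OF T_props(1,2) fs(1) w] sobolev_diff[OF T_props(1,2) fs(2) w]
  have n: "N j (\<lambda>z. f z - g z) \<le> ?X" if j: "j \<le> 1" for j
    using grad_norm_triangle_diff[OF T_props(1,2) d j] grad_norm_le_sobolev_norm[OF j, of "\<lambda>z. f z - w z"]
      grad_norm_le_sobolev_norm[OF j, of "\<lambda>z. g z - w z"] by simp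
  have "L2_norm {0..1} (\<lambda>t. f (edge_path i t) - g (edge_path i t)) \<le> 3 * \<gamma> / h * (N 0 (\<lambda>z. f z - g z) + h * N 1 (\<lambda>z. f z - g z))"
    using edge_L2_le[OF smooth_diff[OF f g]] by simp
  also have "\<dots> \<le> 3 * \<gamma> / h * (?X + h * ?X)"
    using h_pos gamma_ge_1 by (intro mult_left_mono add_mono n) auto
  also have "\<dots> = 3 * \<gamma> / h * (1 + h) * ?X"
    using distrib_right[of 1 h ?X] by (simp only: mult.assoc mult_1_left)
  finally show ?thesis .
qed

lemma sobolev_norm_1_tendsto:
  assumes "\<And>j. j \<le> 1 \<Longrightarrow> (\<lambda>k. N j (f k)) \<longlonglongrightarrow> 0"
  shows "(\<lambda>k. sobolev_norm 1 T (f k)) \<longlonglongrightarrow> 0"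
proof -
  have "(\<lambda>k. sqrt (\<Sum>j\<le>1. (N j (f k))\<^sup>2)) \<longlonglongrightarrow> sqrt (\<Sum>j\<le>(1::nat). 0\<^sup>2)"
    by (intro tendsto_intros assms) auto
  then show ?thesis by (simp add: sobolev_norm_def)
qed

text \<open>By the trace inequality the restrictions of smooth approximations are Cauchy in \<open>L\<^sup>2\<close> of the
  edge.\<close>

lemma has_trace_exists:
  assumes w: "w \<in> sobolev_space 1 T"
  shows "\<exists>g. has_trace T (a (i + 1)) (a (i + 2)) w g"
proof -
  let ?x = "a (i + 1)" and ?y = "a (i + 2)"
  obtain u where u: "\<And>k. smooth (u k)" "\<And>j. j \<le> 1 \<Longrightarrow> (\<lambda>k. N j (\<lambda>z. u k z - w z)) \<longlonglongrightarrow> 0"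
    using sobolev_smooth_dense[OF T_props(1,2,3,4) w] by blast
  have s: "(\<lambda>k. sobolev_norm 1 T (\<lambda>z. u k z - w z)) \<longlonglongrightarrow> 0"
    by (rule sobolev_norm_1_tendsto) (rule u(2))
  define B where "B = 3 * \<gamma> / h * (1 + h)"
  have B: "0 < B" using h_pos gamma_ge_1 by (simp add: B_def add_pos_pos)
  have "\<exists>G\<in>L2_space {0..1}. (\<lambda>k. L2_norm {0..1} (\<lambda>t. u k (edge_path i t) - G t)) \<longlonglongrightarrow> 0"
  proof (rule L2_complete)
    show "(\<lambda>t. u k (edge_path i t)) \<in> L2_space {0..1}" for k by (rule linepath_L2[OF u(1)])
    fix e :: real assume e: "0 < e"
    have "\<forall>\<^sub>F k in sequentially. sobolev_norm 1 T (\<lambda>z. u k z - w z) < e / (2 * B)"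
      using e B by (intro order_tendstoD(2)[OF s]) simp
    then obtain M where M: "\<And>k. k \<ge> M \<Longrightarrow> sobolev_norm 1 T (\<lambda>z. u k z - w z) < e / (2 * B)"
      unfolding eventually_sequentially by blast
    show "\<exists>M. \<forall>m\<ge>M. \<forall>n\<ge>M. L2_norm {0..1} (\<lambda>t. u m (edge_path i t) - u n (edge_path i t)) < e"
    proof (intro exI[of _ M] allI impI)
      fix m n assume "M \<le> m" "M \<le> n"
      then have "sobolev_norm 1 T (\<lambda>z. u m z - w z) + sobolev_norm 1 T (\<lambda>z. u n z - w z) < e / (2 * B) + e / (2 * B)"
        by (intro add_strict_mono M)
      also have "\<dots> = e / B" by simp
      finally have "B * (sobolev_norm 1 T (\<lambda>z. u m z - w z) + sobolev_norm 1 T (\<lambda>z. u n z - w z)) < e"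
        using B by (simp add: field_simps)
      moreover have "L2_norm {0..1} (\<lambda>t. u m (edge_path i t) - u n (edge_path i t))
          \<le> B * (sobolev_norm 1 T (\<lambda>z. u m z - w z) + sobolev_norm 1 T (\<lambda>z. u n z - w z))"
        unfolding B_def by (rule edge_L2_diff_le[OF u(1) u(1) w])
      ultimately show "L2_norm {0..1} (\<lambda>t. u m (edge_path i t) - u n (edge_path i t)) < e" by linarith
    qed
  qed
  then obtain G where G: "G \<in> L2_space {0..1}" "(\<lambda>k. L2_norm {0..1} (\<lambda>t. u k (edge_path i t) - G t)) \<longlonglongrightarrow> 0" by blast
  have xy: "?y - ?x \<noteq> 0" using vertices_distinct[OF nd, of "i + 2" "i + 1"] by simp
  \<comment> \<open>a trace is a function of the plane here, so \<open>G\<close> is extended along the projection onto the edge\<close>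
  define g where "g z = G (((z - ?x) \<bullet> (?y - ?x)) / ((?y - ?x) \<bullet> (?y - ?x)))" for z
  have gL: "g (edge_path i t) = G t" for t
  proof -
    have "edge_path i t - ?x = t *\<^sub>R (?y - ?x)" by (simp add: linepath_def algebra_simps)
    then show ?thesis using xy by (simp add: g_def)
  qed
  have "(\<lambda>k. dist ?x ?y * (L2_norm {0..1} (\<lambda>t. u k (edge_path i t) - G t))\<^sup>2) \<longlonglongrightarrow> dist ?x ?y * 0\<^sup>2"
    by (intro tendsto_intros G(2))
  then have "(\<lambda>k. segment_integral ?x ?y (\<lambda>z. (u k z - g z)\<^sup>2)) \<longlonglongrightarrow> 0"
    by (simp add: segment_integral_def gL L2_norm_sq)
  then have "has_trace T ?x ?y w g"
    unfolding has_trace_def using w G(1) u(1) s by (auto simp: gL)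
  then show ?thesis by blast
qed

text \<open>The sequence that witnesses the trace and the given one both approximate \<open>w\<close> in \<open>H\<^sup>1\<close>, so
  their restrictions to the edge have the same limit.\<close>

lemma trace_integral_converges:
  assumes g: "has_trace T (a (i + 1)) (a (i + 2)) w g" and u: "\<And>k. smooth (u k)"
    and s: "(\<lambda>k. sobolev_norm 1 T (\<lambda>z. u k z - w z)) \<longlonglongrightarrow> 0"
  shows "(\<lambda>k. LINT t|lebesgue_on {0..1}. u k (edge_path i t)) \<longlonglongrightarrow> (LINT t|lebesgue_on {0..1}. g (edge_path i t))"
    and "integrable (lebesgue_on {0..1}) (\<lambda>t. g (edge_path i t))"
proof -
  let ?x = "a (i + 1)" and ?y = "a (i + 2)"
  have w: "w \<in> sobolev_space 1 T" and gL: "(\<lambda>t. g (edge_path i t)) \<in> L2_space {0..1}"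
    using g by (auto simp: has_trace_def)
  obtain u' where u': "\<And>k. smooth (u' k)" "(\<lambda>k. sobolev_norm 1 T (\<lambda>z. u' k z - w z)) \<longlonglongrightarrow> 0"
    "(\<lambda>k. segment_integral ?x ?y (\<lambda>z. (u' k z - g z)\<^sup>2)) \<longlonglongrightarrow> 0"
    using g unfolding has_trace_def by blast
  have d: "0 < dist ?x ?y" using vertices_distinct[OF nd, of "i + 1" "i + 2"] by simp
  have "(\<lambda>k. sqrt (segment_integral ?x ?y (\<lambda>z. (u' k z - g z)\<^sup>2) / dist ?x ?y)) \<longlonglongrightarrow> sqrt (0 / dist ?x ?y)"
    using d by (intro tendsto_intros u'(3)) simp
  then have l2: "(\<lambda>k. L2_norm {0..1} (\<lambda>t. u' k (edge_path i t) - g (edge_path i t))) \<longlonglongrightarrow> 0"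
    using d by (simp add: segment_integral_def L2_norm_def)
  define B where "B = 3 * \<gamma> / h * (1 + h)"
  have I: "{0..1::real} \<in> lmeasurable" by simp
  show "integrable (lebesgue_on {0..1}) (\<lambda>t. g (edge_path i t))" by (rule L2_integrable[OF I gL])
  note gi = this
  have b: "\<bar>(LINT t|lebesgue_on {0..1}. u k (edge_path i t)) - (LINT t|lebesgue_on {0..1}. g (edge_path i t))\<bar>
      \<le> B * (sobolev_norm 1 T (\<lambda>z. u k z - w z) + sobolev_norm 1 T (\<lambda>z. u' k z - w z))
        + L2_norm {0..1} (\<lambda>t. u' k (edge_path i t) - g (edge_path i t))" for k
  proof -
    note uL = linepath_L2[OF u, of k "?x" "?y"] and u'L = linepath_L2[OF u'(1), of k "?x" "?y"]
    have "(LINT t|lebesgue_on {0..1}. u k (edge_path i t)) - (LINT t|lebesgue_on {0..1}. g (edge_path i t))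
      = (LINT t|lebesgue_on {0..1}. u k (edge_path i t) - g (edge_path i t))"
      by (rule Bochner_Integration.integral_diff[symmetric]) (rule continuous_linepath_integrable[OF u], rule gi)
    moreover have "\<bar>LINT t|lebesgue_on {0..1}. u k (edge_path i t) - g (edge_path i t)\<bar>
        \<le> L2_norm {0..1} (\<lambda>t. u k (edge_path i t) - g (edge_path i t))"
      using order_trans[OF integral_abs_bound L1_le_L2[OF I L2_diff[OF uL gL]]] by simp
    moreover have "L2_norm {0..1} (\<lambda>t. u k (edge_path i t) - g (edge_path i t))
        \<le> L2_norm {0..1} (\<lambda>t. u k (edge_path i t) - u' k (edge_path i t)) + L2_norm {0..1} (\<lambda>t. u' k (edge_path i t) - g (edge_path i t))"
      by (rule L2_norm_triangle3[OF uL u'L gL])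
    moreover have "L2_norm {0..1} (\<lambda>t. u k (edge_path i t) - u' k (edge_path i t))
        \<le> B * (sobolev_norm 1 T (\<lambda>z. u k z - w z) + sobolev_norm 1 T (\<lambda>z. u' k z - w z))"
      unfolding B_def by (rule edge_L2_diff_le[OF u u'(1) w])
    ultimately show ?thesis by linarith
  qed
  have "(\<lambda>k. B * (sobolev_norm 1 T (\<lambda>z. u k z - w z) + sobolev_norm 1 T (\<lambda>z. u' k z - w z))
        + L2_norm {0..1} (\<lambda>t. u' k (edge_path i t) - g (edge_path i t))) \<longlonglongrightarrow> B * (0 + 0) + 0"
    by (intro tendsto_intros s u'(2) l2)
  then have "(\<lambda>k. B * (sobolev_norm 1 T (\<lambda>z. u k z - w z) + sobolev_norm 1 T (\<lambda>z. u' k z - w z))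
        + L2_norm {0..1} (\<lambda>t. u' k (edge_path i t) - g (edge_path i t))) \<longlonglongrightarrow> 0"
    by (simp only: add_0_right mult_zero_right)
  then have "(\<lambda>k. (LINT t|lebesgue_on {0..1}. u k (edge_path i t)) - (LINT t|lebesgue_on {0..1}. g (edge_path i t))) \<longlonglongrightarrow> 0"
    by (rule Lim_null_comparison[rotated]) (rule always_eventually, simp only: real_norm_def, intro allI b)
  then show "(\<lambda>k. LINT t|lebesgue_on {0..1}. u k (edge_path i t)) \<longlonglongrightarrow> (LINT t|lebesgue_on {0..1}. g (edge_path i t))"
    by (rule LIM_zero_cancel)
qed

lemma weak_deriv_sobolev:
  assumes v: "v \<in> sobolev_space (Suc m) T"
  shows "weak_deriv T [c] v \<in> sobolev_space m T"
proof -
  have "\<exists>g\<in>L2_space T. has_weak_deriv T is (weak_deriv T [c] v) g" if "length is \<le> m" for "is"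
  proof
    show "has_weak_deriv T is (weak_deriv T [c] v) (weak_deriv T ([c] @ is) v)"
      by (rule has_weak_deriv_append; rule sobolev_weak_deriv(1)[OF T_props(1,2) v]) (use that in simp_all)
    show "weak_deriv T ([c] @ is) v \<in> L2_space T"
      by (rule sobolev_weak_deriv(2)[OF T_props(1,2) v]) (use that in simp)
  qed
  moreover have "weak_deriv T [c] v \<in> L2_space T"
    using sobolev_weak_deriv(2)[OF T_props(1,2) v, of "[c]"] by simp
  ultimately show ?thesis by (simp add: sobolev_space_def)
qed

text \<open>The components of \<open>\<nabla>\<^sup>j \<partial>\<^sub>c\<close> are among those of \<open>\<nabla>\<^sup>j\<^sup>+\<^sup>1\<close>.\<close>

lemma N_partial_deriv_diff_le:
  assumes v: "v \<in> sobolev_space (Suc m) T" and u: "smooth u" and j: "j \<le> m"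
  shows "N j (\<lambda>x. partial_deriv c u x - weak_deriv T [c] v x) \<le> N (Suc j) (\<lambda>x. u x - v x)"
proof -
  define G where "G is x = partial_derivs is u x - weak_deriv T is v x" for "is" x
  have wd: "has_weak_deriv T is (\<lambda>x. u x - v x) (G is)" "G is \<in> L2_space T" if "length is \<le> Suc m" for "is"
    unfolding G_def
    by (rule has_weak_deriv_diff[OF T_props(1) has_weak_deriv_smooth[OF T_props(1) u] sobolev_weak_deriv(1)[OF T_props(1,2) v that]],
      rule L2_diff[OF smooth_T_L2[OF smooth_partial_derivs[OF u]] sobolev_weak_deriv(2)[OF T_props(1,2) v that]])
  have 1: "N (Suc j) (\<lambda>x. u x - v x) = L2_set (\<lambda>is. L2_norm T (G is)) {is. length is = Suc j}"
    by (rule grad_norm_eqI[OF T_props(1,2)]) (use wd j in auto)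
  have "N j (\<lambda>x. partial_deriv c u x - weak_deriv T [c] v x) = L2_set (\<lambda>is. L2_norm T (G ([c] @ is))) {is. length is = j}"
  proof (rule grad_norm_eqI[OF T_props(1,2)])
    fix "is" :: "2 list" assume l: "length is = j"
    have "has_weak_deriv T is (G [c]) (G ([c] @ is))"
      by (rule has_weak_deriv_append[OF wd(1)[of "[c]"] wd(1)[of "[c] @ is"]]) (use l j in auto)
    then show "has_weak_deriv T is (\<lambda>x. partial_deriv c u x - weak_deriv T [c] v x) (G ([c] @ is))"
      by (simp add: G_def[of "[c]", abs_def])
    show "G ([c] @ is) \<in> L2_space T" by (rule wd(2)) (use l j in auto)
  qed
  also have "\<dots> \<le> N (Suc j) (\<lambda>x. u x - v x)"
    unfolding 1 L2_set_def
  proof (rule real_sqrt_le_mono)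
    have "(\<Sum>is | length is = j. (L2_norm T (G ([c] @ is)))\<^sup>2) = (\<Sum>is\<in>(@) [c] ` {is. length is = j}. (L2_norm T (G is))\<^sup>2)"
      by (subst sum.reindex) (auto simp: inj_on_def)
    also have "\<dots> \<le> (\<Sum>is | length is = Suc j. (L2_norm T (G is))\<^sup>2)"
      by (rule sum_mono2) (use finite_multi_indices[OF T_props(1,2), of "Suc j"] in auto)
    finally show "(\<Sum>is | length is = j. (L2_norm T (G ([c] @ is)))\<^sup>2) \<le> (\<Sum>is | length is = Suc j. (L2_norm T (G is))\<^sup>2)" .
  qed
  finally show ?thesis .
qed

context
  fixes v and u :: "nat \<Rightarrow> real^2 \<Rightarrow> real" and m
  assumes m: "2 \<le> m" and v: "v \<in> sobolev_space m T" and u: "\<And>k. smooth (u k)"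
    and lim: "\<And>j. j \<le> m \<Longrightarrow> (\<lambda>k. N j (\<lambda>x. u k x - v x)) \<longlonglongrightarrow> 0"
begin

lemma flux_converges: "(\<lambda>k. flux a i (u k)) \<longlonglongrightarrow> edge_integral a i (normal_deriv_trace a i v)"
proof -
  have v2: "v \<in> sobolev_space (Suc 1) T" using v m by (auto simp: sobolev_space_def)
  define w where "w c = weak_deriv T [c] v" for c
  define g where "g c = segment_trace T (a (i + 1)) (a (i + 2)) (w c)" for c
  have tr: "has_trace T (a (i + 1)) (a (i + 2)) (w c) (g c)" for c
    unfolding g_def segment_trace_def w_def
    by (rule someI_ex[OF has_trace_exists[OF weak_deriv_sobolev[OF v2]]])
  have s: "(\<lambda>k. sobolev_norm 1 T (\<lambda>z. partial_deriv c (u k) z - w c z)) \<longlonglongrightarrow> 0" for c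
  proof (rule sobolev_norm_1_tendsto)
    fix j :: nat assume j: "j \<le> 1"
    show "(\<lambda>k. N j (\<lambda>z. partial_deriv c (u k) z - w c z)) \<longlonglongrightarrow> 0"
    proof (rule tendsto_sandwich[OF _ _ tendsto_const])
      show "(\<lambda>k. N (Suc j) (\<lambda>x. u k x - v x)) \<longlonglongrightarrow> 0" by (rule lim) (use j m in simp)
      show "\<forall>\<^sub>F k in sequentially. N j (\<lambda>z. partial_deriv c (u k) z - w c z) \<le> N (Suc j) (\<lambda>x. u k x - v x)"
        unfolding w_def by (intro always_eventually allI N_partial_deriv_diff_le[OF v2 u j])
    qed simp
  qed
  note conv = trace_integral_converges[OF tr smooth_partial_deriv[OF u] s]
  have "(\<lambda>k. dist (a (i + 1)) (a (i + 2)) * (\<Sum>c\<in>UNIV. edge_normal a i $ c * (LINT t|lebesgue_on {0..1}. partial_deriv c (u k) (edge_path i t))))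
    \<longlonglongrightarrow> dist (a (i + 1)) (a (i + 2)) * (\<Sum>c\<in>UNIV. edge_normal a i $ c * (LINT t|lebesgue_on {0..1}. g c (edge_path i t)))"
    by (intro tendsto_intros conv(1))
  moreover have "flux a i (u k) = dist (a (i + 1)) (a (i + 2)) * (\<Sum>c\<in>UNIV. edge_normal a i $ c * (LINT t|lebesgue_on {0..1}. partial_deriv c (u k) (edge_path i t)))" for k
    unfolding flux_def edge_integral_def segment_integral_def normal_deriv_eq[OF u] dir_deriv_def
    by (simp add: continuous_linepath_integrable smooth_partial_deriv u)
  moreover have "edge_integral a i (normal_deriv_trace a i v) = dist (a (i + 1)) (a (i + 2)) * (\<Sum>c\<in>UNIV. edge_normal a i $ c * (LINT t|lebesgue_on {0..1}. g c (edge_path i t)))"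
    unfolding edge_integral_def segment_integral_def normal_deriv_trace_def g_def[symmetric] w_def[symmetric]
    by (simp add: conv(2))
  ultimately show ?thesis by simp
qed

text \<open>The interpolant is linear in its degrees of freedom, and these converge.\<close>

lemma interp_converges:
  assumes j: "j \<le> 2"
  shows "(\<lambda>k. N j (\<lambda>x. smooth_interp (u k) x - NTW_interp a v x)) \<longlonglongrightarrow> 0"
proof -
  define A where "A i = cont_rep K v (a i)" for i
  define B where "B i = cont_rep K v (edge_midpoint a i)" for i
  define D where "D i = edge_integral a i (normal_deriv_trace a i v)" for i
  have mid: "edge_midpoint a i \<in> K" for i
    unfolding edge_midpoint_linepath[OF nd] by (rule linepath_in_tri) auto
  define F where "F k = dof_sum (\<lambda>i. u k (a i) - A i) (\<lambda>i. u k (edge_midpoint a i) - B i) (\<lambda>i. flux a i (u k) - D i)" for k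
  have "F \<longlonglongrightarrow> (\<Sum>i\<in>(UNIV::3 set). \<bar>A i - A i\<bar>) + (\<Sum>i\<in>(UNIV::3 set). \<bar>B i - B i\<bar>) + (\<Sum>i\<in>(UNIV::3 set). \<bar>D i - D i\<bar>)"
    unfolding F_def dof_sum_def unfolding A_def B_def D_def
    by (intro tendsto_intros point_values_converge[OF m v u lim] flux_converges vertex_in_tri[OF nd] mid)
  then have F0: "F \<longlonglongrightarrow> 0" by simp
  have eq: "(\<lambda>x. smooth_interp (u k) x - NTW_interp a v x) = ntw_fun a (\<lambda>i. u k (a i) - A i) (\<lambda>i. u k (edge_midpoint a i) - B i) (\<lambda>i. flux a i (u k) - D i)" for k
    unfolding smooth_interp_def NTW_interp_eq A_def[symmetric] B_def[symmetric] D_def[symmetric]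
    by (rule ext) (rule ntw_fun_diff[symmetric])
  show ?thesis
  proof (rule tendsto_sandwich[OF _ _ tendsto_const])
    show "\<forall>\<^sub>F k in sequentially. N j (\<lambda>x. smooth_interp (u k) x - NTW_interp a v x) \<le> 8 * C_interp * F k * (h / h ^ j)"
      unfolding eq F_def by (intro always_eventually allI ntw_fun_N_le[OF j])
    have "(\<lambda>k. 8 * C_interp * F k * (h / h ^ j)) \<longlonglongrightarrow> 8 * C_interp * 0 * (h / h ^ j)"
      by (intro tendsto_intros F0)
    then show "(\<lambda>k. 8 * C_interp * F k * (h / h ^ j)) \<longlonglongrightarrow> 0" by simp
  qed simp
qed

lemma smooth_NTW_interp: "smooth (NTW_interp a v)"
  unfolding NTW_interp_eq by (rule smooth_ntw_fun)

lemma error_split: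
  assumes j: "j \<le> 2"
  shows "N j (\<lambda>x. v x - NTW_interp a v x) \<le> N j (\<lambda>x. u k x - v x)
    + N j (\<lambda>x. u k x - smooth_interp (u k) x) + N j (\<lambda>x. smooth_interp (u k) x - NTW_interp a v x)"
proof -
  have jm: "j \<le> m" using j m by simp
  note TT = T_props(1,2)
  have S: "smooth f \<Longrightarrow> f \<in> sobolev_space m T" for f using TT by (rule smooth_sobolev)
  note P = S[OF smooth_NTW_interp] and uk = S[OF u[of k]] and Pk = S[OF smooth_smooth_interp[of "u k"]]
  have "N j (\<lambda>x. v x - NTW_interp a v x) \<le> N j (\<lambda>x. v x - u k x) + N j (\<lambda>x. u k x - NTW_interp a v x)"
    using grad_norm_triangle[OF TT sobolev_diff[OF TT v uk] sobolev_diff[OF TT uk P] jm] by simp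
  moreover have "N j (\<lambda>x. u k x - NTW_interp a v x) \<le> N j (\<lambda>x. u k x - smooth_interp (u k) x) + N j (\<lambda>x. smooth_interp (u k) x - NTW_interp a v x)"
    using grad_norm_triangle[OF TT sobolev_diff[OF TT uk Pk] sobolev_diff[OF TT Pk P] jm] by simp
  moreover have "N j (\<lambda>x. v x - u k x) = N j (\<lambda>x. u k x - v x)"
    by (rule grad_norm_diff_commute[OF TT v uk jm])
  ultimately show ?thesis by linarith
qed

lemma N_approx_le: "j \<le> m \<Longrightarrow> N j (u k) \<le> N j v + N j (\<lambda>x. u k x - v x)"
  using grad_norm_triangle[OF T_props(1,2) v sobolev_diff[OF T_props(1,2) smooth_sobolev[OF T_props(1,2) u] v], of j k] by simp

lemma error_estimate_limit:
  assumes est: "\<And>k. interp_error_sum (\<lambda>x. u k x - smooth_interp (u k) x) \<le> C * N m (u k)" and C: "0 \<le> C"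
  shows "interp_error_sum (\<lambda>x. v x - NTW_interp a v x) \<le> C * N m v"
proof -
  define R where "R k = interp_error_sum (\<lambda>x. u k x - v x) + C * (N m v + N m (\<lambda>x. u k x - v x))
      + interp_error_sum (\<lambda>x. smooth_interp (u k) x - NTW_interp a v x)" for k
  have "interp_error_sum (\<lambda>x. v x - NTW_interp a v x) \<le> R k" for k
  proof -
    have "interp_error_sum (\<lambda>x. v x - NTW_interp a v x) \<le> interp_error_sum (\<lambda>x. u k x - v x)
      + interp_error_sum (\<lambda>x. u k x - smooth_interp (u k) x) + interp_error_sum (\<lambda>x. smooth_interp (u k) x - NTW_interp a v x)"
      using error_split[of 0 k] mult_left_mono[OF error_split[of 1 k], of h] mult_left_mono[OF error_split[of 2 k], of "h\<^sup>2"] h_pos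
      unfolding interp_error_sum_def by (simp add: distrib_left)
    moreover have "C * N m (u k) \<le> C * (N m v + N m (\<lambda>x. u k x - v x))"
      by (intro mult_left_mono N_approx_le C) simp
    ultimately show ?thesis using est[of k] unfolding R_def by linarith
  qed
  moreover have "R \<longlonglongrightarrow> (0 + h * 0 + h\<^sup>2 * 0) + C * (N m v + 0) + (0 + h * 0 + h\<^sup>2 * 0)"
    unfolding R_def interp_error_sum_def using m by (intro tendsto_intros lim interp_converges) auto
  ultimately have "interp_error_sum (\<lambda>x. v x - NTW_interp a v x) \<le> (0 + h * 0 + h\<^sup>2 * 0) + C * (N m v + 0) + (0 + h * 0 + h\<^sup>2 * 0)"
    by (intro LIMSEQ_le_const) auto
  then show ?thesis by simp
qed

lemma multiplicative_estimate_limit: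
  "N 1 (\<lambda>x. v x - NTW_interp a v x) \<le> C_mult * sqrt h * sqrt (N 1 v) * sqrt (N 2 v)"
proof -
  define R where "R k = N 1 (\<lambda>x. u k x - v x)
      + C_mult * sqrt h * sqrt (N 1 v + N 1 (\<lambda>x. u k x - v x)) * sqrt (N 2 v + N 2 (\<lambda>x. u k x - v x))
      + N 1 (\<lambda>x. smooth_interp (u k) x - NTW_interp a v x)" for k
  have C: "0 \<le> C_mult" using C_stab_nonneg C_est_nonneg by (simp add: C_mult_def)
  have "N 1 (\<lambda>x. v x - NTW_interp a v x) \<le> R k" for k
  proof -
    have "C_mult * sqrt h * sqrt (N 1 (u k)) * sqrt (N 2 (u k))
      \<le> C_mult * sqrt h * sqrt (N 1 v + N 1 (\<lambda>x. u k x - v x)) * sqrt (N 2 v + N 2 (\<lambda>x. u k x - v x))"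
      using C h_pos m by (intro mult_mono mult_left_mono real_sqrt_le_mono N_approx_le) auto
    then show ?thesis
      using error_split[of 1 k] smooth_estimate_mult[OF u, of k] unfolding R_def by simp
  qed
  moreover have "R \<longlonglongrightarrow> 0 + C_mult * sqrt h * sqrt (N 1 v + 0) * sqrt (N 2 v + 0) + 0"
    unfolding R_def using m by (intro tendsto_intros lim interp_converges) auto
  ultimately have "N 1 (\<lambda>x. v x - NTW_interp a v x) \<le> 0 + C_mult * sqrt h * sqrt (N 1 v + 0) * sqrt (N 2 v + 0) + 0"
    by (intro LIMSEQ_le_const) auto
  then show ?thesis by simp
qed

end

lemma NTW_estimate:
  assumes v: "v \<in> sobolev_space m T" and m: "m = 2 \<or> m = 3"
  shows "interp_error_sum (\<lambda>x. v x - NTW_interp a v x) \<le> 6 * C_est * h ^ m * N m v"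
proof -
  obtain u where u: "\<And>k. smooth (u k)" "\<And>j. j \<le> m \<Longrightarrow> (\<lambda>k. N j (\<lambda>x. u k x - v x)) \<longlonglongrightarrow> 0"
    using sobolev_smooth_dense[OF T_props(1,2,3,4) v] by blast
  have "interp_error_sum (\<lambda>x. u k x - smooth_interp (u k) x) \<le> 6 * C_est * h ^ m * N m (u k)" for k
    using m
  proof
    assume m2: "m = 2"
    have "0 \<le> C_est * h\<^sup>2 * N 2 (u k)" using C_est_nonneg by simp
    then show ?thesis using smooth_estimate_2[OF u(1), of k] unfolding m2 by simp
  next
    assume "m = 3"
    then show ?thesis using smooth_estimate_3[OF u(1), of k] by simp
  qed
  then show ?thesis
    using m C_est_nonneg h_pos by (intro error_estimate_limit[OF _ v u]) auto
qed

lemma NTW_multiplicative_estimate: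
  assumes v: "v \<in> sobolev_space 2 T"
  shows "N 1 (\<lambda>x. v x - NTW_interp a v x) \<le> C_mult * sqrt h * sqrt (N 1 v) * sqrt (N 2 v)"
proof -
  obtain u where u: "\<And>k. smooth (u k)" "\<And>j. j \<le> 2 \<Longrightarrow> (\<lambda>k. N j (\<lambda>x. u k x - v x)) \<longlonglongrightarrow> 0"
    using sobolev_smooth_dense[OF T_props(1,2,3,4) v] by blast
  show ?thesis by (rule multiplicative_estimate_limit[OF _ v u]) auto
qed

end

theorem lemma4p1:
  fixes \<gamma> :: real
  shows "\<exists>C>0. \<forall>a :: triangle.
    nondegenerate a \<and> diameter (tri a) / inscribed_diameter (tri a) \<le> \<gamma> \<longrightarrow>
      (let h = diameter (tri a); T = interior (tri a) in
        (\<forall>m\<in>{2,3}. \<forall>v\<in>sobolev_space m T.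
           (\<Sum>j\<le>2. h ^ j * grad_norm j T (\<lambda>x. v x - NTW_interp a v x)) \<le> C * h ^ m * grad_norm m T v) \<and>
        (\<forall>v\<in>sobolev_space 2 T.
           grad_norm 1 T (\<lambda>x. v x - NTW_interp a v x)
             \<le> C * sqrt h * sqrt (grad_norm 1 T v) * sqrt (grad_norm 2 T v)))"
proof -
  \<comment> \<open>for \<open>\<gamma> < 1\<close> there is no admissible triangle and the two constants need not be positive\<close>
  define C where "C = max 1 (max (6 * regular_triangle.C_est \<gamma>) (regular_triangle.C_mult \<gamma>))"
  show ?thesis
  proof (intro exI[of _ C] conjI allI impI)
    show "0 < C" by (simp add: C_def)
    fix a :: triangle
    assume "nondegenerate a \<and> diameter (tri a) / inscribed_diameter (tri a) \<le> \<gamma>"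
    then interpret regular_triangle a \<gamma> by unfold_locales auto
    have C1: "6 * C_est \<le> C" "C_mult \<le> C" by (auto simp: C_def)
    have "(\<Sum>j\<le>2. h ^ j * N j (\<lambda>x. v x - NTW_interp a v x)) \<le> C * h ^ m * N m v"
      if m: "m \<in> {2, 3}" and v: "v \<in> sobolev_space m T" for m v
    proof -
      have "(\<Sum>j\<le>2. h ^ j * N j (\<lambda>x. v x - NTW_interp a v x)) = interp_error_sum (\<lambda>x. v x - NTW_interp a v x)"
        by (simp add: interp_error_sum_def numeral_2_eq_2)
      also have "\<dots> \<le> 6 * C_est * h ^ m * N m v" by (rule NTW_estimate[OF v]) (use m in auto)
      also have "\<dots> \<le> C * h ^ m * N m v" using C1(1) h_pos by (intro mult_right_mono) auto
      finally show ?thesis .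
    qed
    moreover have "N 1 (\<lambda>x. v x - NTW_interp a v x) \<le> C * sqrt h * sqrt (N 1 v) * sqrt (N 2 v)"
      if v: "v \<in> sobolev_space 2 T" for v
    proof -
      have "C_mult * sqrt h * sqrt (N 1 v) * sqrt (N 2 v) \<le> C * sqrt h * sqrt (N 1 v) * sqrt (N 2 v)"
        using C1(2) h_pos by (intro mult_right_mono) auto
      then show ?thesis using NTW_multiplicative_estimate[OF v] by linarith
    qed
    ultimately show "let h = diameter (tri a); T = interior (tri a) in
        (\<forall>m\<in>{2,3}. \<forall>v\<in>sobolev_space m T.
           (\<Sum>j\<le>2. h ^ j * grad_norm j T (\<lambda>x. v x - NTW_interp a v x)) \<le> C * h ^ m * grad_norm m T v) \<and>
        (\<forall>v\<in>sobolev_space 2 T.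
           grad_norm 1 T (\<lambda>x. v x - NTW_interp a v x)
             \<le> C * sqrt h * sqrt (grad_norm 1 T v) * sqrt (grad_norm 2 T v))"
      unfolding Let_def by blast
  qed
qed

end
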